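(* Let $D\subset\mathbb{R}^n$ be an open bounded Lipschitz domain and $(\Omega,\mathcal{F},\mathbb{P})$ a probability space. Let $a\in L^\infty(\Omega;L^\infty(D))$ and suppose there are constants $a_{\min},a_{\max}$ with $$0<a_{\min}\le a(\boldsymbol{x},\omega)\le a_{\max}<\infty\quad\text{for a.e. }(\boldsymbol{x},\omega)\in D\times\Omega.$$ Let $g\in L^2(\Omega;H^1(D))$ satisfy $g(\boldsymbol{x},\omega)\le 0$ for a.e. $\boldsymbol{x}\in\partial D$ and a.e. $\omega\in\Omega$. Then for any $f\in L^2(\Omega;L^2(D))$ there exists a unique $u\in\mathcal{K}$ such that $$b(u,v-u)\ge \ell(v-u)\quad\forall\, v\in\mathcal{K},$$ where $$\mathcal{K}=\{v\in V\mid v(\boldsymbol{x},\omega)\ge g(\boldsymbol{x},\omega)\ \text{a.e. in } D\times\Omega\},$$ $$b(u,v)=\mathbb{E}\Big[\int_D a(\boldsymbol{x},\omega)\nabla u(\boldsymbol{x},\omega)\cdot\nabla v(\boldsymbol{x},\omega)\,\mathrm{d}\boldsymbol{x}\Big],\qquad \ell(v)=\mathbb{E}\Big[\int_D f(\boldsymbol{x},\omega)v(\boldsymbol{x},\omega)\,\mathrm{d}\boldsymbol{x}\Big].$$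
   Context: $V=L^2(\Omega;H_0^1(D))$ is the Bochner space with inner product $(v,w)_V=\mathbb{E}[(\nabla v,\nabla w)_{L^2(D)}]$ and norm $\|v\|_V=(v,v)_V^{1/2}$. The gradient $\nabla$ is with respect to $\boldsymbol{x}\in D$, and $\mathbb{E}$ denotes expectation with respect to $\mathbb{P}$. The value of $g$ on $\partial D$ is understood in the sense of traces. *)

theory Defs
  imports "HOL-Probability.Probability"
begin

text \<open>
  Elements of all function spaces are represented by functions, i.e. by representatives of classes
  modulo equality almost everywhere; a random field is a function \<open>u\<close> with \<open>u \<omega> x\<close> standing for
  \<open>u(x, \<omega>)\<close>.
\<close>

section \<open>Lipschitz domains and surface measure\<close>

text \<open>Near each boundary point the set lies, in the direction \<open>\<nu>\<close>, strictly below the graph of a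
  Lipschitz function defined on the hyperplane orthogonal to \<open>\<nu>\<close>.\<close>

definition lipschitz_boundary :: "'a::euclidean_space set \<Rightarrow> bool" where
  "lipschitz_boundary D \<longleftrightarrow>
     (\<forall>p\<in>frontier D. \<exists>\<nu> \<gamma> L r. norm \<nu> = 1 \<and> 0 < r \<and> L-lipschitz_on {y. y \<bullet> \<nu> = 0} \<gamma> \<and>
        D \<inter> ball p r = {x \<in> ball p r. x \<bullet> \<nu> < \<gamma> (x - (x \<bullet> \<nu>) *\<^sub>R \<nu>)})"

definition hausdorff_pre :: "nat \<Rightarrow> real \<Rightarrow> 'a::metric_space set \<Rightarrow> ennreal" where
  "hausdorff_pre s \<delta> A =
     (INF U\<in>{U :: nat \<Rightarrow> 'a set. A \<subseteq> (\<Union>i. U i) \<and> (\<forall>i. bounded (U i) \<and> diameter (U i) \<le> \<delta>)}.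
        \<Sum>i. if U i = {} then 0
            else ennreal (unit_ball_vol (real s) * (diameter (U i) / 2) ^ s))"

definition hausdorff_outer :: "nat \<Rightarrow> 'a::metric_space set \<Rightarrow> ennreal" where
  "hausdorff_outer s A = (SUP \<delta>\<in>{0<..}. hausdorff_pre s \<delta> A)"

definition hausdorff_measure :: "nat \<Rightarrow> 'a::metric_space measure" where
  "hausdorff_measure s = measure_of UNIV (sets borel) (hausdorff_outer s)"

definition surface_measure :: "'a::euclidean_space set \<Rightarrow> 'a measure" where
  "surface_measure D = restrict_space (hausdorff_measure (DIM('a) - 1)) (frontier D)"

section \<open>Lebesgue and Sobolev spaces\<close>

abbreviation vol :: "'a::euclidean_space set \<Rightarrow> 'a measure" where
  "vol D \<equiv> restrict_space lborel D"

definition L2_fun :: "'a measure \<Rightarrow> ('a \<Rightarrow> 'b::euclidean_space) set" where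
  "L2_fun \<mu> = {h \<in> borel_measurable \<mu>. integrable \<mu> (\<lambda>x. (norm (h x))\<^sup>2)}"

definition L2_norm :: "'a measure \<Rightarrow> ('a \<Rightarrow> 'b::euclidean_space) \<Rightarrow> real" where
  "L2_norm \<mu> h = sqrt (\<integral>x. (norm (h x))\<^sup>2 \<partial>\<mu>)"

definition Linf_fun :: "'a measure \<Rightarrow> ('a \<Rightarrow> real) set" where
  "Linf_fun \<mu> = {h \<in> borel_measurable \<mu>. esssup \<mu> (\<lambda>x. ereal \<bar>h x\<bar>) < \<infinity>}"

definition Linf_norm :: "'a measure \<Rightarrow> ('a \<Rightarrow> real) \<Rightarrow> real" where
  "Linf_norm \<mu> h = real_of_ereal (esssup \<mu> (\<lambda>x. ereal \<bar>h x\<bar>))"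

definition partial_deriv :: "'a::euclidean_space \<Rightarrow> ('a \<Rightarrow> real) \<Rightarrow> 'a \<Rightarrow> real" where
  "partial_deriv i \<phi> x = frechet_derivative \<phi> (at x) i"

primrec Ck :: "nat \<Rightarrow> ('a::euclidean_space \<Rightarrow> real) \<Rightarrow> bool" where
  "Ck 0 \<phi> \<longleftrightarrow> continuous_on UNIV \<phi>"
| "Ck (Suc k) \<phi> \<longleftrightarrow> (\<forall>x. \<phi> differentiable (at x)) \<and> (\<forall>i\<in>Basis. Ck k (partial_deriv i \<phi>))"

definition smooth :: "('a::euclidean_space \<Rightarrow> real) \<Rightarrow> bool" where
  "smooth \<phi> \<longleftrightarrow> (\<forall>k. Ck k \<phi>)"

definition test_fun :: "'a::euclidean_space set \<Rightarrow> ('a \<Rightarrow> real) set" where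
  "test_fun D = {\<phi>. smooth \<phi> \<and> compact (closure {x. \<phi> x \<noteq> 0}) \<and> closure {x. \<phi> x \<noteq> 0} \<subseteq> D}"

definition has_weak_grad ::
  "'a::euclidean_space set \<Rightarrow> ('a \<Rightarrow> real) \<Rightarrow> ('a \<Rightarrow> 'a) \<Rightarrow> bool" where
  "has_weak_grad D u G \<longleftrightarrow>
     (\<forall>\<phi>\<in>test_fun D. \<forall>i\<in>Basis.
        (\<integral>x. u x * partial_deriv i \<phi> x \<partial>vol D) = - (\<integral>x. (G x \<bullet> i) * \<phi> x \<partial>vol D))"

definition H1 :: "'a::euclidean_space set \<Rightarrow> ('a \<Rightarrow> real) set" where
  "H1 D = {u \<in> L2_fun (vol D). \<exists>G \<in> L2_fun (vol D). has_weak_grad D u G}"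

text \<open>The weak gradient of an element of \<open>H1 D\<close>; it is determined up to a null set.\<close>

definition weak_grad :: "'a::euclidean_space set \<Rightarrow> ('a \<Rightarrow> real) \<Rightarrow> 'a \<Rightarrow> 'a" where
  "weak_grad D u = (SOME G. G \<in> L2_fun (vol D) \<and> has_weak_grad D u G)"

definition H1_norm :: "'a::euclidean_space set \<Rightarrow> ('a \<Rightarrow> real) \<Rightarrow> real" where
  "H1_norm D u = sqrt ((L2_norm (vol D) u)\<^sup>2 + (L2_norm (vol D) (weak_grad D u))\<^sup>2)"

definition H10 :: "'a::euclidean_space set \<Rightarrow> ('a \<Rightarrow> real) set" where
  "H10 D = {u \<in> H1 D. \<exists>\<phi> :: nat \<Rightarrow> 'a \<Rightarrow> real.
     (\<forall>k. \<phi> k \<in> test_fun D) \<and> (\<lambda>k. H1_norm D (\<lambda>x. \<phi> k x - u x)) \<longlonglongrightarrow> 0}"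

definition H10_norm :: "'a::euclidean_space set \<Rightarrow> ('a \<Rightarrow> real) \<Rightarrow> real" where
  "H10_norm D u = L2_norm (vol D) (weak_grad D u)"

text \<open>The graph of the trace operator, i.e. of the continuous extension to \<open>H1 D\<close> of the restriction
  to the boundary, as a map into \<open>L\<^sup>2\<close> of the boundary, of functions smooth up to the boundary.
  The \<open>nn_integral\<close> makes the convergence meaningful without knowing the restrictions to be square
  integrable.\<close>

definition has_trace :: "'a::euclidean_space set \<Rightarrow> ('a \<Rightarrow> real) \<Rightarrow> ('a \<Rightarrow> real) \<Rightarrow> bool" where
  "has_trace D u h \<longleftrightarrow> u \<in> H1 D \<and> h \<in> L2_fun (surface_measure D) \<and>
     (\<exists>\<phi> :: nat \<Rightarrow> 'a \<Rightarrow> real. (\<forall>k. smooth (\<phi> k)) \<and>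
        (\<lambda>k. H1_norm D (\<lambda>x. \<phi> k x - u x)) \<longlonglongrightarrow> 0 \<and>
        (\<lambda>k. \<integral>\<^sup>+x. ennreal ((\<phi> k x - h x)\<^sup>2) \<partial>surface_measure D) \<longlonglongrightarrow> 0)"

section \<open>Bochner spaces\<close>

text \<open>Strong measurability with respect to a space \<open>X\<close> of functions, normed (modulo null functions)
  by \<open>N\<close>. Convergence is required everywhere, so that no completeness of \<open>M\<close> is needed for the
  measurability of \<open>\<lambda>\<omega>. N (u \<omega>)\<close>; every Bochner class has such a representative.\<close>

definition strongly_measurable ::
  "'w measure \<Rightarrow> ('a \<Rightarrow> real) set \<Rightarrow> (('a \<Rightarrow> real) \<Rightarrow> real) \<Rightarrow> ('w \<Rightarrow> 'a \<Rightarrow> real) \<Rightarrow> bool" where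
  "strongly_measurable M X N u \<longleftrightarrow> (\<forall>\<omega>\<in>space M. u \<omega> \<in> X) \<and>
     (\<exists>s :: nat \<Rightarrow> 'w \<Rightarrow> 'a \<Rightarrow> real.
        (\<forall>k. simple_function M (s k) \<and> s k ` space M \<subseteq> X) \<and>
        (\<forall>\<omega>\<in>space M. (\<lambda>k. N (\<lambda>x. s k \<omega> x - u \<omega> x)) \<longlonglongrightarrow> 0))"

text \<open>Every class in one of the Bochner spaces below has a representative that is jointly measurable
  on \<open>\<Omega> \<times> D\<close>. Only such representatives are admitted, which gives statements holding almost
  everywhere in \<open>D \<times> \<Omega>\<close> their literal meaning with respect to the product measure.\<close>

definition bochner_L2 ::
  "'w measure \<Rightarrow> 'a::euclidean_space set \<Rightarrow> ('a \<Rightarrow> real) set \<Rightarrow> (('a \<Rightarrow> real) \<Rightarrow> real) \<Rightarrow>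
     ('w \<Rightarrow> 'a \<Rightarrow> real) set" where
  "bochner_L2 M D X N = {u. case_prod u \<in> borel_measurable (M \<Otimes>\<^sub>M vol D) \<and>
     strongly_measurable M X N u \<and> integrable M (\<lambda>\<omega>. (N (u \<omega>))\<^sup>2)}"

definition bochner_Linf ::
  "'w measure \<Rightarrow> 'a::euclidean_space set \<Rightarrow> ('a \<Rightarrow> real) set \<Rightarrow> (('a \<Rightarrow> real) \<Rightarrow> real) \<Rightarrow>
     ('w \<Rightarrow> 'a \<Rightarrow> real) set" where
  "bochner_Linf M D X N = {u. case_prod u \<in> borel_measurable (M \<Otimes>\<^sub>M vol D) \<and>
     strongly_measurable M X N u \<and> esssup M (\<lambda>\<omega>. ereal (N (u \<omega>))) < \<infinity>}"

definition L2_L2 :: "'w measure \<Rightarrow> 'a::euclidean_space set \<Rightarrow> ('w \<Rightarrow> 'a \<Rightarrow> real) set" where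
  "L2_L2 M D = bochner_L2 M D (L2_fun (vol D)) (L2_norm (vol D))"

definition L2_H1 :: "'w measure \<Rightarrow> 'a::euclidean_space set \<Rightarrow> ('w \<Rightarrow> 'a \<Rightarrow> real) set" where
  "L2_H1 M D = bochner_L2 M D (H1 D) (H1_norm D)"

definition L2_H10 :: "'w measure \<Rightarrow> 'a::euclidean_space set \<Rightarrow> ('w \<Rightarrow> 'a \<Rightarrow> real) set" where
  "L2_H10 M D = bochner_L2 M D (H10 D) (H10_norm D)"

definition Linf_Linf :: "'w measure \<Rightarrow> 'a::euclidean_space set \<Rightarrow> ('w \<Rightarrow> 'a \<Rightarrow> real) set" where
  "Linf_Linf M D = bochner_Linf M D (Linf_fun (vol D)) (Linf_norm (vol D))"

section \<open>The obstacle problem\<close>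

definition obstacle_set ::
  "'w measure \<Rightarrow> 'a::euclidean_space set \<Rightarrow> ('w \<Rightarrow> 'a \<Rightarrow> real) \<Rightarrow> ('w \<Rightarrow> 'a \<Rightarrow> real) set" where
  "obstacle_set M D g = {v \<in> L2_H10 M D. AE (\<omega>, x) in M \<Otimes>\<^sub>M vol D. v \<omega> x \<ge> g \<omega> x}"

definition bilin_form ::
  "'w measure \<Rightarrow> 'a::euclidean_space set \<Rightarrow> ('w \<Rightarrow> 'a \<Rightarrow> real) \<Rightarrow>
     ('w \<Rightarrow> 'a \<Rightarrow> real) \<Rightarrow> ('w \<Rightarrow> 'a \<Rightarrow> real) \<Rightarrow> real" where
  "bilin_form M D a u v =
     (\<integral>\<omega>. (\<integral>x. a \<omega> x * (weak_grad D (u \<omega>) x \<bullet> weak_grad D (v \<omega>) x) \<partial>vol D) \<partial>M)"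

definition load_form ::
  "'w measure \<Rightarrow> 'a::euclidean_space set \<Rightarrow> ('w \<Rightarrow> 'a \<Rightarrow> real) \<Rightarrow> ('w \<Rightarrow> 'a \<Rightarrow> real) \<Rightarrow> real" where
  "load_form M D f v = (\<integral>\<omega>. (\<integral>x. f \<omega> x * v \<omega> x \<partial>vol D) \<partial>M)"

definition solves_obstacle ::
  "'w measure \<Rightarrow> 'a::euclidean_space set \<Rightarrow> ('w \<Rightarrow> 'a \<Rightarrow> real) \<Rightarrow> ('w \<Rightarrow> 'a \<Rightarrow> real) \<Rightarrow>
     ('w \<Rightarrow> 'a \<Rightarrow> real) \<Rightarrow> ('w \<Rightarrow> 'a \<Rightarrow> real) \<Rightarrow> bool" where
  "solves_obstacle M D a f g u \<longleftrightarrow> u \<in> obstacle_set M D g \<and>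
     (\<forall>v \<in> obstacle_set M D g.
        bilin_form M D a u (\<lambda>\<omega> x. v \<omega> x - u \<omega> x) \<ge> load_form M D f (\<lambda>\<omega> x. v \<omega> x - u \<omega> x))"

end

theory Submission
  imports Defs
begin

text \<open>
  The form \<open>b\<close> is symmetric and coercive, so that a solution of the variational inequality is a minimiser
  of \<open>b(v, v) / 2 - \<ell>(v)\<close> over the closed convex set \<open>K\<close>; minimising sequences converge by the
  parallelogram law and the completeness of \<open>V\<close>. The substance lies in showing that \<open>K\<close> is nonempty,
  for which the positive part of \<open>g\<close> is used. That it belongs to \<open>H10 D\<close> follows from the trace
  condition: for smooth \<open>\<psi>\<close>, integrating along segments in the direction of the local graph bounds the
  square integral of \<open>\<psi>\<close> over a boundary collar of width \<open>\<delta>\<close> by \<open>O(\<delta>)\<close> times that over the boundary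
  plus \<open>O(\<delta>^2)\<close> times that of the gradient over a comparable collar. If the boundary values tend to
  zero, a cutoff at distance \<open>\<delta>\<close> from the boundary therefore changes the limit only by a quantity that
  tends to zero with \<open>\<delta>\<close>. The positive part is replaced by smooth functions \<open>spos \<epsilon>\<close> throughout, so that
  the cut-off approximants are themselves test functions.
\<close>

section \<open>Smooth functions\<close>

text \<open>Two obstacles beyond the collar estimate shape the proof. One is measurability in
  \<omega>: \<open>weak_grad\<close> and the approximating test functions are chosen separately for
  every function, and nothing makes such choices measurable in \<omega>. Continuity replaces
  selection. The maps \<open>spos \<epsilon>\<close> and, for a fixed coefficient, the energy are
  continuous in the Sobolev norms and so turn convergence of simple approximants into measurability,
  and a field is strongly measurable as soon as some countable set is dense along its values. The
  smoothing helps here again, since continuity of \<open>spos \<epsilon>\<close> comes from a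
  Lipschitz bound on its derivative. Limit fields are defined as pointwise limits, which keeps them
  jointly measurable. The other obstacle is the surface measure. As a Hausdorff measure it is
  compared with volume in one direction: a cover of a boundary piece by small sets yields a cover by
  balls of the strip swept out from it, hence an inequality between the projected volume and a
  multiple of the surface measure.\<close>

definition grad :: "('a::euclidean_space \<Rightarrow> real) \<Rightarrow> 'a \<Rightarrow> 'a" where
  "grad \<phi> x = (\<Sum>i\<in>Basis. partial_deriv i \<phi> x *\<^sub>R i)"

lemma grad_inner_Basis: "i \<in> Basis \<Longrightarrow> grad \<phi> x \<bullet> i = partial_deriv i \<phi> x"
  unfolding grad_def by (simp add: inner_sum_left inner_Basis if_distrib cong: if_cong)

lemma partial_deriv_eq: "(\<phi> has_derivative \<phi>') (at x) \<Longrightarrow> partial_deriv i \<phi> x = \<phi>' i"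
  unfolding partial_deriv_def using frechet_derivative_at by metis

lemma has_derivative_grad:
  assumes "\<phi> differentiable (at x)"
  shows "(\<phi> has_derivative (\<lambda>h. grad \<phi> x \<bullet> h)) (at x)"
proof -
  have d: "(\<phi> has_derivative frechet_derivative \<phi> (at x)) (at x)"
    using assms frechet_derivative_works by blast
  have l: "linear (frechet_derivative \<phi> (at x))"
    using d has_derivative_linear by blast
  have "frechet_derivative \<phi> (at x) = (\<lambda>h. grad \<phi> x \<bullet> h)"
  proof
    fix h
    have "frechet_derivative \<phi> (at x) h = frechet_derivative \<phi> (at x) (\<Sum>i\<in>Basis. (h \<bullet> i) *\<^sub>R i)"
      by (simp add: euclidean_representation)
    also have "\<dots> = (\<Sum>i\<in>Basis. (h \<bullet> i) * frechet_derivative \<phi> (at x) i)"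
      using l by (simp add: linear_sum linear_scale)
    also have "\<dots> = grad \<phi> x \<bullet> h"
      unfolding grad_def partial_deriv_def
      by (simp add: inner_sum_left inner_commute[of _ h] inner_sum_right mult.commute)
    finally show "frechet_derivative \<phi> (at x) h = grad \<phi> x \<bullet> h" .
  qed
  with d show ?thesis by simp
qed

lemma Ck_Suc_imp: "Ck (Suc k) \<phi> \<Longrightarrow> Ck k \<phi>"
proof (induction k arbitrary: \<phi>)
  case 0
  then show ?case
    by (auto intro!: differentiable_imp_continuous_on simp: differentiable_on_def differentiable_at_withinI)
qed auto

lemma smooth_iff:
  "smooth \<phi> \<longleftrightarrow> (\<forall>x. \<phi> differentiable (at x)) \<and> (\<forall>i\<in>Basis. smooth (partial_deriv i \<phi>))"
proof
  assume "smooth \<phi>"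
  then have "Ck (Suc k) \<phi>" for k unfolding smooth_def by blast
  then show "(\<forall>x. \<phi> differentiable (at x)) \<and> (\<forall>i\<in>Basis. smooth (partial_deriv i \<phi>))"
    unfolding smooth_def by auto
next
  assume "(\<forall>x. \<phi> differentiable (at x)) \<and> (\<forall>i\<in>Basis. smooth (partial_deriv i \<phi>))"
  then have "Ck (Suc k) \<phi>" for k unfolding smooth_def by auto
  then show "smooth \<phi>" unfolding smooth_def using Ck_Suc_imp by blast
qed

lemma smooth_partial_deriv: "smooth \<phi> \<Longrightarrow> i \<in> Basis \<Longrightarrow> smooth (partial_deriv i \<phi>)"
  using smooth_iff by blast

lemma smooth_differentiable: "smooth \<phi> \<Longrightarrow> \<phi> differentiable (at x)"
  using smooth_iff by blast

lemma smooth_continuous_on: "smooth \<phi> \<Longrightarrow> continuous_on S \<phi>"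
proof -
  assume "smooth \<phi>"
  then have "Ck 0 \<phi>" unfolding smooth_def by blast
  then show ?thesis using continuous_on_subset by auto
qed

lemma continuous_on_grad: "smooth \<phi> \<Longrightarrow> continuous_on S (grad \<phi>)"
  unfolding grad_def by (intro continuous_intros smooth_continuous_on smooth_partial_deriv)

lemma Ck_const: "Ck k (\<lambda>x. c)"
proof (induction k arbitrary: c)
  case (Suc k)
  have "partial_deriv i (\<lambda>x. c) = (\<lambda>x. 0)" for i :: 'a
    by (rule ext, subst partial_deriv_eq[where \<phi>' = "\<lambda>h. 0"]) auto
  then show ?case using Suc by auto
qed simp

lemma Ck_inner: "Ck k (\<lambda>x. x \<bullet> b)"
proof (cases k)
  case (Suc k)
  have d: "((\<lambda>x. x \<bullet> b) has_derivative (\<lambda>h. h \<bullet> b)) (at x)" for x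
    by (auto intro!: derivative_eq_intros)
  have "partial_deriv i (\<lambda>x. x \<bullet> b) = (\<lambda>x. i \<bullet> b)" for i :: 'a
    by (rule ext, subst partial_deriv_eq[OF d]) auto
  then show ?thesis using Suc d by (auto simp: Ck_const differentiable_def)
qed (auto intro!: continuous_intros)

lemma partial_deriv_add:
  assumes "\<phi> differentiable (at x)" "\<psi> differentiable (at x)"
  shows "partial_deriv i (\<lambda>x. \<phi> x + \<psi> x) x = partial_deriv i \<phi> x + partial_deriv i \<psi> x"
  using partial_deriv_eq[OF has_derivative_add[OF assms[unfolded frechet_derivative_works]]]
  by (simp add: partial_deriv_def)

lemma partial_deriv_mult:
  assumes "\<phi> differentiable (at x)" "\<psi> differentiable (at x)"
  shows "partial_deriv i (\<lambda>x. \<phi> x * \<psi> x) x = \<phi> x * partial_deriv i \<psi> x + partial_deriv i \<phi> x * \<psi> x"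
  using partial_deriv_eq[OF has_derivative_mult[OF assms[unfolded frechet_derivative_works]]]
  by (simp add: partial_deriv_def)

lemma partial_deriv_compose:
  assumes "\<phi> differentiable (at x)" "(F has_real_derivative F') (at (\<phi> x))"
  shows "((\<lambda>x. F (\<phi> x)) has_derivative (\<lambda>h. F' * (grad \<phi> x \<bullet> h))) (at x)"
    and "i \<in> Basis \<Longrightarrow> partial_deriv i (\<lambda>x. F (\<phi> x)) x = F' * partial_deriv i \<phi> x"
proof -
  show d: "((\<lambda>x. F (\<phi> x)) has_derivative (\<lambda>h. F' * (grad \<phi> x \<bullet> h))) (at x)"
    using has_derivative_compose[OF has_derivative_grad[OF assms(1)]
        assms(2)[unfolded has_field_derivative_def]] .
  show "i \<in> Basis \<Longrightarrow> partial_deriv i (\<lambda>x. F (\<phi> x)) x = F' * partial_deriv i \<phi> x"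
    by (subst partial_deriv_eq[OF d]) (simp add: grad_inner_Basis)
qed

lemma Ck_add: "Ck k \<phi> \<Longrightarrow> Ck k \<psi> \<Longrightarrow> Ck k (\<lambda>x. \<phi> x + \<psi> x)"
proof (induction k arbitrary: \<phi> \<psi>)
  case (Suc k)
  have "partial_deriv i (\<lambda>x. \<phi> x + \<psi> x) = (\<lambda>x. partial_deriv i \<phi> x + partial_deriv i \<psi> x)" for i
    using Suc.prems by (auto simp: partial_deriv_add)
  then show ?case using Suc by auto
qed (auto intro!: continuous_intros)

lemma Ck_mult: "Ck k \<phi> \<Longrightarrow> Ck k \<psi> \<Longrightarrow> Ck k (\<lambda>x. \<phi> x * \<psi> x)"
proof (induction k arbitrary: \<phi> \<psi>)
  case (Suc k)
  have "partial_deriv i (\<lambda>x. \<phi> x * \<psi> x) = (\<lambda>x. \<phi> x * partial_deriv i \<psi> x + partial_deriv i \<phi> x * \<psi> x)" for i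
    using Suc.prems by (auto simp: partial_deriv_mult)
  moreover have "Ck k \<phi>" "Ck k \<psi>" using Suc.prems Ck_Suc_imp by blast+
  ultimately show ?case using Suc by (auto intro!: Ck_add)
qed (auto intro!: continuous_intros)

text \<open>The outer function enters as a whole sequence of successive derivatives: the chain rule
  replaces \<open>F n\<close> by \<open>F (Suc n)\<close>, and the induction on \<open>k\<close>
  must be ready for every \<open>n\<close>.\<close>

lemma Ck_compose:
  assumes F: "\<And>n t. (F n has_real_derivative F (Suc n) t) (at t)"
  shows "Ck k \<phi> \<Longrightarrow> Ck k (\<lambda>x. F n (\<phi> x))"
proof (induction k arbitrary: n)
  case 0
  have "continuous_on UNIV (F n)"
    using F by (intro continuous_at_imp_continuous_on ballI) (blast intro: DERIV_isCont)
  then show ?case using 0 by (auto intro: continuous_on_compose2)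
next
  case (Suc k)
  then have "\<phi> differentiable (at x)" for x by auto
  note c = partial_deriv_compose[OF this F]
  have "partial_deriv i (\<lambda>x. F n (\<phi> x)) = (\<lambda>x. F (Suc n) (\<phi> x) * partial_deriv i \<phi> x)" if "i \<in> Basis" for i
    using c(2)[OF that] by auto
  moreover have "Ck k \<phi>" using Suc.prems Ck_Suc_imp by blast
  moreover have "(\<lambda>x. F n (\<phi> x)) differentiable (at x)" for x
    using c(1) by (auto simp: differentiable_def)
  ultimately show ?case using Suc by (auto intro!: Ck_mult)
qed

lemma smooth_const: "smooth (\<lambda>x. c)"
  and smooth_inner: "smooth (\<lambda>x. x \<bullet> b)"
  and smooth_add: "smooth \<phi> \<Longrightarrow> smooth \<psi> \<Longrightarrow> smooth (\<lambda>x. \<phi> x + \<psi> x)"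
  and smooth_mult: "smooth \<phi> \<Longrightarrow> smooth \<psi> \<Longrightarrow> smooth (\<lambda>x. \<phi> x * \<psi> x)"
  and smooth_compose: "(\<And>n t. (F n has_real_derivative F (Suc n) t) (at t)) \<Longrightarrow> smooth \<phi> \<Longrightarrow>
    smooth (\<lambda>x. F n (\<phi> x))"
  unfolding smooth_def by (simp_all add: Ck_const Ck_inner Ck_add Ck_mult Ck_compose)

lemma smooth_prod: "finite I \<Longrightarrow> (\<And>i. i \<in> I \<Longrightarrow> smooth (\<phi> i)) \<Longrightarrow> smooth (\<lambda>x. \<Prod>i\<in>I. \<phi> i x)"
  by (induction I rule: finite_induct) (simp_all add: smooth_const smooth_mult)

lemma smooth_diff: "smooth \<phi> \<Longrightarrow> smooth \<psi> \<Longrightarrow> smooth (\<lambda>x. \<phi> x - \<psi> x)"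
  using smooth_add[of \<phi> "\<lambda>x. (-1) * \<psi> x"] smooth_mult[OF smooth_const[of "-1"], of \<psi>] by simp

lemma grad_mult:
  assumes "smooth \<phi>" "smooth \<psi>"
  shows "grad (\<lambda>x. \<phi> x * \<psi> x) x = \<phi> x *\<^sub>R grad \<psi> x + \<psi> x *\<^sub>R grad \<phi> x"
  unfolding grad_def using assms[THEN smooth_differentiable]
  by (simp add: partial_deriv_mult scaleR_add_left sum.distrib scaleR_sum_right mult.commute)

lemma grad_compose:
  assumes "smooth \<phi>" "(F has_real_derivative F') (at (\<phi> x))"
  shows "grad (\<lambda>x. F (\<phi> x)) x = F' *\<^sub>R grad \<phi> x"
  unfolding grad_def using partial_deriv_compose(2)[OF smooth_differentiable[OF assms(1)] assms(2)]
  by (simp add: scaleR_sum_right)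

lemma partial_deriv_eq_0:
  assumes "open U" "x \<in> U" "\<And>y. y \<in> U \<Longrightarrow> \<phi> y = 0"
  shows "partial_deriv i \<phi> x = 0"
proof -
  have "((\<lambda>y. 0::real) has_derivative (\<lambda>h. 0)) (at x)" by simp
  then have "(\<phi> has_derivative (\<lambda>h. 0)) (at x)"
    by (rule has_derivative_transform_within_open[OF _ assms(1,2)]) (simp add: assms(3))
  then show ?thesis by (simp add: partial_deriv_eq)
qed

lemma partial_deriv_outside_support:
  "x \<notin> closure {x. \<phi> x \<noteq> 0} \<Longrightarrow> partial_deriv i \<phi> x = 0"
  by (rule partial_deriv_eq_0[of "- closure {x. \<phi> x \<noteq> 0}"])
     (use closure_subset[of "{x. \<phi> x \<noteq> 0}"] in auto)

lemma grad_outside_support: "x \<notin> closure {x. \<phi> x \<noteq> 0} \<Longrightarrow> grad \<phi> x = 0"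
  unfolding grad_def by (simp add: partial_deriv_outside_support)

lemma DERIV_along_line:
  assumes "smooth \<phi>"
  shows "((\<lambda>t. \<phi> (x + t *\<^sub>R e)) has_real_derivative (grad \<phi> (x + t *\<^sub>R e) \<bullet> e)) (at t)"
proof -
  have "((\<lambda>t. x + t *\<^sub>R e) has_derivative (\<lambda>s. s *\<^sub>R e)) (at t)"
    by (auto intro!: derivative_eq_intros)
  from has_derivative_compose[OF this has_derivative_grad[OF smooth_differentiable[OF assms]]]
  show ?thesis unfolding has_field_derivative_def
    by (rule has_derivative_eq_rhs) (simp add: fun_eq_iff)
qed

subsection \<open>The flat exponential\<close>

text \<open>The polynomial in 1/t makes the family closed under differentiation, so that every
  derivative of exp(-c/t), extended by zero, is again a member.\<close>

definition flat_exp :: "real poly \<Rightarrow> real \<Rightarrow> real \<Rightarrow> real" where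
  "flat_exp p c t = (if t > 0 then poly p (1/t) * exp (- c / t) else 0)"

text \<open>With s = 1/t one has ds/dt = -s^2, so p(s) exp(-c s) has the t-derivative s^2 (c p(s) -
  p'(s)) exp(-c s). The factor \<open>[:0,0,1:]\<close> is s^2.\<close>

definition flat_deriv :: "real \<Rightarrow> real poly \<Rightarrow> real poly" where
  "flat_deriv c p = [:0,0,1:] * (smult c p - pderiv p)"

text \<open>The free power \<open>k\<close> is what the induction consumes: stripping the constant
  coefficient off the polynomial raises it by one.\<close>

lemma tendsto_poly_exp_0:
  fixes c :: real
  assumes "c > 0"
  shows "((\<lambda>s. s ^ k * poly p s * exp (- c * s)) \<longlongrightarrow> 0) at_top"
proof (induction p arbitrary: k rule: pCons_induct)
  case 0
  then show ?case by simp
next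
  case (pCons a p)
  have "((\<lambda>s. (c * s) ^ k / exp (c * s)) \<longlongrightarrow> 0) at_top"
    by (rule filterlim_compose[OF tendsto_power_div_exp_0[of k]])
       (use assms in \<open>auto intro!: filterlim_tendsto_pos_mult_at_top[OF tendsto_const] filterlim_ident\<close>)
  then have "((\<lambda>s. a / c ^ k * ((c * s) ^ k / exp (c * s))) \<longlongrightarrow> a / c ^ k * 0) at_top"
    by (intro tendsto_intros)
  then have "((\<lambda>s. a * s ^ k * exp (- c * s)) \<longlongrightarrow> 0) at_top"
    using assms by (simp add: power_mult_distrib exp_minus field_simps)
  from tendsto_add[OF this pCons.IH[of "Suc k"]] show ?case
    by (simp add: algebra_simps)
qed

lemma DERIV_flat_exp:
  assumes c: "c > 0"
  shows "(flat_exp p c has_real_derivative flat_exp (flat_deriv c p) c t) (at t)"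
proof -
  consider "t > 0" | "t < 0" | "t = 0" by linarith
  then show ?thesis
  proof cases
    case 1
    have d1: "((\<lambda>t. 1 / t) has_real_derivative (- 1 / t\<^sup>2)) (at t)"
      and d2: "((\<lambda>t. exp (- c / t)) has_real_derivative exp (- c / t) * (c / t\<^sup>2)) (at t)"
      using 1 by (auto intro!: derivative_eq_intros simp: power2_eq_square)
    have "poly (flat_deriv c p) (1 / t) * exp (- c / t) =
        (poly (pderiv p) (1 / t) * (- 1 / t\<^sup>2)) * exp (- c / t)
        + (exp (- c / t) * (c / t\<^sup>2)) * poly p (1 / t)"
      by (simp add: flat_deriv_def algebra_simps power2_eq_square)
    then have "((\<lambda>t. poly p (1/t) * exp (- c / t)) has_real_derivative flat_exp (flat_deriv c p) c t) (at t)"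
      using DERIV_mult[OF DERIV_chain2[OF poly_DERIV d1] d2] 1 by (simp add: flat_exp_def)
    then show ?thesis
      by (rule has_field_derivative_transform_within_open[of _ _ _ "{0<..}"])
         (use 1 in \<open>auto simp: flat_exp_def\<close>)
  next
    case 2
    have "((\<lambda>t. 0) has_real_derivative flat_exp (flat_deriv c p) c t) (at t)"
      using 2 by (simp add: flat_exp_def)
    then show ?thesis
      by (rule has_field_derivative_transform_within_open[of _ _ _ "{..<0}"])
         (use 2 in \<open>auto simp: flat_exp_def\<close>)
  next
    case 3
    \<comment> \<open>In s = 1/t the right difference quotient at 0 is s p(s) exp(-c s), which the
      exponential drives to 0. The left one vanishes identically.\<close>
    have "((\<lambda>s. poly p s * exp (- c * s) * s) \<longlongrightarrow> 0) at_top"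
      using tendsto_poly_exp_0[OF c, of 1 p] by (simp add: mult_ac)
    then have "((\<lambda>t. poly p (inverse t) * exp (- c * inverse t) * inverse t) \<longlongrightarrow> 0) (at_right 0)"
      by (subst filterlim_at_right_to_top) simp
    then have "((\<lambda>h. (flat_exp p c (0 + h) - flat_exp p c 0) / h) \<longlongrightarrow> 0) (at_right 0)"
      by (rule Lim_transform_eventually)
         (simp add: eventually_at_filter flat_exp_def divide_inverse)
    moreover have "((\<lambda>h. (flat_exp p c (0 + h) - flat_exp p c 0) / h) \<longlongrightarrow> 0) (at_left 0)"
      by (rule Lim_transform_eventually[OF tendsto_const])
         (simp add: eventually_at_filter flat_exp_def)
    ultimately have "((\<lambda>h. (flat_exp p c (0 + h) - flat_exp p c 0) / h) \<longlongrightarrow> 0) (at 0)"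
      using filterlim_split_at by blast
    then show ?thesis
      using 3 by (simp add: DERIV_def flat_exp_def)
  qed
qed

lemma smooth_flat_exp:
  assumes "c > 0" "smooth \<phi>"
  shows "smooth (\<lambda>x. flat_exp p c (\<phi> x))"
proof -
  have "smooth (\<lambda>x. flat_exp ((flat_deriv c ^^ 0) p) c (\<phi> x))"
    by (rule smooth_compose[where F = "\<lambda>n. flat_exp ((flat_deriv c ^^ n) p) c"])
       (use DERIV_flat_exp[OF assms(1)] assms(2) in auto)
  then show ?thesis by simp
qed

subsection \<open>Test functions\<close>

lemma test_fun_mono: "D \<subseteq> E \<Longrightarrow> test_fun D \<subseteq> test_fun E"
  unfolding test_fun_def by auto

lemma test_funD:
  assumes "\<phi> \<in> test_fun D"
  shows "smooth \<phi>" "compact (closure {x. \<phi> x \<noteq> 0})" "x \<notin> D \<Longrightarrow> \<phi> x = 0"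
    "x \<notin> D \<Longrightarrow> partial_deriv i \<phi> x = 0" "x \<notin> D \<Longrightarrow> grad \<phi> x = 0"
  using assms partial_deriv_outside_support[of x \<phi>] grad_outside_support[of x \<phi>]
    closure_subset[of "{x. \<phi> x \<noteq> 0}"] unfolding test_fun_def by auto

lemma test_funI:
  assumes "smooth \<phi>" "compact K" "K \<subseteq> D" "\<And>x. x \<notin> K \<Longrightarrow> \<phi> x = 0"
  shows "\<phi> \<in> test_fun D"
proof -
  have "closure {x. \<phi> x \<noteq> 0} \<subseteq> K"
    using assms(2,4) by (intro closure_minimal) (auto simp: compact_imp_closed)
  moreover from this have "compact (closure {x. \<phi> x \<noteq> 0})"
    using assms(2) by (meson bounded_subset closed_closure compact_eq_bounded_closed)
  ultimately show ?thesis using assms unfolding test_fun_def by auto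
qed

lemma test_fun_mult:
  assumes "smooth w" "\<phi> \<in> test_fun D"
  shows "(\<lambda>x. w x * \<phi> x) \<in> test_fun D"
proof (rule test_funI)
  show "smooth (\<lambda>x. w x * \<phi> x)" using assms test_funD smooth_mult by blast
  show "compact (closure {x. \<phi> x \<noteq> 0})" "closure {x. \<phi> x \<noteq> 0} \<subseteq> D"
    using assms by (auto simp: test_fun_def)
  show "\<And>x. x \<notin> closure {x. \<phi> x \<noteq> 0} \<Longrightarrow> w x * \<phi> x = 0"
    using closure_subset[of "{x. \<phi> x \<noteq> 0}"] by auto
qed

lemma test_fun_partial_deriv:
  assumes "\<phi> \<in> test_fun D" "i \<in> Basis"
  shows "partial_deriv i \<phi> \<in> test_fun D"
  by (rule test_funI[where K = "closure {x. \<phi> x \<noteq> 0}"])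
     (use assms partial_deriv_outside_support in \<open>auto simp: test_fun_def smooth_partial_deriv\<close>)

lemma test_fun_diff:
  assumes "\<phi> \<in> test_fun D" "\<psi> \<in> test_fun D"
  shows "(\<lambda>x. \<phi> x - \<psi> x) \<in> test_fun D"
  by (rule test_funI[where K = "closure {x. \<phi> x \<noteq> 0} \<union> closure {x. \<psi> x \<noteq> 0}"])
     (use assms closure_subset[of "{x. \<phi> x \<noteq> 0}"] closure_subset[of "{x. \<psi> x \<noteq> 0}"] in
      \<open>fastforce simp: test_fun_def intro: smooth_diff compact_Un\<close>)+

lemma integrable_continuous_compact_support:
  fixes f :: "'a::euclidean_space \<Rightarrow> 'b::euclidean_space"
  assumes "continuous_on UNIV f" "compact K" "\<And>x. x \<notin> K \<Longrightarrow> f x = 0"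
  shows "integrable lborel f"
proof -
  have "integrable lborel (\<lambda>x. indicator K x *\<^sub>R f x)"
    using assms by (intro borel_integrable_compact) (auto intro: continuous_on_subset)
  moreover have "(\<lambda>x. indicator K x *\<^sub>R f x) = f"
    using assms(3) by (auto simp: fun_eq_iff indicator_def)
  ultimately show ?thesis by simp
qed

lemma integrable_test_fun: "\<phi> \<in> test_fun D \<Longrightarrow> integrable lborel \<phi>"
  by (rule integrable_continuous_compact_support[where K = "closure {x. \<phi> x \<noteq> 0}"])
     (use closure_subset[of "{x. \<phi> x \<noteq> 0}"] in
      \<open>auto simp: test_fun_def intro: smooth_continuous_on\<close>)

lemma abs_diff_along_line_le:
  assumes "smooth \<phi>" "\<And>t. \<bar>grad \<phi> (x + t *\<^sub>R e) \<bullet> e\<bar> \<le> B"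
  shows "\<bar>\<phi> (x + h *\<^sub>R e) - \<phi> x\<bar> \<le> B * \<bar>h\<bar>"
proof -
  have "norm (\<phi> (x + h *\<^sub>R e) - \<phi> (x + 0 *\<^sub>R e)) \<le> B * norm (h - 0)"
    by (rule field_differentiable_bound[where S = UNIV and f' = "\<lambda>t. grad \<phi> (x + t *\<^sub>R e) \<bullet> e"])
       (use assms DERIV_along_line[OF assms(1)] in auto)
  then show ?thesis by simp
qed

text \<open>Translation invariance makes the integrals of the difference quotients vanish, and
  dominated convergence hands this on to the derivative.\<close>

lemma integral_partial_deriv_eq_0:
  fixes \<theta> :: "'a::euclidean_space \<Rightarrow> real"
  assumes \<theta>: "\<theta> \<in> test_fun UNIV" and i: "i \<in> Basis"
  shows "(\<integral>x. partial_deriv i \<theta> x \<partial>lborel) = 0"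
proof -
  have sm: "smooth \<theta>" using \<theta> by (rule test_funD)
  obtain R where R: "R > 0" "\<And>x. norm x > R \<Longrightarrow> \<theta> x = 0"
  proof -
    have "bounded {x. \<theta> x \<noteq> 0}"
      using test_funD(2)[OF \<theta>] bounded_subset closure_subset compact_imp_bounded by metis
    then obtain R where "\<And>x. \<theta> x \<noteq> 0 \<Longrightarrow> norm x \<le> R"
      unfolding bounded_iff by auto
    then show ?thesis using that[of "max R 1"] by fastforce
  qed
  obtain B where B: "\<And>x. \<bar>partial_deriv i \<theta> x\<bar> \<le> B"
  proof -
    let ?K = "closure {x. \<theta> x \<noteq> 0}"
    have "bounded (partial_deriv i \<theta> ` ?K)"
      using test_funD(2)[OF \<theta>] smooth_continuous_on[OF smooth_partial_deriv[OF sm i]]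
      by (intro compact_imp_bounded compact_continuous_image) auto
    then obtain B where B: "\<And>x. x \<in> ?K \<Longrightarrow> \<bar>partial_deriv i \<theta> x\<bar> \<le> B"
      unfolding bounded_iff by auto
    have "\<bar>partial_deriv i \<theta> x\<bar> \<le> max B 0" for x
      using B[of x] partial_deriv_outside_support[of x \<theta> i] by (cases "x \<in> ?K") auto
    then show ?thesis using that by blast
  qed
  have int: "integrable lborel \<theta>" using integrable_test_fun \<theta> by blast
  have sh: "integrable lborel (\<lambda>x. \<theta> (x + h))" "(\<integral>x. \<theta> (x + h) \<partial>lborel) = (\<integral>x. \<theta> x \<partial>lborel)" for h
  proof -
    have [measurable]: "\<theta> \<in> borel_measurable borel" using int by auto
    have e: "lborel = distr lborel borel (\<lambda>x. x + h)"
      using lborel_distr_plus[of h] by (simp add: add.commute[of _ h])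
    show "integrable lborel (\<lambda>x. \<theta> (x + h))"
      using int by (subst (asm) e) (simp add: integrable_distr_eq)
    show "(\<integral>x. \<theta> (x + h) \<partial>lborel) = (\<integral>x. \<theta> x \<partial>lborel)"
      by (subst (2) e) (simp add: integral_distr)
  qed
  define s where "s n x = real (Suc n) * (\<theta> (x + (1 / real (Suc n)) *\<^sub>R i) - \<theta> x)" for n x
  have s0: "(\<integral>x. s n x \<partial>lborel) = 0" for n
    unfolding s_def using sh int by simp
  \<comment> \<open>By the mean value theorem the quotients inherit the bound \<open>B\<close> of
    the derivative. The shifts have length at most 1, so the quotients vanish outside the ball of
    radius R + 1.\<close>
  have "(\<lambda>n. \<integral>x. s n x \<partial>lborel) \<longlonglongrightarrow> (\<integral>x. partial_deriv i \<theta> x \<partial>lborel)"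
  proof (rule integral_dominated_convergence[where w = "\<lambda>x. B * indicator (cball 0 (R + 1)) x"])
    show "partial_deriv i \<theta> \<in> borel_measurable lborel"
      using smooth_continuous_on[OF smooth_partial_deriv[OF sm i]] by (simp add: borel_measurable_continuous_onI)
    show "s n \<in> borel_measurable lborel" for n
      unfolding s_def using sh int by (auto intro!: borel_measurable_times borel_measurable_diff)
    show "integrable lborel (\<lambda>x::'a. B * indicator (cball 0 (R + 1)) x :: real)"
      using emeasure_bounded_finite[OF bounded_cball, of "0::'a" "R + 1"] by (simp add: integrable_indicator_iff)
    show "AE x in lborel. (\<lambda>n. s n x) \<longlonglongrightarrow> partial_deriv i \<theta> x"
    proof (rule AE_I2)
      fix x
      have "((\<lambda>t. \<theta> (x + t *\<^sub>R i)) has_real_derivative partial_deriv i \<theta> x) (at 0)"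
        using DERIV_along_line[OF sm, of x i 0] i by (simp add: grad_inner_Basis)
      then have *: "((\<lambda>h. (\<theta> (x + h *\<^sub>R i) - \<theta> x) / h) \<longlongrightarrow> partial_deriv i \<theta> x) (at 0)"
        by (simp add: DERIV_def)
      have "filterlim (\<lambda>n. 1 / real (Suc n)) (at 0) sequentially"
        by (rule filterlim_atI) (use LIMSEQ_inverse_real_of_nat in \<open>auto simp: inverse_eq_divide\<close>)
      from filterlim_compose[OF * this] show "(\<lambda>n. s n x) \<longlonglongrightarrow> partial_deriv i \<theta> x"
        by (simp add: s_def mult.commute)
    qed
    show "AE x in lborel. norm (s n x) \<le> B * indicator (cball 0 (R + 1)) x" for n
    proof (rule AE_I2)
      fix x
      let ?h = "1 / real (Suc n)"
      show "norm (s n x) \<le> B * indicator (cball 0 (R + 1)) x"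
      proof (cases "norm x \<le> R + 1")
        case True
        have "\<bar>\<theta> (x + ?h *\<^sub>R i) - \<theta> x\<bar> \<le> B * \<bar>?h\<bar>"
          by (rule abs_diff_along_line_le[OF sm]) (use B i in \<open>simp add: grad_inner_Basis\<close>)
        then have "real (Suc n) * \<bar>\<theta> (x + ?h *\<^sub>R i) - \<theta> x\<bar> \<le> real (Suc n) * (B * \<bar>?h\<bar>)"
          by (intro mult_left_mono) auto
        then show ?thesis using True by (simp add: s_def abs_mult)
      next
        case False
        have "norm (?h *\<^sub>R i) \<le> 1" using i by simp
        then have "norm (x + ?h *\<^sub>R i) > R"
          using False norm_triangle_ineq2[of x "- (?h *\<^sub>R i)"] by (smt (verit) diff_minus_eq_add norm_minus_cancel)
        then show ?thesis using False R by (simp add: s_def)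
      qed
    qed
  qed
  then show ?thesis using s0 by (simp add: LIMSEQ_const_iff)
qed

lemma integral_vol_eq:
  fixes f :: "'a::euclidean_space \<Rightarrow> 'b::euclidean_space"
  assumes "open D" "\<And>x. x \<notin> D \<Longrightarrow> f x = 0"
  shows "(\<integral>x. f x \<partial>vol D) = (\<integral>x. f x \<partial>lborel)" "integrable (vol D) f \<longleftrightarrow> integrable lborel f"
proof -
  have "(\<lambda>x. indicator D x *\<^sub>R f x) = f"
    using assms(2) by (auto simp: fun_eq_iff indicator_def)
  then show "(\<integral>x. f x \<partial>vol D) = (\<integral>x. f x \<partial>lborel)" "integrable (vol D) f \<longleftrightarrow> integrable lborel f"
    using assms(1) by (simp_all add: integral_restrict_space integrable_restrict_space)
qed

lemma integral_by_parts:
  assumes D: "open D" and w: "smooth w" and \<phi>: "\<phi> \<in> test_fun D" and i: "i \<in> Basis"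
  shows "(\<integral>x. w x * partial_deriv i \<phi> x \<partial>vol D) = - (\<integral>x. partial_deriv i w x * \<phi> x \<partial>vol D)"
proof -
  have 1: "(\<lambda>x. w x * partial_deriv i \<phi> x) \<in> test_fun D"
    by (intro test_fun_mult w test_fun_partial_deriv \<phi> i)
  have 2: "(\<lambda>x. partial_deriv i w x * \<phi> x) \<in> test_fun D"
    by (intro test_fun_mult smooth_partial_deriv w \<phi> i)
  have "(\<lambda>x. w x * \<phi> x) \<in> test_fun UNIV"
    using test_fun_mult[OF w \<phi>] test_fun_mono[of D UNIV] by auto
  from integral_partial_deriv_eq_0[OF this i]
  have "(\<integral>x. w x * partial_deriv i \<phi> x + partial_deriv i w x * \<phi> x \<partial>lborel) = 0"
    using w test_funD(1)[OF \<phi>] by (simp add: partial_deriv_mult smooth_differentiable)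
  then show ?thesis
    using integrable_test_fun[OF 1] integrable_test_fun[OF 2]
    by (subst (1 2) integral_vol_eq[OF D]) (use test_funD[OF \<phi>] in auto)
qed

lemma has_weak_grad_smooth:
  assumes "open D" "smooth w"
  shows "has_weak_grad D w (grad w)"
  unfolding has_weak_grad_def
  using integral_by_parts[OF assms] by (simp add: grad_inner_Basis)

text \<open>The derivative of x_i \<phi>^2 has integral zero, so the integral of \<phi>^2 is minus
  twice that of x_i \<phi> d_i \<phi>. As |x_i| is at most R on D, Young's inequality absorbs half
  of the left side.\<close>

lemma poincare_test_fun:
  assumes D: "open D" and R: "R > 0" "\<And>x. x \<in> D \<Longrightarrow> norm x \<le> R" and \<phi>: "\<phi> \<in> test_fun D" and i: "i \<in> Basis"
  shows "(\<integral>x. (\<phi> x)\<^sup>2 \<partial>vol D) \<le> 4 * R\<^sup>2 * (\<integral>x. (partial_deriv i \<phi> x)\<^sup>2 \<partial>vol D)"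
proof -
  have sm: "smooth \<phi>" using \<phi> by (rule test_funD)
  have p2: "(\<lambda>x. \<phi> x * \<phi> x) \<in> test_fun D" using test_fun_mult[OF sm \<phi>] .
  have q2: "(\<lambda>x. partial_deriv i \<phi> x * partial_deriv i \<phi> x) \<in> test_fun D"
    using test_fun_mult[OF smooth_partial_deriv[OF sm i] test_fun_partial_deriv[OF \<phi> i]] .
  have pq: "(\<lambda>x. (x \<bullet> i) * (\<phi> x * partial_deriv i \<phi> x)) \<in> test_fun D"
    using test_fun_mult[OF smooth_inner test_fun_mult[OF sm test_fun_partial_deriv[OF \<phi> i]]] .
  note int = p2[THEN integrable_test_fun] q2[THEN integrable_test_fun] pq[THEN integrable_test_fun]
  have d: "partial_deriv i (\<lambda>x. (x \<bullet> i) * (\<phi> x * \<phi> x)) x =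
     \<phi> x * \<phi> x + 2 * ((x \<bullet> i) * (\<phi> x * partial_deriv i \<phi> x))" for x
  proof -
    have "partial_deriv i (\<lambda>x. x \<bullet> i) x = i \<bullet> i"
      by (rule partial_deriv_eq) (auto intro!: derivative_eq_intros)
    then show ?thesis
      using smooth_differentiable[OF sm] smooth_differentiable[OF smooth_inner]
        smooth_differentiable[OF smooth_mult[OF sm sm]] i
      by (simp add: partial_deriv_mult algebra_simps)
  qed
  have "(\<lambda>x. (x \<bullet> i) * (\<phi> x * \<phi> x)) \<in> test_fun UNIV"
    using test_fun_mult[OF smooth_inner p2] test_fun_mono[of D UNIV] by auto
  from integral_partial_deriv_eq_0[OF this i]
  have "0 = (\<integral>x. \<phi> x * \<phi> x + 2 * ((x \<bullet> i) * (\<phi> x * partial_deriv i \<phi> x)) \<partial>lborel)"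
    by (simp add: d)
  \<comment> \<open>The weights are those of 2 R |\<phi>| |d_i \<phi>| \<le> \<phi>^2/2 + 2 R^2 |d_i
    \<phi>|^2; doubling afterwards produces the factor 4 R^2.\<close>
  also have "\<dots> \<ge> (\<integral>x. \<phi> x * \<phi> x - (\<phi> x * \<phi> x / 2 + 2 * R\<^sup>2 * (partial_deriv i \<phi> x * partial_deriv i \<phi> x)) \<partial>lborel)"
  proof (rule integral_mono)
    fix x
    have "- ((x \<bullet> i) * (\<phi> x * partial_deriv i \<phi> x)) \<le> \<bar>\<phi> x\<bar> * (R * \<bar>partial_deriv i \<phi> x\<bar>)"
    proof (cases "x \<in> D")
      case True
      then have "\<bar>x \<bullet> i\<bar> \<le> R" using R(2) Basis_le_norm[OF i] order_trans by blast
      then have "\<bar>x \<bullet> i\<bar> * \<bar>\<phi> x * partial_deriv i \<phi> x\<bar> \<le> R * \<bar>\<phi> x * partial_deriv i \<phi> x\<bar>"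
        by (intro mult_right_mono) auto
      then show ?thesis by (auto simp: abs_mult mult_ac intro: order_trans[OF abs_ge_minus_self])
    next
      case False
      then show ?thesis using test_funD[OF \<phi>] by simp
    qed
    also have "2 * (\<bar>\<phi> x\<bar> * (R * \<bar>partial_deriv i \<phi> x\<bar>)) \<le> \<phi> x * \<phi> x / 2 + 2 * R\<^sup>2 * (partial_deriv i \<phi> x * partial_deriv i \<phi> x)"
    proof -
      have "0 \<le> (\<bar>\<phi> x\<bar> - 2 * R * \<bar>partial_deriv i \<phi> x\<bar>)\<^sup>2" by simp
      then show ?thesis by (simp add: power2_diff power2_eq_square algebra_simps)
    qed
    ultimately show "\<phi> x * \<phi> x - (\<phi> x * \<phi> x / 2 + 2 * R\<^sup>2 * (partial_deriv i \<phi> x * partial_deriv i \<phi> x))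
        \<le> \<phi> x * \<phi> x + 2 * ((x \<bullet> i) * (\<phi> x * partial_deriv i \<phi> x))"
      by linarith
  qed (use int in auto)
  finally have "(\<integral>x. \<phi> x * \<phi> x \<partial>lborel) \<le> 4 * R\<^sup>2 * (\<integral>x. partial_deriv i \<phi> x * partial_deriv i \<phi> x \<partial>lborel)"
    using int by simp
  then show ?thesis
    by (subst (1 2) integral_vol_eq[OF D]) (use test_funD[OF \<phi>] in \<open>auto simp: power2_eq_square\<close>)
qed

subsection \<open>Smooth bumps on boxes and the fundamental lemma\<close>

text \<open>Each factor is flat at one face of the box. The parameter \<open>c\<close> is there to
  be sent to 0, when the bump increases to the indicator of the open box.\<close>

definition box_bump :: "'a::euclidean_space \<Rightarrow> 'a \<Rightarrow> real \<Rightarrow> 'a \<Rightarrow> real" where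
  "box_bump a b c x = (\<Prod>i\<in>Basis. flat_exp 1 c ((x - a) \<bullet> i) * flat_exp 1 c ((b - x) \<bullet> i))"

lemma flat_exp_1_bounds: "c > 0 \<Longrightarrow> 0 \<le> flat_exp 1 c t" "c > 0 \<Longrightarrow> flat_exp 1 c t \<le> 1"
  by (auto simp: flat_exp_def)

lemma smooth_box_bump: "c > 0 \<Longrightarrow> smooth (box_bump a b c)"
proof -
  assume c: "c > 0"
  have 1: "smooth (\<lambda>x. (x - a) \<bullet> i)" for i
    using smooth_add[OF smooth_inner smooth_const[of "- (a \<bullet> i)"], of i] by (simp add: inner_diff_left)
  have 2: "smooth (\<lambda>x. (b - x) \<bullet> i)" for i
    using smooth_diff[OF smooth_const[of "b \<bullet> i"] smooth_inner, of i] by (simp add: inner_diff_left)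
  show ?thesis unfolding box_bump_def[abs_def]
    by (intro smooth_prod smooth_mult smooth_flat_exp 1 2 c finite_Basis)
qed

lemma box_bump_bounds: "c > 0 \<Longrightarrow> 0 \<le> box_bump a b c x" "c > 0 \<Longrightarrow> box_bump a b c x \<le> 1"
  unfolding box_bump_def
  by (auto intro!: prod_nonneg prod_le_1 mult_le_one simp: flat_exp_1_bounds)

lemma box_bump_pos: "x \<in> box a b \<Longrightarrow> box_bump a b c x > 0"
  unfolding box_bump_def
  by (rule prod_pos) (auto simp: mem_box inner_diff_left flat_exp_def)

lemma box_bump_eq_0: "x \<notin> box a b \<Longrightarrow> box_bump a b c x = 0"
  unfolding box_bump_def by (force simp: mem_box inner_diff_left flat_exp_def not_less)

lemma box_bump_test_fun: "c > 0 \<Longrightarrow> cbox a b \<subseteq> D \<Longrightarrow> box_bump a b c \<in> test_fun D"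
  by (rule test_funI[OF smooth_box_bump, where K = "cbox a b"])
     (use box_bump_eq_0[of _ a b] box_subset_cbox[of a b] in auto)

lemma box_bump_tendsto:
  "(\<lambda>m. box_bump a b (1 / real (Suc m)) x) \<longlonglongrightarrow> indicator (box a b) x"
proof (cases "x \<in> box a b")
  case True
  have "(\<lambda>m. flat_exp 1 (1 / real (Suc m)) t) \<longlonglongrightarrow> 1" if "t > 0" for t
  proof -
    have "(\<lambda>m. exp (- (inverse (real (Suc m)) / t))) \<longlonglongrightarrow> exp (- (0 / t))"
      by (intro tendsto_intros LIMSEQ_inverse_real_of_nat) (use that in auto)
    then show ?thesis using that by (simp add: flat_exp_def inverse_eq_divide)
  qed
  then have "(\<lambda>m. box_bump a b (1 / real (Suc m)) x) \<longlonglongrightarrow> (\<Prod>i\<in>(Basis::'a set). 1 * 1)"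
    unfolding box_bump_def using True by (intro tendsto_intros) (auto simp: mem_box inner_diff_left)
  then show ?thesis using True by simp
qed (simp add: box_bump_eq_0)

text \<open>Bumps give vanishing integrals over boxes whose closure lies in D, a Dynkin argument
  extends this to the Borel subsets of one such box, and by Lindelof countably many of these boxes
  cover D.\<close>

lemma AE_eq_0_if_test_fun_integrals_0:
  fixes h :: "'a::euclidean_space \<Rightarrow> real"
  assumes D: "open D" and h: "integrable (vol D) h"
    and 0: "\<And>\<phi>. \<phi> \<in> test_fun D \<Longrightarrow> (\<integral>x. h x * \<phi> x \<partial>vol D) = 0"
  shows "AE x in vol D. h x = 0"
proof -
  define H where "H x = indicator D x * h x" for x
  have H: "integrable lborel H"
    using h D unfolding H_def by (simp add: integrable_restrict_space)
  have H0: "(\<integral>x. H x * \<phi> x \<partial>lborel) = 0" if "\<phi> \<in> test_fun D" for \<phi>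
    using 0[OF that] D unfolding H_def by (simp add: integral_restrict_space mult_ac)
  have Hbox: "(\<integral>x. H x * indicator (box a b) x \<partial>lborel) = 0" if "cbox a b \<subseteq> D" for a b
  proof -
    have "(\<lambda>m. \<integral>x. H x * box_bump a b (1 / real (Suc m)) x \<partial>lborel) \<longlonglongrightarrow> (\<integral>x. H x * indicator (box a b) x \<partial>lborel)"
    proof (rule integral_dominated_convergence[where w = "\<lambda>x. \<bar>H x\<bar>"])
      show "AE x in lborel. (\<lambda>m. H x * box_bump a b (1 / real (Suc m)) x) \<longlonglongrightarrow> H x * indicator (box a b) x"
        by (intro AE_I2 tendsto_intros box_bump_tendsto)
      have "box_bump a b (1 / real (Suc m)) \<in> borel_measurable lborel" for m
        using smooth_continuous_on[OF smooth_box_bump[of "1 / real (Suc m)" a b], of UNIV]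
        by (simp add: borel_measurable_continuous_onI)
      then show "(\<lambda>x. H x * box_bump a b (1 / real (Suc m)) x) \<in> borel_measurable lborel" for m
        using H by auto
      show "AE x in lborel. norm (H x * box_bump a b (1 / real (Suc m)) x) \<le> \<bar>H x\<bar>" for m
        using box_bump_bounds[of "1 / real (Suc m)" a b] by (intro AE_I2) (simp add: abs_mult mult_left_le)
    qed (use H in auto)
    moreover have "(\<integral>x. H x * box_bump a b (1 / real (Suc m)) x \<partial>lborel) = 0" for m
      by (intro H0 box_bump_test_fun that) simp
    ultimately show ?thesis by (simp add: LIMSEQ_const_iff)
  qed
  have loc: "AE x in lborel. x \<in> box c d \<longrightarrow> H x = 0" if cd: "cbox c d \<subseteq> D" for c d
  proof -
    \<comment> \<open>Cut off at a single box, the function can be integrated over arbitrary boxes,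
      as these only contribute their intersection with it. The boxes of the whole space then serve
      as the intersection-stable generator.\<close>
    define F where "F x = H x * indicator (box c d) x" for x
    have F: "integrable lborel F"
      unfolding F_def using H by (intro integrable_real_mult_indicator) auto
    have Fbox: "(\<integral>x. indicator (box a b) x * F x \<partial>lborel) = 0" for a b
    proof (cases "box a b \<inter> box c d = {}")
      case True
      then have "(\<lambda>x. indicator (box a b) x * F x) = (\<lambda>x. 0)"
        unfolding F_def by (auto simp: fun_eq_iff indicator_def)
      then show ?thesis by simp
    next
      case False
      obtain p q where pq: "box a b \<inter> box c d = box p q" using box_Int_box by blast
      then have "closure (box p q) \<subseteq> closure (box c d)" by (intro closure_mono) auto
      \<comment> \<open>\<open>Hbox\<close> asks for the closed box inside D, and
        \<open>closure_box\<close> turns open boxes into closed ones only when they are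
        nonempty.\<close>
      moreover have "box c d \<noteq> {}" "box p q \<noteq> {}" using False pq by auto
      ultimately have "cbox p q \<subseteq> cbox c d" by (simp add: closure_box)
      then have "(\<integral>x. H x * indicator (box p q) x \<partial>lborel) = 0" using Hbox cd by auto
      moreover have "indicator (box a b) x * F x = H x * indicator (box p q) x" for x
        unfolding F_def pq[symmetric] by (simp add: indicator_def)
      ultimately show ?thesis by simp
    qed
    have all: "(\<integral>x. indicator A x * F x \<partial>lborel) = 0" if "A \<in> sets borel" for A
    proof -
      let ?G = "range (\<lambda>(a, b). box a b :: 'a set)"
      have st: "Int_stable ?G" by (auto simp: Int_stable_def box_Int_box)
      have b: "sets borel = sigma_sets UNIV ?G" by (subst borel_eq_box) simp
      have "?G \<subseteq> Pow UNIV" "A \<in> sigma_sets UNIV ?G" using that b by auto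
      with st show ?thesis
      proof (induction A rule: sigma_sets_induct_disjoint)
        case (compl A)
        then have mA: "A \<in> sets lborel" using b by simp
        \<comment> \<open>The complement case subtracts from the integral over the whole space,
          which is that over \<open>box c d\<close> because \<open>F\<close> vanishes outside
          it.\<close>
        have UN: "(\<integral>x. F x \<partial>lborel) = 0"
        proof -
          have "(\<lambda>x. indicator (box c d) x * F x) = F" by (simp add: F_def indicator_def fun_eq_iff)
          then show ?thesis using Fbox[of c d] by metis
        qed
        have "(\<integral>x. indicator (UNIV - A) x * F x \<partial>lborel) = (\<integral>x. F x - indicator A x * F x \<partial>lborel)"
          by (intro Bochner_Integration.integral_cong) (auto simp: indicator_def)
        also have "\<dots> = (\<integral>x. F x \<partial>lborel) - (\<integral>x. indicator A x * F x \<partial>lborel)"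
          by (intro Bochner_Integration.integral_diff F integrable_mult_indicator[OF mA F, simplified])
        finally show ?case using UN compl by simp
      next
        case (union A)
        then have mA: "A i \<in> sets lborel" for i using b by auto
        have "set_lebesgue_integral lborel (\<Union>i. A i) F = (\<Sum>i. set_lebesgue_integral lborel (A i) F)"
        proof (rule lebesgue_integral_countable_add)
          show "A i \<inter> A j = {}" if "i \<noteq> j" for i j
            using union that by (auto simp: disjoint_family_on_def)
          have "(\<Union>i. A i) \<in> sets lborel" using mA by blast
          then show "set_integrable lborel (\<Union>i. A i) F"
            unfolding set_integrable_def by (rule integrable_mult_indicator[OF _ F])
        qed (use mA in auto)
        then show ?case using union by (simp add: set_lebesgue_integral_def)
      qed (use Fbox in auto)
    qed
    have "AE x in lborel. F x = 0"
      using F all by (intro sigma_finite_measure.density_zero[OF sigma_finite_lborel]) (auto simp: set_lebesgue_integral_def)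
    then show ?thesis by eventually_elim (auto simp: F_def indicator_def)
  qed
  define \<B> where "\<B> = {box a b |a b. cbox a b \<subseteq> D}"
  have "\<And>S. S \<in> \<B> \<Longrightarrow> open S" unfolding \<B>_def by auto
  then obtain \<D> where \<D>: "\<D> \<subseteq> \<B>" "countable \<D>" "\<Union>\<D> = \<Union>\<B>"
    using Lindelof by metis
  have "D \<subseteq> \<Union>\<D>"
  proof
    fix x assume "x \<in> D"
    then obtain a b where "cbox a b \<subseteq> D" "x \<in> box a b" by (rule open_contains_cbox[OF D])
    then show "x \<in> \<Union>\<D>" unfolding \<D> \<B>_def by blast
  qed
  have "AE x in lborel. \<forall>B\<in>\<D>. x \<in> B \<longrightarrow> H x = 0"
  proof (rule AE_ball_countable'[OF _ \<D>(2)])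
    fix B assume "B \<in> \<D>"
    then obtain a b where "B = box a b" "cbox a b \<subseteq> D" using \<D>(1) unfolding \<B>_def by auto
    then show "AE x in lborel. x \<in> B \<longrightarrow> H x = 0" using loc by simp
  qed
  then have "AE x in lborel. x \<in> D \<longrightarrow> h x = 0"
  proof eventually_elim
    case (elim x)
    show ?case
    proof
      assume "x \<in> D"
      then have "H x = 0" using elim \<open>D \<subseteq> \<Union>\<D>\<close> by blast
      then show "h x = 0" using \<open>x \<in> D\<close> by (simp add: H_def)
    qed
  qed
  then show ?thesis using D by (simp add: AE_restrict_space_iff)
qed

subsection \<open>Smooth cutoffs\<close>

text \<open>The derivative falls on the kernel alone, so \<open>d\<close> may be merely continuous.
  Integrating over a fixed compact box brings the Leibniz rule within reach.\<close>

lemma has_derivative_convolution: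
  fixes d :: "'a::euclidean_space \<Rightarrow> real"
  assumes d: "continuous_on UNIV d" and \<rho>: "smooth \<rho>"
  shows "(\<lambda>x. integral (cbox a b) (\<lambda>y. d y * \<rho> (x - y))) differentiable (at x)"
    and "i \<in> Basis \<Longrightarrow> partial_deriv i (\<lambda>x. integral (cbox a b) (\<lambda>y. d y * \<rho> (x - y))) x
          = integral (cbox a b) (\<lambda>y. d y * partial_deriv i \<rho> (x - y))"
proof -
  define G where "G x t = d t *\<^sub>R blinfun_inner_right (grad \<rho> (x - t))" for x t
  have c1: "continuous_on S (\<lambda>t. d t)" for S using d continuous_on_subset by blast
  have cont: "continuous_on S (\<lambda>(x, t). G x t)" for S
    unfolding G_def split_beta
    by (intro continuous_intros continuous_on_compose2[OF d] continuous_on_compose2[OF continuous_on_grad[OF \<rho>, of UNIV]]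
        bounded_linear.continuous_on[OF bounded_linear_blinfun_inner_right]) auto
  have D: "((\<lambda>x. integral (cbox a b) (\<lambda>y. d y * \<rho> (x - y))) has_derivative integral (cbox a b) (G x)) (at x)"
  proof (rule leibniz_rule[where U = UNIV, simplified])
    fix x t :: 'a
    have "((\<lambda>x. x - t) has_derivative (\<lambda>h. h)) (at x)" by (auto intro!: derivative_eq_intros)
    from has_derivative_compose[OF this has_derivative_grad[OF smooth_differentiable[OF \<rho>]]]
    have "((\<lambda>x. \<rho> (x - t)) has_derivative (\<lambda>h. grad \<rho> (x - t) \<bullet> h)) (at x)" .
    from has_derivative_mult_right[OF this, of "d t"]
    show "((\<lambda>x. d t * \<rho> (x - t)) has_derivative blinfun_apply (G x t)) (at x)"
      by (rule has_derivative_eq_rhs) (simp add: fun_eq_iff G_def blinfun.scaleR_left)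
    show "(\<lambda>y. d y * \<rho> (x - y)) integrable_on cbox a b"
      by (intro integrable_continuous continuous_intros c1
          continuous_on_compose2[OF smooth_continuous_on[OF \<rho>, of UNIV]]) auto
  qed (rule cont)
  then show "(\<lambda>x. integral (cbox a b) (\<lambda>y. d y * \<rho> (x - y))) differentiable (at x)"
    by (auto simp: differentiable_def)
  assume i: "i \<in> Basis"
  have "continuous_on (cbox a b) (G x)"
    using continuous_on_compose2[OF cont[of UNIV], of "cbox a b" "\<lambda>t. (x, t)"]
      continuous_on_Pair[OF continuous_on_const continuous_on_id, of "cbox a b" x] by simp
  then have "blinfun_apply (integral (cbox a b) (G x)) i = integral (cbox a b) (\<lambda>t. blinfun_apply (G x t) i)"
    by (intro blinfun_apply_integral integrable_continuous)
  then show "partial_deriv i (\<lambda>x. integral (cbox a b) (\<lambda>y. d y * \<rho> (x - y))) x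
          = integral (cbox a b) (\<lambda>y. d y * partial_deriv i \<rho> (x - y))"
    using partial_deriv_eq[OF D, of i] i by (simp add: G_def blinfun.scaleR_left grad_inner_Basis)
qed

lemma smooth_convolution:
  fixes d :: "'a::euclidean_space \<Rightarrow> real"
  assumes d: "continuous_on UNIV d" and "smooth \<rho>"
  shows "smooth (\<lambda>x. integral (cbox a b) (\<lambda>y. d y * \<rho> (x - y)))"
proof -
  have "Ck (Suc k) (\<lambda>x. integral (cbox a b) (\<lambda>y. d y * \<rho> (x - y)))" if "smooth \<rho>" for k \<rho>
    using that
  proof (induction k arbitrary: \<rho>)
    case 0
    have "continuous_on UNIV (\<lambda>x. integral (cbox a b) (\<lambda>y. d y * partial_deriv i \<rho> (x - y)))" if "i \<in> Basis" for i
      using has_derivative_convolution(1)[OF d smooth_partial_deriv[OF 0 that]]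
      by (auto intro!: differentiable_imp_continuous_on simp: differentiable_on_def)
    moreover have "partial_deriv i (\<lambda>x. integral (cbox a b) (\<lambda>y. d y * \<rho> (x - y)))
       = (\<lambda>x. integral (cbox a b) (\<lambda>y. d y * partial_deriv i \<rho> (x - y)))" if "i \<in> Basis" for i
      using has_derivative_convolution(2)[OF d 0 that] by auto
    ultimately show ?case using has_derivative_convolution(1)[OF d 0] by simp
  next
    case (Suc k)
    have "partial_deriv i (\<lambda>x. integral (cbox a b) (\<lambda>y. d y * \<rho> (x - y)))
       = (\<lambda>x. integral (cbox a b) (\<lambda>y. d y * partial_deriv i \<rho> (x - y)))" if "i \<in> Basis" for i
      using has_derivative_convolution(2)[OF d Suc.prems that] by auto
    then show ?case
      using has_derivative_convolution(1)[OF d Suc.prems] Suc.IH[OF smooth_partial_deriv[OF Suc.prems]]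
      by (subst Ck.simps) simp
  qed
  then show ?thesis using assms(2) Ck_Suc_imp unfolding smooth_def by blast
qed

text \<open>The derivative in the direction of the normalised gradient is the norm of the
  gradient.\<close>

lemma norm_grad_le_lipschitz:
  assumes \<phi>: "smooth \<phi>" and L: "\<And>x y. \<bar>\<phi> x - \<phi> y\<bar> \<le> L * norm (x - y)"
  shows "norm (grad \<phi> x) \<le> L"
proof (cases "grad \<phi> x = 0")
  case True
  \<comment> \<open>A vanishing gradient still leaves L \<ge> 0 to be shown, which two distinct
    points reveal.\<close>
  have "0 \<le> L * norm ((SOME i. i \<in> Basis) - 0 :: 'a)" using L[of "SOME i. i \<in> Basis" 0] by (auto intro: order_trans)
  then show ?thesis using True by (simp add: SOME_Basis)
next
  case False
  define e where "e = grad \<phi> x /\<^sub>R norm (grad \<phi> x)"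
  have e: "norm e = 1" "grad \<phi> x \<bullet> e = norm (grad \<phi> x)"
    using False by (simp_all add: e_def flip: power2_norm_eq_inner) (simp add: power2_eq_square)
  have "((\<lambda>h. (\<phi> (x + h *\<^sub>R e) - \<phi> x) / h) \<longlongrightarrow> grad \<phi> x \<bullet> e) (at 0)"
    using DERIV_along_line[OF \<phi>, of x e 0] by (simp add: DERIV_def)
  moreover have "(\<phi> (x + h *\<^sub>R e) - \<phi> x) / h \<le> L" if "h \<noteq> 0" for h
  proof -
    have "\<bar>(\<phi> (x + h *\<^sub>R e) - \<phi> x) / h\<bar> \<le> L * norm (h *\<^sub>R e) / \<bar>h\<bar>"
      using divide_right_mono[OF L[of "x + h *\<^sub>R e" x], of "\<bar>h\<bar>"] by simp
    then show ?thesis using that e abs_ge_self[of "(\<phi> (x + h *\<^sub>R e) - \<phi> x) / h"] by simp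
  qed
  then have "eventually (\<lambda>h. (\<phi> (x + h *\<^sub>R e) - \<phi> x) / h \<le> L) (at 0)"
    by (simp add: eventually_at_filter)
  ultimately have "grad \<phi> x \<bullet> e \<le> L"
    by (rule tendsto_upperbound) simp
  then show ?thesis using e by simp
qed

text \<open>A clipped distance to the complement is mollified at scale \<delta>/4. Averaging keeps
  both the range [0, 1] and the Lipschitz constant 4/\<delta>, and the latter bounds the
  gradient.\<close>

lemma smooth_cutoff_exists:
  fixes D :: "'a::euclidean_space set"
  assumes D: "open D" "bounded D" and \<delta>: "\<delta> > 0"
  shows "\<exists>\<zeta>. \<zeta> \<in> test_fun D \<and> (\<forall>x. 0 \<le> \<zeta> x \<and> \<zeta> x \<le> 1) \<and> (\<forall>x. norm (grad \<zeta> x) \<le> 4 / \<delta>)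
           \<and> (\<forall>x. infdist x (- D) \<ge> \<delta> \<longrightarrow> \<zeta> x = 1)"
proof -
  define e where "e x = infdist x (- D)" for x
  have nD: "- D \<noteq> {}" using D(2) not_bounded_UNIV by (metis Compl_empty_eq double_complement)
  have eL: "\<bar>e x - e y\<bar> \<le> norm (x - y)" for x y
    using infdist_triangle[of x "- D" y] infdist_triangle[of y "- D" x]
    by (auto simp: e_def dist_norm norm_minus_commute)
  have e0: "e x > 0 \<Longrightarrow> x \<in> D" for x
    unfolding e_def by (metis ComplI infdist_zero less_irrefl)
  \<comment> \<open>The profile is 0 up to distance \<delta>/2 and 1 from distance 3\<delta>/4 on.
    Averaging over displacements shorter than \<delta>/4 leaves the value 1 from distance \<delta>
    on and the value 0 below distance \<delta>/4.\<close>
  define d where "d y = min 1 (max 0 (4 / \<delta> * e y - 2))" for y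
  have d01: "0 \<le> d y" "d y \<le> 1" for y by (auto simp: d_def)
  have dL: "\<bar>d x - d y\<bar> \<le> 4 / \<delta> * norm (x - y)" for x y
  proof -
    have "\<bar>d x - d y\<bar> \<le> \<bar>4 / \<delta> * e x - 4 / \<delta> * e y\<bar>" unfolding d_def by auto
    also have "\<dots> = 4 / \<delta> * \<bar>e x - e y\<bar>"
      using \<delta> by (subst right_diff_distrib[symmetric], subst abs_mult) simp
    also have "\<dots> \<le> 4 / \<delta> * norm (x - y)" using eL \<delta> by (intro mult_left_mono) auto
    finally show ?thesis .
  qed
  have dc: "continuous_on UNIV d"
    unfolding d_def e_def by (intro continuous_intros)
  \<comment> \<open>Half-width of the mollifier's box: by the l1 bound all points of that box have
    norm below \<delta>/4.\<close>
  define s where "s = \<delta> / (4 * real DIM('a))"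
  have s: "s > 0" using \<delta> by (simp add: s_def)
  define B where "B = box_bump (- s *\<^sub>R One) (s *\<^sub>R One :: 'a) 1"
  have Bs: "norm z < \<delta> / 4" if "B z \<noteq> 0" for z
  proof -
    have "z \<in> box (- s *\<^sub>R One) (s *\<^sub>R One)" using that box_bump_eq_0 unfolding B_def by metis
    then have *: "\<bar>z \<bullet> i\<bar> < s" if "i \<in> Basis" for i
      using that by (auto simp: mem_box abs_less_iff)
    have "norm z \<le> (\<Sum>i\<in>Basis. \<bar>z \<bullet> i\<bar>)" by (rule norm_le_l1)
    also have "\<dots> < (\<Sum>i\<in>(Basis::'a set). s)" using * by (intro sum_strict_mono) auto
    also have "\<dots> = \<delta> / 4" by (simp add: s_def)
    finally show ?thesis .
  qed
  have Btest: "B \<in> test_fun UNIV" unfolding B_def by (rule box_bump_test_fun) auto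
  have Bint: "integrable lborel B" by (rule integrable_test_fun[OF Btest])
  have B0: "B z \<ge> 0" for z unfolding B_def by (simp add: box_bump_bounds)
  define I where "I = (\<integral>z. B z \<partial>lborel)"
  have I: "I > 0"
  proof -
    have "I \<noteq> 0"
    proof
      assume "I = 0"
      then have "AE z in lborel. B z = 0"
        using integral_nonneg_eq_0_iff_AE[OF Bint] B0 by (simp add: I_def)
      then have "AE z in lborel. z \<notin> box (- s *\<^sub>R One) (s *\<^sub>R One :: 'a)"
        by eventually_elim (metis B_def box_bump_pos less_irrefl)
      then have "emeasure lborel (box (- s *\<^sub>R One) (s *\<^sub>R One :: 'a)) = 0"
        by (subst (asm) AE_iff_measurable[where N = "box (- s *\<^sub>R One) (s *\<^sub>R One :: 'a)"]) auto
      moreover have "prod ((\<bullet>) (s *\<^sub>R One + s *\<^sub>R One :: 'a)) Basis > 0"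
        using s by (intro prod_pos) (auto simp: inner_add_left)
      ultimately show False using s by (auto simp: emeasure_lborel_box_eq inner_add_left)
    qed
    moreover have "I \<ge> 0" unfolding I_def using B0 by (intro integral_nonneg_AE) auto
    ultimately show ?thesis by simp
  qed
  define \<rho> where "\<rho> z = (1 / I) * B z" for z
  have \<rho>s: "smooth \<rho>" unfolding \<rho>_def
    by (intro smooth_mult smooth_const) (use Btest test_funD in blast)
  have \<rho>1: "(\<integral>z. \<rho> z \<partial>lborel) = 1" and \<rho>i: "integrable lborel \<rho>" and \<rho>0: "\<rho> z \<ge> 0" for z
    using Bint B0 I unfolding \<rho>_def I_def by auto
  have \<rho>m: "\<rho> \<in> borel_measurable borel" using \<rho>i by auto
  obtain a where a: "D \<subseteq> cbox (- a) a" using bounded_subset_cbox_symmetric[OF D(2)] by blast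
  define \<zeta> where "\<zeta> x = integral (cbox (- a) a) (\<lambda>y. d y * \<rho> (x - y))" for x
  have \<zeta>s: "smooth \<zeta>" unfolding \<zeta>_def[abs_def] by (rule smooth_convolution[OF dc \<rho>s])
  have dm: "d \<in> borel_measurable borel" using dc by (rule borel_measurable_continuous_onI)
  have int: "integrable lborel (\<lambda>z. d (x - z) * \<rho> z)" for x
    by (rule Bochner_Integration.integrable_bound[OF \<rho>i])
       (use dm \<rho>m d01 \<rho>0 in \<open>auto simp: abs_mult mult_left_le_one_le intro!: borel_measurable_times\<close>)
  have \<zeta>: "\<zeta> x = (\<integral>z. d (x - z) * \<rho> z \<partial>lborel)" for x
  proof -
    have 1: "d y = 0" if "y \<notin> cbox (- a) a" for y
    proof -
      have "y \<notin> D" using that a by auto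
      then have "e y = 0" using e0 infdist_nonneg[of y "- D"] unfolding e_def by force
      then show ?thesis by (simp add: d_def)
    qed
    \<comment> \<open>Reflection preserves volume, the Jacobian |-1|^n being 1. Both forms of the
      convolution are wanted: with x in the kernel for smoothness, with x in \<open>d\<close> for
      the values and the Lipschitz bound.\<close>
    have "lborel = density (distr lborel borel (\<lambda>z. x + (-1) *\<^sub>R z)) (\<lambda>_. \<bar>-1\<bar> ^ DIM('a) :: real)"
      by (rule lborel_affine) simp
    then have lb: "(lborel::'a measure) = distr lborel borel (\<lambda>z. x - z)"
      by (simp add: density_1)
    have i2: "integrable lborel (\<lambda>y. d y * \<rho> (x - y))"
      by (subst lb, subst integrable_distr_eq) (use int dm \<rho>m in auto)
    have "integral (cbox (- a) a) (\<lambda>y. d y * \<rho> (x - y)) = integral UNIV (\<lambda>y. d y * \<rho> (x - y))"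
      by (subst integral_restrict_UNIV[symmetric]) (auto intro!: integral_cong simp: 1)
    also have "\<dots> = (\<integral>y. d y * \<rho> (x - y) \<partial>lborel)"
      using i2 by (intro integral_lborel)
    also have "\<dots> = (\<integral>z. d (x - z) * \<rho> z \<partial>lborel)"
      by (subst lb, subst integral_distr) (use dm \<rho>m in auto)
    finally show ?thesis by (simp add: \<zeta>_def)
  qed
  have \<zeta>01: "0 \<le> \<zeta> x" "\<zeta> x \<le> 1" for x
  proof -
    show "0 \<le> \<zeta> x" unfolding \<zeta> by (intro integral_nonneg_AE) (use d01 \<rho>0 in auto)
    have "\<zeta> x \<le> (\<integral>z. \<rho> z \<partial>lborel)" unfolding \<zeta>
      by (intro integral_mono int \<rho>i) (use d01 \<rho>0 in \<open>auto simp: mult_left_le_one_le\<close>)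
    then show "\<zeta> x \<le> 1" using \<rho>1 by simp
  qed
  have \<zeta>1: "\<zeta> x = 1" if "e x \<ge> \<delta>" for x
  proof -
    have "d (x - z) * \<rho> z = \<rho> z" for z
    proof (cases "\<rho> z = 0")
      case False
      then have "norm z < \<delta> / 4" using Bs by (auto simp: \<rho>_def)
      then have "e (x - z) \<ge> 3 / 4 * \<delta>" using eL[of x "x - z"] that by auto
      then have "4 / \<delta> * e (x - z) \<ge> 3" using \<delta> by (simp add: field_simps)
      then show ?thesis by (simp add: d_def)
    qed simp
    then have "(\<lambda>z. d (x - z) * \<rho> z) = \<rho>" by blast
    then show ?thesis using \<rho>1 \<zeta> by simp
  qed
  have \<zeta>0: "\<zeta> x = 0" if "e x < \<delta> / 4" for x
  proof -
    have "d (x - z) * \<rho> z = 0" for z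
    proof (cases "\<rho> z = 0")
      case False
      then have "norm z < \<delta> / 4" using Bs by (auto simp: \<rho>_def)
      then have "e (x - z) \<le> \<delta> / 2" using eL[of x "x - z"] that by auto
      then have "4 / \<delta> * e (x - z) \<le> 2" using \<delta> by (simp add: field_simps)
      then show ?thesis by (simp add: d_def)
    qed simp
    then have "(\<lambda>z. d (x - z) * \<rho> z) = (\<lambda>z. 0)" by blast
    then show ?thesis using \<zeta> by simp
  qed
  have \<zeta>L: "\<bar>\<zeta> x - \<zeta> y\<bar> \<le> 4 / \<delta> * norm (x - y)" for x y
  proof -
    have "\<zeta> x - \<zeta> y = (\<integral>z. (d (x - z) - d (y - z)) * \<rho> z \<partial>lborel)"
      unfolding \<zeta> using int by (simp add: left_diff_distrib)
    also have "\<bar>\<dots>\<bar> \<le> (\<integral>z. \<bar>(d (x - z) - d (y - z)) * \<rho> z\<bar> \<partial>lborel)"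
      by (rule integral_abs_bound)
    also have "\<dots> \<le> (\<integral>z. (4 / \<delta> * norm (x - y)) * \<rho> z \<partial>lborel)"
    proof (rule integral_mono)
      have "integrable lborel (\<lambda>z. (d (x - z) - d (y - z)) * \<rho> z)"
        using int[of x] int[of y] by (simp add: left_diff_distrib)
      then show "integrable lborel (\<lambda>z. \<bar>(d (x - z) - d (y - z)) * \<rho> z\<bar>)" by simp
      show "\<bar>(d (x - z) - d (y - z)) * \<rho> z\<bar> \<le> (4 / \<delta> * norm (x - y)) * \<rho> z" for z
        using mult_right_mono[OF dL[of "x - z" "y - z"] \<rho>0[of z]] \<rho>0[of z] by (simp add: abs_mult)
    qed (use \<rho>i in auto)
    finally show ?thesis using \<rho>1 by simp
  qed
  have "\<zeta> \<in> test_fun D"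
  proof (rule test_funI[OF \<zeta>s, where K = "{x. e x \<ge> \<delta> / 4}"])
    have c: "closed {x. e x \<ge> \<delta> / 4}"
      unfolding e_def by (intro closed_Collect_le continuous_intros)
    show sub: "{x. e x \<ge> \<delta> / 4} \<subseteq> D" using e0 \<delta> by (auto intro: e0[OF less_le_trans])
    show "compact {x. e x \<ge> \<delta> / 4}"
      using c sub D(2) bounded_subset compact_eq_bounded_closed by blast
  qed (use \<zeta>0 in auto)
  then show ?thesis
    using \<zeta>01 \<zeta>1 norm_grad_le_lipschitz[OF \<zeta>s \<zeta>L] unfolding e_def by blast
qed

section \<open>Square integrable functions\<close>

lemma L2_funD:
  assumes "h \<in> L2_fun \<mu>"
  shows "h \<in> borel_measurable \<mu>" "integrable \<mu> (\<lambda>x. (norm (h x))\<^sup>2)"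
  using assms by (auto simp: L2_fun_def)

lemma L2_fun_integrable_prod:
  fixes h k :: "'a \<Rightarrow> 'b::euclidean_space"
  assumes "h \<in> L2_fun \<mu>" "k \<in> L2_fun \<mu>"
  shows "integrable \<mu> (\<lambda>x. norm (h x) * norm (k x))" "integrable \<mu> (\<lambda>x. h x \<bullet> k x)"
proof -
  note [measurable] = assms[THEN L2_funD(1)]
  have i: "integrable \<mu> (\<lambda>x. (norm (h x))\<^sup>2 + (norm (k x))\<^sup>2)"
    using assms[THEN L2_funD(2)] by simp
  have "norm (h x) * norm (k x) \<le> (norm (h x))\<^sup>2 + (norm (k x))\<^sup>2" for x
  proof -
    have "2 * (norm (h x) * norm (k x)) \<le> (norm (h x))\<^sup>2 + (norm (k x))\<^sup>2"
      using sum_squares_bound[of "norm (h x)" "norm (k x)"] by (simp add: mult.assoc)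
    moreover have "0 \<le> norm (h x) * norm (k x)" by simp
    ultimately show ?thesis by linarith
  qed
  note b = this
  show p: "integrable \<mu> (\<lambda>x. norm (h x) * norm (k x))"
    by (rule Bochner_Integration.integrable_bound[OF i]) (use b in auto)
  show "integrable \<mu> (\<lambda>x. h x \<bullet> k x)"
    by (rule Bochner_Integration.integrable_bound[OF p]) (auto simp: Cauchy_Schwarz_ineq2)
qed

lemma L2_norm_power2: "(L2_norm \<mu> h)\<^sup>2 = (\<integral>x. (norm (h x))\<^sup>2 \<partial>\<mu>)"
  unfolding L2_norm_def by (simp add: Bochner_Integration.integral_nonneg)

lemma L2_norm_nonneg: "L2_norm \<mu> h \<ge> 0"
  unfolding L2_norm_def by (simp add: Bochner_Integration.integral_nonneg)

lemma L2_norm_zero: "L2_norm \<mu> (\<lambda>x. 0) = 0"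
  unfolding L2_norm_def by simp

lemma L2_norm_norm: "L2_norm \<mu> (\<lambda>x. norm (h x)) = L2_norm \<mu> h"
  unfolding L2_norm_def by simp

text \<open>The square of s |h| - t |k| has nonnegative integral; the inequality results from taking
  for s the norm of k and for t that of h.\<close>

lemma L2_Cauchy_Schwarz:
  fixes h k :: "'a \<Rightarrow> 'b::euclidean_space"
  assumes h: "h \<in> L2_fun \<mu>" and k: "k \<in> L2_fun \<mu>"
  shows "(\<integral>x. norm (h x) * norm (k x) \<partial>\<mu>) \<le> L2_norm \<mu> h * L2_norm \<mu> k"
proof -
  let ?a = "L2_norm \<mu> h" and ?b = "L2_norm \<mu> k" and ?p = "\<integral>x. norm (h x) * norm (k x) \<partial>\<mu>"
  have key: "2 * s * t * ?p \<le> s\<^sup>2 * ?a\<^sup>2 + t\<^sup>2 * ?b\<^sup>2" for s t :: real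
  proof -
    have "0 \<le> (\<integral>x. (s * norm (h x) - t * norm (k x))\<^sup>2 \<partial>\<mu>)" by simp
    also have "\<dots> = (\<integral>x. s\<^sup>2 * (norm (h x))\<^sup>2 + t\<^sup>2 * (norm (k x))\<^sup>2 - 2 * s * t * (norm (h x) * norm (k x)) \<partial>\<mu>)"
      by (intro Bochner_Integration.integral_cong) (auto simp: power2_diff power_mult_distrib)
    also have "\<dots> = s\<^sup>2 * ?a\<^sup>2 + t\<^sup>2 * ?b\<^sup>2 - 2 * s * t * ?p"
      using h[THEN L2_funD(2)] k[THEN L2_funD(2)] L2_fun_integrable_prod(1)[OF h k]
      by (simp add: L2_norm_power2)
    finally show ?thesis by simp
  qed
  have a: "?a \<ge> 0" and b: "?b \<ge> 0" by (simp_all add: L2_norm_nonneg)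
  \<comment> \<open>When one norm vanishes the balanced choice of s and t is void. A large
    multiplier on the vanishing side then contradicts a positive \<open>?p\<close>.\<close>
  have z: "?p \<le> 0" if "?a = 0 \<or> ?b = 0"
  proof (rule ccontr)
    assume "\<not> ?p \<le> 0"
    then have p: "?p > 0" by simp
    show False
    proof (cases "?a = 0")
      case True
      have "2 * ((?b\<^sup>2 + 1) / ?p) * 1 * ?p = 2 * (?b\<^sup>2 + 1)" using p by simp
      then show False using key[of "(?b\<^sup>2 + 1) / ?p" 1] True zero_le_power2[of ?b] by simp
    next
      case False
      then have b0: "?b = 0" using that by simp
      have "2 * 1 * ((?a\<^sup>2 + 1) / ?p) * ?p = 2 * (?a\<^sup>2 + 1)" using p by simp
      then show False using key[of 1 "(?a\<^sup>2 + 1) / ?p"] b0 zero_le_power2[of ?a] by simp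
    qed
  qed
  show ?thesis
  proof (cases "?a = 0 \<or> ?b = 0")
    case True
    then show ?thesis using z by auto
  next
    case False
    then have ab: "?a > 0" "?b > 0" using a b by auto
    have "2 * (?a * ?b) * ?p \<le> 2 * (?a * ?b) * (?a * ?b)"
      using key[of ?b ?a] by (simp add: power2_eq_square mult_ac)
    then show ?thesis using ab by (simp add: mult_le_cancel_left)
  qed
qed

lemma L2_inner_le:
  fixes h k :: "'a \<Rightarrow> 'b::euclidean_space"
  assumes "h \<in> L2_fun \<mu>" "k \<in> L2_fun \<mu>"
  shows "\<bar>\<integral>x. h x \<bullet> k x \<partial>\<mu>\<bar> \<le> L2_norm \<mu> h * L2_norm \<mu> k"
proof -
  have "\<bar>\<integral>x. h x \<bullet> k x \<partial>\<mu>\<bar> \<le> (\<integral>x. \<bar>h x \<bullet> k x\<bar> \<partial>\<mu>)" by (rule integral_abs_bound)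
  also have "\<dots> \<le> (\<integral>x. norm (h x) * norm (k x) \<partial>\<mu>)"
    by (intro integral_mono L2_fun_integrable_prod assms integrable_abs) (rule Cauchy_Schwarz_ineq2)
  also note L2_Cauchy_Schwarz[OF assms]
  finally show ?thesis .
qed

lemma L2_fun_bound:
  fixes h :: "'a \<Rightarrow> 'b::euclidean_space" and k :: "'a \<Rightarrow> 'c::euclidean_space"
  assumes k: "k \<in> L2_fun \<mu>" and h: "h \<in> borel_measurable \<mu>" and le: "AE x in \<mu>. norm (h x) \<le> norm (k x)"
  shows "h \<in> L2_fun \<mu>" "L2_norm \<mu> h \<le> L2_norm \<mu> k"
proof -
  have le2: "AE x in \<mu>. (norm (h x))\<^sup>2 \<le> (norm (k x))\<^sup>2"
    using le by eventually_elim (simp add: power_mono)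
  have i: "integrable \<mu> (\<lambda>x. (norm (h x))\<^sup>2)"
    by (rule Bochner_Integration.integrable_bound[OF L2_funD(2)[OF k]]) (use h le2 in auto)
  then show "h \<in> L2_fun \<mu>" using h by (simp add: L2_fun_def)
  show "L2_norm \<mu> h \<le> L2_norm \<mu> k"
    unfolding L2_norm_def using integral_mono_AE[OF i L2_funD(2)[OF k] le2] by simp
qed

lemma L2_fun_zero: "(\<lambda>x. 0) \<in> L2_fun \<mu>"
  by (simp add: L2_fun_def)

lemma L2_fun_scaleR:
  fixes h :: "'a \<Rightarrow> 'b::euclidean_space"
  assumes "h \<in> L2_fun \<mu>"
  shows "(\<lambda>x. c *\<^sub>R h x) \<in> L2_fun \<mu>" "L2_norm \<mu> (\<lambda>x. c *\<^sub>R h x) = \<bar>c\<bar> * L2_norm \<mu> h"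
  using assms by (auto simp: L2_fun_def L2_norm_def power_mult_distrib real_sqrt_mult)

lemma L2_fun_add:
  fixes h k :: "'a \<Rightarrow> 'b::euclidean_space"
  assumes "h \<in> L2_fun \<mu>" "k \<in> L2_fun \<mu>"
  shows "(\<lambda>x. h x + k x) \<in> L2_fun \<mu>" "L2_norm \<mu> (\<lambda>x. h x + k x) \<le> L2_norm \<mu> h + L2_norm \<mu> k"
proof -
  note [measurable] = assms[THEN L2_funD(1)]
  have i: "integrable \<mu> (\<lambda>x. (norm (h x))\<^sup>2 + (norm (k x))\<^sup>2 + 2 * (norm (h x) * norm (k x)))"
    using assms[THEN L2_funD(2)] L2_fun_integrable_prod(1)[OF assms] by simp
  have b: "(norm (h x + k x))\<^sup>2 \<le> (norm (h x))\<^sup>2 + (norm (k x))\<^sup>2 + 2 * (norm (h x) * norm (k x))" for x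
    using power_mono[OF norm_triangle_ineq[of "h x" "k x"], of 2] by (simp add: power2_sum)
  have i2: "integrable \<mu> (\<lambda>x. (norm (h x + k x))\<^sup>2)"
    by (rule Bochner_Integration.integrable_bound[OF i]) (use b in auto)
  then show "(\<lambda>x. h x + k x) \<in> L2_fun \<mu>" by (simp add: L2_fun_def)
  have "(L2_norm \<mu> (\<lambda>x. h x + k x))\<^sup>2 \<le> (\<integral>x. (norm (h x))\<^sup>2 + (norm (k x))\<^sup>2 + 2 * (norm (h x) * norm (k x)) \<partial>\<mu>)"
    unfolding L2_norm_power2 using i2 i b by (intro integral_mono)
  also have "\<dots> = (L2_norm \<mu> h)\<^sup>2 + (L2_norm \<mu> k)\<^sup>2 + 2 * (\<integral>x. norm (h x) * norm (k x) \<partial>\<mu>)"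
    using assms[THEN L2_funD(2)] L2_fun_integrable_prod(1)[OF assms] by (simp add: L2_norm_power2)
  also have "\<dots> \<le> (L2_norm \<mu> h + L2_norm \<mu> k)\<^sup>2"
    using L2_Cauchy_Schwarz[OF assms] by (simp add: power2_sum)
  finally show "L2_norm \<mu> (\<lambda>x. h x + k x) \<le> L2_norm \<mu> h + L2_norm \<mu> k"
    by (rule power2_le_imp_le) (simp add: L2_norm_nonneg)
qed

lemma L2_fun_minus:
  fixes h :: "'a \<Rightarrow> 'b::euclidean_space"
  assumes "h \<in> L2_fun \<mu>"
  shows "(\<lambda>x. - h x) \<in> L2_fun \<mu>" "L2_norm \<mu> (\<lambda>x. - h x) = L2_norm \<mu> h"
  using L2_fun_scaleR[OF assms, of "-1"] by simp_all

lemma L2_fun_diff: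
  fixes h k :: "'a \<Rightarrow> 'b::euclidean_space"
  assumes "h \<in> L2_fun \<mu>" "k \<in> L2_fun \<mu>"
  shows "(\<lambda>x. h x - k x) \<in> L2_fun \<mu>" "L2_norm \<mu> (\<lambda>x. h x - k x) \<le> L2_norm \<mu> h + L2_norm \<mu> k"
  using L2_fun_add[OF assms(1) L2_fun_minus(1)[OF assms(2)]] L2_fun_minus(2)[OF assms(2)] by simp_all

lemma L2_norm_diff_commute:
  fixes h k :: "'a \<Rightarrow> 'b::euclidean_space"
  shows "L2_norm \<mu> (\<lambda>x. h x - k x) = L2_norm \<mu> (\<lambda>x. k x - h x)"
  by (simp add: L2_norm_def norm_minus_commute)

lemma L2_norm_triangle:
  fixes h k l :: "'a \<Rightarrow> 'b::euclidean_space"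
  assumes "h \<in> L2_fun \<mu>" "k \<in> L2_fun \<mu>" "l \<in> L2_fun \<mu>"
  shows "L2_norm \<mu> (\<lambda>x. h x - l x) \<le> L2_norm \<mu> (\<lambda>x. h x - k x) + L2_norm \<mu> (\<lambda>x. k x - l x)"
  using L2_fun_add(2)[OF L2_fun_diff(1)[OF assms(1,2)] L2_fun_diff(1)[OF assms(2,3)]] by simp

lemma L2_norm_cong_AE:
  assumes "h \<in> borel_measurable \<mu>" "k \<in> borel_measurable \<mu>" "AE x in \<mu>. h x = k x"
  shows "L2_norm \<mu> h = L2_norm \<mu> k"
proof -
  have "(\<integral>x. (norm (h x))\<^sup>2 \<partial>\<mu>) = (\<integral>x. (norm (k x))\<^sup>2 \<partial>\<mu>)"
    using assms by (intro integral_cong_AE) auto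
  then show ?thesis by (simp add: L2_norm_def)
qed

lemma L2_norm_eq_0_iff:
  assumes "h \<in> L2_fun \<mu>"
  shows "L2_norm \<mu> h = 0 \<longleftrightarrow> (AE x in \<mu>. h x = 0)"
  using integral_nonneg_eq_0_iff_AE[OF L2_funD(2)[OF assms]]
  by (simp add: L2_norm_def)

lemma L2_norm_tendsto:
  fixes h :: "'a \<Rightarrow> 'b::euclidean_space"
  assumes "h \<in> L2_fun \<mu>" "\<And>k. hk k \<in> L2_fun \<mu>" "(\<lambda>k. L2_norm \<mu> (\<lambda>x. hk k x - h x)) \<longlonglongrightarrow> 0"
  shows "(\<lambda>k. L2_norm \<mu> (hk k)) \<longlonglongrightarrow> L2_norm \<mu> h"
proof (rule LIM_zero_cancel, rule tendsto_rabs_zero_cancel, rule tendsto_sandwich[OF _ _ tendsto_const assms(3)])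
  have "\<bar>L2_norm \<mu> (hk k) - L2_norm \<mu> h\<bar> \<le> L2_norm \<mu> (\<lambda>x. hk k x - h x)" for k
    using L2_fun_add(2)[OF L2_fun_diff(1)[OF assms(2)[of k] assms(1)] assms(1)]
      L2_fun_add(2)[OF L2_fun_diff(1)[OF assms(1) assms(2)[of k]] assms(2)[of k]]
    by (simp add: L2_norm_diff_commute[of \<mu> h])
  then show "\<forall>\<^sub>F k in sequentially. \<bar>L2_norm \<mu> (hk k) - L2_norm \<mu> h\<bar> \<le> L2_norm \<mu> (\<lambda>x. hk k x - h x)"
    by simp
qed simp

lemma L2_inner_tendsto:
  fixes h :: "'a \<Rightarrow> 'b::euclidean_space"
  assumes h: "h \<in> L2_fun \<mu>" "\<And>k. hk k \<in> L2_fun \<mu>" "(\<lambda>k. L2_norm \<mu> (\<lambda>x. hk k x - h x)) \<longlonglongrightarrow> 0"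
    and l: "l \<in> L2_fun \<mu>"
  shows "(\<lambda>k. \<integral>x. hk k x \<bullet> l x \<partial>\<mu>) \<longlonglongrightarrow> (\<integral>x. h x \<bullet> l x \<partial>\<mu>)"
proof (rule LIM_zero_cancel, rule tendsto_rabs_zero_cancel, rule tendsto_sandwich[OF _ _ tendsto_const])
  show "(\<lambda>k. L2_norm \<mu> (\<lambda>x. hk k x - h x) * L2_norm \<mu> l) \<longlonglongrightarrow> 0"
    using tendsto_mult_right[OF h(3), of "L2_norm \<mu> l"] by simp
  have "(\<integral>x. hk k x \<bullet> l x \<partial>\<mu>) - (\<integral>x. h x \<bullet> l x \<partial>\<mu>) = (\<integral>x. (hk k x - h x) \<bullet> l x \<partial>\<mu>)" for k
    using L2_fun_integrable_prod(2)[OF h(1) l] L2_fun_integrable_prod(2)[OF h(2) l]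
    by (simp add: inner_diff_left)
  then show "\<forall>\<^sub>F k in sequentially. \<bar>(\<integral>x. hk k x \<bullet> l x \<partial>\<mu>) - (\<integral>x. h x \<bullet> l x \<partial>\<mu>)\<bar> \<le> L2_norm \<mu> (\<lambda>x. hk k x - h x) * L2_norm \<mu> l"
    using L2_inner_le[OF L2_fun_diff(1)[OF h(2) h(1)] l] by simp
qed simp

lemma L2_fun_mult_bounded:
  fixes h :: "'a \<Rightarrow> 'b::euclidean_space"
  assumes h: "h \<in> L2_fun \<mu>" and c: "c \<in> borel_measurable \<mu>" "AE x in \<mu>. \<bar>c x\<bar> \<le> B"
  shows "(\<lambda>x. c x *\<^sub>R h x) \<in> L2_fun \<mu>" "L2_norm \<mu> (\<lambda>x. c x *\<^sub>R h x) \<le> \<bar>B\<bar> * L2_norm \<mu> h"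
proof -
  have 1: "AE x in \<mu>. norm (c x *\<^sub>R h x) \<le> norm (B *\<^sub>R h x)"
    using c(2) by eventually_elim (simp add: mult_right_mono)
  have 2: "(\<lambda>x. c x *\<^sub>R h x) \<in> borel_measurable \<mu>"
    using c(1) L2_funD(1)[OF h] by simp
  show "(\<lambda>x. c x *\<^sub>R h x) \<in> L2_fun \<mu>" "L2_norm \<mu> (\<lambda>x. c x *\<^sub>R h x) \<le> \<bar>B\<bar> * L2_norm \<mu> h"
    using L2_fun_bound[OF L2_fun_scaleR(1)[OF h] 2 1] L2_fun_scaleR(2)[OF h] by auto
qed

lemma L2_fun_integrable:
  fixes h :: "'a \<Rightarrow> 'b::euclidean_space"
  assumes "finite_measure \<mu>" "h \<in> L2_fun \<mu>"
  shows "integrable \<mu> h" "(\<integral>x. norm (h x) \<partial>\<mu>) \<le> sqrt (measure \<mu> (space \<mu>)) * L2_norm \<mu> h"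
proof -
  interpret finite_measure \<mu> by fact
  have 1: "(\<lambda>x. 1::real) \<in> L2_fun \<mu>" by (simp add: L2_fun_def)
  have n: "(\<lambda>x. norm (h x)) \<in> L2_fun \<mu>" using assms(2) by (auto simp: L2_fun_def)
  have "integrable \<mu> (\<lambda>x. norm (h x))"
    using L2_fun_integrable_prod(1)[OF 1 n] by simp
  then show "integrable \<mu> h"
    using L2_funD(1)[OF assms(2)] integrable_norm_iff by blast
  have "L2_norm \<mu> (\<lambda>x. 1::real) = sqrt (measure \<mu> (space \<mu>))"
    by (simp add: L2_norm_def)
  then show "(\<integral>x. norm (h x) \<partial>\<mu>) \<le> sqrt (measure \<mu> (space \<mu>)) * L2_norm \<mu> h"
    using L2_Cauchy_Schwarz[OF 1 n] by (simp add: L2_norm_norm)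
qed

text \<open>Fatou's lemma. It also yields the membership in \<open>L2_fun\<close>, so that a limit
  can be defined pointwise and placed in the space afterwards.\<close>

lemma L2_norm_liminf_le:
  fixes h :: "'a \<Rightarrow> 'b::euclidean_space"
  assumes hk: "\<And>k. hk k \<in> L2_fun \<mu>" and h: "h \<in> borel_measurable \<mu>"
    and lim: "AE x in \<mu>. (\<lambda>k. hk k x) \<longlonglongrightarrow> h x" and le: "\<forall>\<^sub>F k in sequentially. L2_norm \<mu> (hk k) \<le> C"
  shows "h \<in> L2_fun \<mu>" "L2_norm \<mu> h \<le> C"
proof -
  obtain k where "L2_norm \<mu> (hk k) \<le> C" using le eventually_sequentially by auto
  then have C: "C \<ge> 0" using L2_norm_nonneg[of \<mu> "hk k"] by simp
  have fin: "(\<integral>\<^sup>+x. ennreal ((norm (hk k x))\<^sup>2) \<partial>\<mu>) = ennreal ((L2_norm \<mu> (hk k))\<^sup>2)" for k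
    using L2_funD(2)[OF hk[of k]] by (simp add: L2_norm_power2 nn_integral_eq_integral)
  have "(\<integral>\<^sup>+x. ennreal ((norm (h x))\<^sup>2) \<partial>\<mu>) = (\<integral>\<^sup>+x. liminf (\<lambda>k. ennreal ((norm (hk k x))\<^sup>2)) \<partial>\<mu>)"
  proof (rule nn_integral_cong_AE)
    show "AE x in \<mu>. ennreal ((norm (h x))\<^sup>2) = liminf (\<lambda>k. ennreal ((norm (hk k x))\<^sup>2))"
      using lim
    proof eventually_elim
      case (elim x)
      then have "(\<lambda>k. ennreal ((norm (hk k x))\<^sup>2)) \<longlonglongrightarrow> ennreal ((norm (h x))\<^sup>2)"
        by (intro tendsto_intros)
      then show ?case by (intro lim_imp_Liminf[symmetric]) auto
    qed
  qed
  also have "\<dots> \<le> liminf (\<lambda>k. \<integral>\<^sup>+x. ennreal ((norm (hk k x))\<^sup>2) \<partial>\<mu>)"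
    using hk[THEN L2_funD(1)] by (intro nn_integral_liminf) simp
  also have "\<dots> \<le> ennreal (C\<^sup>2)"
  proof -
    have "\<forall>\<^sub>F k in sequentially. (\<integral>\<^sup>+x. ennreal ((norm (hk k x))\<^sup>2) \<partial>\<mu>) \<le> ennreal (C\<^sup>2)"
      using le unfolding fin by eventually_elim (simp add: L2_norm_nonneg power_mono)
    then have "limsup (\<lambda>k. \<integral>\<^sup>+x. ennreal ((norm (hk k x))\<^sup>2) \<partial>\<mu>) \<le> ennreal (C\<^sup>2)"
      by (rule Limsup_bounded)
    then show ?thesis using Liminf_le_Limsup[of sequentially] order_trans trivial_limit_sequentially by blast
  qed
  finally have b: "(\<integral>\<^sup>+x. ennreal ((norm (h x))\<^sup>2) \<partial>\<mu>) \<le> ennreal (C\<^sup>2)" .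
  then have i: "integrable \<mu> (\<lambda>x. (norm (h x))\<^sup>2)"
    using h by (intro integrableI_bounded) (auto simp: le_less_trans ennreal_less_top)
  then show "h \<in> L2_fun \<mu>" using h by (simp add: L2_fun_def)
  have "ennreal ((L2_norm \<mu> h)\<^sup>2) \<le> ennreal (C\<^sup>2)"
    using b i by (simp add: L2_norm_power2 nn_integral_eq_integral)
  then have "(L2_norm \<mu> h)\<^sup>2 \<le> C\<^sup>2" by simp
  then show "L2_norm \<mu> h \<le> C" using C power2_le_imp_le by blast
qed

section \<open>Completeness of the space of square integrable functions\<close>

lemma L2_norm_telescope:
  fixes hk :: "nat \<Rightarrow> 'a \<Rightarrow> 'b::euclidean_space"
  assumes hk: "\<And>k. hk k \<in> L2_fun \<mu>" and "k \<le> j"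
  shows "L2_norm \<mu> (\<lambda>x. hk j x - hk k x) \<le> (\<Sum>i=k..<j. L2_norm \<mu> (\<lambda>x. hk (Suc i) x - hk i x))"
  using assms(2)
proof (induction j rule: dec_induct)
  case base
  then show ?case by (simp add: L2_norm_zero)
next
  case (step j)
  have "L2_norm \<mu> (\<lambda>x. hk (Suc j) x - hk k x) \<le> L2_norm \<mu> (\<lambda>x. hk (Suc j) x - hk j x) + L2_norm \<mu> (\<lambda>x. hk j x - hk k x)"
    using L2_norm_triangle[OF hk hk hk] .
  then show ?case using step by simp
qed

text \<open>On a finite measure space increments that are summable in L2 are summable in L1, so
  their pointwise sum is finite almost everywhere. The limit \<open>h\<close> is handed in by the
  caller, who may need a particular representative, such as a section of a jointly measurable
  field.\<close>

lemma L2_Riesz_Fischer: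
  fixes hk :: "nat \<Rightarrow> 'a \<Rightarrow> 'b::euclidean_space"
  assumes fin: "finite_measure \<mu>" and hk: "\<And>k. hk k \<in> L2_fun \<mu>"
    and sm: "summable (\<lambda>k. L2_norm \<mu> (\<lambda>x. hk (Suc k) x - hk k x))"
  shows "AE x in \<mu>. convergent (\<lambda>k. hk k x)"
    and "h \<in> borel_measurable \<mu> \<Longrightarrow> AE x in \<mu>. (\<lambda>k. hk k x) \<longlonglongrightarrow> h x \<Longrightarrow>
      h \<in> L2_fun \<mu> \<and> (\<lambda>k. L2_norm \<mu> (\<lambda>x. hk k x - h x)) \<longlonglongrightarrow> 0"
proof -
  have dif: "(\<lambda>x. hk (Suc k) x - hk k x) \<in> L2_fun \<mu>" for k using hk by (intro L2_fun_diff)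
  have "AE x in \<mu>. summable (\<lambda>k. norm (hk (Suc k) x - hk k x))"
  proof -
    let ?d = "\<lambda>k x. norm (hk (Suc k) x - hk k x)"
    have m: "?d k \<in> borel_measurable \<mu>" for k
      using L2_funD(1)[OF dif[of k]] by auto
    have "(\<integral>\<^sup>+x. (\<Sum>k. ennreal (?d k x)) \<partial>\<mu>) = (\<Sum>k. \<integral>\<^sup>+x. ennreal (?d k x) \<partial>\<mu>)"
      using m by (intro nn_integral_suminf) auto
    also have "\<dots> = (\<Sum>k. ennreal (\<integral>x. ?d k x \<partial>\<mu>))"
      using L2_fun_integrable(1)[OF fin dif] by (intro suminf_cong nn_integral_eq_integral) auto
    also have "\<dots> \<le> (\<Sum>k. ennreal (sqrt (measure \<mu> (space \<mu>)) * L2_norm \<mu> (\<lambda>x. hk (Suc k) x - hk k x)))"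
      by (intro suminf_le ennreal_leI L2_fun_integrable(2)[OF fin dif]) auto
    also have "\<dots> < \<top>"
      using summable_mult[OF sm, of "sqrt (measure \<mu> (space \<mu>))"]
      by (subst suminf_ennreal2) (auto simp: L2_norm_nonneg)
    finally have "AE x in \<mu>. (\<Sum>k. ennreal (?d k x)) \<noteq> \<top>"
      using m by (intro nn_integral_PInf_AE[unfolded infinity_ennreal_def]) auto
    then show ?thesis
      by eventually_elim (auto intro!: summable_suminf_not_top)
  qed
  then show "AE x in \<mu>. convergent (\<lambda>k. hk k x)"
  proof eventually_elim
    case (elim x)
    then have "summable (\<lambda>k. hk (Suc k) x - hk k x)" by (rule summable_norm_cancel)
    then have "convergent (\<lambda>n. \<Sum>k<n. hk (Suc k) x - hk k x)" using summable_iff_convergent by blast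
    then have "convergent (\<lambda>n. hk n x - hk 0 x)"
      unfolding sum_lessThan_telescope[of "\<lambda>k. hk k x"] .
    then show ?case using convergent_add[OF _ convergent_const[of "hk 0 x"]] by fastforce
  qed
  assume h: "h \<in> borel_measurable \<mu>" and lim: "AE x in \<mu>. (\<lambda>k. hk k x) \<longlonglongrightarrow> h x"
  let ?t = "\<lambda>k. L2_norm \<mu> (\<lambda>x. hk (Suc k) x - hk k x)"
  \<comment> \<open>The telescoping bound is uniform in j, so Fatou in j turns it into a bound for
    the distance to the limit: the tail of a convergent series.\<close>
  have tail: "(\<lambda>x. hk k x - h x) \<in> L2_fun \<mu> \<and> L2_norm \<mu> (\<lambda>x. hk k x - h x) \<le> (\<Sum>i. ?t (i + k))" for k
  proof -
    have "\<forall>\<^sub>F j in sequentially. L2_norm \<mu> (\<lambda>x. hk k x - hk j x) \<le> (\<Sum>i. ?t (i + k))"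
    proof (rule eventually_sequentiallyI[of k])
      fix j assume "k \<le> j"
      have "L2_norm \<mu> (\<lambda>x. hk k x - hk j x) = L2_norm \<mu> (\<lambda>x. hk j x - hk k x)" by (rule L2_norm_diff_commute)
      also have "\<dots> \<le> (\<Sum>i=k..<j. ?t i)" using L2_norm_telescope[OF hk \<open>k \<le> j\<close>] .
      also have "\<dots> = (\<Sum>i<j-k. ?t (i + k))"
        using sum.shift_bounds_nat_ivl[of ?t 0 k "j - k"] \<open>k \<le> j\<close> by (simp add: atLeast0LessThan)
      also have "\<dots> \<le> (\<Sum>i. ?t (i + k))"
        using summable_ignore_initial_segment[OF sm, of k]
        by (intro sum_le_suminf) (auto simp: L2_norm_nonneg)
      finally show "L2_norm \<mu> (\<lambda>x. hk k x - hk j x) \<le> (\<Sum>i. ?t (i + k))" .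
    qed
    moreover have "AE x in \<mu>. (\<lambda>j. hk k x - hk j x) \<longlonglongrightarrow> hk k x - h x"
      using lim by eventually_elim (intro tendsto_intros)
    ultimately show ?thesis
      using L2_norm_liminf_le[where hk = "\<lambda>j x. hk k x - hk j x" and h = "\<lambda>x. hk k x - h x"]
        L2_fun_diff(1)[OF hk hk] h L2_funD(1)[OF hk] by auto
  qed
  have "(\<lambda>x. hk 0 x - (hk 0 x - h x)) \<in> L2_fun \<mu>"
    by (rule L2_fun_diff(1)[OF hk]) (use tail in blast)
  then have hL: "h \<in> L2_fun \<mu>" by simp
  have "(\<lambda>k. L2_norm \<mu> (\<lambda>x. hk k x - h x)) \<longlonglongrightarrow> 0"
  proof (rule tendsto_sandwich[OF _ _ tendsto_const])
    show "(\<lambda>k. \<Sum>i. ?t (i + k)) \<longlonglongrightarrow> 0" by (rule suminf_exist_split2[OF sm])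
  qed (use tail in \<open>auto simp: L2_norm_nonneg\<close>)
  with hL show "h \<in> L2_fun \<mu> \<and> (\<lambda>k. L2_norm \<mu> (\<lambda>x. hk k x - h x)) \<longlonglongrightarrow> 0" by blast
qed

section \<open>Hausdorff measure\<close>

text \<open>Caratheodory's additivity for sets at positive distance. A lower bound
  \<open>\<eta>\<close> on all pairwise distances stands for the distance of the sets, so that empty
  sets call for no convention.\<close>

definition metric_outer :: "('a::metric_space set \<Rightarrow> ennreal) \<Rightarrow> bool" where
  "metric_outer \<mu> \<longleftrightarrow> outer_measure_space UNIV \<mu> \<and>
     (\<forall>A B \<eta>. 0 < \<eta> \<longrightarrow> (\<forall>x\<in>A. \<forall>y\<in>B. \<eta> \<le> dist x y) \<longrightarrow> \<mu> A + \<mu> B \<le> \<mu> (A \<union> B))"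

lemma metric_outerD:
  assumes "metric_outer \<mu>"
  shows "\<mu> {} = 0" "A \<subseteq> B \<Longrightarrow> \<mu> A \<le> \<mu> B" "\<mu> (\<Union>i. S i) \<le> (\<Sum>i. \<mu> (S i))" "\<mu> (A \<union> B) \<le> \<mu> A + \<mu> B"
    "0 < \<eta> \<Longrightarrow> (\<And>x y. x \<in> A \<Longrightarrow> y \<in> B \<Longrightarrow> \<eta> \<le> dist x y) \<Longrightarrow> \<mu> A + \<mu> B \<le> \<mu> (A \<union> B)"
proof -
  note a = assms[unfolded metric_outer_def outer_measure_space_def positive_def increasing_def]
  show 0: "\<mu> {} = 0" using a by auto
  show m: "A \<subseteq> B \<Longrightarrow> \<mu> A \<le> \<mu> B" for A B using a by auto
  \<comment> \<open>\<open>countably_subadditive\<close> speaks of disjoint families only;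
    disjointing and monotonicity give arbitrary ones.\<close>
  have dis: "\<mu> (\<Union>i. S i) \<le> (\<Sum>i. \<mu> (S i))" if "disjoint_family S" for S :: "nat \<Rightarrow> _"
    using a that unfolding countably_subadditive_def by auto
  show cs: "\<mu> (\<Union>i. S i) \<le> (\<Sum>i. \<mu> (S i))" for S
  proof -
    have "\<mu> (\<Union>i. S i) = \<mu> (\<Union>i. disjointed S i)" by (simp add: UN_disjointed_eq)
    also have "\<dots> \<le> (\<Sum>i. \<mu> (disjointed S i))" by (rule dis[OF disjoint_family_disjointed])
    also have "\<dots> \<le> (\<Sum>i. \<mu> (S i))" by (intro suminf_le m disjointed_subset) auto
    finally show ?thesis .
  qed
  show "\<mu> (A \<union> B) \<le> \<mu> A + \<mu> B"
  proof -
    have "\<mu> (A \<union> B) = \<mu> (\<Union>i. binaryset A B i)" by (simp add: UN_binaryset_eq)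
    also have "\<dots> \<le> (\<Sum>i. \<mu> (binaryset A B i))" by (rule cs)
    also have "\<dots> = \<mu> A + \<mu> B" using 0 by (intro suminf_binaryset_eq)
    finally show ?thesis .
  qed
  show "0 < \<eta> \<Longrightarrow> (\<And>x y. x \<in> A \<Longrightarrow> y \<in> B \<Longrightarrow> \<eta> \<le> dist x y) \<Longrightarrow> \<mu> A + \<mu> B \<le> \<mu> (A \<union> B)"
    using assms[unfolded metric_outer_def, THEN conjunct2, rule_format, of \<eta> A B] by blast
qed

text \<open>Caratheodory's criterion: a set is exhausted by the points at distance at least \<open>1/(k+1)\<close> from
  the closed set, and every second of the shells in between contributes additively, so that the
  total mass of the shells is finite and the remainder of the exhaustion is negligible.\<close>

lemma metric_outer_closed:
  fixes \<mu> :: "'a::metric_space set \<Rightarrow> ennreal"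
  assumes \<mu>: "metric_outer \<mu>" and F: "closed F"
  shows "\<mu> (F \<inter> A) + \<mu> (A - F) \<le> \<mu> A"
proof (cases "\<mu> A = \<top> \<or> F = {}")
  case True
  then show ?thesis using metric_outerD(1)[OF \<mu>] by auto
next
  case False
  note m = metric_outerD[OF \<mu>]
  let ?d = "\<lambda>x. infdist x F"
  have tri: "?d x \<le> ?d y + dist x y" for x y by (rule infdist_triangle)
  have pos: "?d x > 0" if "x \<notin> F" for x
    using that False F infdist_pos_not_in_closed by blast
  define E where "E k = {x \<in> A. 1 / real (Suc k) \<le> ?d x}" for k
  define R where "R k = {x \<in> A. 1 / real (Suc (Suc k)) \<le> ?d x \<and> ?d x < 1 / real (Suc k)}" for k
  have EF: "\<mu> (F \<inter> A) + \<mu> (E k) \<le> \<mu> A" for k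
  proof -
    have "\<mu> (F \<inter> A) + \<mu> (E k) \<le> \<mu> ((F \<inter> A) \<union> E k)"
    proof (rule m(5)[of "1 / real (Suc k)"])
      fix x y assume "x \<in> F \<inter> A" "y \<in> E k"
      then show "1 / real (Suc k) \<le> dist x y"
        using tri[of y x] by (auto simp: E_def dist_commute)
    qed simp
    also have "\<dots> \<le> \<mu> A" by (rule m(2)) (auto simp: E_def)
    finally show ?thesis .
  qed
  have sep: "(\<Sum>j<n. \<mu> (R (2 * j + p))) \<le> \<mu> (\<Union>j<n. R (2 * j + p))" for n p
  proof (induction n)
    case 0
    then show ?case by (simp add: m)
  next
    case (Suc n)
    \<comment> \<open>The gap between shell 2n + p and all earlier shells of the same parity. For n
      = 0 and p = 0 it would contain 1/0, but then there are no earlier shells, whence the case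
      distinction below.\<close>
    let ?\<eta> = "1 / real (2 * n + p) - 1 / real (Suc (2 * n + p))"
    have "(\<Sum>j<Suc n. \<mu> (R (2 * j + p))) \<le> \<mu> (\<Union>j<n. R (2 * j + p)) + \<mu> (R (2 * n + p))"
      using Suc by (simp add: add_right_mono)
    also have "\<dots> \<le> \<mu> ((\<Union>j<n. R (2 * j + p)) \<union> R (2 * n + p))"
    proof (cases "n = 0")
      case True
      then show ?thesis using m(1) by simp
    next
      case False
      show ?thesis
      proof (rule m(5)[of ?\<eta>])
        show "0 < ?\<eta>" using False by (simp add: frac_less2)
        fix x y assume "x \<in> (\<Union>j<n. R (2 * j + p))" "y \<in> R (2 * n + p)"
        then obtain j where j: "j < n" "1 / real (Suc (Suc (2 * j + p))) \<le> ?d x"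
          and y: "?d y < 1 / real (Suc (2 * n + p))" by (auto simp: R_def)
        have "1 / real (2 * n + p) \<le> 1 / real (Suc (Suc (2 * j + p)))"
          using j by (intro divide_left_mono) auto
        then show "?\<eta> \<le> dist x y" using j y tri[of x y] by linarith
      qed
    qed
    also have "(\<Union>j<n. R (2 * j + p)) \<union> R (2 * n + p) = (\<Union>j<Suc n. R (2 * j + p))"
      by (auto simp: lessThan_Suc)
    finally show ?case .
  qed
  have fin1: "(\<Sum>j. \<mu> (R (2 * j + p))) \<le> \<mu> A" for p
  proof (rule suminf_le_const)
    fix n
    have "(\<Sum>j<n. \<mu> (R (2 * j + p))) \<le> \<mu> (\<Union>j<n. R (2 * j + p))" by (rule sep)
    also have "\<dots> \<le> \<mu> A" by (rule m(2)) (auto simp: R_def)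
    finally show "(\<Sum>j<n. \<mu> (R (2 * j + p))) \<le> \<mu> A" .
  qed simp
  have "(\<Sum>j. \<mu> (R j)) \<le> \<mu> A + \<mu> A"
  proof (rule suminf_le_const)
    fix n
    have "(\<Sum>j<n. \<mu> (R j)) \<le> (\<Sum>j<2 * n. \<mu> (R j))" by (rule sum_mono2) auto
    also have "\<dots> = (\<Sum>j<n. \<mu> (R (2 * j + 0))) + (\<Sum>j<n. \<mu> (R (2 * j + 1)))"
      by (induction n) (auto simp: algebra_simps)
    also have "\<dots> \<le> \<mu> A + \<mu> A"
      by (intro add_mono order_trans[OF sum_le_suminf fin1]) auto
    finally show "(\<Sum>j<n. \<mu> (R j)) \<le> \<mu> A + \<mu> A" .
  qed simp
  also have "\<dots> < \<top>" using False by (simp add: less_top)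
  finally have fin: "(\<Sum>j. \<mu> (R j)) \<noteq> \<top>" by simp
  have tail: "(\<lambda>k. \<Sum>j. \<mu> (R (j + k))) \<longlonglongrightarrow> 0"
  proof -
    have f: "\<mu> (R j) < \<top>" for j using fin ennreal_suminf_lessD[of "\<lambda>j. \<mu> (R j)" \<top>] by (simp add: less_top)
    have s: "summable (\<lambda>j. enn2real (\<mu> (R j)))"
      using fin f by (intro summable_suminf_not_top) auto
    have "(\<lambda>k. ennreal (\<Sum>j. enn2real (\<mu> (R (j + k))))) \<longlonglongrightarrow> ennreal 0"
      by (intro tendsto_ennrealI suminf_exist_split2[OF s])
    moreover have "ennreal (\<Sum>j. enn2real (\<mu> (R (j + k)))) = (\<Sum>j. \<mu> (R (j + k)))" for k
      using f summable_ignore_initial_segment[OF s, of k] by (subst suminf_ennreal2[symmetric]) auto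
    ultimately show ?thesis by simp
  qed
  have cov: "\<mu> (A - F) \<le> \<mu> (E k) + (\<Sum>j. \<mu> (R (j + k)))" for k
  proof -
    have "A - F \<subseteq> E k \<union> (\<Union>j. R (j + k))"
    proof
      fix x assume x: "x \<in> A - F"
      then have p: "?d x > 0" using pos by auto
      obtain n where n: "1 / real (Suc n) \<le> ?d x"
        using reals_Archimedean[OF p] by (auto simp: inverse_eq_divide intro: less_imp_le)
      \<comment> \<open>The least level that x reaches. If it exceeds k, then x misses the preceding
        level and lies in the shell of index q - 1.\<close>
      define q where "q = (LEAST n. 1 / real (Suc n) \<le> ?d x)"
      have q: "1 / real (Suc q) \<le> ?d x" unfolding q_def by (rule LeastI[of "\<lambda>n. 1 / real (Suc n) \<le> ?d x", OF n])
      show "x \<in> E k \<union> (\<Union>j. R (j + k))"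
      proof (cases "q \<le> k")
        case True
        then have "1 / real (Suc k) \<le> 1 / real (Suc q)" by (intro divide_left_mono) auto
        then show ?thesis using q x by (auto simp: E_def)
      next
        case False
        then obtain r where r: "q = Suc r" "k \<le> r" by (cases q) auto
        then have "\<not> 1 / real (Suc r) \<le> ?d x" using not_less_Least[of r "\<lambda>n. 1 / real (Suc n) \<le> ?d x"] by (simp add: q_def)
        then have "x \<in> R ((r - k) + k)" using q x r by (auto simp: R_def)
        then show ?thesis by blast
      qed
    qed
    then have "\<mu> (A - F) \<le> \<mu> (E k \<union> (\<Union>j. R (j + k)))" by (rule m(2))
    also have "\<dots> \<le> \<mu> (E k) + \<mu> (\<Union>j. R (j + k))" by (rule m(4))
    also have "\<dots> \<le> \<mu> (E k) + (\<Sum>j. \<mu> (R (j + k)))" by (intro add_left_mono m(3))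
    finally show ?thesis .
  qed
  have "\<mu> (F \<inter> A) + \<mu> (A - F) \<le> \<mu> A + (\<Sum>j. \<mu> (R (j + k)))" for k
  proof -
    have "\<mu> (F \<inter> A) + \<mu> (A - F) \<le> \<mu> (F \<inter> A) + (\<mu> (E k) + (\<Sum>j. \<mu> (R (j + k))))"
      by (intro add_left_mono cov)
    also have "\<dots> \<le> \<mu> A + (\<Sum>j. \<mu> (R (j + k)))"
      using EF[of k] by (simp add: add.assoc[symmetric] add_right_mono)
    finally show ?thesis .
  qed
  moreover have "(\<lambda>k. \<mu> A + (\<Sum>j. \<mu> (R (j + k)))) \<longlonglongrightarrow> \<mu> A + 0"
    by (intro tendsto_add tendsto_const tail)
  ultimately show ?thesis
    by (intro LIMSEQ_le_const[of "\<lambda>k. \<mu> A + (\<Sum>j. \<mu> (R (j + k)))"]) auto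
qed

text \<open>Closed sets generate the Borel sets, so it suffices that they satisfy the splitting
  condition of \<open>lambda_system\<close>.\<close>

lemma metric_outer_measure_space:
  fixes \<mu> :: "'a::metric_space set \<Rightarrow> ennreal"
  assumes \<mu>: "metric_outer \<mu>"
  shows "measure_space UNIV (sets borel) \<mu>"
proof -
  interpret P: sigma_algebra UNIV "UNIV :: 'a set set"
    using sigma_algebra_Pow[of UNIV] by simp
  have om: "outer_measure_space UNIV \<mu>" using \<mu> by (simp add: metric_outer_def)
  have ms: "measure_space UNIV (lambda_system UNIV UNIV \<mu>) \<mu>"
    by (rule P.caratheodory_lemma[OF om])
  then interpret L: sigma_algebra UNIV "lambda_system UNIV UNIV \<mu>"
    by (simp add: measure_space_def)
  have "F \<in> lambda_system UNIV UNIV \<mu>" if "closed F" for F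
    unfolding lambda_system_def
  proof (intro CollectI conjI ballI)
    fix A
    have "\<mu> A \<le> \<mu> (F \<inter> A) + \<mu> ((UNIV - F) \<inter> A)"
      using metric_outerD(4)[OF \<mu>, of "F \<inter> A" "(UNIV - F) \<inter> A"] by (simp add: Int_Un_distrib2[symmetric])
    moreover have "(UNIV - F) \<inter> A = A - F" by auto
    ultimately show "\<mu> (F \<inter> A) + \<mu> ((UNIV - F) \<inter> A) = \<mu> A"
      using metric_outer_closed[OF \<mu> that, of A] by (simp add: antisym)
  qed simp
  then have "sigma_sets UNIV (Collect closed) \<subseteq> lambda_system UNIV UNIV \<mu>"
    by (intro L.sigma_sets_subset) auto
  moreover have "sets (borel :: 'a measure) = sigma_sets UNIV (Collect closed)"
    by (subst borel_eq_closed) simp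
  ultimately have "sets borel \<subseteq> lambda_system UNIV UNIV \<mu>" by simp
  then show ?thesis
    using ms sets.sigma_algebra_axioms[of borel] by (intro measure_down[OF ms]) auto
qed

section \<open>The Hausdorff outer measure\<close>

definition hausdorff_term :: "nat \<Rightarrow> 'a::metric_space set \<Rightarrow> ennreal" where
  "hausdorff_term s U = (if U = {} then 0 else ennreal (unit_ball_vol (real s) * (diameter U / 2) ^ s))"

definition delta_cover :: "real \<Rightarrow> 'a::metric_space set \<Rightarrow> (nat \<Rightarrow> 'a set) \<Rightarrow> bool" where
  "delta_cover \<delta> A U \<longleftrightarrow> A \<subseteq> (\<Union>i. U i) \<and> (\<forall>i. bounded (U i) \<and> diameter (U i) \<le> \<delta>)"

lemma hausdorff_pre_alt:
  "hausdorff_pre s \<delta> A = (INF U\<in>Collect (delta_cover \<delta> A). \<Sum>i. hausdorff_term s (U i))"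
  unfolding hausdorff_pre_def delta_cover_def hausdorff_term_def ..

lemma hausdorff_pre_le: "delta_cover \<delta> A U \<Longrightarrow> hausdorff_pre s \<delta> A \<le> (\<Sum>i. hausdorff_term s (U i))"
  unfolding hausdorff_pre_alt by (rule INF_lower) simp

lemma hausdorff_pre_mono: "A \<subseteq> B \<Longrightarrow> \<delta>' \<le> \<delta> \<Longrightarrow> hausdorff_pre s \<delta> A \<le> hausdorff_pre s \<delta>' B"
  unfolding hausdorff_pre_alt
proof (rule INF_superset_mono)
  assume "A \<subseteq> B" "\<delta>' \<le> \<delta>"
  then show "Collect (delta_cover \<delta>' B) \<subseteq> Collect (delta_cover \<delta> A)"
    unfolding delta_cover_def by (auto intro: order_trans)
qed simp

lemma hausdorff_pre_empty: "\<delta> > 0 \<Longrightarrow> hausdorff_pre s \<delta> {} = 0"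
  using hausdorff_pre_le[of \<delta> "{}" "\<lambda>i. {}" s] by (simp add: delta_cover_def hausdorff_term_def)

text \<open>The usual argument with errors e/2^(n+1), the double sequence of covering sets being
  enumerated along \<open>prod_decode\<close>.\<close>

lemma hausdorff_pre_UN:
  assumes "\<delta> > 0"
  shows "hausdorff_pre s \<delta> (\<Union>i. A i) \<le> (\<Sum>i. hausdorff_pre s \<delta> (A i))"
proof (rule ennreal_le_epsilon)
  fix e :: real assume e: "0 < e" and fin: "(\<Sum>n. hausdorff_pre s \<delta> (A n)) < top"
  then have "hausdorff_pre s \<delta> (A n) < hausdorff_pre s \<delta> (A n) + e * (1/2)^Suc n" for n
    by (auto simp: less_top dest!: ennreal_suminf_lessD)
  then have "\<exists>U. delta_cover \<delta> (A n) U \<and> (\<Sum>i. hausdorff_term s (U i)) < hausdorff_pre s \<delta> (A n) + e * (1/2)^Suc n" for n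
    by (subst (asm) (1) hausdorff_pre_alt) (auto simp: INF_less_iff)
  then obtain U where U: "\<And>n. delta_cover \<delta> (A n) (U n)"
    and Ule: "\<And>n. (\<Sum>i. hausdorff_term s (U n i)) < hausdorff_pre s \<delta> (A n) + e * (1/2)^Suc n"
    by metis
  define C where "C = case_prod U \<circ> prod_decode"
  have "(\<Union>i. A i) \<subseteq> (\<Union>i. C i)"
  proof
    fix x assume "x \<in> (\<Union>i. A i)"
    then obtain n i where "x \<in> U n i" using U unfolding delta_cover_def by blast
    then have "x \<in> C (prod_encode (n, i))" by (simp add: C_def)
    then show "x \<in> (\<Union>i. C i)" by blast
  qed
  then have "delta_cover \<delta> (\<Union>i. A i) C"
    using U by (auto simp: delta_cover_def C_def split_def)
  then have "hausdorff_pre s \<delta> (\<Union>i. A i) \<le> (\<Sum>i. hausdorff_term s (C i))" by (rule hausdorff_pre_le)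
  also have "\<dots> = (\<Sum>n. \<Sum>i. hausdorff_term s (U n i))"
    using suminf_ennreal_2dimen[of "\<lambda>n. \<Sum>i. hausdorff_term s (U n i)" "\<lambda>(n, i). hausdorff_term s (U n i)"]
    by (simp add: C_def comp_def split_def)
  also have "\<dots> \<le> (\<Sum>n. hausdorff_pre s \<delta> (A n) + e * (1/2) ^ Suc n)"
    using Ule by (intro suminf_le less_imp_le) auto
  also have "\<dots> = (\<Sum>n. hausdorff_pre s \<delta> (A n)) + (\<Sum>n. ennreal e * ennreal ((1/2) ^ Suc n))"
    using e by (subst suminf_add[symmetric]) (auto simp del: ennreal_suminf_cmult simp add: ennreal_mult[symmetric])
  also have "\<dots> = (\<Sum>n. hausdorff_pre s \<delta> (A n)) + e"
    unfolding ennreal_suminf_cmult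
    by (subst suminf_ennreal_eq[OF zero_le_power power_half_series]) auto
  finally show "hausdorff_pre s \<delta> (\<Union>i. A i) \<le> (\<Sum>n. hausdorff_pre s \<delta> (A n)) + e" .
qed

text \<open>A covering set of diameter at most \<delta> < \<eta> meets at most one of A and B, so
  that a cover of the union splits into two covers.\<close>

lemma hausdorff_pre_separated:
  assumes "0 < \<delta>" "\<delta> < \<eta>" "\<And>x y. x \<in> A \<Longrightarrow> y \<in> B \<Longrightarrow> \<eta> \<le> dist x y"
  shows "hausdorff_pre s \<delta> A + hausdorff_pre s \<delta> B \<le> hausdorff_pre s \<delta> (A \<union> B)"
  unfolding hausdorff_pre_alt[of s \<delta> "A \<union> B"]
proof (rule INF_greatest, clarify)
  fix U assume U: "delta_cover \<delta> (A \<union> B) U"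
  \<comment> \<open>Sets that miss C are emptied rather than dropped. The index set stays the same,
    and the empty set costs 0 also for s = 0, where every nonempty set costs 1.\<close>
  define V where "V C i = (if U i \<inter> C = {} then {} else U i)" for C i
  have cov: "delta_cover \<delta> C (V C)" if CAB: "C \<subseteq> A \<union> B" for C
  proof -
    have "C \<subseteq> (\<Union>i. V C i)"
    proof
      fix x assume x: "x \<in> C"
      then obtain i where "x \<in> U i" using U CAB unfolding delta_cover_def by blast
      then have "x \<in> V C i" using x by (auto simp: V_def)
      then show "x \<in> (\<Union>i. V C i)" by blast
    qed
    then show ?thesis using U assms(1) by (auto simp: delta_cover_def V_def)
  qed
  have "hausdorff_term s (V A i) + hausdorff_term s (V B i) \<le> hausdorff_term s (U i)" for i
  proof -
    have "U i \<inter> A = {} \<or> U i \<inter> B = {}"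
    proof (rule ccontr)
      assume "\<not> ?thesis"
      then obtain x y where xy: "x \<in> U i" "x \<in> A" "y \<in> U i" "y \<in> B" by blast
      have "dist x y \<le> diameter (U i)" using U xy by (intro diameter_bounded_bound) (auto simp: delta_cover_def)
      also have "\<dots> \<le> \<delta>" using U by (auto simp: delta_cover_def)
      finally show False using assms(2) assms(3)[OF xy(2,4)] by simp
    qed
    then show ?thesis by (auto simp: V_def hausdorff_term_def)
  qed
  then have "(\<Sum>i. hausdorff_term s (V A i)) + (\<Sum>i. hausdorff_term s (V B i)) \<le> (\<Sum>i. hausdorff_term s (U i))"
    by (subst suminf_add) (auto intro!: suminf_le)
  then show "hausdorff_pre s \<delta> A + hausdorff_pre s \<delta> B \<le> (\<Sum>i. hausdorff_term s (U i))"
    using add_mono[OF hausdorff_pre_le[OF cov[of A]] hausdorff_pre_le[OF cov[of B]]] order_trans by blast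
qed

lemma hausdorff_pre_le_outer: "\<delta> > 0 \<Longrightarrow> hausdorff_pre s \<delta> A \<le> hausdorff_outer s A"
  unfolding hausdorff_outer_def by (rule SUP_upper) simp

lemma metric_outer_hausdorff: "metric_outer (hausdorff_outer s)"
proof -
  have "hausdorff_outer s {} = 0"
    unfolding hausdorff_outer_def by (simp add: hausdorff_pre_empty)
  moreover have "hausdorff_outer s A \<le> hausdorff_outer s B" if "A \<subseteq> B" for A B :: "'a set"
    unfolding hausdorff_outer_def using that by (intro SUP_mono) (auto intro: hausdorff_pre_mono)
  moreover have "hausdorff_outer s (\<Union>i. A i) \<le> (\<Sum>i. hausdorff_outer s (A i))" for A :: "nat \<Rightarrow> 'a set"
    unfolding hausdorff_outer_def[of s "\<Union>i. A i"]
  proof (rule SUP_least)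
    fix \<delta> :: real assume "\<delta> \<in> {0<..}"
    then have \<delta>: "\<delta> > 0" by simp
    have "hausdorff_pre s \<delta> (\<Union>i. A i) \<le> (\<Sum>i. hausdorff_pre s \<delta> (A i))" by (rule hausdorff_pre_UN[OF \<delta>])
    also have "\<dots> \<le> (\<Sum>i. hausdorff_outer s (A i))" by (intro suminf_le hausdorff_pre_le_outer \<delta>) auto
    finally show "hausdorff_pre s \<delta> (\<Union>i. A i) \<le> (\<Sum>i. hausdorff_outer s (A i))" .
  qed
  moreover have "hausdorff_outer s A + hausdorff_outer s B \<le> hausdorff_outer s (A \<union> B)"
    if \<eta>: "0 < \<eta>" "\<forall>x\<in>A. \<forall>y\<in>B. \<eta> \<le> dist x y" for A B :: "'a set" and \<eta>
  proof -
    \<comment> \<open>Two independent scales allow the two suprema to be taken one after the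
      other.\<close>
    have *: "hausdorff_pre s \<delta>1 A + hausdorff_pre s \<delta>2 B \<le> hausdorff_outer s (A \<union> B)"
      if "\<delta>1 > 0" "\<delta>2 > 0" for \<delta>1 \<delta>2
    proof -
      define \<delta> where "\<delta> = min (min \<delta>1 \<delta>2) (\<eta> / 2)"
      have \<delta>: "\<delta> > 0" "\<delta> \<le> \<delta>1" "\<delta> \<le> \<delta>2" "\<delta> < \<eta>" using that \<eta> by (auto simp: \<delta>_def)
      have "hausdorff_pre s \<delta>1 A + hausdorff_pre s \<delta>2 B \<le> hausdorff_pre s \<delta> A + hausdorff_pre s \<delta> B"
        by (intro add_mono hausdorff_pre_mono \<delta> order_refl)
      also have "\<dots> \<le> hausdorff_pre s \<delta> (A \<union> B)"
        using \<eta> by (intro hausdorff_pre_separated[OF \<delta>(1,4)]) auto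
      also have "\<dots> \<le> hausdorff_outer s (A \<union> B)" by (rule hausdorff_pre_le_outer[OF \<delta>(1)])
      finally show ?thesis .
    qed
    have ne: "{0<..} \<noteq> ({} :: real set)" by (metis greaterThan_iff empty_iff zero_less_one)
    have "hausdorff_pre s \<delta>1 A + hausdorff_outer s B \<le> hausdorff_outer s (A \<union> B)" if "\<delta>1 > 0" for \<delta>1
      unfolding hausdorff_outer_def[of s B] using ne *[OF that]
      by (subst ennreal_SUP_add_right) (auto intro!: SUP_least)
    then show ?thesis
      unfolding hausdorff_outer_def[of s A] using ne
      by (subst ennreal_SUP_add_left[symmetric]) (auto intro!: SUP_least)
  qed
  ultimately show ?thesis
    unfolding metric_outer_def outer_measure_space_def positive_def increasing_def countably_subadditive_def
    by auto
qed

lemma sets_hausdorff_measure [simp]: "sets (hausdorff_measure s) = sets borel"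
  and space_hausdorff_measure [simp]: "space (hausdorff_measure s) = UNIV"
  unfolding hausdorff_measure_def
  using sets.sets_measure_of_eq[of borel "hausdorff_outer s"] sets.space_measure_of_eq[of borel "hausdorff_outer s"]
  by (simp_all only: space_borel)

lemma emeasure_hausdorff_measure:
  fixes A :: "'a::metric_space set"
  assumes "A \<in> sets borel"
  shows "emeasure (hausdorff_measure s) A = hausdorff_outer s A"
proof -
  have "measure_space UNIV (sets borel) (hausdorff_outer s :: 'a set \<Rightarrow> ennreal)"
    by (rule metric_outer_measure_space[OF metric_outer_hausdorff])
  then show ?thesis using assms
    by (intro emeasure_measure_of[OF hausdorff_measure_def]) (simp_all add: measure_space_def)
qed

section \<open>Volume of swept strips in terms of Hausdorff measure\<close>

lemma strip_cover:
  fixes U :: "'a::euclidean_space set"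
  assumes \<nu>: "norm \<nu> = 1" and d: "0 < d" "d \<le> \<delta>" and U: "bounded U" "diameter U \<le> d"
  shows "\<exists>B\<in>sets borel. {y - t *\<^sub>R \<nu> |y t. y \<in> U \<and> 0 \<le> t \<and> t \<le> \<delta>} \<subseteq> B \<and>
    emeasure lborel B \<le> ennreal (unit_ball_vol (real DIM('a)) * 2 ^ (DIM('a) + 1) * \<delta> * d ^ (DIM('a) - 1))"
proof (cases "U = {}")
  case True
  then show ?thesis by (intro bexI[of _ "{}"]) auto
next
  case False
  then obtain y0 where y0: "y0 \<in> U" by auto
  \<comment> \<open>Centres are placed at spacing d along a segment of length \<delta>. The radius
    2d pays d for the diameter of U and d for the offset from the centre just passed. As d is at
    most \<delta>, the N + 1 balls number at most 2\<delta>/d.\<close>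
  define N where "N = nat \<lfloor>\<delta> / d\<rfloor>"
  define B where "B = (\<Union>m\<le>N. cball (y0 - (real m * d) *\<^sub>R \<nu>) (2 * d))"
  let ?n = "DIM('a)" and ?w = "unit_ball_vol (real DIM('a))"
  have w: "?w \<ge> 0" by simp
  have N: "real N \<le> \<delta> / d" using d by (simp add: N_def of_nat_nat)
  have sub: "{y - t *\<^sub>R \<nu> |y t. y \<in> U \<and> 0 \<le> t \<and> t \<le> \<delta>} \<subseteq> B"
  proof clarify
    fix y t assume y: "y \<in> U" and t: "0 \<le> t" "t \<le> \<delta>"
    define m where "m = nat \<lfloor>t / d\<rfloor>"
    have m: "real m \<le> t / d" "t / d < real m + 1"
      using t d by (auto simp: m_def of_nat_nat)
    have mN: "m \<le> N" unfolding m_def N_def using t d by (intro nat_mono floor_mono divide_right_mono) auto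
    have td: "\<bar>t - real m * d\<bar> \<le> d" using m d by (simp add: field_simps abs_le_iff)
    have "norm ((y0 - (real m * d) *\<^sub>R \<nu>) - (y - t *\<^sub>R \<nu>)) = norm ((y0 - y) + (t - real m * d) *\<^sub>R \<nu>)"
      by (simp add: algebra_simps)
    also have "\<dots> \<le> norm (y0 - y) + norm ((t - real m * d) *\<^sub>R \<nu>)" by (rule norm_triangle_ineq)
    also have "norm (y0 - y) \<le> d"
      using diameter_bounded_bound[OF U(1) y0 y] U(2) by (simp add: dist_norm)
    also have "norm ((t - real m * d) *\<^sub>R \<nu>) \<le> d" using td \<nu> by simp
    finally have "y - t *\<^sub>R \<nu> \<in> cball (y0 - (real m * d) *\<^sub>R \<nu>) (2 * d)"
      by (simp add: dist_norm)
    then show "y - t *\<^sub>R \<nu> \<in> B" unfolding B_def using mN by blast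
  qed
  have "emeasure lborel B \<le> (\<Sum>m\<le>N. emeasure lborel (cball (y0 - (real m * d) *\<^sub>R \<nu>) (2 * d)))"
    unfolding B_def by (rule emeasure_subadditive_finite) auto
  also have "\<dots> = (\<Sum>m\<le>N. ennreal (?w * (2 * d) ^ ?n))"
    using d by (simp add: emeasure_cball)
  also have "\<dots> = ennreal (real (Suc N) * (?w * (2 * d) ^ ?n))"
    using w d by (simp add: ennreal_mult ennreal_of_nat_eq_real_of_nat algebra_simps ennreal_plus)
  also have "\<dots> \<le> ennreal (?w * 2 ^ (?n + 1) * \<delta> * d ^ (?n - 1))"
  proof (rule ennreal_leI)
    have "real (Suc N) \<le> 2 * (\<delta> / d)" using N d by (simp add: field_simps)
    then have "real (Suc N) * (?w * (2 * d) ^ ?n) \<le> 2 * (\<delta> / d) * (?w * (2 * d) ^ ?n)"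
      using w d by (intro mult_right_mono) auto
    also have "\<dots> = ?w * 2 ^ (?n + 1) * \<delta> * (d ^ ?n / d)"
      by (simp add: power_mult_distrib)
    also have "d ^ ?n / d = d ^ (?n - 1)" using d by (simp add: power_diff)
    finally show "real (Suc N) * (?w * (2 * d) ^ ?n) \<le> ?w * 2 ^ (?n + 1) * \<delta> * d ^ (?n - 1)" .
  qed
  finally show ?thesis using sub by (intro bexI[of _ B]) (auto simp: B_def)
qed

text \<open>The bound of \<open>strip_cover\<close> with d equal to the diameter, divided by
  \<delta> times the Hausdorff term. The factor 2^(n-1) undoes the halving of the diameter, and the
  quotient of ball volumes exchanges dimension n - 1 for dimension n.\<close>

definition strip_const :: "'a::euclidean_space itself \<Rightarrow> real" where
  "strip_const _ = unit_ball_vol (real DIM('a)) * 2 ^ (DIM('a) + 1) * 2 ^ (DIM('a) - 1)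
     / unit_ball_vol (real (DIM('a) - 1))"

lemma strip_const_pos: "strip_const TYPE('a::euclidean_space) > 0"
  unfolding strip_const_def by simp

text \<open>\<open>strip_cover\<close> wants a positive scale, so nonempty sets of diameter 0 are
  treated apart. In dimension 1 a point has Hausdorff term 1, and the scale \<delta> serves. In
  higher dimension the term is 0, and intersecting covers at the scales \<delta>/(k+1) shows that
  the strip lies in a null set.\<close>

lemma strip_cover_hausdorff_term:
  fixes U :: "'a::euclidean_space set"
  assumes \<nu>: "norm \<nu> = 1" and \<delta>: "0 < \<delta>" and U: "bounded U" "diameter U \<le> \<delta>"
  shows "\<exists>B\<in>sets borel. {y - t *\<^sub>R \<nu> |y t. y \<in> U \<and> 0 \<le> t \<and> t \<le> \<delta>} \<subseteq> B \<and>
    emeasure lborel B \<le> ennreal (strip_const TYPE('a) * \<delta>) * hausdorff_term (DIM('a) - 1) U"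
proof -
  let ?n = "DIM('a)" and ?w = "unit_ball_vol (real DIM('a))" and ?C = "strip_const TYPE('a)"
  let ?S = "{y - t *\<^sub>R \<nu> |y t. y \<in> U \<and> 0 \<le> t \<and> t \<le> \<delta>}"
  have C: "?w * 2 ^ (?n + 1) * \<delta> * d ^ (?n - 1) = ?C * \<delta> * (unit_ball_vol (real (?n - 1)) * (d / 2) ^ (?n - 1))" for d
  proof -
    define v where "v = unit_ball_vol (real (?n - 1))"
    have "v > 0" by (simp add: v_def)
    then show ?thesis unfolding strip_const_def v_def[symmetric] by (simp add: power_divide)
  qed
  have C': "ennreal (?w * 2 ^ (?n + 1) * \<delta> * diameter U ^ (?n - 1)) = ennreal (?C * \<delta>) * hausdorff_term (?n - 1) U" if "U \<noteq> {}"
    unfolding C hausdorff_term_def using that strip_const_pos[where 'a='a] \<delta> diameter_ge_0[OF U(1)]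
    by (simp add: ennreal_mult)
  consider "U = {}" | "U \<noteq> {}" "diameter U > 0" | "U \<noteq> {}" "diameter U = 0" "?n = 1" | "U \<noteq> {}" "diameter U = 0" "?n > 1"
    using diameter_ge_0[OF U(1)] DIM_positive[where 'a='a] by linarith
  then show ?thesis
  proof cases
    case 1
    then show ?thesis by (intro bexI[of _ "{}"]) auto
  next
    case 2
    then show ?thesis using strip_cover[OF \<nu> 2(2) U(2) U(1) order_refl] C' by simp
  next
    case 3
    then show ?thesis using strip_cover[OF \<nu> \<delta> order_refl U] C' by simp
  next
    case 4
    have "\<exists>B\<in>sets borel. ?S \<subseteq> B \<and> emeasure lborel B \<le> ennreal (?w * 2 ^ (?n + 1) * \<delta> * (\<delta> / real (Suc k)) ^ (?n - 1))" for k
      using \<delta> 4 U by (intro strip_cover[OF \<nu>]) (auto simp: field_simps)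
    then have "\<forall>k. \<exists>B. B \<in> sets borel \<and> ?S \<subseteq> B \<and> emeasure lborel B \<le> ennreal (?w * 2 ^ (?n + 1) * \<delta> * (\<delta> / real (Suc k)) ^ (?n - 1))"
      by (simp add: Bex_def)
    from choice[OF this] obtain B where B: "\<And>k. B k \<in> sets borel" "\<And>k. ?S \<subseteq> B k"
      "\<And>k. emeasure lborel (B k) \<le> ennreal (?w * 2 ^ (?n + 1) * \<delta> * (\<delta> / real (Suc k)) ^ (?n - 1))" by blast
    have "emeasure lborel (\<Inter>k. B k) \<le> ennreal (?w * 2 ^ (?n + 1) * \<delta> * (\<delta> / real (Suc k)) ^ (?n - 1))" for k
      using B(1) by (intro order_trans[OF emeasure_mono[of _ "B k"] B(3)]) auto
    moreover have "(\<lambda>k. ennreal (?w * 2 ^ (?n + 1) * \<delta> * (\<delta> / real (Suc k)) ^ (?n - 1))) \<longlonglongrightarrow> ennreal (?w * 2 ^ (?n + 1) * \<delta> * (\<delta> * 0) ^ (?n - 1))"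
      unfolding divide_inverse by (intro tendsto_intros LIMSEQ_inverse_real_of_nat)
    ultimately have "emeasure lborel (\<Inter>k. B k) \<le> ennreal (?w * 2 ^ (?n + 1) * \<delta> * (\<delta> * 0) ^ (?n - 1))"
      by (intro LIMSEQ_le_const) auto
    then have "emeasure lborel (\<Inter>k. B k) \<le> 0" using 4 by (simp add: power_0_left)
    moreover have "(\<Inter>k. B k) \<in> sets borel" using B by auto
    ultimately show ?thesis using B(2) by (intro bexI[of _ "\<Inter>k. B k"]) auto
  qed
qed

text \<open>Covering the swept set by balls spares coordinates on the hyperplane orthogonal to \<open>\<nu>\<close>.\<close>

lemma emeasure_strip_le_hausdorff:
  fixes A :: "'a::euclidean_space set"
  assumes \<nu>: "norm \<nu> = 1" and \<delta>: "0 < \<delta>" and E: "E \<subseteq> {y - t *\<^sub>R \<nu> |y t. y \<in> A \<and> 0 \<le> t \<and> t \<le> \<delta>}"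
  shows "emeasure lborel E \<le> ennreal (strip_const TYPE('a) * \<delta>) * hausdorff_outer (DIM('a) - 1) A"
proof -
  let ?c = "strip_const TYPE('a) * \<delta>"
  have c: "?c > 0" by (intro mult_pos_pos strip_const_pos \<delta>)
  \<comment> \<open>The constant is divided out on the left, so that the infimum over covers is
    taken of the bare covering sums.\<close>
  have "1 / ?c * ?c = 1" using c by (metis less_irrefl nonzero_eq_divide_eq)
  then have inv: "ennreal (1 / ?c) * ennreal ?c = 1" "ennreal ?c * ennreal (1 / ?c) = 1"
    using c by (simp_all only: ennreal_mult[symmetric] less_imp_le divide_nonneg_pos mult.commute[of ?c] ennreal_1 zero_le_one)
  have "ennreal (1 / ?c) * emeasure lborel E \<le> (\<Sum>i. hausdorff_term (DIM('a) - 1) (U i))" if U: "delta_cover \<delta> A U" for U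
  proof -
    have "\<exists>B\<in>sets borel. {y - t *\<^sub>R \<nu> |y t. y \<in> U i \<and> 0 \<le> t \<and> t \<le> \<delta>} \<subseteq> B \<and>
      emeasure lborel B \<le> ennreal ?c * hausdorff_term (DIM('a) - 1) (U i)" for i
      using U by (intro strip_cover_hausdorff_term[OF \<nu> \<delta>]) (auto simp: delta_cover_def)
    then have "\<forall>i. \<exists>B. B \<in> sets borel \<and> {y - t *\<^sub>R \<nu> |y t. y \<in> U i \<and> 0 \<le> t \<and> t \<le> \<delta>} \<subseteq> B \<and>
      emeasure lborel B \<le> ennreal ?c * hausdorff_term (DIM('a) - 1) (U i)"
      by (simp add: Bex_def)
    from choice[OF this] obtain B where B: "\<And>i. B i \<in> sets borel" "\<And>i. {y - t *\<^sub>R \<nu> |y t. y \<in> U i \<and> 0 \<le> t \<and> t \<le> \<delta>} \<subseteq> B i"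
      "\<And>i. emeasure lborel (B i) \<le> ennreal ?c * hausdorff_term (DIM('a) - 1) (U i)" by blast
    have "E \<subseteq> (\<Union>i. B i)"
    proof
      fix x assume "x \<in> E"
      then obtain y t where yt: "x = y - t *\<^sub>R \<nu>" "y \<in> A" "0 \<le> t" "t \<le> \<delta>" using E by blast
      then obtain i where "y \<in> U i" using U unfolding delta_cover_def by blast
      then have "x \<in> B i" using B(2)[of i] yt by blast
      then show "x \<in> (\<Union>i. B i)" by blast
    qed
    then have "emeasure lborel E \<le> emeasure lborel (\<Union>i. B i)" using B by (intro emeasure_mono) auto
    also have "\<dots> \<le> (\<Sum>i. emeasure lborel (B i))" using B by (intro emeasure_subadditive_countably) auto
    also have "\<dots> \<le> (\<Sum>i. ennreal ?c * hausdorff_term (DIM('a) - 1) (U i))" using B by (intro suminf_le) auto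
    also have "\<dots> = ennreal ?c * (\<Sum>i. hausdorff_term (DIM('a) - 1) (U i))" by simp
    finally have "ennreal (1 / ?c) * emeasure lborel E \<le> ennreal (1 / ?c) * (ennreal ?c * (\<Sum>i. hausdorff_term (DIM('a) - 1) (U i)))"
      by (intro mult_left_mono) auto
    also have "\<dots> = (\<Sum>i. hausdorff_term (DIM('a) - 1) (U i))"
      unfolding mult.assoc[symmetric] inv by simp
    finally show ?thesis .
  qed
  then have "ennreal (1 / ?c) * emeasure lborel E \<le> hausdorff_pre (DIM('a) - 1) \<delta> A"
    unfolding hausdorff_pre_alt by (intro INF_greatest) auto
  also have "\<dots> \<le> hausdorff_outer (DIM('a) - 1) A" by (rule hausdorff_pre_le_outer[OF \<delta>])
  finally have "ennreal ?c * (ennreal (1 / ?c) * emeasure lborel E) \<le> ennreal ?c * hausdorff_outer (DIM('a) - 1) A"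
    by (intro mult_left_mono) auto
  moreover have "ennreal ?c * (ennreal (1 / ?c) * emeasure lborel E) = emeasure lborel E"
    unfolding mult.assoc[symmetric] inv by simp
  ultimately show ?thesis by simp
qed

section \<open>Sobolev spaces\<close>

lemma finite_measure_vol:
  fixes D :: "'a::euclidean_space set"
  assumes "open D" "bounded D"
  shows "finite_measure (vol D)"
proof
  have "emeasure (vol D) (space (vol D)) = emeasure lborel D"
    using assms(1) by (simp add: emeasure_restrict_space space_restrict_space)
  also have "\<dots> < \<infinity>" using emeasure_bounded_finite[OF assms(2)] by simp
  finally show "emeasure (vol D) (space (vol D)) \<noteq> \<infinity>" by simp
qed

lemma continuous_L2_fun_vol:
  fixes h :: "'a::euclidean_space \<Rightarrow> 'b::euclidean_space"
  assumes "open D" "bounded D" "continuous_on UNIV h"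
  shows "h \<in> L2_fun (vol D)"
proof -
  have m: "h \<in> borel_measurable (vol D)"
    using borel_measurable_continuous_onI[OF assms(3)] by (simp add: measurable_restrict_space1)
  obtain B where B: "\<And>x. x \<in> closure D \<Longrightarrow> norm (h x) \<le> B"
  proof -
    have "compact (h ` closure D)"
      using assms by (intro compact_continuous_image) (auto intro: continuous_on_subset)
    then have "bounded (h ` closure D)" by (rule compact_imp_bounded)
    then show ?thesis using that unfolding bounded_iff by auto
  qed
  have "integrable (vol D) (\<lambda>x. (norm (h x))\<^sup>2)"
  proof (rule finite_measure.integrable_const_bound[OF finite_measure_vol[OF assms(1,2)], where B = "B\<^sup>2"])
    show "AE x in vol D. norm ((norm (h x))\<^sup>2) \<le> B\<^sup>2"
    proof (rule AE_I2)
      fix x assume "x \<in> space (vol D)"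
      then have "x \<in> closure D" using closure_subset by (auto simp: space_restrict_space)
      then show "norm ((norm (h x))\<^sup>2) \<le> B\<^sup>2" using B power_mono[of "norm (h x)" B 2] by simp
    qed
  qed (use m in measurable)
  then show ?thesis using m by (simp add: L2_fun_def)
qed

lemma smooth_L2_fun_vol:
  assumes "open D" "bounded D" "smooth w"
  shows "w \<in> L2_fun (vol D)" "grad w \<in> L2_fun (vol D)"
  using continuous_L2_fun_vol[OF assms(1,2)] smooth_continuous_on[OF assms(3)] continuous_on_grad[OF assms(3)]
  by blast+

lemma test_fun_L2:
  assumes "open D" "\<phi> \<in> test_fun D"
  shows "\<phi> \<in> L2_fun (vol D)"
proof -
  have "(\<lambda>x. \<phi> x * \<phi> x) \<in> test_fun D" using test_fun_mult[OF test_funD(1)[OF assms(2)] assms(2)] .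
  then have "integrable (vol D) (\<lambda>x. \<phi> x * \<phi> x)"
    by (subst integral_vol_eq(2)[OF assms(1)]) (use integrable_test_fun test_funD[OF assms(2)] in auto)
  moreover have "\<phi> \<in> borel_measurable (vol D)"
    using integrable_test_fun[OF assms(2)] by (auto simp: measurable_restrict_space1)
  ultimately show ?thesis by (simp add: L2_fun_def power2_eq_square)
qed

section \<open>Weak gradients and the space H1\<close>

lemma has_weak_grad_unique:
  fixes D :: "'a::euclidean_space set"
  assumes D: "open D" "bounded D" and G: "G \<in> L2_fun (vol D)" "has_weak_grad D u G"
    and H: "H \<in> L2_fun (vol D)" "has_weak_grad D u H"
  shows "AE x in vol D. G x = H x"
proof -
  have "AE x in vol D. (G x - H x) \<bullet> i = 0" if i: "i \<in> Basis" for i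
  proof (rule AE_eq_0_if_test_fun_integrals_0[OF D(1)])
    have GH: "(\<lambda>x. G x - H x) \<in> L2_fun (vol D)" using G H by (intro L2_fun_diff)
    show "integrable (vol D) (\<lambda>x. (G x - H x) \<bullet> i)"
      using L2_fun_integrable(1)[OF finite_measure_vol[OF D] GH] by simp
    fix \<phi> assume \<phi>: "\<phi> \<in> test_fun D"
    have \<phi>i: "(\<lambda>x. \<phi> x *\<^sub>R i) \<in> L2_fun (vol D)"
      using test_fun_L2[OF D(1) \<phi>] i by (auto simp: L2_fun_def)
    have "(\<integral>x. (G x \<bullet> i) * \<phi> x \<partial>vol D) = (\<integral>x. (H x \<bullet> i) * \<phi> x \<partial>vol D)"
      using G(2) H(2) \<phi> i unfolding has_weak_grad_def by fastforce
    moreover have "integrable (vol D) (\<lambda>x. (G x \<bullet> i) * \<phi> x)" "integrable (vol D) (\<lambda>x. (H x \<bullet> i) * \<phi> x)"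
      using L2_fun_integrable_prod(2)[OF G(1) \<phi>i] L2_fun_integrable_prod(2)[OF H(1) \<phi>i]
      by (simp_all add: mult.commute)
    ultimately show "(\<integral>x. ((G x - H x) \<bullet> i) * \<phi> x \<partial>vol D) = 0"
      by (simp add: inner_diff_left left_diff_distrib)
  qed
  then have "AE x in vol D. \<forall>i\<in>Basis. (G x - H x) \<bullet> i = 0"
    by (intro AE_finite_allI) auto
  then show ?thesis
    by eventually_elim (metis euclidean_all_zero_iff eq_iff_diff_eq_0)
qed

lemma weak_grad_H1:
  assumes "u \<in> H1 D"
  shows "weak_grad D u \<in> L2_fun (vol D)" "has_weak_grad D u (weak_grad D u)" "u \<in> L2_fun (vol D)"
proof -
  have "\<exists>G. G \<in> L2_fun (vol D) \<and> has_weak_grad D u G" using assms by (auto simp: H1_def)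
  from someI_ex[OF this] show "weak_grad D u \<in> L2_fun (vol D)" "has_weak_grad D u (weak_grad D u)"
    unfolding weak_grad_def by auto
  show "u \<in> L2_fun (vol D)" using assms by (auto simp: H1_def)
qed

text \<open>\<open>weak_grad\<close> is an arbitrary choice among the weak gradients. Computing with
  it means exhibiting a candidate and passing to it almost everywhere by uniqueness.\<close>

lemma weak_grad_AE:
  assumes "open D" "bounded D" "u \<in> L2_fun (vol D)" "G \<in> L2_fun (vol D)" "has_weak_grad D u G"
  shows "u \<in> H1 D" "AE x in vol D. weak_grad D u x = G x"
    "L2_norm (vol D) (weak_grad D u) = L2_norm (vol D) G"
proof -
  show u: "u \<in> H1 D" using assms by (auto simp: H1_def)
  show ae: "AE x in vol D. weak_grad D u x = G x"
    using has_weak_grad_unique[OF assms(1,2) weak_grad_H1(1,2)[OF u] assms(4,5)] .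
  show "L2_norm (vol D) (weak_grad D u) = L2_norm (vol D) G"
    by (rule L2_norm_cong_AE[OF _ _ ae]) (use weak_grad_H1[OF u] assms(4) L2_funD in auto)
qed

lemma has_weak_grad_linear:
  assumes D: "open D" and u: "u \<in> L2_fun (vol D)" "G \<in> L2_fun (vol D)" "has_weak_grad D u G"
    and v: "v \<in> L2_fun (vol D)" "H \<in> L2_fun (vol D)" "has_weak_grad D v H"
  shows "has_weak_grad D (\<lambda>x. s * u x + t * v x) (\<lambda>x. s *\<^sub>R G x + t *\<^sub>R H x)"
  unfolding has_weak_grad_def
proof (intro ballI)
  fix \<phi> i assume \<phi>: "\<phi> \<in> test_fun D" and i: "(i::'a) \<in> Basis"
  have \<phi>i: "(\<lambda>x. \<phi> x *\<^sub>R i) \<in> L2_fun (vol D)" and \<partial>: "partial_deriv i \<phi> \<in> L2_fun (vol D)"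
    using test_fun_L2[OF D \<phi>] test_fun_L2[OF D test_fun_partial_deriv[OF \<phi> i]] i by (auto simp: L2_fun_def)
  have 1: "integrable (vol D) (\<lambda>x. (G x \<bullet> i) * \<phi> x)" "integrable (vol D) (\<lambda>x. (H x \<bullet> i) * \<phi> x)"
    using L2_fun_integrable_prod(2)[OF u(2) \<phi>i] L2_fun_integrable_prod(2)[OF v(2) \<phi>i]
    by (simp_all add: mult.commute)
  have 2: "integrable (vol D) (\<lambda>x. u x * partial_deriv i \<phi> x)" "integrable (vol D) (\<lambda>x. v x * partial_deriv i \<phi> x)"
    using L2_fun_integrable_prod(2)[OF u(1) \<partial>] L2_fun_integrable_prod(2)[OF v(1) \<partial>] by simp_all
  have e1: "(\<integral>x. (s * u x + t * v x) * partial_deriv i \<phi> x \<partial>vol D)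
      = s * (\<integral>x. u x * partial_deriv i \<phi> x \<partial>vol D) + t * (\<integral>x. v x * partial_deriv i \<phi> x \<partial>vol D)"
    using 2 by (simp add: distrib_right mult.assoc)
  have e2: "(\<integral>x. ((s *\<^sub>R G x + t *\<^sub>R H x) \<bullet> i) * \<phi> x \<partial>vol D)
      = s * (\<integral>x. (G x \<bullet> i) * \<phi> x \<partial>vol D) + t * (\<integral>x. (H x \<bullet> i) * \<phi> x \<partial>vol D)"
    using 1 by (simp add: inner_add_left distrib_right mult.assoc)
  show "(\<integral>x. (s * u x + t * v x) * partial_deriv i \<phi> x \<partial>vol D)
       = - (\<integral>x. ((s *\<^sub>R G x + t *\<^sub>R H x) \<bullet> i) * \<phi> x \<partial>vol D)"
    using u(3) v(3) \<phi> i unfolding e1 e2 has_weak_grad_def by simp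
qed

lemma H1_linear:
  assumes D: "open D" "bounded D" and u: "u \<in> H1 D" and v: "v \<in> H1 D"
  shows "(\<lambda>x. s * u x + t * v x) \<in> H1 D"
    "AE x in vol D. weak_grad D (\<lambda>x. s * u x + t * v x) x = s *\<^sub>R weak_grad D u x + t *\<^sub>R weak_grad D v x"
    "L2_norm (vol D) (weak_grad D (\<lambda>x. s * u x + t * v x)) = L2_norm (vol D) (\<lambda>x. s *\<^sub>R weak_grad D u x + t *\<^sub>R weak_grad D v x)"
proof -
  note U = weak_grad_H1[OF u] and V = weak_grad_H1[OF v]
  have 1: "(\<lambda>x. s * u x + t * v x) \<in> L2_fun (vol D)"
    using L2_fun_add(1)[OF L2_fun_scaleR(1)[OF U(3), of s] L2_fun_scaleR(1)[OF V(3), of t]] by simp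
  have 2: "(\<lambda>x. s *\<^sub>R weak_grad D u x + t *\<^sub>R weak_grad D v x) \<in> L2_fun (vol D)"
    using L2_fun_add(1)[OF L2_fun_scaleR(1)[OF U(1)] L2_fun_scaleR(1)[OF V(1)]] .
  note W = weak_grad_AE[OF D 1 2 has_weak_grad_linear[OF D(1) U(3,1,2) V(3,1,2)]]
  show "(\<lambda>x. s * u x + t * v x) \<in> H1 D"
    "AE x in vol D. weak_grad D (\<lambda>x. s * u x + t * v x) x = s *\<^sub>R weak_grad D u x + t *\<^sub>R weak_grad D v x"
    "L2_norm (vol D) (weak_grad D (\<lambda>x. s * u x + t * v x)) = L2_norm (vol D) (\<lambda>x. s *\<^sub>R weak_grad D u x + t *\<^sub>R weak_grad D v x)"
    by (fact W)+
qed

lemma H1_diff: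
  assumes D: "open D" "bounded D" and u: "u \<in> H1 D" and v: "v \<in> H1 D"
  shows "(\<lambda>x. u x - v x) \<in> H1 D"
    "AE x in vol D. weak_grad D (\<lambda>x. u x - v x) x = weak_grad D u x - weak_grad D v x"
    "L2_norm (vol D) (weak_grad D (\<lambda>x. u x - v x)) = L2_norm (vol D) (\<lambda>x. weak_grad D u x - weak_grad D v x)"
  using H1_linear[OF D u v, of 1 "-1"] by simp_all

lemma smooth_H1:
  assumes "open D" "bounded D" "smooth w"
  shows "w \<in> H1 D" "AE x in vol D. weak_grad D w x = grad w x"
    "L2_norm (vol D) (weak_grad D w) = L2_norm (vol D) (grad w)"
  using weak_grad_AE[OF assms(1,2) smooth_L2_fun_vol[OF assms] has_weak_grad_smooth[OF assms(1,3)]] by blast+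

lemma H1_norm_tendsto_0_iff:
  "(\<lambda>k. H1_norm D (w k)) \<longlonglongrightarrow> 0 \<longleftrightarrow>
   (\<lambda>k. L2_norm (vol D) (w k)) \<longlonglongrightarrow> 0 \<and> (\<lambda>k. L2_norm (vol D) (weak_grad D (w k))) \<longlonglongrightarrow> 0"
proof
  assume a: "(\<lambda>k. H1_norm D (w k)) \<longlonglongrightarrow> 0"
  have "L2_norm (vol D) (w k) \<le> H1_norm D (w k)" "L2_norm (vol D) (weak_grad D (w k)) \<le> H1_norm D (w k)" for k
    unfolding H1_norm_def by (auto intro!: real_le_rsqrt)
  then show "(\<lambda>k. L2_norm (vol D) (w k)) \<longlonglongrightarrow> 0 \<and> (\<lambda>k. L2_norm (vol D) (weak_grad D (w k))) \<longlonglongrightarrow> 0"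
    by (auto intro!: tendsto_sandwich[OF _ _ tendsto_const a] simp: L2_norm_nonneg)
next
  assume "(\<lambda>k. L2_norm (vol D) (w k)) \<longlonglongrightarrow> 0 \<and> (\<lambda>k. L2_norm (vol D) (weak_grad D (w k))) \<longlonglongrightarrow> 0"
  then have "(\<lambda>k. H1_norm D (w k)) \<longlonglongrightarrow> sqrt (0\<^sup>2 + 0\<^sup>2)"
    unfolding H1_norm_def by (intro tendsto_intros) auto
  then show "(\<lambda>k. H1_norm D (w k)) \<longlonglongrightarrow> 0" by simp
qed

text \<open>The weak gradient is a closed operator, because both sides of its defining identity are
  pairings with fixed square integrable functions.\<close>

lemma has_weak_grad_limit:
  assumes D: "open D" and u: "u \<in> L2_fun (vol D)" "\<And>k. uk k \<in> L2_fun (vol D)" "(\<lambda>k. L2_norm (vol D) (\<lambda>x. uk k x - u x)) \<longlonglongrightarrow> 0"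
    and G: "G \<in> L2_fun (vol D)" "\<And>k. Gk k \<in> L2_fun (vol D)" "(\<lambda>k. L2_norm (vol D) (\<lambda>x. Gk k x - G x)) \<longlonglongrightarrow> 0"
    and w: "\<And>k. has_weak_grad D (uk k) (Gk k)"
  shows "has_weak_grad D u G"
  unfolding has_weak_grad_def
proof (intro ballI)
  fix \<phi> i assume \<phi>: "\<phi> \<in> test_fun D" and i: "(i::'a) \<in> Basis"
  have \<phi>i: "(\<lambda>x. \<phi> x *\<^sub>R i) \<in> L2_fun (vol D)" and \<partial>: "partial_deriv i \<phi> \<in> L2_fun (vol D)"
    using test_fun_L2[OF D \<phi>] test_fun_L2[OF D test_fun_partial_deriv[OF \<phi> i]] i by (auto simp: L2_fun_def)
  have 1: "(\<lambda>k. \<integral>x. uk k x * partial_deriv i \<phi> x \<partial>vol D) \<longlonglongrightarrow> (\<integral>x. u x * partial_deriv i \<phi> x \<partial>vol D)"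
    using L2_inner_tendsto[OF u \<partial>] by simp
  have "(\<lambda>k. - (\<integral>x. (Gk k x \<bullet> i) * \<phi> x \<partial>vol D)) \<longlonglongrightarrow> - (\<integral>x. (G x \<bullet> i) * \<phi> x \<partial>vol D)"
    using tendsto_minus[OF L2_inner_tendsto[OF G \<phi>i]] by (simp add: mult.commute)
  moreover have "- (\<integral>x. (Gk k x \<bullet> i) * \<phi> x \<partial>vol D) = (\<integral>x. uk k x * partial_deriv i \<phi> x \<partial>vol D)" for k
    using w \<phi> i unfolding has_weak_grad_def by simp
  ultimately show "(\<integral>x. u x * partial_deriv i \<phi> x \<partial>vol D) = - (\<integral>x. (G x \<bullet> i) * \<phi> x \<partial>vol D)"
    using 1 LIMSEQ_unique by simp
qed

section \<open>The closure of the test functions and the Poincare inequality\<close>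

lemma H10D:
  assumes "u \<in> H10 D"
  shows "u \<in> H1 D" "\<exists>\<phi>. (\<forall>k. \<phi> k \<in> test_fun D) \<and> (\<lambda>k. H1_norm D (\<lambda>x. \<phi> k x - u x)) \<longlonglongrightarrow> 0"
  using assms by (auto simp: H10_def)

lemma test_fun_H10:
  assumes "open D" "bounded D" "\<phi> \<in> test_fun D"
  shows "\<phi> \<in> H10 D"
proof -
  have z: "(\<lambda>x. 0) \<in> L2_fun (vol D)" "(\<lambda>x. 0::'a) \<in> L2_fun (vol D)" by (rule L2_fun_zero)+
  have "has_weak_grad D (\<lambda>x. 0) (\<lambda>x. 0)" by (simp add: has_weak_grad_def)
  from weak_grad_AE(3)[OF assms(1,2) z this] have "H1_norm D (\<lambda>x. 0) = 0"
    by (simp add: H1_norm_def L2_norm_zero)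
  then show ?thesis using smooth_H1(1)[OF assms(1,2) test_funD(1)[OF assms(3)]] assms(3)
    unfolding H10_def by (auto intro!: exI[of _ "\<lambda>k. \<phi>"])
qed

lemma zero_H10:
  assumes "open D" "bounded D"
  shows "(\<lambda>x. 0) \<in> H10 D" "L2_norm (vol D) (weak_grad D (\<lambda>x. 0)) = 0"
proof -
  show "(\<lambda>x. 0) \<in> H10 D"
    by (rule test_fun_H10[OF assms], rule test_funI[of _ "{}"]) (auto simp: smooth_const)
  have z: "(\<lambda>x. 0) \<in> L2_fun (vol D)" "(\<lambda>x. 0::'a) \<in> L2_fun (vol D)" by (rule L2_fun_zero)+
  have "has_weak_grad D (\<lambda>x. 0) (\<lambda>x. 0)" by (simp add: has_weak_grad_def)
  from weak_grad_AE(3)[OF assms z this] show "L2_norm (vol D) (weak_grad D (\<lambda>x. 0)) = 0"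
    by (simp add: L2_norm_zero)
qed

lemma H1_norm_triangle:
  assumes D: "open D" "bounded D" and u: "u \<in> H1 D" and v: "v \<in> H1 D" and w: "w \<in> H1 D"
  shows "H1_norm D (\<lambda>x. u x - w x) \<le> H1_norm D (\<lambda>x. u x - v x) + H1_norm D (\<lambda>x. v x - w x)"
proof -
  note l = H1_diff(3)[OF D]
  have "sqrt ((a1 + a2)\<^sup>2 + (b1 + b2)\<^sup>2) \<le> sqrt (a1\<^sup>2 + b1\<^sup>2) + sqrt (a2\<^sup>2 + b2\<^sup>2)" for a1 a2 b1 b2 :: real
    by (rule real_sqrt_sum_squares_triangle_ineq)
  moreover have "H1_norm D (\<lambda>x. u x - w x) \<le> sqrt ((L2_norm (vol D) (\<lambda>x. u x - v x) + L2_norm (vol D) (\<lambda>x. v x - w x))\<^sup>2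
     + (L2_norm (vol D) (weak_grad D (\<lambda>x. u x - v x)) + L2_norm (vol D) (weak_grad D (\<lambda>x. v x - w x)))\<^sup>2)"
    unfolding H1_norm_def l[OF u w] l[OF u v] l[OF v w]
    using L2_norm_triangle[OF weak_grad_H1(3)[OF u] weak_grad_H1(3)[OF v] weak_grad_H1(3)[OF w]]
      L2_norm_triangle[OF weak_grad_H1(1)[OF u] weak_grad_H1(1)[OF v] weak_grad_H1(1)[OF w]]
    by (intro real_sqrt_le_mono add_mono power_mono) (auto simp: L2_norm_nonneg)
  ultimately show ?thesis unfolding H1_norm_def by (rule order_trans[rotated])
qed

lemma H1_norm_commute:
  assumes D: "open D" "bounded D" and u: "u \<in> H1 D" and v: "v \<in> H1 D"
  shows "H1_norm D (\<lambda>x. u x - v x) = H1_norm D (\<lambda>x. v x - u x)"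
  unfolding H1_norm_def H1_diff(3)[OF D u v] H1_diff(3)[OF D v u]
  using L2_norm_diff_commute[of "vol D" u v] L2_norm_diff_commute[of "vol D" "weak_grad D u" "weak_grad D v"] by simp

lemma H1_norm_nonneg: "H1_norm D u \<ge> 0"
  unfolding H1_norm_def by simp

text \<open>An approximant from \<open>H10 D\<close> is in turn approximated by test functions. The
  hypothesis asks for one approximant at each accuracy, which is the form in which the cutoff
  construction delivers them.\<close>

lemma H10_closed:
  assumes D: "open D" "bounded D" and u: "u \<in> H1 D"
    and approx: "\<And>e. e > 0 \<Longrightarrow> \<exists>v\<in>H10 D. H1_norm D (\<lambda>x. v x - u x) < e"
  shows "u \<in> H10 D"
proof -
  have "\<exists>\<phi>. \<phi> \<in> test_fun D \<and> H1_norm D (\<lambda>x. \<phi> x - u x) < 1 / real (Suc k)" for k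
  proof -
    obtain v where v: "v \<in> H10 D" "H1_norm D (\<lambda>x. v x - u x) < 1 / real (Suc k) / 2"
      using approx[of "1 / real (Suc k) / 2"] by auto
    obtain \<phi> where \<phi>: "\<And>k. \<phi> k \<in> test_fun D" "(\<lambda>k. H1_norm D (\<lambda>x. \<phi> k x - v x)) \<longlonglongrightarrow> 0"
      using H10D(2)[OF v(1)] by blast
    then obtain j where "H1_norm D (\<lambda>x. \<phi> j x - v x) < 1 / real (Suc k) / 2"
      using order_tendstoD(2)[OF \<phi>(2), of "1 / real (Suc k) / 2"] unfolding eventually_sequentially by auto
    moreover have "H1_norm D (\<lambda>x. \<phi> j x - u x) \<le> H1_norm D (\<lambda>x. \<phi> j x - v x) + H1_norm D (\<lambda>x. v x - u x)"
      using test_fun_H10[OF D \<phi>(1)] H10D(1) v u by (intro H1_norm_triangle[OF D]) auto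
    ultimately have "H1_norm D (\<lambda>x. \<phi> j x - u x) < 1 / real (Suc k)" using v by linarith
    then show ?thesis using \<phi>(1) by blast
  qed
  then obtain \<phi> where \<phi>: "\<And>k. \<phi> k \<in> test_fun D" "\<And>k. H1_norm D (\<lambda>x. \<phi> k x - u x) < 1 / real (Suc k)"
    by metis
  have "(\<lambda>k. H1_norm D (\<lambda>x. \<phi> k x - u x)) \<longlonglongrightarrow> 0"
    by (rule tendsto_sandwich[OF _ _ tendsto_const LIMSEQ_inverse_real_of_nat])
       (use \<phi>(2) in \<open>auto simp: H1_norm_nonneg inverse_eq_divide intro!: always_eventually less_imp_le\<close>)
  then show ?thesis using \<phi>(1) u by (auto simp: H10_def)
qed

lemma H10_linear:
  assumes D: "open D" "bounded D" and u: "u \<in> H10 D" and v: "v \<in> H10 D"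
  shows "(\<lambda>x. s * u x + t * v x) \<in> H10 D"
proof -
  have sc: "(\<lambda>x. s * u x) \<in> H10 D" if u: "u \<in> H10 D" for s u
  proof -
    obtain \<phi> where \<phi>: "\<And>k. \<phi> k \<in> test_fun D" "(\<lambda>k. H1_norm D (\<lambda>x. \<phi> k x - u x)) \<longlonglongrightarrow> 0"
      using H10D(2)[OF u] by blast
    have tf: "(\<lambda>x. s * \<phi> k x) \<in> test_fun D" for k using test_fun_mult[OF smooth_const \<phi>(1)] .
    have H: "(\<lambda>x. \<phi> k x - u x) \<in> H1 D" for k
      using H1_diff(1)[OF D] test_fun_H10[OF D \<phi>(1)] H10D(1) u by blast
    have "H1_norm D (\<lambda>x. s * \<phi> k x - s * u x) = \<bar>s\<bar> * H1_norm D (\<lambda>x. \<phi> k x - u x)" for k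
    proof -
      note h = H1_linear[OF D H[of k] H[of k], of s 0, simplified]
      have e: "(\<lambda>x. s * \<phi> k x - s * u x) = (\<lambda>x. s * (\<phi> k x - u x))" by (simp add: algebra_simps)
      have "H1_norm D (\<lambda>x. s * (\<phi> k x - u x)) = sqrt ((\<bar>s\<bar> * L2_norm (vol D) (\<lambda>x. \<phi> k x - u x))\<^sup>2
          + (\<bar>s\<bar> * L2_norm (vol D) (weak_grad D (\<lambda>x. \<phi> k x - u x)))\<^sup>2)"
        unfolding H1_norm_def h(3)
        using L2_fun_scaleR(2)[OF weak_grad_H1(3)[OF H], of s k] L2_fun_scaleR(2)[OF weak_grad_H1(1)[OF H], of s k] by simp
      also have "\<dots> = \<bar>s\<bar> * H1_norm D (\<lambda>x. \<phi> k x - u x)"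
        unfolding H1_norm_def by (simp add: power_mult_distrib real_sqrt_mult flip: distrib_left)
      finally show ?thesis unfolding e .
    qed
    then have "(\<lambda>k. H1_norm D (\<lambda>x. s * \<phi> k x - s * u x)) \<longlonglongrightarrow> 0"
      using tendsto_mult_right_zero[OF \<phi>(2), of "\<bar>s\<bar>"] by simp
    then show ?thesis
      using tf H1_linear(1)[OF D H10D(1)[OF u] H10D(1)[OF u], of s 0]
      unfolding H10_def by (auto intro!: exI[of _ "\<lambda>k x. s * \<phi> k x"])
  qed
  have ad: "(\<lambda>x. u x + v x) \<in> H10 D" if u: "u \<in> H10 D" and v: "v \<in> H10 D" for u v
  proof (rule H10_closed[OF D])
    show uv: "(\<lambda>x. u x + v x) \<in> H1 D" using H1_linear(1)[OF D H10D(1)[OF u] H10D(1)[OF v], of 1 1] by simp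
    obtain \<phi> where \<phi>: "\<And>k. \<phi> k \<in> test_fun D" "(\<lambda>k. H1_norm D (\<lambda>x. \<phi> k x - u x)) \<longlonglongrightarrow> 0"
      using H10D(2)[OF u] by blast
    obtain \<psi> where \<psi>: "\<And>k. \<psi> k \<in> test_fun D" "(\<lambda>k. H1_norm D (\<lambda>x. \<psi> k x - v x)) \<longlonglongrightarrow> 0"
      using H10D(2)[OF v] by blast
    fix e :: real assume e: "e > 0"
    have "\<forall>\<^sub>F k in sequentially. H1_norm D (\<lambda>x. \<phi> k x - u x) < e / 2 \<and> H1_norm D (\<lambda>x. \<psi> k x - v x) < e / 2"
      using order_tendstoD(2)[OF \<phi>(2), of "e/2"] order_tendstoD(2)[OF \<psi>(2), of "e/2"] e by (simp add: eventually_conj)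
    then obtain k where k: "H1_norm D (\<lambda>x. \<phi> k x - u x) < e / 2" "H1_norm D (\<lambda>x. \<psi> k x - v x) < e / 2"
      unfolding eventually_sequentially by auto
    have tf: "(\<lambda>x. \<phi> k x + \<psi> k x) \<in> test_fun D"
      using test_fun_diff[OF \<phi>(1)[of k] test_fun_mult[OF smooth_const[of "-1"] \<psi>(1)[of k]]] by simp
    have \<phi>H: "\<phi> k \<in> H1 D" and \<psi>H: "\<psi> k \<in> H1 D" using test_fun_H10[OF D] \<phi>(1) \<psi>(1) H10D(1) by blast+
    have m: "(\<lambda>x. u x + \<psi> k x) \<in> H1 D" using H1_linear(1)[OF D H10D(1)[OF u] \<psi>H, of 1 1] by simp
    have "H1_norm D (\<lambda>x. (\<phi> k x + \<psi> k x) - (u x + v x)) \<le>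
       H1_norm D (\<lambda>x. (\<phi> k x + \<psi> k x) - (u x + \<psi> k x)) + H1_norm D (\<lambda>x. (u x + \<psi> k x) - (u x + v x))"
      by (rule H1_norm_triangle[OF D H10D(1)[OF test_fun_H10[OF D tf]] m uv])
    also have "\<dots> < e" using k by simp
    finally show "\<exists>w\<in>H10 D. H1_norm D (\<lambda>x. w x - (u x + v x)) < e"
      using test_fun_H10[OF D tf] by (intro bexI[of _ "\<lambda>x. \<phi> k x + \<psi> k x"]) auto
  qed
  show ?thesis using ad[OF sc[OF u, of s] sc[OF v, of t]] .
qed

text \<open>Both norms converge along the approximating test functions. The inequality is what lets
  the gradient norm alone control functions of \<open>H10 D\<close>: increments summable in
  \<open>H10_norm\<close> are summable in L2.\<close>

lemma poincare_H10:
  fixes D :: "'a::euclidean_space set"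
  assumes D: "open D" "bounded D"
  obtains C where "C > 0" "\<And>u. u \<in> H10 D \<Longrightarrow> L2_norm (vol D) u \<le> C * L2_norm (vol D) (weak_grad D u)"
proof -
  obtain R where R: "R > 0" "\<And>x. x \<in> D \<Longrightarrow> norm x \<le> R"
    using D(2) unfolding bounded_pos by auto
  obtain i :: 'a where i: "i \<in> Basis" using nonempty_Basis by blast
  have t: "L2_norm (vol D) \<phi> \<le> 2 * R * L2_norm (vol D) (weak_grad D \<phi>)" if \<phi>: "\<phi> \<in> test_fun D" for \<phi>
  proof -
    note sm = test_funD(1)[OF \<phi>]
    have p: "L2_norm (vol D) (partial_deriv i \<phi>) \<le> L2_norm (vol D) (grad \<phi>)"
    proof (rule L2_fun_bound(2)[OF smooth_L2_fun_vol(2)[OF D sm]])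
      show "partial_deriv i \<phi> \<in> borel_measurable (vol D)"
        using smooth_L2_fun_vol(1)[OF D smooth_partial_deriv[OF sm i]] L2_funD by blast
      show "AE x in vol D. norm (partial_deriv i \<phi> x) \<le> norm (grad \<phi> x)"
        using Basis_le_norm[OF i, of "grad \<phi> _"] grad_inner_Basis[OF i, of \<phi>] by (intro AE_I2) simp
    qed
    have "(L2_norm (vol D) \<phi>)\<^sup>2 \<le> (2 * R * L2_norm (vol D) (partial_deriv i \<phi>))\<^sup>2"
      using poincare_test_fun[OF D(1) R \<phi> i] by (simp add: L2_norm_power2 power_mult_distrib)
    then have "L2_norm (vol D) \<phi> \<le> 2 * R * L2_norm (vol D) (partial_deriv i \<phi>)"
      by (rule power2_le_imp_le) (use R in \<open>auto simp: L2_norm_nonneg\<close>)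
    also have "\<dots> \<le> 2 * R * L2_norm (vol D) (grad \<phi>)" using p R by simp
    finally show ?thesis using smooth_H1(3)[OF D sm] by simp
  qed
  have "L2_norm (vol D) u \<le> 2 * R * L2_norm (vol D) (weak_grad D u)" if u: "u \<in> H10 D" for u
  proof -
    obtain \<phi> where \<phi>: "\<And>k. \<phi> k \<in> test_fun D" "(\<lambda>k. H1_norm D (\<lambda>x. \<phi> k x - u x)) \<longlonglongrightarrow> 0"
      using H10D(2)[OF u] by blast
    note uH = H10D(1)[OF u]
    have \<phi>H: "\<phi> k \<in> H1 D" for k using test_fun_H10[OF D \<phi>(1)] H10D(1) by blast
    have l: "(\<lambda>k. L2_norm (vol D) (\<lambda>x. \<phi> k x - u x)) \<longlonglongrightarrow> 0"
      "(\<lambda>k. L2_norm (vol D) (\<lambda>x. weak_grad D (\<phi> k) x - weak_grad D u x)) \<longlonglongrightarrow> 0"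
      using \<phi>(2) unfolding H1_norm_tendsto_0_iff H1_diff(3)[OF D \<phi>H uH] by auto
    have 1: "(\<lambda>k. L2_norm (vol D) (\<phi> k)) \<longlonglongrightarrow> L2_norm (vol D) u"
      using l \<phi>H uH by (intro L2_norm_tendsto) (auto intro: weak_grad_H1)
    have 2: "(\<lambda>k. L2_norm (vol D) (weak_grad D (\<phi> k))) \<longlonglongrightarrow> L2_norm (vol D) (weak_grad D u)"
      using l \<phi>H uH by (intro L2_norm_tendsto) (auto intro: weak_grad_H1)
    show ?thesis
      by (rule LIMSEQ_le[OF 1 tendsto_mult_left[OF 2]]) (use t \<phi>(1) in auto)
  qed
  then show ?thesis using that[of "2 * R"] R by auto
qed

subsection \<open>Smoothed positive parts\<close>

lemma L2_norm_dominated_tendsto_0: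
  fixes h :: "'a \<Rightarrow> 'b::euclidean_space"
  assumes h: "h \<in> L2_fun \<mu>" and c: "\<And>n. c n \<in> borel_measurable \<mu>" "\<And>n. AE x in \<mu>. \<bar>c n x\<bar> \<le> B"
    and lim: "AE x in \<mu>. h x \<noteq> 0 \<longrightarrow> (\<lambda>n. c n x) \<longlonglongrightarrow> 0"
  shows "(\<lambda>n. L2_norm \<mu> (\<lambda>x. c n x *\<^sub>R h x)) \<longlonglongrightarrow> 0"
proof -
  note [measurable] = L2_funD(1)[OF h] c(1)
  have "(\<lambda>n. \<integral>x. (norm (c n x *\<^sub>R h x))\<^sup>2 \<partial>\<mu>) \<longlonglongrightarrow> (\<integral>x. 0 \<partial>\<mu>)"
  proof (rule integral_dominated_convergence[where w = "\<lambda>x. B\<^sup>2 * (norm (h x))\<^sup>2"])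
    show "AE x in \<mu>. (\<lambda>n. (norm (c n x *\<^sub>R h x))\<^sup>2) \<longlonglongrightarrow> 0"
      using lim
    proof eventually_elim
      case (elim x)
      show ?case
      proof (cases "h x = 0")
        case False
        with elim have "(\<lambda>n. (norm (c n x *\<^sub>R h x))\<^sup>2) \<longlonglongrightarrow> (norm (0 *\<^sub>R h x))\<^sup>2"
          by (intro tendsto_intros) auto
        then show ?thesis by simp
      qed simp
    qed
    show "AE x in \<mu>. norm ((norm (c n x *\<^sub>R h x))\<^sup>2) \<le> B\<^sup>2 * (norm (h x))\<^sup>2" for n
      using c(2)[of n]
    proof eventually_elim
      case (elim x)
      have "(c n x)\<^sup>2 \<le> B\<^sup>2" using elim power_mono[of "\<bar>c n x\<bar>" B 2] by simp
      then show ?case by (simp add: power_mult_distrib mult_right_mono)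
    qed
  qed (use L2_funD(2)[OF h] in auto)
  then have "(\<lambda>n. sqrt (\<integral>x. (norm (c n x *\<^sub>R h x))\<^sup>2 \<partial>\<mu>)) \<longlonglongrightarrow> sqrt 0"
    by (intro tendsto_intros) simp
  then show ?thesis by (simp add: L2_norm_def)
qed

text \<open>For positive t this is t exp(-\<epsilon>/t), a smooth function between 0 and the
  positive part of t that vanishes at 0 with all its derivatives.\<close>

definition spos :: "real \<Rightarrow> real \<Rightarrow> real" where
  "spos \<epsilon> t = t * flat_exp 1 \<epsilon> t"

text \<open>For positive t this is (1 + \<epsilon>/t) exp(-\<epsilon>/t), which stays below 1
  because 1 + z \<le> exp z.\<close>

definition spos' :: "real \<Rightarrow> real \<Rightarrow> real" where
  "spos' \<epsilon> = flat_exp [:1, \<epsilon>:] \<epsilon>"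

lemma DERIV_spos:
  assumes "\<epsilon> > 0"
  shows "(spos \<epsilon> has_real_derivative spos' \<epsilon> t) (at t)"
proof -
  have "flat_deriv \<epsilon> 1 = [:0, 0, \<epsilon>:]" by (simp add: flat_deriv_def one_pCons)
  moreover have "((\<lambda>t. t * flat_exp 1 \<epsilon> t) has_real_derivative (1 * flat_exp 1 \<epsilon> t + flat_exp (flat_deriv \<epsilon> 1) \<epsilon> t * t)) (at t)"
    by (rule DERIV_mult[OF DERIV_ident DERIV_flat_exp[OF assms]])
  moreover have "1 * flat_exp 1 \<epsilon> t + flat_exp [:0, 0, \<epsilon>:] \<epsilon> t * t = spos' \<epsilon> t"
    by (simp add: spos'_def flat_exp_def algebra_simps)
  ultimately show ?thesis unfolding spos_def[abs_def] by simp
qed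

lemma smooth_spos:
  assumes "\<epsilon> > 0" "smooth \<phi>"
  shows "smooth (\<lambda>x. spos \<epsilon> (\<phi> x))"
proof -
  define F where "F n = (case n of 0 \<Rightarrow> spos \<epsilon> | Suc m \<Rightarrow> flat_exp ((flat_deriv \<epsilon> ^^ m) [:1, \<epsilon>:]) \<epsilon>)" for n
  have "smooth (\<lambda>x. F 0 (\<phi> x))"
  proof (rule smooth_compose[OF _ assms(2)])
    show "(F n has_real_derivative F (Suc n) t) (at t)" for n t
      using DERIV_spos[OF assms(1), of t] DERIV_flat_exp[OF assms(1)]
      by (cases n) (auto simp: F_def spos'_def)
  qed
  then show ?thesis by (simp add: F_def)
qed

lemma spos_bounds:
  assumes "\<epsilon> > 0"
  shows "0 \<le> spos \<epsilon> t" "spos \<epsilon> t \<le> max 0 t" "0 \<le> spos' \<epsilon> t" "spos' \<epsilon> t \<le> 1"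
proof -
  show "0 \<le> spos \<epsilon> t" "spos \<epsilon> t \<le> max 0 t" "0 \<le> spos' \<epsilon> t"
    using assms by (auto simp: spos_def spos'_def flat_exp_def mult_left_le)
  show "spos' \<epsilon> t \<le> 1"
  proof (cases "t > 0")
    case True
    have "1 + \<epsilon> / t \<le> exp (\<epsilon> / t)" by (rule exp_ge_add_one_self)
    then have "(1 + \<epsilon> / t) * exp (- (\<epsilon> / t)) \<le> exp (\<epsilon> / t) * exp (- (\<epsilon> / t))"
      by (intro mult_right_mono) auto
    then show ?thesis using True by (simp add: spos'_def flat_exp_def exp_minus)
  qed (simp add: spos'_def flat_exp_def)
qed

lemma abs_spos_diff_le:
  assumes "\<epsilon> > 0"
  shows "\<bar>spos \<epsilon> s - spos \<epsilon> t\<bar> \<le> \<bar>s - t\<bar>"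
  using field_differentiable_bound[where S = UNIV and f = "spos \<epsilon>" and f' = "spos' \<epsilon>" and B = 1 and x = t and y = s]
    DERIV_spos[OF assms] spos_bounds[OF assms] by auto

text \<open>In z = \<epsilon>/t the second derivative of \<open>spos \<epsilon>\<close> is z^3
  exp(-z)/\<epsilon>, and z^3 \<le> 27 exp z is the cube of z/3 \<le> exp(z/3).\<close>

lemma abs_spos'_diff_le:
  assumes \<epsilon>: "\<epsilon> > 0"
  shows "\<bar>spos' \<epsilon> s - spos' \<epsilon> t\<bar> \<le> 27 / \<epsilon> * \<bar>s - t\<bar>"
proof -
  define q where "q = flat_exp (flat_deriv \<epsilon> [:1, \<epsilon>:]) \<epsilon>"
  have d: "(spos' \<epsilon> has_real_derivative q t) (at t)" for t
    unfolding spos'_def q_def by (rule DERIV_flat_exp[OF \<epsilon>])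
  have "\<bar>q t\<bar> \<le> 27 / \<epsilon>" for t
  proof (cases "t > 0")
    case True
    define z where "z = \<epsilon> / t"
    have z: "z > 0" using True \<epsilon> by (simp add: z_def)
    have "z / 3 \<le> exp (z / 3)" using exp_ge_add_one_self[of "z / 3"] by linarith
    then have "(z / 3) ^ 3 \<le> exp (z / 3) ^ 3" using z by (intro power_mono) auto
    also have "\<dots> = exp z" by (simp flip: exp_of_nat_mult)
    finally have "z ^ 3 \<le> 27 * exp z" by (simp add: power_divide)
    then have "z ^ 3 * exp (- z) \<le> 27 * exp z * exp (- z)" by (intro mult_right_mono) auto
    also have "27 * exp z * exp (- z) = 27" by (simp add: exp_minus)
    finally have *: "z ^ 3 * exp (- z) \<le> 27" .
    have "flat_deriv \<epsilon> [:1, \<epsilon>:] = [:0, 0, 0, \<epsilon>\<^sup>2:]"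
      by (simp add: flat_deriv_def pderiv_pCons power2_eq_square)
    then have "q t = (\<epsilon>\<^sup>2 * (1 / t) ^ 3) * exp (- z)"
      using True by (simp add: q_def flat_exp_def z_def power3_eq_cube)
    also have "\<dots> = z ^ 3 * exp (- z) / \<epsilon>"
      using \<epsilon> True by (simp add: z_def power3_eq_cube power2_eq_square)
    finally have "q t = z ^ 3 * exp (- z) / \<epsilon>" .
    moreover have "0 \<le> z ^ 3 * exp (- z)" using z by simp
    ultimately show ?thesis using * \<epsilon> by (simp add: divide_right_mono)
  qed (use \<epsilon> in \<open>simp add: q_def flat_exp_def\<close>)
  then show ?thesis
    using field_differentiable_bound[where S = UNIV and f = "spos' \<epsilon>" and f' = q and B = "27 / \<epsilon>" and x = s and y = t] d
    by auto
qed

lemma spos_tendsto: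
  "(\<lambda>n. flat_exp 1 (1 / real (Suc n)) t) \<longlonglongrightarrow> (if t > 0 then 1 else 0)"
  "(\<lambda>n. spos' (1 / real (Suc n)) t) \<longlonglongrightarrow> (if t > 0 then 1 else 0)"
proof -
  have "(\<lambda>n. exp (- (inverse (real (Suc n)) / t))) \<longlonglongrightarrow> exp (- (0 / t))" if "t > 0"
    by (intro tendsto_intros LIMSEQ_inverse_real_of_nat) (use that in auto)
  then show "(\<lambda>n. flat_exp 1 (1 / real (Suc n)) t) \<longlonglongrightarrow> (if t > 0 then 1 else 0)"
    by (auto simp: flat_exp_def inverse_eq_divide)
  have "(\<lambda>n. (1 + inverse (real (Suc n)) / t) * exp (- (inverse (real (Suc n)) / t))) \<longlonglongrightarrow> (1 + 0 / t) * exp (- (0 / t))" if "t > 0"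
    by (intro tendsto_intros LIMSEQ_inverse_real_of_nat) (use that in auto)
  then show "(\<lambda>n. spos' (1 / real (Suc n)) t) \<longlonglongrightarrow> (if t > 0 then 1 else 0)"
    by (auto simp: spos'_def flat_exp_def inverse_eq_divide field_simps)
qed

lemma spos_measurable [measurable]:
  assumes "\<epsilon> > 0"
  shows "spos \<epsilon> \<in> borel_measurable borel" "spos' \<epsilon> \<in> borel_measurable borel"
    "flat_exp p \<epsilon> \<in> borel_measurable borel"
proof -
  have f: "flat_exp p \<epsilon> \<in> borel_measurable borel" for p
    using DERIV_flat_exp[OF assms, of p] DERIV_isCont
    by (intro borel_measurable_continuous_onI continuous_at_imp_continuous_on) blast
  then show "spos \<epsilon> \<in> borel_measurable borel" "spos' \<epsilon> \<in> borel_measurable borel"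
    "flat_exp p \<epsilon> \<in> borel_measurable borel"
    unfolding spos_def[abs_def] spos'_def by auto
qed

lemma spos_L2:
  assumes \<epsilon>: "\<epsilon> > 0" and u: "u \<in> L2_fun \<mu>"
  shows "(\<lambda>x. spos \<epsilon> (u x)) \<in> L2_fun \<mu>"
proof (rule L2_fun_bound(1)[OF u])
  show "(\<lambda>x. spos \<epsilon> (u x)) \<in> borel_measurable \<mu>"
    using spos_measurable(1)[OF \<epsilon>] L2_funD(1)[OF u] by simp
  have "\<bar>spos \<epsilon> t\<bar> \<le> \<bar>t\<bar>" for t using spos_bounds(1,2)[OF \<epsilon>, of t] by auto
  then show "AE x in \<mu>. norm (spos \<epsilon> (u x)) \<le> norm (u x)" by simp
qed

lemma spos'_L2:
  fixes G :: "'a \<Rightarrow> 'b::euclidean_space"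
  assumes \<epsilon>: "\<epsilon> > 0" and u: "u \<in> borel_measurable \<mu>" and G: "G \<in> L2_fun \<mu>"
  shows "(\<lambda>x. spos' \<epsilon> (u x) *\<^sub>R G x) \<in> L2_fun \<mu>" "L2_norm \<mu> (\<lambda>x. spos' \<epsilon> (u x) *\<^sub>R G x) \<le> L2_norm \<mu> G"
  using L2_fun_mult_bounded[OF G, of "\<lambda>x. spos' \<epsilon> (u x)" 1] spos_measurable(2)[OF \<epsilon>] u spos_bounds(3,4)[OF \<epsilon>]
  by auto

text \<open>The delicate term is the difference of the values of \<open>spos' \<epsilon>\<close>
  times a fixed \<open>G\<close> that need not be bounded. Where \<open>G\<close> has norm at most
  n, the Lipschitz bound is multiplied by n; where the norm exceeds n, the difference is at most 1
  and the contribution is the tail \<open>T n\<close>.\<close>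

lemma spos_L2_continuous:
  fixes G :: "'a \<Rightarrow> 'b::euclidean_space"
  assumes \<epsilon>: "\<epsilon> > 0" and u: "u \<in> L2_fun \<mu>" "\<And>k. uk k \<in> L2_fun \<mu>" "(\<lambda>k. L2_norm \<mu> (\<lambda>x. uk k x - u x)) \<longlonglongrightarrow> 0"
    and G: "G \<in> L2_fun \<mu>" "\<And>k. Gk k \<in> L2_fun \<mu>" "(\<lambda>k. L2_norm \<mu> (\<lambda>x. Gk k x - G x)) \<longlonglongrightarrow> 0"
  shows "(\<lambda>k. L2_norm \<mu> (\<lambda>x. spos \<epsilon> (uk k x) - spos \<epsilon> (u x))) \<longlonglongrightarrow> 0"
    and "(\<lambda>k. L2_norm \<mu> (\<lambda>x. spos' \<epsilon> (uk k x) *\<^sub>R Gk k x - spos' \<epsilon> (u x) *\<^sub>R G x)) \<longlonglongrightarrow> 0"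
proof -
  note m[measurable] = L2_funD(1)[OF u(1)] L2_funD(1)[OF u(2)] L2_funD(1)[OF G(1)] L2_funD(1)[OF G(2)] spos_measurable(1,2)[OF \<epsilon>]
  have du: "(\<lambda>x. uk k x - u x) \<in> L2_fun \<mu>" for k using L2_fun_diff(1)[OF u(2) u(1)] .
  have "L2_norm \<mu> (\<lambda>x. spos \<epsilon> (uk k x) - spos \<epsilon> (u x)) \<le> L2_norm \<mu> (\<lambda>x. uk k x - u x)" for k
    by (rule L2_fun_bound(2)[OF du]) (use abs_spos_diff_le[OF \<epsilon>] in auto)
  then show "(\<lambda>k. L2_norm \<mu> (\<lambda>x. spos \<epsilon> (uk k x) - spos \<epsilon> (u x))) \<longlonglongrightarrow> 0"
    by (intro tendsto_sandwich[OF _ _ tendsto_const u(3)]) (auto simp: L2_norm_nonneg)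
  define T where "T n = L2_norm \<mu> (\<lambda>x. indicator {x. norm (G x) > real n} x *\<^sub>R G x)" for n
  have T: "T \<longlonglongrightarrow> 0" unfolding T_def
  proof (rule L2_norm_dominated_tendsto_0[OF G(1), where B = 1])
    show "AE x in \<mu>. G x \<noteq> 0 \<longrightarrow> (\<lambda>n. indicator {x. real n < norm (G x)} x :: real) \<longlonglongrightarrow> 0"
    proof (intro AE_I2 impI tendsto_eventually)
      fix x
      obtain N where N: "norm (G x) < real N" using reals_Archimedean2 by blast
      show "\<forall>\<^sub>F n in sequentially. indicator {x. real n < norm (G x)} x = (0::real)"
        by (rule eventually_sequentiallyI[of N]) (use N in auto)
    qed
  qed auto
  have key: "L2_norm \<mu> (\<lambda>x. spos' \<epsilon> (uk k x) *\<^sub>R Gk k x - spos' \<epsilon> (u x) *\<^sub>R G x)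
      \<le> L2_norm \<mu> (\<lambda>x. Gk k x - G x) + (27 / \<epsilon> * real n * L2_norm \<mu> (\<lambda>x. uk k x - u x) + T n)" for k n
  proof -
    have a: "(\<lambda>x. spos' \<epsilon> (uk k x) *\<^sub>R (Gk k x - G x)) \<in> L2_fun \<mu>"
      "L2_norm \<mu> (\<lambda>x. spos' \<epsilon> (uk k x) *\<^sub>R (Gk k x - G x)) \<le> L2_norm \<mu> (\<lambda>x. Gk k x - G x)"
      using spos'_L2[OF \<epsilon> m(2) L2_fun_diff(1)[OF G(2) G(1)]] by auto
    have tn: "(\<lambda>x. norm (indicator {x. norm (G x) > real n} x *\<^sub>R G x)) \<in> L2_fun \<mu>"
      by (rule L2_fun_bound(1)[OF G(1)]) (auto simp: indicator_def)
    have su: "(\<lambda>x. (27 / \<epsilon> * real n) *\<^sub>R \<bar>uk k x - u x\<bar>) \<in> L2_fun \<mu>"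
      using du[of k] by (intro L2_fun_scaleR(1) L2_fun_bound(1)[OF du[of k]]) auto
    have sm: "(\<lambda>x. (27 / \<epsilon> * real n) *\<^sub>R \<bar>uk k x - u x\<bar> + norm (indicator {x. norm (G x) > real n} x *\<^sub>R G x)) \<in> L2_fun \<mu>"
      by (rule L2_fun_add(1)[OF su tn])
    have pw: "norm ((spos' \<epsilon> (uk k x) - spos' \<epsilon> (u x)) *\<^sub>R G x)
        \<le> norm ((27 / \<epsilon> * real n) *\<^sub>R \<bar>uk k x - u x\<bar> + norm (indicator {x. norm (G x) > real n} x *\<^sub>R G x))" for x
    proof -
      have "\<bar>spos' \<epsilon> (uk k x) - spos' \<epsilon> (u x)\<bar> * norm (G x)
        \<le> (27 / \<epsilon> * real n) * \<bar>uk k x - u x\<bar> + norm (indicator {x. norm (G x) > real n} x *\<^sub>R G x)"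
      proof (cases "norm (G x) > real n")
        case True
        have "\<bar>spos' \<epsilon> (uk k x) - spos' \<epsilon> (u x)\<bar> \<le> 1"
          using spos_bounds(3,4)[OF \<epsilon>, of "uk k x"] spos_bounds(3,4)[OF \<epsilon>, of "u x"] by auto
        then have "\<bar>spos' \<epsilon> (uk k x) - spos' \<epsilon> (u x)\<bar> * norm (G x) \<le> 1 * norm (G x)" by (intro mult_right_mono) auto
        moreover have "0 \<le> (27 / \<epsilon> * real n) * \<bar>uk k x - u x\<bar>" using \<epsilon> by simp
        ultimately show ?thesis using True by simp
      next
        case False
        then have "\<bar>spos' \<epsilon> (uk k x) - spos' \<epsilon> (u x)\<bar> * norm (G x) \<le> (27 / \<epsilon> * \<bar>uk k x - u x\<bar>) * real n"
          using abs_spos'_diff_le[OF \<epsilon>, of "uk k x" "u x"] \<epsilon> by (intro mult_mono) auto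
        then show ?thesis using False by (simp add: mult_ac)
      qed
      then show ?thesis by (simp add: abs_of_nonneg)
    qed
    have b: "(\<lambda>x. (spos' \<epsilon> (uk k x) - spos' \<epsilon> (u x)) *\<^sub>R G x) \<in> L2_fun \<mu>"
      "L2_norm \<mu> (\<lambda>x. (spos' \<epsilon> (uk k x) - spos' \<epsilon> (u x)) *\<^sub>R G x) \<le> 27 / \<epsilon> * real n * L2_norm \<mu> (\<lambda>x. uk k x - u x) + T n"
    proof -
      have mm: "(\<lambda>x. (spos' \<epsilon> (uk k x) - spos' \<epsilon> (u x)) *\<^sub>R G x) \<in> borel_measurable \<mu>" by measurable
      note B = L2_fun_bound[OF sm mm AE_I2[OF pw]]
      show "(\<lambda>x. (spos' \<epsilon> (uk k x) - spos' \<epsilon> (u x)) *\<^sub>R G x) \<in> L2_fun \<mu>" by (rule B(1))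
      have "L2_norm \<mu> (\<lambda>x. (spos' \<epsilon> (uk k x) - spos' \<epsilon> (u x)) *\<^sub>R G x) \<le>
         L2_norm \<mu> (\<lambda>x. (27 / \<epsilon> * real n) *\<^sub>R \<bar>uk k x - u x\<bar>) + L2_norm \<mu> (\<lambda>x. norm (indicator {x. norm (G x) > real n} x *\<^sub>R G x))"
        using B(2) L2_fun_add(2)[OF su tn] by linarith
      also have "L2_norm \<mu> (\<lambda>x. (27 / \<epsilon> * real n) *\<^sub>R \<bar>uk k x - u x\<bar>) = 27 / \<epsilon> * real n * L2_norm \<mu> (\<lambda>x. uk k x - u x)"
      proof -
        have "(\<lambda>x. \<bar>uk k x - u x\<bar>) \<in> L2_fun \<mu>" by (rule L2_fun_bound(1)[OF du[of k]]) auto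
        from L2_fun_scaleR(2)[OF this, of "27 / \<epsilon> * real n"] L2_norm_norm[of \<mu> "\<lambda>x. uk k x - u x"]
        show ?thesis using \<epsilon> by simp
      qed
      finally show "L2_norm \<mu> (\<lambda>x. (spos' \<epsilon> (uk k x) - spos' \<epsilon> (u x)) *\<^sub>R G x) \<le> 27 / \<epsilon> * real n * L2_norm \<mu> (\<lambda>x. uk k x - u x) + T n"
        unfolding T_def L2_norm_norm .
    qed
    have "(\<lambda>x. spos' \<epsilon> (uk k x) *\<^sub>R Gk k x - spos' \<epsilon> (u x) *\<^sub>R G x)
      = (\<lambda>x. spos' \<epsilon> (uk k x) *\<^sub>R (Gk k x - G x) + (spos' \<epsilon> (uk k x) - spos' \<epsilon> (u x)) *\<^sub>R G x)"
      by (simp add: algebra_simps)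
    then show ?thesis using L2_fun_add(2)[OF a(1) b(1)] a(2) b(2) by simp
  qed
  show "(\<lambda>k. L2_norm \<mu> (\<lambda>x. spos' \<epsilon> (uk k x) *\<^sub>R Gk k x - spos' \<epsilon> (u x) *\<^sub>R G x)) \<longlonglongrightarrow> 0"
  proof (rule order_tendstoI)
    fix e :: real assume e: "0 < e"
    \<comment> \<open>The truncation level is fixed before k grows, since the Lipschitz part carries
      the factor n.\<close>
    obtain n where n: "T n < e / 2"
      using order_tendstoD(2)[OF T, of "e / 2"] e unfolding eventually_sequentially by auto
    have "(\<lambda>k. L2_norm \<mu> (\<lambda>x. Gk k x - G x) + (27 / \<epsilon> * real n * L2_norm \<mu> (\<lambda>x. uk k x - u x) + T n)) \<longlonglongrightarrow> 0 + (27 / \<epsilon> * real n * 0 + T n)"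
      by (intro tendsto_intros u G)
    then have "\<forall>\<^sub>F k in sequentially. L2_norm \<mu> (\<lambda>x. Gk k x - G x) + (27 / \<epsilon> * real n * L2_norm \<mu> (\<lambda>x. uk k x - u x) + T n) < e"
      by (rule order_tendstoD(2)) (use n e in auto)
    then show "\<forall>\<^sub>F k in sequentially. L2_norm \<mu> (\<lambda>x. spos' \<epsilon> (uk k x) *\<^sub>R Gk k x - spos' \<epsilon> (u x) *\<^sub>R G x) < e"
      by eventually_elim (rule le_less_trans[OF key])
  qed (auto intro!: always_eventually less_le_trans[OF _ L2_norm_nonneg])
qed

text \<open>The class on which the chain rule is obtained by density. A function with
  \<open>has_trace\<close> belongs to it through the same approximating sequence.\<close>

definition smooth_closure :: "'a::euclidean_space set \<Rightarrow> ('a \<Rightarrow> real) set" where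
  "smooth_closure D = {u \<in> H1 D. \<exists>\<phi>. (\<forall>k. smooth (\<phi> k)) \<and> (\<lambda>k. H1_norm D (\<lambda>x. \<phi> k x - u x)) \<longlonglongrightarrow> 0}"

text \<open>The classical chain rule for the smooth approximants survives the limit, since functions
  and gradients both converge in L2 and the weak gradient is closed.\<close>

lemma spos_smooth_closure:
  assumes D: "open D" "bounded D" and \<epsilon>: "\<epsilon> > 0" and u: "u \<in> smooth_closure D"
  shows "(\<lambda>x. spos \<epsilon> (u x)) \<in> H1 D"
    "AE x in vol D. weak_grad D (\<lambda>x. spos \<epsilon> (u x)) x = spos' \<epsilon> (u x) *\<^sub>R weak_grad D u x"
proof -
  obtain \<phi> where \<phi>: "\<And>k. smooth (\<phi> k)" "(\<lambda>k. H1_norm D (\<lambda>x. \<phi> k x - u x)) \<longlonglongrightarrow> 0"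
    using u unfolding smooth_closure_def by blast
  have uH: "u \<in> H1 D" using u by (simp add: smooth_closure_def)
  note U = weak_grad_H1[OF uH]
  note \<phi>H = smooth_H1[OF D \<phi>(1)]
  have l: "(\<lambda>k. L2_norm (vol D) (\<lambda>x. \<phi> k x - u x)) \<longlonglongrightarrow> 0"
    "(\<lambda>k. L2_norm (vol D) (\<lambda>x. weak_grad D (\<phi> k) x - weak_grad D u x)) \<longlonglongrightarrow> 0"
    using \<phi>(2) unfolding H1_norm_tendsto_0_iff H1_diff(3)[OF D \<phi>H(1) uH] by auto
  have e: "L2_norm (vol D) (\<lambda>x. weak_grad D (\<phi> k) x - weak_grad D u x) = L2_norm (vol D) (\<lambda>x. grad (\<phi> k) x - weak_grad D u x)" for k
    using \<phi>H(2)[of k] L2_funD(1)[OF U(1)] L2_funD(1)[OF weak_grad_H1(1)[OF \<phi>H(1)[of k]]]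
      L2_funD(1)[OF smooth_L2_fun_vol(2)[OF D \<phi>(1)[of k]]]
    by (intro L2_norm_cong_AE) auto
  note c = spos_L2_continuous[OF \<epsilon> U(3) smooth_L2_fun_vol(1)[OF D \<phi>(1)] l(1) U(1) smooth_L2_fun_vol(2)[OF D \<phi>(1)] l(2)[unfolded e]]
  have g: "grad (\<lambda>x. spos \<epsilon> (\<phi> k x)) x = spos' \<epsilon> (\<phi> k x) *\<^sub>R grad (\<phi> k) x" for k x
    by (rule grad_compose[OF \<phi>(1) DERIV_spos[OF \<epsilon>]])
  have L: "(\<lambda>x. spos \<epsilon> (u x)) \<in> L2_fun (vol D)" "(\<lambda>x. spos' \<epsilon> (u x) *\<^sub>R weak_grad D u x) \<in> L2_fun (vol D)"
    using spos_L2[OF \<epsilon> U(3)] spos'_L2(1)[OF \<epsilon> L2_funD(1)[OF U(3)] U(1)] .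
  have w: "has_weak_grad D (\<lambda>x. spos \<epsilon> (u x)) (\<lambda>x. spos' \<epsilon> (u x) *\<^sub>R weak_grad D u x)"
  proof (rule has_weak_grad_limit[OF D(1) L(1) _ c(1) L(2) _ c(2)])
    note s = smooth_spos[OF \<epsilon> \<phi>(1)]
    show "(\<lambda>x. spos \<epsilon> (\<phi> k x)) \<in> L2_fun (vol D)" for k using smooth_L2_fun_vol(1)[OF D s] .
    show "(\<lambda>x. spos' \<epsilon> (\<phi> k x) *\<^sub>R grad (\<phi> k) x) \<in> L2_fun (vol D)" for k
      using smooth_L2_fun_vol(2)[OF D s[of k]] unfolding g[abs_def] .
    show "has_weak_grad D (\<lambda>x. spos \<epsilon> (\<phi> k x)) (\<lambda>x. spos' \<epsilon> (\<phi> k x) *\<^sub>R grad (\<phi> k) x)" for k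
      using has_weak_grad_smooth[OF D(1) s[of k]] unfolding g[abs_def] .
  qed
  show "(\<lambda>x. spos \<epsilon> (u x)) \<in> H1 D"
    "AE x in vol D. weak_grad D (\<lambda>x. spos \<epsilon> (u x)) x = spos' \<epsilon> (u x) *\<^sub>R weak_grad D u x"
    using weak_grad_AE[OF D L w] by blast+
qed

lemma smooth_in_smooth_closure:
  assumes "open D" "bounded D" "smooth \<phi>"
  shows "\<phi> \<in> smooth_closure D"
proof -
  have "H1_norm D (\<lambda>x. 0) = 0" using zero_H10(2)[OF assms(1,2)] by (simp add: H1_norm_def L2_norm_zero)
  then show ?thesis
    using assms smooth_H1(1)[OF assms] unfolding smooth_closure_def by (auto intro!: exI[of _ "\<lambda>k. \<phi>"])
qed

text \<open>Continuity of this nonlinear map carries approximants over: the smooth ones of the trace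
  condition in x, and the simple ones of strong measurability in \<omega>.\<close>

lemma spos_H1_continuous:
  assumes D: "open D" "bounded D" and \<epsilon>: "\<epsilon> > 0" and u: "u \<in> smooth_closure D" "\<And>k. uk k \<in> smooth_closure D"
    and lim: "(\<lambda>k. H1_norm D (\<lambda>x. uk k x - u x)) \<longlonglongrightarrow> 0"
  shows "(\<lambda>k. H1_norm D (\<lambda>x. spos \<epsilon> (uk k x) - spos \<epsilon> (u x))) \<longlonglongrightarrow> 0"
proof -
  have uH: "u \<in> H1 D" and ukH: "uk k \<in> H1 D" for k using u by (auto simp: smooth_closure_def)
  note U = weak_grad_H1[OF uH] and Uk = weak_grad_H1[OF ukH]
  have l: "(\<lambda>k. L2_norm (vol D) (\<lambda>x. uk k x - u x)) \<longlonglongrightarrow> 0"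
    "(\<lambda>k. L2_norm (vol D) (\<lambda>x. weak_grad D (uk k) x - weak_grad D u x)) \<longlonglongrightarrow> 0"
    using lim unfolding H1_norm_tendsto_0_iff H1_diff(3)[OF D ukH uH] by auto
  note c = spos_L2_continuous[OF \<epsilon> U(3) Uk(3) l(1) U(1) Uk(1) l(2)]
  note s = spos_smooth_closure[OF D \<epsilon> u(1)] and sk = spos_smooth_closure[OF D \<epsilon> u(2)]
  have "L2_norm (vol D) (weak_grad D (\<lambda>x. spos \<epsilon> (uk k x) - spos \<epsilon> (u x)))
     = L2_norm (vol D) (\<lambda>x. spos' \<epsilon> (uk k x) *\<^sub>R weak_grad D (uk k) x - spos' \<epsilon> (u x) *\<^sub>R weak_grad D u x)" for k
    unfolding H1_diff(3)[OF D sk(1) s(1)]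
  proof (rule L2_norm_cong_AE)
    show "AE x in vol D. weak_grad D (\<lambda>x. spos \<epsilon> (uk k x)) x - weak_grad D (\<lambda>x. spos \<epsilon> (u x)) x
      = spos' \<epsilon> (uk k x) *\<^sub>R weak_grad D (uk k) x - spos' \<epsilon> (u x) *\<^sub>R weak_grad D u x"
      using s(2) sk(2)[of k] by eventually_elim simp
    show "(\<lambda>x. weak_grad D (\<lambda>x. spos \<epsilon> (uk k x)) x - weak_grad D (\<lambda>x. spos \<epsilon> (u x)) x) \<in> borel_measurable (vol D)"
      using L2_funD(1)[OF weak_grad_H1(1)[OF s(1)]] L2_funD(1)[OF weak_grad_H1(1)[OF sk(1)[of k]]] by simp
    show "(\<lambda>x. spos' \<epsilon> (uk k x) *\<^sub>R weak_grad D (uk k) x - spos' \<epsilon> (u x) *\<^sub>R weak_grad D u x) \<in> borel_measurable (vol D)"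
      using L2_funD(1)[OF spos'_L2(1)[OF \<epsilon> L2_funD(1)[OF U(3)] U(1)]]
        L2_funD(1)[OF spos'_L2(1)[OF \<epsilon> L2_funD(1)[OF Uk(3)[of k]] Uk(1)[of k]]] by simp
  qed
  then show ?thesis unfolding H1_norm_tendsto_0_iff using c by simp
qed

text \<open>Passing to the limit in \<open>spos \<epsilon>\<close> only after the chain rule is established avoids having to know that
  the gradient of \<open>u\<close> vanishes almost everywhere on the set where \<open>u\<close> does.\<close>

lemma pos_part_smooth_closure:
  assumes D: "open D" "bounded D" and u: "u \<in> smooth_closure D"
  shows "(\<lambda>x. max 0 (u x)) \<in> H1 D"
    "(\<lambda>n. H1_norm D (\<lambda>x. spos (1 / real (Suc n)) (u x) - max 0 (u x))) \<longlonglongrightarrow> 0"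
    "L2_norm (vol D) (weak_grad D (\<lambda>x. max 0 (u x))) \<le> L2_norm (vol D) (weak_grad D u)"
proof -
  have uH: "u \<in> H1 D" using u by (simp add: smooth_closure_def)
  note U = weak_grad_H1[OF uH]
  note [measurable] = L2_funD(1)[OF U(1)] L2_funD(1)[OF U(3)]
  let ?e = "\<lambda>n. 1 / real (Suc n)"
  have e: "?e n > 0" for n by simp
  note [measurable] = spos_measurable[OF e]
  note s = spos_smooth_closure[OF D e u]
  \<comment> \<open>The strict inequality matches the pointwise limit of \<open>spos'\<close>, which
    is 0 at t = 0.\<close>
  define G where "G x = (if u x > 0 then 1 else 0) *\<^sub>R weak_grad D u x" for x
  have Gm [measurable]: "G \<in> borel_measurable (vol D)" unfolding G_def by measurable
  have GL: "G \<in> L2_fun (vol D)" "L2_norm (vol D) G \<le> L2_norm (vol D) (weak_grad D u)"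
    by (rule L2_fun_bound[OF U(1) Gm], auto simp: G_def)+
  have PL: "(\<lambda>x. max 0 (u x)) \<in> L2_fun (vol D)"
    by (rule L2_fun_bound(1)[OF U(3)]) auto
  have 1: "(\<lambda>n. L2_norm (vol D) (\<lambda>x. spos (?e n) (u x) - max 0 (u x))) \<longlonglongrightarrow> 0"
  proof -
    have "(\<lambda>n. L2_norm (vol D) (\<lambda>x. (flat_exp 1 (?e n) (u x) - (if u x > 0 then 1 else 0)) *\<^sub>R u x)) \<longlonglongrightarrow> 0"
    proof (rule L2_norm_dominated_tendsto_0[OF U(3), where B = 1])
      show "AE x in vol D. u x \<noteq> 0 \<longrightarrow> (\<lambda>n. flat_exp 1 (?e n) (u x) - (if 0 < u x then 1 else 0)) \<longlonglongrightarrow> 0"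
        using LIM_zero[OF spos_tendsto(1)] by auto
      show "AE x in vol D. \<bar>flat_exp 1 (?e n) (u x) - (if 0 < u x then 1 else 0)\<bar> \<le> 1" for n
      proof (rule AE_I2)
        fix x
        show "\<bar>flat_exp 1 (?e n) (u x) - (if 0 < u x then 1 else 0)\<bar> \<le> 1"
          using flat_exp_1_bounds[OF e[of n], of "u x"] by auto
      qed
    qed measurable
    moreover have "spos (?e n) t - max 0 t = (flat_exp 1 (?e n) t - (if t > 0 then 1 else 0)) *\<^sub>R t" for n t
      by (auto simp: spos_def flat_exp_def algebra_simps)
    ultimately show ?thesis by simp
  qed
  have 2: "(\<lambda>n. L2_norm (vol D) (\<lambda>x. spos' (?e n) (u x) *\<^sub>R weak_grad D u x - G x)) \<longlonglongrightarrow> 0"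
  proof -
    have "(\<lambda>n. L2_norm (vol D) (\<lambda>x. (spos' (?e n) (u x) - (if u x > 0 then 1 else 0)) *\<^sub>R weak_grad D u x)) \<longlonglongrightarrow> 0"
    proof (rule L2_norm_dominated_tendsto_0[OF U(1), where B = 1])
      show "AE x in vol D. weak_grad D u x \<noteq> 0 \<longrightarrow> (\<lambda>n. spos' (?e n) (u x) - (if 0 < u x then 1 else 0)) \<longlonglongrightarrow> 0"
        using LIM_zero[OF spos_tendsto(2)] by auto
      show "AE x in vol D. \<bar>spos' (?e n) (u x) - (if 0 < u x then 1 else 0)\<bar> \<le> 1" for n
      proof (rule AE_I2)
        fix x
        show "\<bar>spos' (?e n) (u x) - (if 0 < u x then 1 else 0)\<bar> \<le> 1"
          using spos_bounds(3,4)[OF e[of n], of "u x"] by auto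
      qed
    qed measurable
    then show ?thesis unfolding G_def by (simp add: scaleR_left_diff_distrib)
  qed
  have sL: "(\<lambda>x. spos (?e n) (u x)) \<in> L2_fun (vol D)" "(\<lambda>x. spos' (?e n) (u x) *\<^sub>R weak_grad D u x) \<in> L2_fun (vol D)" for n
    using spos_L2[OF e U(3)] spos'_L2(1)[OF e L2_funD(1)[OF U(3)] U(1)] by auto
  have ae: "AE x in vol D. weak_grad D (\<lambda>x. spos (?e n) (u x)) x = spos' (?e n) (u x) *\<^sub>R weak_grad D u x" for n
    by (rule s(2))
  have e2: "L2_norm (vol D) (\<lambda>x. weak_grad D (\<lambda>x. spos (?e n) (u x)) x - F x)
      = L2_norm (vol D) (\<lambda>x. spos' (?e n) (u x) *\<^sub>R weak_grad D u x - F x)" if "F \<in> L2_fun (vol D)" for n F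
  proof (rule L2_norm_cong_AE)
    show "(\<lambda>x. weak_grad D (\<lambda>x. spos (?e n) (u x)) x - F x) \<in> borel_measurable (vol D)"
      "(\<lambda>x. spos' (?e n) (u x) *\<^sub>R weak_grad D u x - F x) \<in> borel_measurable (vol D)"
      using L2_funD(1)[OF weak_grad_H1(1)[OF s(1)[of n]]] L2_funD(1)[OF that] L2_funD(1)[OF sL(2)[of n]] by auto
    show "AE x in vol D. weak_grad D (\<lambda>x. spos (?e n) (u x)) x - F x = spos' (?e n) (u x) *\<^sub>R weak_grad D u x - F x"
      using ae[of n] by eventually_elim simp
  qed
  have w: "has_weak_grad D (\<lambda>x. max 0 (u x)) G"
    by (rule has_weak_grad_limit[OF D(1) PL sL(1) 1 GL(1) weak_grad_H1(1)[OF s(1)] _ weak_grad_H1(2)[OF s(1)]])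
       (use 2 e2[OF GL(1)] in simp)
  note W = weak_grad_AE[OF D PL GL(1) w]
  show PH: "(\<lambda>x. max 0 (u x)) \<in> H1 D" by (rule W(1))
  show "L2_norm (vol D) (weak_grad D (\<lambda>x. max 0 (u x))) \<le> L2_norm (vol D) (weak_grad D u)"
    using W(3) GL(2) by simp
  have "L2_norm (vol D) (weak_grad D (\<lambda>x. spos (?e n) (u x) - max 0 (u x)))
    = L2_norm (vol D) (\<lambda>x. spos' (?e n) (u x) *\<^sub>R weak_grad D u x - G x)" for n
  proof -
    have "L2_norm (vol D) (\<lambda>x. spos' (?e n) (u x) *\<^sub>R weak_grad D u x - weak_grad D (\<lambda>x. max 0 (u x)) x)
      = L2_norm (vol D) (\<lambda>x. spos' (?e n) (u x) *\<^sub>R weak_grad D u x - G x)"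
    proof (rule L2_norm_cong_AE)
      show "AE x in vol D. spos' (?e n) (u x) *\<^sub>R weak_grad D u x - weak_grad D (\<lambda>x. max 0 (u x)) x
          = spos' (?e n) (u x) *\<^sub>R weak_grad D u x - G x" using W(2) by eventually_elim simp
    qed (use L2_funD(1)[OF weak_grad_H1(1)[OF PH]] L2_funD(1)[OF sL(2)[of n]] in auto)
    then show ?thesis unfolding H1_diff(3)[OF D s(1) PH] e2[OF weak_grad_H1(1)[OF PH]] .
  qed
  then show "(\<lambda>n. H1_norm D (\<lambda>x. spos (?e n) (u x) - max 0 (u x))) \<longlonglongrightarrow> 0"
    unfolding H1_norm_tendsto_0_iff using 1 2 by simp
qed

section \<open>Boundary estimates on Lipschitz domains\<close>

lemma surface_measure_nn_integral:
  fixes D :: "'a::euclidean_space set"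
  shows "(\<integral>\<^sup>+x. f x \<partial>surface_measure D) = (\<integral>\<^sup>+x. f x * indicator (frontier D) x \<partial>hausdorff_measure (DIM('a) - 1))"
  unfolding surface_measure_def by (rule nn_integral_restrict_space) (simp add: frontier_closed)

text \<open>The increment along the segment is bounded by the fundamental theorem of calculus and
  Cauchy-Schwarz. The split a^2 \<le> 2 b^2 + 2 (b - a)^2 is the inequality (2b - a)^2 \<ge>
  0.\<close>

lemma power2_le_along_segment:
  fixes \<psi> :: "'a::euclidean_space \<Rightarrow> real"
  assumes \<psi>: "smooth \<psi>" and \<nu>: "norm \<nu> = 1" and h: "0 \<le> h" "h \<le> \<delta>"
  shows "ennreal ((\<psi> x)\<^sup>2) \<le> ennreal (2 * (\<psi> (x + h *\<^sub>R \<nu>))\<^sup>2)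
     + ennreal (2 * \<delta>) * (\<integral>\<^sup>+t. ennreal ((norm (grad \<psi> (x + t *\<^sub>R \<nu>)))\<^sup>2) * indicator {0..<h} t \<partial>lborel)"
proof -
  let ?g = "\<lambda>t. grad \<psi> (x + t *\<^sub>R \<nu>)"
  let ?f = "\<lambda>t. ?g t \<bullet> \<nu>"
  let ?\<mu> = "restrict_space lborel {0..h}"
  have cg: "continuous_on S ?g" for S
    by (intro continuous_on_compose2[OF continuous_on_grad[OF \<psi>, of UNIV]] continuous_intros) auto
  then have cf: "continuous_on S ?f" for S by (intro continuous_intros)
  have FTC: "(\<integral>t. indicator {0..h} t *\<^sub>R ?f t \<partial>lborel) = \<psi> (x + h *\<^sub>R \<nu>) - \<psi> (x + 0 *\<^sub>R \<nu>)"
    by (rule integral_FTC_atLeastAtMost[OF h(1) _ cf])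
       (use DERIV_along_line[OF \<psi>] in \<open>auto simp: has_real_derivative_iff_has_vector_derivative intro: has_vector_derivative_at_within\<close>)
  have fm: "finite_measure ?\<mu>"
    by (rule finite_measureI) (use h in \<open>simp add: emeasure_restrict_space space_restrict_space\<close>)
  have gm: "(\<lambda>t. norm (?g t)) \<in> borel_measurable borel" "?f \<in> borel_measurable borel"
    using cg[of UNIV] cf[of UNIV] by (auto intro!: borel_measurable_continuous_onI continuous_intros)
  have int: "integrable ?\<mu> (\<lambda>t. (norm (?g t))\<^sup>2)"
    using borel_integrable_compact[of "{0..h}" "\<lambda>t. (norm (?g t))\<^sup>2"] cg
    by (simp add: integrable_restrict_space continuous_intros)
  have fL: "?f \<in> L2_fun ?\<mu>"
  proof (rule L2_fun_bound(1))
    show "(\<lambda>t. norm (?g t)) \<in> L2_fun ?\<mu>" using int gm by (simp add: L2_fun_def measurable_restrict_space1)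
    show "?f \<in> borel_measurable ?\<mu>" using gm by (simp add: measurable_restrict_space1)
    show "AE t in ?\<mu>. norm (?f t) \<le> norm (norm (?g t))"
      using Cauchy_Schwarz_ineq2[of "?g _" \<nu>] \<nu> by simp
  qed
  have "\<bar>\<psi> (x + h *\<^sub>R \<nu>) - \<psi> x\<bar> = \<bar>\<integral>t. ?f t \<partial>?\<mu>\<bar>"
    using FTC by (simp add: integral_restrict_space)
  also have "\<dots> \<le> (\<integral>t. norm (?f t) \<partial>?\<mu>)" using integral_abs_bound[of ?\<mu> ?f] by simp
  also have "\<dots> \<le> sqrt (measure ?\<mu> (space ?\<mu>)) * L2_norm ?\<mu> ?f" by (rule L2_fun_integrable(2)[OF fm fL])
  also have "measure ?\<mu> (space ?\<mu>) = h"
    using h by (simp add: measure_restrict_space space_restrict_space)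
  finally have "(\<psi> (x + h *\<^sub>R \<nu>) - \<psi> x)\<^sup>2 \<le> (sqrt h * L2_norm ?\<mu> ?f)\<^sup>2"
    using power_mono[of "\<bar>\<psi> (x + h *\<^sub>R \<nu>) - \<psi> x\<bar>" "sqrt h * L2_norm ?\<mu> ?f" 2] by simp
  also have "\<dots> = h * (\<integral>t. (norm (?f t))\<^sup>2 \<partial>?\<mu>)"
    using h by (simp add: power_mult_distrib L2_norm_power2)
  also have "\<dots> \<le> \<delta> * (\<integral>t. (norm (?g t))\<^sup>2 \<partial>?\<mu>)"
  proof (rule mult_mono)
    show "(\<integral>t. (norm (?f t))\<^sup>2 \<partial>?\<mu>) \<le> (\<integral>t. (norm (?g t))\<^sup>2 \<partial>?\<mu>)"
    proof (rule integral_mono[OF L2_funD(2)[OF fL] int])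
      fix t show "(norm (?f t))\<^sup>2 \<le> (norm (?g t))\<^sup>2"
        using Cauchy_Schwarz_ineq2[of "?g t" \<nu>] \<nu> power_mono[of "\<bar>?f t\<bar>" "norm (?g t)" 2] by simp
    qed
  qed (use h in auto)
  finally have d: "(\<psi> (x + h *\<^sub>R \<nu>) - \<psi> x)\<^sup>2 \<le> \<delta> * (\<integral>t. (norm (?g t))\<^sup>2 \<partial>?\<mu>)" .
  have "(\<psi> x)\<^sup>2 \<le> 2 * (\<psi> (x + h *\<^sub>R \<nu>))\<^sup>2 + 2 * (\<psi> (x + h *\<^sub>R \<nu>) - \<psi> x)\<^sup>2"
    using sum_power2_ge_zero[of "2 * \<psi> (x + h *\<^sub>R \<nu>) - \<psi> x" 0] by (simp add: power2_eq_square algebra_simps)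
  then have "(\<psi> x)\<^sup>2 \<le> 2 * (\<psi> (x + h *\<^sub>R \<nu>))\<^sup>2 + 2 * \<delta> * (\<integral>t. (norm (?g t))\<^sup>2 \<partial>?\<mu>)"
    using d by linarith
  then have "ennreal ((\<psi> x)\<^sup>2) \<le> ennreal (2 * (\<psi> (x + h *\<^sub>R \<nu>))\<^sup>2 + 2 * \<delta> * (\<integral>t. (norm (?g t))\<^sup>2 \<partial>?\<mu>))"
    by (rule ennreal_leI)
  also have "\<dots> = ennreal (2 * (\<psi> (x + h *\<^sub>R \<nu>))\<^sup>2) + ennreal (2 * \<delta>) * ennreal (\<integral>t. (norm (?g t))\<^sup>2 \<partial>?\<mu>)"
    using h by (subst ennreal_plus) (auto simp: ennreal_mult intro!: mult_nonneg_nonneg)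
  also have "ennreal (\<integral>t. (norm (?g t))\<^sup>2 \<partial>?\<mu>) = (\<integral>\<^sup>+t. ennreal ((norm (?g t))\<^sup>2) \<partial>?\<mu>)"
    using int by (simp add: nn_integral_eq_integral)
  also have "\<dots> = (\<integral>\<^sup>+t. ennreal ((norm (?g t))\<^sup>2) * indicator {0..h} t \<partial>lborel)"
    by (rule nn_integral_restrict_space) simp
  \<comment> \<open>The end point is dropped because it will lie on the boundary, outside the collar
    to which the gradient term is to be confined.\<close>
  also have "\<dots> = (\<integral>\<^sup>+t. ennreal ((norm (?g t))\<^sup>2) * indicator {0..<h} t \<partial>lborel)"
  proof (rule nn_integral_cong_AE)
    have "AE t in lborel. t \<noteq> h" by (rule AE_lborel_singleton)
    then show "AE t in lborel. ennreal ((norm (?g t))\<^sup>2) * indicator {0..h} t = ennreal ((norm (?g t))\<^sup>2) * indicator {0..<h} t"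
      by eventually_elim (auto simp: indicator_def)
  qed
  finally show ?thesis .
qed

text \<open>Tonelli and translation invariance: integrals along parallel segments of length
  \<delta>, integrated over space, amount to \<delta> times one volume integral. One of the two
  factors \<delta> before the gradient term of the collar estimate arises here, the other from
  Cauchy-Schwarz on the segments.\<close>

lemma nn_integral_translate_average:
  fixes F :: "'a::euclidean_space \<Rightarrow> ennreal"
  assumes F: "F \<in> borel_measurable borel" and \<delta>: "\<delta> \<ge> 0"
  shows "(\<integral>\<^sup>+x. (\<integral>\<^sup>+t. F (x + t *\<^sub>R \<nu>) * indicator {0..\<delta>} t \<partial>lborel) \<partial>lborel) = ennreal \<delta> * (\<integral>\<^sup>+x. F x \<partial>lborel)"
proof -
  have [measurable]: "F \<in> borel_measurable borel" by fact
  have "(\<integral>\<^sup>+x. (\<integral>\<^sup>+t. F (x + t *\<^sub>R \<nu>) * indicator {0..\<delta>} t \<partial>lborel) \<partial>lborel)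
      = (\<integral>\<^sup>+t. (\<integral>\<^sup>+x. F (x + t *\<^sub>R \<nu>) * indicator {0..\<delta>} t \<partial>lborel) \<partial>lborel)"
    by (rule lborel_pair.Fubini'[symmetric]) measurable
  also have "\<dots> = (\<integral>\<^sup>+t. (\<integral>\<^sup>+x. F x \<partial>lborel) * indicator {0..\<delta>} t \<partial>lborel)"
  proof (rule nn_integral_cong)
    fix t :: real
    have e: "(lborel::'a measure) = distr lborel borel (\<lambda>x. x + t *\<^sub>R \<nu>)"
      using lborel_distr_plus[of "t *\<^sub>R \<nu>"] by (simp add: add.commute[of _ "t *\<^sub>R \<nu>"])
    have "(\<integral>\<^sup>+x. F (x + t *\<^sub>R \<nu>) \<partial>lborel) = (\<integral>\<^sup>+x. F x \<partial>lborel)"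
      by (subst (2) e) (simp add: nn_integral_distr)
    then show "(\<integral>\<^sup>+x. F (x + t *\<^sub>R \<nu>) * indicator {0..\<delta>} t \<partial>lborel) = (\<integral>\<^sup>+x. F x \<partial>lborel) * indicator {0..\<delta>} t"
      by (subst nn_integral_multc) auto
  qed
  also have "\<dots> = (\<integral>\<^sup>+x. F x \<partial>lborel) * ennreal \<delta>"
    using \<delta> by (simp add: nn_integral_cmult_indicator)
  finally show ?thesis by (simp add: mult.commute)
qed

definition collar :: "'a::euclidean_space set \<Rightarrow> real \<Rightarrow> 'a set" where
  "collar D \<delta> = {x \<in> D. infdist x (- D) < \<delta>}"

lemma collar_measurable: "open D \<Longrightarrow> collar D \<delta> \<in> sets borel"
proof -
  assume "open D"
  moreover have "open {x. infdist x (- D) < \<delta>}"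
    by (intro open_Collect_less continuous_intros)
  moreover have "collar D \<delta> = D \<inter> {x. infdist x (- D) < \<delta>}" by (auto simp: collar_def)
  ultimately show ?thesis by auto
qed

lemma collar_mono: "\<delta> \<le> \<delta>' \<Longrightarrow> collar D \<delta> \<subseteq> collar D \<delta>'"
  by (auto simp: collar_def)

text \<open>On a graph domain every point near the boundary is joined to a boundary point by a segment in the
  direction of the graph. The squares of the boundary values are controlled by
  the strip bound, the increments along the segments by the gradient.\<close>

lemma collar_estimate_chart:
  fixes D :: "'a::euclidean_space set"
  assumes D: "open D" "D \<noteq> UNIV" and \<nu>: "norm \<nu> = 1" and r: "0 < r" and \<gamma>: "L-lipschitz_on {y. y \<bullet> \<nu> = 0} \<gamma>"
    and chart: "D \<inter> ball p r = {x \<in> ball p r. x \<bullet> \<nu> < \<gamma> (x - (x \<bullet> \<nu>) *\<^sub>R \<nu>)}"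
  shows "\<exists>K>0. \<exists>\<rho>>0. \<exists>\<delta>0>0. \<forall>\<psi> \<delta>. smooth \<psi> \<longrightarrow> 0 < \<delta> \<longrightarrow> \<delta> < \<delta>0 \<longrightarrow>
    (\<integral>\<^sup>+x. ennreal ((\<psi> x)\<^sup>2) * indicator (collar D \<delta> \<inter> ball p \<rho>) x \<partial>lborel)
      \<le> ennreal (K * \<delta>) * (\<integral>\<^sup>+x. ennreal ((\<psi> x)\<^sup>2) \<partial>surface_measure D)
       + ennreal (K * \<delta>\<^sup>2) * (\<integral>\<^sup>+x. ennreal ((norm (grad \<psi> x))\<^sup>2) * indicator (collar D (K * \<delta>)) x \<partial>lborel)"
proof -
  \<comment> \<open>The height of the graph above x in the direction \<nu>. Inside the ball, D is
    the set where it is positive.\<close>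
  define h where "h x = \<gamma> (x - (x \<bullet> \<nu>) *\<^sub>R \<nu>) - x \<bullet> \<nu>" for x
  have \<nu>\<nu>: "\<nu> \<bullet> \<nu> = 1" using \<nu> by (simp add: norm_eq_1)
  have L: "L \<ge> 0" using \<gamma> lipschitz_on_nonneg by blast
  \<comment> \<open>The height has Lipschitz constant 2L + 1: the projection orthogonal to \<nu> is
    bounded crudely by 2, and x \<bullet> \<nu> contributes 1. One further unit makes the later
    bound by H \<delta> strict.\<close>
  define H where "H = 2 * L + 2"
  have hL: "\<bar>h x - h y\<bar> \<le> (H - 1) * norm (x - y)" for x y
  proof -
    have on: "x - (x \<bullet> \<nu>) *\<^sub>R \<nu> \<in> {y. y \<bullet> \<nu> = 0}" for x using \<nu>\<nu> by (simp add: inner_diff_left)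
    have n: "\<bar>(x - y) \<bullet> \<nu>\<bar> \<le> norm (x - y)" using Cauchy_Schwarz_ineq2[of "x - y" \<nu>] \<nu> by simp
    have "norm ((x - (x \<bullet> \<nu>) *\<^sub>R \<nu>) - (y - (y \<bullet> \<nu>) *\<^sub>R \<nu>)) = norm ((x - y) - ((x - y) \<bullet> \<nu>) *\<^sub>R \<nu>)"
      by (simp add: inner_diff_left algebra_simps)
    also have "\<dots> \<le> norm (x - y) + norm (((x - y) \<bullet> \<nu>) *\<^sub>R \<nu>)" by (rule norm_triangle_ineq4)
    also have "\<dots> \<le> 2 * norm (x - y)" using n \<nu> by simp
    finally have "L * norm ((x - (x \<bullet> \<nu>) *\<^sub>R \<nu>) - (y - (y \<bullet> \<nu>) *\<^sub>R \<nu>)) \<le> L * (2 * norm (x - y))"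
      using L by (rule mult_left_mono)
    then have "\<bar>\<gamma> (x - (x \<bullet> \<nu>) *\<^sub>R \<nu>) - \<gamma> (y - (y \<bullet> \<nu>) *\<^sub>R \<nu>)\<bar> \<le> 2 * L * norm (x - y)"
      using lipschitz_onD[OF \<gamma> on on, of x y] by (simp add: dist_norm)
    moreover have "(H - 1) * norm (x - y) = 2 * L * norm (x - y) + norm (x - y)" by (simp add: H_def algebra_simps)
    ultimately show ?thesis using n unfolding h_def by (simp add: inner_diff_left)
  qed
  have hc: "continuous_on UNIV h"
  proof -
    have "(H - 1)-lipschitz_on UNIV h" using hL L by (intro lipschitz_onI) (auto simp: dist_norm H_def)
    then show ?thesis by (rule lipschitz_on_continuous_on)
  qed
  have hm [measurable]: "h \<in> borel_measurable borel" using hc by (rule borel_measurable_continuous_onI)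
  have ht: "h (x + t *\<^sub>R \<nu>) = h x - t" for x t
    using \<nu>\<nu> by (simp add: h_def inner_add_left algebra_simps)
  have inD: "x \<in> D \<longleftrightarrow> h x > 0" if "x \<in> ball p r" for x
    using chart that unfolding h_def by (auto simp: set_eq_iff)
  define \<tau> where "\<tau> x = x + h x *\<^sub>R \<nu>" for x
  have \<tau>m [measurable]: "\<tau> \<in> borel_measurable borel" unfolding \<tau>_def by measurable
  have h\<tau>: "h (\<tau> x) = 0" for x by (simp add: \<tau>_def ht)
  \<comment> \<open>The half radius leaves room for segments of length at most r/2 inside the ball
    where the chart is valid.\<close>
  define R where "R \<delta> = {x \<in> ball p (r / 2). 0 < h x \<and> h x < \<delta>}" for \<delta>
  have Rm [measurable]: "R \<delta> \<in> sets borel" for \<delta>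
  proof -
    have "R \<delta> = ball p (r / 2) \<inter> {x. 0 < h x} \<inter> {x. h x < \<delta>}" by (auto simp: R_def)
    moreover have "open {x. 0 < h x}" "open {x. h x < \<delta>}"
      using hc by (auto intro!: open_Collect_less continuous_intros)
    ultimately show ?thesis by auto
  qed
  have seg: "x + t *\<^sub>R \<nu> \<in> ball p r" if "x \<in> R \<delta>" "\<delta> \<le> r / 2" "0 \<le> t" "t \<le> h x" for x t \<delta>
  proof -
    have "norm (p - (x + t *\<^sub>R \<nu>)) \<le> norm (p - x) + norm (t *\<^sub>R \<nu>)"
      using norm_triangle_ineq4[of "p - x" "t *\<^sub>R \<nu>"] by (simp add: algebra_simps)
    also have "\<dots> < r / 2 + r / 2" using that \<nu> by (intro add_less_le_mono) (auto simp: R_def dist_norm)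
    finally show ?thesis by (simp add: dist_norm)
  qed
  have fr: "\<tau> x \<in> frontier D" if x: "x \<in> R \<delta>" "\<delta> \<le> r / 2" for x \<delta>
  proof -
    have b: "\<tau> x \<in> ball p r" unfolding \<tau>_def using seg[OF x, of "h x"] x by (auto simp: R_def)
    then have "\<tau> x \<notin> D" using inD h\<tau> by auto
    moreover have "\<tau> x \<in> closure D"
    proof (rule closure_approachable[THEN iffD2], intro allI impI)
      fix e :: real assume e: "0 < e"
      define s where "s = max 0 (h x - e / 2)"
      have s: "0 \<le> s" "s < h x" "h x - s < e" using e x by (auto simp: s_def R_def)
      have "x + s *\<^sub>R \<nu> \<in> D" using inD[OF seg[OF x, of s]] s ht[of x s] by simp
      moreover have "dist (x + s *\<^sub>R \<nu>) (\<tau> x) = \<bar>s - h x\<bar>"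
        using \<nu> by (simp add: dist_norm \<tau>_def flip: scaleR_diff_left)
      ultimately show "\<exists>y\<in>D. dist y (\<tau> x) < e" using s by (intro bexI[of _ "x + s *\<^sub>R \<nu>"]) auto
    qed
    ultimately show ?thesis using D(1) by (simp add: frontier_def interior_open)
  qed
  have col: "x + t *\<^sub>R \<nu> \<in> collar D \<delta>" if x: "x \<in> R \<delta>" "\<delta> \<le> r / 2" and t: "0 \<le> t" "t < h x" for x t \<delta>
  proof -
    have "x + t *\<^sub>R \<nu> \<in> D" using inD[OF seg[OF x]] t ht[of x t] by simp
    moreover have "\<tau> x \<in> - D"
      using fr[OF x] D(1) by (simp add: frontier_def interior_open)
    then have "infdist (x + t *\<^sub>R \<nu>) (- D) \<le> dist (x + t *\<^sub>R \<nu>) (\<tau> x)" by (rule infdist_le)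
    moreover have "dist (x + t *\<^sub>R \<nu>) (\<tau> x) = \<bar>t - h x\<bar>"
      using \<nu> by (simp add: dist_norm \<tau>_def flip: scaleR_diff_left)
    ultimately show ?thesis using x t by (auto simp: collar_def R_def)
  qed
  define c where "c = strip_const TYPE('a)"
  have c: "c > 0" unfolding c_def by (rule strip_const_pos)
  \<comment> \<open>The image of volume on the strip \<open>R \<delta>\<close> under the landing map
    \<open>\<tau>\<close> is compared with c \<delta> times the surface measure. The strip bound
    holds set by set, hence between the measures, hence for integrals.\<close>
  have bdry: "(\<integral>\<^sup>+x. ennreal ((\<psi> (\<tau> x))\<^sup>2) * indicator (R \<delta>) x \<partial>lborel) \<le> ennreal (c * \<delta>) * (\<integral>\<^sup>+x. ennreal ((\<psi> x)\<^sup>2) \<partial>surface_measure D)"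
    if \<delta>: "0 < \<delta>" "\<delta> \<le> r / 2" and \<psi>: "smooth \<psi>" for \<delta> \<psi>
  proof -
    have [measurable]: "\<psi> \<in> borel_measurable borel"
      using smooth_continuous_on[OF \<psi>] by (rule borel_measurable_continuous_onI)
    define \<mu>1 where "\<mu>1 = distr (restrict_space lborel (R \<delta>)) borel \<tau>"
    define \<mu>2 where "\<mu>2 = density (hausdorff_measure (DIM('a) - 1)) (\<lambda>x::'a. ennreal (c * \<delta>) * indicator (frontier D) x)"
    have tr: "\<tau> \<in> measurable (restrict_space lborel (R \<delta>)) borel" by (simp add: measurable_restrict_space1)
    have frm: "(\<lambda>x::'a. ennreal (c * \<delta>) * indicator (frontier D) x) \<in> borel_measurable (hausdorff_measure (DIM('a) - 1))"
      by (intro borel_measurable_times_ennreal borel_measurable_const borel_measurable_indicator) (simp add: frontier_closed)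
    have "\<mu>1 \<le> \<mu>2"
    proof (rule le_measure[THEN iffD2])
      show "sets \<mu>1 = sets \<mu>2" by (simp add: \<mu>1_def \<mu>2_def)
      show "\<forall>A\<in>sets \<mu>1. emeasure \<mu>1 A \<le> emeasure \<mu>2 A"
      proof
        fix A assume "A \<in> sets \<mu>1"
        then have A: "A \<in> sets borel" by (simp add: \<mu>1_def)
        define E where "E = \<tau> -` A \<inter> R \<delta>"
        have "emeasure \<mu>1 A = emeasure lborel E"
          unfolding \<mu>1_def E_def using A tr
          by (subst emeasure_distr) (auto simp: emeasure_restrict_space space_restrict_space intro!: emeasure_restrict_space)
        also have "\<dots> \<le> ennreal (c * \<delta>) * hausdorff_outer (DIM('a) - 1) (A \<inter> frontier D)"
          unfolding c_def
        proof (rule emeasure_strip_le_hausdorff[OF \<nu> \<delta>(1)])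
          show "E \<subseteq> {y - t *\<^sub>R \<nu> |y t. y \<in> A \<inter> frontier D \<and> 0 \<le> t \<and> t \<le> \<delta>}"
          proof
            fix x assume x: "x \<in> E"
            then have "x = \<tau> x - h x *\<^sub>R \<nu>" "\<tau> x \<in> A" "0 \<le> h x" "h x \<le> \<delta>" "\<tau> x \<in> frontier D"
              using fr[OF _ \<delta>(2)] by (auto simp: E_def \<tau>_def R_def)
            then show "x \<in> {y - t *\<^sub>R \<nu> |y t. y \<in> A \<inter> frontier D \<and> 0 \<le> t \<and> t \<le> \<delta>}" by blast
          qed
        qed
        also have "\<dots> = ennreal (c * \<delta>) * emeasure (hausdorff_measure (DIM('a) - 1)) (A \<inter> frontier D)"
          using A by (simp add: emeasure_hausdorff_measure frontier_closed)
        also have "\<dots> = emeasure \<mu>2 A"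
        proof -
          have "emeasure \<mu>2 A = (\<integral>\<^sup>+x. ennreal (c * \<delta>) * indicator (frontier D) x * indicator A x \<partial>hausdorff_measure (DIM('a) - 1))"
            unfolding \<mu>2_def using A frm by (intro emeasure_density) auto
          also have "\<dots> = (\<integral>\<^sup>+x. ennreal (c * \<delta>) * indicator (A \<inter> frontier D) x \<partial>hausdorff_measure (DIM('a) - 1))"
            by (intro nn_integral_cong) (auto simp: indicator_def)
          also have "\<dots> = ennreal (c * \<delta>) * emeasure (hausdorff_measure (DIM('a) - 1)) (A \<inter> frontier D)"
            using A by (intro nn_integral_cmult_indicator) (simp add: frontier_closed)
          finally show ?thesis by simp
        qed
        finally show "emeasure \<mu>1 A \<le> emeasure \<mu>2 A" .
      qed
    qed
    have "(\<integral>\<^sup>+x. ennreal ((\<psi> (\<tau> x))\<^sup>2) * indicator (R \<delta>) x \<partial>lborel) = (\<integral>\<^sup>+x. ennreal ((\<psi> (\<tau> x))\<^sup>2) \<partial>restrict_space lborel (R \<delta>))"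
      by (rule nn_integral_restrict_space[symmetric]) simp
    also have "\<dots> = (\<integral>\<^sup>+x. ennreal ((\<psi> x)\<^sup>2) \<partial>\<mu>1)"
      unfolding \<mu>1_def by (subst nn_integral_distr[OF tr]) auto
    also have "\<dots> \<le> (\<integral>\<^sup>+x. ennreal ((\<psi> x)\<^sup>2) \<partial>\<mu>2)"
      using \<open>\<mu>1 \<le> \<mu>2\<close> by (intro nn_integral_mono_measure) (auto simp: \<mu>1_def \<mu>2_def)
    also have "\<dots> = (\<integral>\<^sup>+x. ennreal (c * \<delta>) * indicator (frontier D) x * ennreal ((\<psi> x)\<^sup>2) \<partial>hausdorff_measure (DIM('a) - 1))"
      unfolding \<mu>2_def using frm by (intro nn_integral_density) (auto simp: measurable_cong_sets[OF sets_hausdorff_measure refl])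
    also have "\<dots> = (\<integral>\<^sup>+x. ennreal (c * \<delta>) * (ennreal ((\<psi> x)\<^sup>2) * indicator (frontier D) x) \<partial>hausdorff_measure (DIM('a) - 1))"
      by (intro nn_integral_cong) (simp add: mult_ac)
    also have "\<dots> = ennreal (c * \<delta>) * (\<integral>\<^sup>+x. ennreal ((\<psi> x)\<^sup>2) * indicator (frontier D) x \<partial>hausdorff_measure (DIM('a) - 1))"
      by (intro nn_integral_cmult) (simp add: measurable_cong_sets[OF sets_hausdorff_measure refl] frontier_closed)
    finally show ?thesis unfolding surface_measure_nn_integral .
  qed
  have strip: "(\<integral>\<^sup>+x. ennreal ((\<psi> x)\<^sup>2) * indicator (R \<delta>) x \<partial>lborel) \<le>
      ennreal (2 * c * \<delta>) * (\<integral>\<^sup>+x. ennreal ((\<psi> x)\<^sup>2) \<partial>surface_measure D)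
      + ennreal (2 * \<delta>\<^sup>2) * (\<integral>\<^sup>+x. ennreal ((norm (grad \<psi> x))\<^sup>2) * indicator (collar D \<delta>) x \<partial>lborel)"
    if \<delta>: "0 < \<delta>" "\<delta> \<le> r / 2" and \<psi>: "smooth \<psi>" for \<delta> \<psi>
  proof -
    have [measurable]: "\<psi> \<in> borel_measurable borel" "grad \<psi> \<in> borel_measurable borel"
      using smooth_continuous_on[OF \<psi>] continuous_on_grad[OF \<psi>] by (auto intro: borel_measurable_continuous_onI)
    have [measurable]: "collar D \<delta> \<in> sets borel" by (rule collar_measurable[OF D(1)])
    define F where "F z = ennreal ((norm (grad \<psi> z))\<^sup>2) * indicator (collar D \<delta>) z" for z
    have Fm [measurable]: "F \<in> borel_measurable borel" unfolding F_def by measurable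
    define I where "I x = (\<integral>\<^sup>+t. F (x + t *\<^sub>R \<nu>) * indicator {0..\<delta>} t \<partial>lborel)" for x
    have Im [measurable]: "I \<in> borel_measurable borel" unfolding I_def by measurable
    have pw: "ennreal ((\<psi> x)\<^sup>2) * indicator (R \<delta>) x \<le> ennreal 2 * (ennreal ((\<psi> (\<tau> x))\<^sup>2) * indicator (R \<delta>) x) + ennreal (2 * \<delta>) * I x" for x
    proof (cases "x \<in> R \<delta>")
      case True
      then have "0 \<le> h x" "h x \<le> \<delta>" by (auto simp: R_def)
      from power2_le_along_segment[OF \<psi> \<nu> this, of x]
      have "ennreal ((\<psi> x)\<^sup>2) \<le> ennreal (2 * (\<psi> (\<tau> x))\<^sup>2)
         + ennreal (2 * \<delta>) * (\<integral>\<^sup>+t. ennreal ((norm (grad \<psi> (x + t *\<^sub>R \<nu>)))\<^sup>2) * indicator {0..<h x} t \<partial>lborel)"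
        by (simp add: \<tau>_def)
      also have "(\<integral>\<^sup>+t. ennreal ((norm (grad \<psi> (x + t *\<^sub>R \<nu>)))\<^sup>2) * indicator {0..<h x} t \<partial>lborel) \<le> I x"
        unfolding I_def
      proof (rule nn_integral_mono)
        fix t
        show "ennreal ((norm (grad \<psi> (x + t *\<^sub>R \<nu>)))\<^sup>2) * indicator {0..<h x} t \<le> F (x + t *\<^sub>R \<nu>) * indicator {0..\<delta>} t"
          using col[OF True \<delta>(2), of t] True by (auto simp: F_def R_def indicator_def)
      qed
      finally show ?thesis using True by (simp add: ennreal_mult mult_left_mono add_left_mono)
    qed simp
    have "(\<integral>\<^sup>+x. ennreal ((\<psi> x)\<^sup>2) * indicator (R \<delta>) x \<partial>lborel) \<le>
       (\<integral>\<^sup>+x. ennreal 2 * (ennreal ((\<psi> (\<tau> x))\<^sup>2) * indicator (R \<delta>) x) + ennreal (2 * \<delta>) * I x \<partial>lborel)"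
      by (intro nn_integral_mono pw)
    also have "\<dots> = ennreal 2 * (\<integral>\<^sup>+x. ennreal ((\<psi> (\<tau> x))\<^sup>2) * indicator (R \<delta>) x \<partial>lborel) + ennreal (2 * \<delta>) * (\<integral>\<^sup>+x. I x \<partial>lborel)"
      by (subst nn_integral_add) (auto simp: nn_integral_cmult)
    also have "(\<integral>\<^sup>+x. I x \<partial>lborel) = ennreal \<delta> * (\<integral>\<^sup>+x. F x \<partial>lborel)"
      unfolding I_def using \<delta> by (intro nn_integral_translate_average) auto
    also have "ennreal 2 * (\<integral>\<^sup>+x. ennreal ((\<psi> (\<tau> x))\<^sup>2) * indicator (R \<delta>) x \<partial>lborel) + ennreal (2 * \<delta>) * (ennreal \<delta> * (\<integral>\<^sup>+x. F x \<partial>lborel))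
      \<le> ennreal 2 * (ennreal (c * \<delta>) * (\<integral>\<^sup>+x. ennreal ((\<psi> x)\<^sup>2) \<partial>surface_measure D)) + ennreal (2 * \<delta>) * (ennreal \<delta> * (\<integral>\<^sup>+x. F x \<partial>lborel))"
      by (intro add_mono mult_left_mono bdry[OF \<delta> \<psi>]) auto
    also have "\<dots> = ennreal (2 * c * \<delta>) * (\<integral>\<^sup>+x. ennreal ((\<psi> x)\<^sup>2) \<partial>surface_measure D) + ennreal (2 * \<delta>\<^sup>2) * (\<integral>\<^sup>+x. F x \<partial>lborel)"
      using c \<delta> by (simp add: ennreal_mult power2_eq_square mult.assoc)
    finally show ?thesis unfolding F_def .
  qed
  \<comment> \<open>One constant for three purposes: the boundary factor 2cH, the gradient factor
    2H^2 and the widening of the collar by H.\<close>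
  define K where "K = max (2 * c * H) (2 * H\<^sup>2) + H"
  have H: "H \<ge> 2" using L by (simp add: H_def)
  have "0 \<le> max (2 * c * H) (2 * H\<^sup>2)" by (simp add: le_max_iff_disj)
  then have K: "2 * c * H \<le> K" "2 * H\<^sup>2 \<le> K" "H \<le> K" "K > 0"
    using H max.cobounded1[of "2 * c * H" "2 * H\<^sup>2"] max.cobounded2[of "2 * H\<^sup>2" "2 * c * H"]
    unfolding K_def by linarith+
  \<comment> \<open>Distance becomes height: the nearest point outside D has height at most 0, so
    the Lipschitz bound keeps the height of x below H \<delta>. The quarter of r keeps that nearest
    point inside the chart.\<close>
  have sub: "collar D \<delta> \<inter> ball p (r / 4) \<subseteq> R (H * \<delta>)" if \<delta>: "0 < \<delta>" "\<delta> < r / 4" for \<delta>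
  proof
    fix x assume x: "x \<in> collar D \<delta> \<inter> ball p (r / 4)"
    have xp: "dist p x < r / 4" using x by simp
    obtain y where y: "y \<in> - D" "infdist x (- D) = dist x y"
      using infdist_attains_inf[of "- D" x] D by auto
    have "dist x y < \<delta>" using x y by (simp add: collar_def)
    then have "dist p y < r" using dist_triangle[of p y x] xp \<delta> by linarith
    then have hy: "h y \<le> 0" using inD[of y] y by auto
    have "x \<in> ball p r" using xp r by simp
    then have hx: "h x > 0" using inD x by (auto simp: collar_def)
    have "h x \<le> h y + (H - 1) * norm (x - y)" using hL[of x y] by linarith
    also have "\<dots> \<le> (H - 1) * \<delta>"
    proof -
      have "(H - 1) * norm (x - y) \<le> (H - 1) * \<delta>"
        using \<open>dist x y < \<delta>\<close> H by (intro mult_left_mono) (auto simp: dist_norm)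
      then show ?thesis using hy by linarith
    qed
    also have "\<dots> < H * \<delta>" using \<delta> by (simp add: algebra_simps)
    finally show "x \<in> R (H * \<delta>)" using hx xp r by (simp add: R_def)
  qed
  show ?thesis
  proof (rule exI[of _ K], intro conjI K(4), rule exI[of _ "r / 4"], intro conjI,
      use r in simp, rule exI[of _ "r / (4 * H)"], intro conjI allI impI)
    show "r / (4 * H) > 0" using r H by auto
    fix \<psi> :: "'a \<Rightarrow> real" and \<delta> :: real assume \<psi>: "smooth \<psi>" and \<delta>: "0 < \<delta>" "\<delta> < r / (4 * H)"
    have H\<delta>: "0 < H * \<delta>" "H * \<delta> \<le> r / 2" using \<delta> H r by (auto simp: field_simps)
    have "\<delta> * 1 \<le> \<delta> * H" using \<delta> H by (intro mult_left_mono) auto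
    moreover have "4 * (\<delta> * H) < r" using \<delta> H by (simp add: field_simps)
    ultimately have \<delta>r: "\<delta> < r / 4" by linarith
    have "(\<integral>\<^sup>+x. ennreal ((\<psi> x)\<^sup>2) * indicator (collar D \<delta> \<inter> ball p (r / 4)) x \<partial>lborel) \<le> (\<integral>\<^sup>+x. ennreal ((\<psi> x)\<^sup>2) * indicator (R (H * \<delta>)) x \<partial>lborel)"
      using sub[OF \<delta>(1) \<delta>r] by (intro nn_integral_mono) (auto simp: indicator_def)
    also note strip[OF H\<delta> \<psi>]
    also have "ennreal (2 * c * (H * \<delta>)) * (\<integral>\<^sup>+x. ennreal ((\<psi> x)\<^sup>2) \<partial>surface_measure D)
      + ennreal (2 * (H * \<delta>)\<^sup>2) * (\<integral>\<^sup>+x. ennreal ((norm (grad \<psi> x))\<^sup>2) * indicator (collar D (H * \<delta>)) x \<partial>lborel)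
      \<le> ennreal (K * \<delta>) * (\<integral>\<^sup>+x. ennreal ((\<psi> x)\<^sup>2) \<partial>surface_measure D)
       + ennreal (K * \<delta>\<^sup>2) * (\<integral>\<^sup>+x. ennreal ((norm (grad \<psi> x))\<^sup>2) * indicator (collar D (K * \<delta>)) x \<partial>lborel)"
    proof (rule add_mono)
      have "2 * c * (H * \<delta>) \<le> K * \<delta>" using mult_right_mono[OF K(1), of \<delta>] \<delta> by (simp add: mult.assoc)
      then show "ennreal (2 * c * (H * \<delta>)) * (\<integral>\<^sup>+x. ennreal ((\<psi> x)\<^sup>2) \<partial>surface_measure D)
        \<le> ennreal (K * \<delta>) * (\<integral>\<^sup>+x. ennreal ((\<psi> x)\<^sup>2) \<partial>surface_measure D)"
        by (intro mult_right_mono ennreal_leI) auto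
      have 1: "2 * (H * \<delta>)\<^sup>2 \<le> K * \<delta>\<^sup>2"
        using mult_right_mono[OF K(2), of "\<delta>\<^sup>2"] by (simp add: power_mult_distrib mult.assoc)
      have 2: "(\<integral>\<^sup>+x. ennreal ((norm (grad \<psi> x))\<^sup>2) * indicator (collar D (H * \<delta>)) x \<partial>lborel)
        \<le> (\<integral>\<^sup>+x. ennreal ((norm (grad \<psi> x))\<^sup>2) * indicator (collar D (K * \<delta>)) x \<partial>lborel)"
        using collar_mono[of "H * \<delta>" "K * \<delta>" D] K(3) \<delta>
        by (intro nn_integral_mono mult_left_mono) (auto simp: indicator_def)
      show "ennreal (2 * (H * \<delta>)\<^sup>2) * (\<integral>\<^sup>+x. ennreal ((norm (grad \<psi> x))\<^sup>2) * indicator (collar D (H * \<delta>)) x \<partial>lborel)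
        \<le> ennreal (K * \<delta>\<^sup>2) * (\<integral>\<^sup>+x. ennreal ((norm (grad \<psi> x))\<^sup>2) * indicator (collar D (K * \<delta>)) x \<partial>lborel)"
        by (intro mult_mono ennreal_leI 1 2) auto
    qed
    finally show "(\<integral>\<^sup>+x. ennreal ((\<psi> x)\<^sup>2) * indicator (collar D \<delta> \<inter> ball p (r / 4)) x \<partial>lborel)
      \<le> ennreal (K * \<delta>) * (\<integral>\<^sup>+x. ennreal ((\<psi> x)\<^sup>2) \<partial>surface_measure D)
       + ennreal (K * \<delta>\<^sup>2) * (\<integral>\<^sup>+x. ennreal ((norm (grad \<psi> x))\<^sup>2) * indicator (collar D (K * \<delta>)) x \<partial>lborel)" .
  qed
qed

text \<open>The boundary is compact, so finitely many charts cover it, and sufficiently thin collars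
  lie inside their union.\<close>

lemma collar_estimate:
  fixes D :: "'a::euclidean_space set"
  assumes D: "open D" "bounded D" and lip: "lipschitz_boundary D"
  shows "\<exists>K>0. \<exists>\<delta>0>0. \<forall>\<psi> \<delta>. smooth \<psi> \<longrightarrow> 0 < \<delta> \<longrightarrow> \<delta> < \<delta>0 \<longrightarrow>
    (\<integral>\<^sup>+x. ennreal ((\<psi> x)\<^sup>2) * indicator (collar D \<delta>) x \<partial>lborel)
      \<le> ennreal (K * \<delta>) * (\<integral>\<^sup>+x. ennreal ((\<psi> x)\<^sup>2) \<partial>surface_measure D)
       + ennreal (K * \<delta>\<^sup>2) * (\<integral>\<^sup>+x. ennreal ((norm (grad \<psi> x))\<^sup>2) * indicator (collar D (K * \<delta>)) x \<partial>lborel)"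
proof -
  have DU: "D \<noteq> UNIV" using D(2) not_bounded_UNIV by blast
  define S where "S \<psi> = (\<integral>\<^sup>+x. ennreal ((\<psi> x)\<^sup>2) \<partial>surface_measure D)" for \<psi>
  define G where "G \<psi> \<delta> = (\<integral>\<^sup>+x. ennreal ((norm (grad \<psi> x))\<^sup>2) * indicator (collar D \<delta>) x \<partial>lborel)" for \<psi> and \<delta> :: real
  have Gmono: "G \<psi> \<delta> \<le> G \<psi> \<delta>'" if "\<delta> \<le> \<delta>'" for \<psi> \<delta> \<delta>'
    unfolding G_def using collar_mono[OF that, of D] by (intro nn_integral_mono mult_left_mono) (auto simp: indicator_def)
  have "\<forall>p\<in>frontier D. \<exists>K \<rho> \<delta>0. K > 0 \<and> \<rho> > 0 \<and> \<delta>0 > 0 \<and> (\<forall>\<psi> \<delta>. smooth \<psi> \<longrightarrow> 0 < \<delta> \<longrightarrow> \<delta> < \<delta>0 \<longrightarrow>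
    (\<integral>\<^sup>+x. ennreal ((\<psi> x)\<^sup>2) * indicator (collar D \<delta> \<inter> ball p \<rho>) x \<partial>lborel)
      \<le> ennreal (K * \<delta>) * S \<psi> + ennreal (K * \<delta>\<^sup>2) * G \<psi> (K * \<delta>))"
  proof
    fix p assume p: "p \<in> frontier D"
    obtain \<nu> \<gamma> L r where "norm \<nu> = 1" "0 < r" "L-lipschitz_on {y. y \<bullet> \<nu> = 0} \<gamma>"
      "D \<inter> ball p r = {x \<in> ball p r. x \<bullet> \<nu> < \<gamma> (x - (x \<bullet> \<nu>) *\<^sub>R \<nu>)}"
      using lip p unfolding lipschitz_boundary_def by blast
    from collar_estimate_chart[OF D(1) DU this]
    show "\<exists>K \<rho> \<delta>0. K > 0 \<and> \<rho> > 0 \<and> \<delta>0 > 0 \<and> (\<forall>\<psi> \<delta>. smooth \<psi> \<longrightarrow> 0 < \<delta> \<longrightarrow> \<delta> < \<delta>0 \<longrightarrow>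
      (\<integral>\<^sup>+x. ennreal ((\<psi> x)\<^sup>2) * indicator (collar D \<delta> \<inter> ball p \<rho>) x \<partial>lborel)
      \<le> ennreal (K * \<delta>) * S \<psi> + ennreal (K * \<delta>\<^sup>2) * G \<psi> (K * \<delta>))"
      unfolding S_def G_def by blast
  qed
  from bchoice[OF this] obtain K where "\<forall>p\<in>frontier D. \<exists>\<rho> \<delta>0. K p > 0 \<and> \<rho> > 0 \<and> \<delta>0 > 0 \<and> (\<forall>\<psi> \<delta>. smooth \<psi> \<longrightarrow> 0 < \<delta> \<longrightarrow> \<delta> < \<delta>0 \<longrightarrow>
    (\<integral>\<^sup>+x. ennreal ((\<psi> x)\<^sup>2) * indicator (collar D \<delta> \<inter> ball p \<rho>) x \<partial>lborel)
      \<le> ennreal (K p * \<delta>) * S \<psi> + ennreal (K p * \<delta>\<^sup>2) * G \<psi> (K p * \<delta>))" by blast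
  from bchoice[OF this] obtain \<rho> where "\<forall>p\<in>frontier D. \<exists>\<delta>0. K p > 0 \<and> \<rho> p > 0 \<and> \<delta>0 > 0 \<and> (\<forall>\<psi> \<delta>. smooth \<psi> \<longrightarrow> 0 < \<delta> \<longrightarrow> \<delta> < \<delta>0 \<longrightarrow>
    (\<integral>\<^sup>+x. ennreal ((\<psi> x)\<^sup>2) * indicator (collar D \<delta> \<inter> ball p (\<rho> p)) x \<partial>lborel)
      \<le> ennreal (K p * \<delta>) * S \<psi> + ennreal (K p * \<delta>\<^sup>2) * G \<psi> (K p * \<delta>))" by blast
  from bchoice[OF this] obtain d where d: "\<forall>p\<in>frontier D. K p > 0 \<and> \<rho> p > 0 \<and> d p > 0 \<and> (\<forall>\<psi> \<delta>. smooth \<psi> \<longrightarrow> 0 < \<delta> \<longrightarrow> \<delta> < d p \<longrightarrow>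
    (\<integral>\<^sup>+x. ennreal ((\<psi> x)\<^sup>2) * indicator (collar D \<delta> \<inter> ball p (\<rho> p)) x \<partial>lborel)
      \<le> ennreal (K p * \<delta>) * S \<psi> + ennreal (K p * \<delta>\<^sup>2) * G \<psi> (K p * \<delta>))" by blast
  have cpt: "compact (frontier D)" using D(2) by (rule compact_frontier_bounded)
  have "frontier D \<subseteq> (\<Union>p\<in>frontier D. ball p (\<rho> p))" using d by force
  then obtain T where T: "T \<subseteq> frontier D" "finite T" "frontier D \<subseteq> (\<Union>p\<in>T. ball p (\<rho> p))"
    using compactE_image[OF cpt, of "frontier D" "\<lambda>p. ball p (\<rho> p)"] by auto
  define U where "U = (\<Union>p\<in>T. ball p (\<rho> p))"
  have "open U" unfolding U_def by auto
  have "closed (- U)" "frontier D \<inter> - U = {}" using T(3) \<open>open U\<close> unfolding U_def[symmetric] by auto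
  from separate_compact_closed[OF cpt this]
  obtain d' where d': "d' > 0" "\<And>x y. x \<in> frontier D \<Longrightarrow> y \<in> - U \<Longrightarrow> d' \<le> dist x y" by blast
  have cov: "collar D \<delta> \<subseteq> U" if "\<delta> < d'" for \<delta>
  proof
    fix x assume x: "x \<in> collar D \<delta>"
    obtain y where y: "y \<in> - D" "infdist x (- D) = dist x y"
      using infdist_attains_inf[of "- D" x] D(1) DU by auto
    \<comment> \<open>The segment to the nearest point outside D crosses the frontier, which places
      a frontier point at distance less than \<delta> from x.\<close>
    have "closed_segment x y \<inter> frontier D \<noteq> {}"
      by (rule connected_Int_frontier[OF connected_segment(1)]) (use x y in \<open>auto simp: collar_def\<close>)
    then obtain q where q: "q \<in> closed_segment x y" "q \<in> frontier D" by blast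
    have "dist q x \<le> dist x y" using q(1) by (metis dist_commute dist_in_closed_segment)
    also have "\<dots> < d'" using x y that by (auto simp: collar_def)
    finally show "x \<in> U" using d'(2)[OF q(2), of x] by force
  qed
  define \<delta>0 where "\<delta>0 = Min (insert d' (d ` T))"
  have \<delta>0: "\<delta>0 > 0" "\<delta>0 \<le> d'" "\<And>p. p \<in> T \<Longrightarrow> \<delta>0 \<le> d p"
    unfolding \<delta>0_def using T d d' by (auto simp: subset_eq)
  \<comment> \<open>The sum dominates both the added constants of the charts and each single one;
    the 1 keeps it positive when there are no charts.\<close>
  define K0 where "K0 = (\<Sum>p\<in>T. K p) + 1"
  have Kp: "K p \<ge> 0" if "p \<in> T" for p using d T that by force
  have K0: "K0 > 0" "\<And>p. p \<in> T \<Longrightarrow> K p \<le> K0" "(\<Sum>p\<in>T. K p) \<le> K0"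
    using Kp member_le_sum[of _ T K] T(2) sum_nonneg[of T K] unfolding K0_def by (auto intro: add_increasing2 add_nonneg_pos)
  show ?thesis
  proof (rule exI[of _ K0], intro conjI K0(1), rule exI[of _ \<delta>0], intro conjI \<delta>0(1) allI impI)
    fix \<psi> :: "'a \<Rightarrow> real" and \<delta> :: real assume \<psi>: "smooth \<psi>" and \<delta>: "0 < \<delta>" "\<delta> < \<delta>0"
    have [measurable]: "\<psi> \<in> borel_measurable borel"
      using smooth_continuous_on[OF \<psi>] by (auto intro: borel_measurable_continuous_onI)
    have "collar D \<delta> \<in> sets borel" by (rule collar_measurable[OF D(1)])
    then have [measurable]: "collar D \<delta> \<inter> ball p (\<rho> p) \<in> sets borel" for p by (intro sets.Int) auto
    have "(\<integral>\<^sup>+x. ennreal ((\<psi> x)\<^sup>2) * indicator (collar D \<delta>) x \<partial>lborel)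
        \<le> (\<integral>\<^sup>+x. (\<Sum>p\<in>T. ennreal ((\<psi> x)\<^sup>2) * indicator (collar D \<delta> \<inter> ball p (\<rho> p)) x) \<partial>lborel)"
    proof (rule nn_integral_mono)
      fix x
      show "ennreal ((\<psi> x)\<^sup>2) * indicator (collar D \<delta>) x \<le> (\<Sum>p\<in>T. ennreal ((\<psi> x)\<^sup>2) * indicator (collar D \<delta> \<inter> ball p (\<rho> p)) x)"
      proof (cases "x \<in> collar D \<delta>")
        case True
        then obtain p where p: "p \<in> T" "x \<in> ball p (\<rho> p)" using cov[of \<delta>] \<delta> \<delta>0(2) unfolding U_def by force
        then have "ennreal ((\<psi> x)\<^sup>2) * indicator (collar D \<delta>) x = ennreal ((\<psi> x)\<^sup>2) * indicator (collar D \<delta> \<inter> ball p (\<rho> p)) x"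
          using True by simp
        also have "\<dots> \<le> (\<Sum>p\<in>T. ennreal ((\<psi> x)\<^sup>2) * indicator (collar D \<delta> \<inter> ball p (\<rho> p)) x)"
          using p T(2) by (intro member_le_sum) auto
        finally show ?thesis .
      qed simp
    qed
    also have "\<dots> = (\<Sum>p\<in>T. \<integral>\<^sup>+x. ennreal ((\<psi> x)\<^sup>2) * indicator (collar D \<delta> \<inter> ball p (\<rho> p)) x \<partial>lborel)"
      by (intro nn_integral_sum) measurable
    also have "\<dots> \<le> (\<Sum>p\<in>T. ennreal (K p * \<delta>) * S \<psi> + ennreal (K p * \<delta>\<^sup>2) * G \<psi> (K0 * \<delta>))"
    proof (rule sum_mono)
      fix p assume p: "p \<in> T"
      have "(\<integral>\<^sup>+x. ennreal ((\<psi> x)\<^sup>2) * indicator (collar D \<delta> \<inter> ball p (\<rho> p)) x \<partial>lborel)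
        \<le> ennreal (K p * \<delta>) * S \<psi> + ennreal (K p * \<delta>\<^sup>2) * G \<psi> (K p * \<delta>)"
        using d T(1) p \<psi> \<delta> \<delta>0(3)[OF p] by force
      also have "\<dots> \<le> ennreal (K p * \<delta>) * S \<psi> + ennreal (K p * \<delta>\<^sup>2) * G \<psi> (K0 * \<delta>)"
        using K0(2)[OF p] \<delta> by (intro add_left_mono mult_left_mono Gmono) auto
      finally show "(\<integral>\<^sup>+x. ennreal ((\<psi> x)\<^sup>2) * indicator (collar D \<delta> \<inter> ball p (\<rho> p)) x \<partial>lborel)
        \<le> ennreal (K p * \<delta>) * S \<psi> + ennreal (K p * \<delta>\<^sup>2) * G \<psi> (K0 * \<delta>)" .
    qed
    also have "\<dots> = ennreal ((\<Sum>p\<in>T. K p) * \<delta>) * S \<psi> + ennreal ((\<Sum>p\<in>T. K p) * \<delta>\<^sup>2) * G \<psi> (K0 * \<delta>)"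
      using Kp \<delta> by (simp add: sum.distrib sum_distrib_right sum_ennreal flip: sum_distrib_right)
    also have "\<dots> \<le> ennreal (K0 * \<delta>) * S \<psi> + ennreal (K0 * \<delta>\<^sup>2) * G \<psi> (K0 * \<delta>)"
      using K0(3) \<delta> by (intro add_mono mult_right_mono ennreal_leI) auto
    finally show "(\<integral>\<^sup>+x. ennreal ((\<psi> x)\<^sup>2) * indicator (collar D \<delta>) x \<partial>lborel)
      \<le> ennreal (K0 * \<delta>) * (\<integral>\<^sup>+x. ennreal ((\<psi> x)\<^sup>2) \<partial>surface_measure D)
       + ennreal (K0 * \<delta>\<^sup>2) * (\<integral>\<^sup>+x. ennreal ((norm (grad \<psi> x))\<^sup>2) * indicator (collar D (K0 * \<delta>)) x \<partial>lborel)"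
      unfolding S_def G_def .
  qed
qed

text \<open>Applied to the cutoff: its gradient vanishes wherever the cutoff equals 1, also at
  points that are not interior to that set.\<close>

lemma grad_eq_0_at_max:
  assumes \<phi>: "smooth \<phi>" and max: "\<And>y. \<phi> y \<le> \<phi> x"
  shows "grad \<phi> x = 0"
proof -
  have "((\<lambda>t. \<phi> (x + t *\<^sub>R grad \<phi> x)) has_real_derivative (grad \<phi> x \<bullet> grad \<phi> x)) (at 0)"
    using DERIV_along_line[OF \<phi>, of x "grad \<phi> x" 0] by simp
  then have "grad \<phi> x \<bullet> grad \<phi> x = 0"
    by (rule DERIV_local_max[where d = 1]) (use max in auto)
  then show ?thesis by simp
qed

section \<open>From vanishing boundary values to membership in H10\<close>

lemma nn_integral_collar:
  fixes w :: "'a::euclidean_space \<Rightarrow> 'b::euclidean_space"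
  assumes D: "open D" "bounded D" and w: "continuous_on UNIV w"
  shows "(\<integral>\<^sup>+x. ennreal ((norm (w x))\<^sup>2) * indicator (collar D \<delta>) x \<partial>lborel)
     = ennreal ((L2_norm (vol D) (\<lambda>x. indicator (collar D \<delta>) x *\<^sub>R w x))\<^sup>2)"
proof -
  have [measurable]: "collar D \<delta> \<in> sets borel" by (rule collar_measurable[OF D(1)])
  have [measurable]: "w \<in> borel_measurable borel" using w by (rule borel_measurable_continuous_onI)
  have m: "(\<lambda>x. indicator (collar D \<delta>) x *\<^sub>R w x) \<in> borel_measurable (vol D)"
    by (rule measurable_restrict_space1) measurable
  have L: "(\<lambda>x. indicator (collar D \<delta>) x *\<^sub>R w x) \<in> L2_fun (vol D)"
    by (rule L2_fun_bound(1)[OF continuous_L2_fun_vol[OF D w] m]) (auto simp: indicator_def)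
  have "(\<integral>\<^sup>+x. ennreal ((norm (w x))\<^sup>2) * indicator (collar D \<delta>) x \<partial>lborel)
     = (\<integral>\<^sup>+x. ennreal ((norm (indicator (collar D \<delta>) x *\<^sub>R w x))\<^sup>2) * indicator D x \<partial>lborel)"
    by (intro nn_integral_cong) (auto simp: indicator_def collar_def)
  also have "\<dots> = (\<integral>\<^sup>+x. ennreal ((norm (indicator (collar D \<delta>) x *\<^sub>R w x))\<^sup>2) \<partial>vol D)"
    using D(1) by (intro nn_integral_restrict_space[symmetric]) auto
  also have "\<dots> = ennreal ((L2_norm (vol D) (\<lambda>x. indicator (collar D \<delta>) x *\<^sub>R w x))\<^sup>2)"
    using L2_funD(2)[OF L] by (simp add: nn_integral_eq_integral L2_norm_power2)
  finally show ?thesis .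
qed

lemma L2_norm_collar_tendsto_0:
  fixes w :: "'a::euclidean_space \<Rightarrow> 'b::euclidean_space"
  assumes D: "open D" "bounded D" and w: "w \<in> L2_fun (vol D)" and c: "c > 0"
  shows "(\<lambda>m. L2_norm (vol D) (\<lambda>x. indicator (collar D (c / real (Suc m))) x *\<^sub>R w x)) \<longlonglongrightarrow> 0"
proof (rule L2_norm_dominated_tendsto_0[OF w, where B = 1])
  have DU: "- D \<noteq> {}" using D(2) not_bounded_UNIV by (metis Compl_empty_eq double_complement)
  show "AE x in vol D. w x \<noteq> 0 \<longrightarrow> (\<lambda>m. indicator (collar D (c / real (Suc m))) x :: real) \<longlonglongrightarrow> 0"
  proof (intro AE_I2 impI)
    fix x assume "x \<in> space (vol D)"
    then have "x \<in> D" by (simp add: space_restrict_space)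
    then have "infdist x (- D) > 0" using D(1) DU by (intro infdist_pos_not_in_closed) auto
    moreover have "(\<lambda>m. c * inverse (real (Suc m))) \<longlonglongrightarrow> c * 0" by (intro tendsto_intros LIMSEQ_inverse_real_of_nat)
    ultimately have "\<forall>\<^sub>F m in sequentially. c / real (Suc m) < infdist x (- D)"
      using order_tendstoD(2)[of "\<lambda>m. c * inverse (real (Suc m))" 0] by (simp add: divide_inverse)
    then show "(\<lambda>m. indicator (collar D (c / real (Suc m))) x :: real) \<longlonglongrightarrow> 0"
      by (intro tendsto_eventually) (auto elim!: eventually_mono simp: collar_def indicator_def)
  qed
  show "(\<lambda>x. indicator (collar D (c / real (Suc m))) x :: real) \<in> borel_measurable (vol D)" for m
    by (intro measurable_restrict_space1 borel_measurable_indicator) (simp add: collar_measurable[OF D(1)])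
qed (auto simp: indicator_def)

text \<open>The collar estimate bounds the only dangerous term, the product of \<open>\<psi>\<close> with the gradient \<open>O(1/\<delta>)\<close> of
  the cutoff, by the gradient of \<open>\<psi>\<close> on a comparable collar.\<close>

lemma H10_if_boundary_values_vanish:
  fixes D :: "'a::euclidean_space set"
  assumes D: "open D" "bounded D" and lip: "lipschitz_boundary D" and u: "u \<in> H1 D"
    and \<psi>: "\<And>k. smooth (\<psi> k)" and lim: "(\<lambda>k. H1_norm D (\<lambda>x. \<psi> k x - u x)) \<longlonglongrightarrow> 0"
    and bd: "(\<lambda>k. \<integral>\<^sup>+x. ennreal ((\<psi> k x)\<^sup>2) \<partial>surface_measure D) \<longlonglongrightarrow> 0"
  shows "u \<in> H10 D"
proof (rule H10_closed[OF D u])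
  fix e :: real assume e: "e > 0"
  let ?n = "L2_norm (vol D)" and ?n' = "L2_norm (vol D)"
  note U = weak_grad_H1[OF u]
  define C where "C \<delta> w = ?n (\<lambda>x. indicator (collar D \<delta>) x *\<^sub>R w x)" for \<delta> and w :: "'a \<Rightarrow> real"
  define C' where "C' \<delta> w = ?n' (\<lambda>x. indicator (collar D \<delta>) x *\<^sub>R w x)" for \<delta> and w :: "'a \<Rightarrow> 'a"
  have im: "(\<lambda>x. indicator (collar D \<delta>) x :: real) \<in> borel_measurable (vol D)" for \<delta>
    by (intro measurable_restrict_space1 borel_measurable_indicator) (simp add: collar_measurable[OF D(1)])
  obtain K \<delta>0 where K: "K > 0" "\<delta>0 > 0" "\<And>\<psi> \<delta>. smooth \<psi> \<Longrightarrow> 0 < \<delta> \<Longrightarrow> \<delta> < \<delta>0 \<Longrightarrow>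
    (\<integral>\<^sup>+x. ennreal ((\<psi> x)\<^sup>2) * indicator (collar D \<delta>) x \<partial>lborel)
      \<le> ennreal (K * \<delta>) * (\<integral>\<^sup>+x. ennreal ((\<psi> x)\<^sup>2) \<partial>surface_measure D)
       + ennreal (K * \<delta>\<^sup>2) * (\<integral>\<^sup>+x. ennreal ((norm (grad \<psi> x))\<^sup>2) * indicator (collar D (K * \<delta>)) x \<partial>lborel)"
    using collar_estimate[OF D lip] by blast
  define S where "S k = (\<integral>\<^sup>+x. ennreal ((\<psi> k x)\<^sup>2) \<partial>surface_measure D)" for k
  define s where "s k = enn2real (S k)" for k
  have s: "s \<longlonglongrightarrow> 0" unfolding s_def[abs_def]
    by (rule tendsto_enn2real) (use bd in \<open>simp_all add: S_def[abs_def]\<close>)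
  have Sfin: "\<forall>\<^sub>F k in sequentially. S k < \<top>" using order_tendstoD(2)[OF bd, of \<top>] by (simp add: S_def)
  \<comment> \<open>The collar estimate divided by \<delta>^2, with roots taken: a Hardy inequality
    near the boundary, up to the boundary mass \<open>s k\<close>.\<close>
  have hardy: "C \<delta> (\<psi> k) / \<delta> \<le> sqrt (K * s k / \<delta>) + sqrt K * C' (K * \<delta>) (grad (\<psi> k))"
    if \<delta>: "0 < \<delta>" "\<delta> < \<delta>0" and k: "S k < \<top>" for \<delta> k
  proof -
    have Sk: "S k = ennreal (s k)" "s k \<ge> 0" using k by (simp_all add: s_def)
    have "ennreal ((C \<delta> (\<psi> k))\<^sup>2) \<le> ennreal (K * \<delta>) * ennreal (s k) + ennreal (K * \<delta>\<^sup>2) * ennreal ((C' (K * \<delta>) (grad (\<psi> k)))\<^sup>2)"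
      using K(3)[OF \<psi> \<delta>, of k] nn_integral_collar[OF D smooth_continuous_on[OF \<psi>], of k \<delta>]
        nn_integral_collar[OF D continuous_on_grad[OF \<psi>], of k "K * \<delta>"] Sk(1)
      by (simp add: C_def C'_def S_def)
    also have "\<dots> = ennreal (K * \<delta> * s k + K * \<delta>\<^sup>2 * (C' (K * \<delta>) (grad (\<psi> k)))\<^sup>2)"
      using K(1) \<delta> Sk by (simp add: ennreal_mult ennreal_plus)
    finally have "(C \<delta> (\<psi> k))\<^sup>2 \<le> K * \<delta> * s k + K * \<delta>\<^sup>2 * (C' (K * \<delta>) (grad (\<psi> k)))\<^sup>2"
      using K(1) \<delta> Sk by (subst (asm) ennreal_le_iff) auto
    then have "(C \<delta> (\<psi> k) / \<delta>)\<^sup>2 \<le> (K * \<delta> * s k + K * \<delta>\<^sup>2 * (C' (K * \<delta>) (grad (\<psi> k)))\<^sup>2) / \<delta>\<^sup>2"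
      by (simp add: power_divide divide_right_mono)
    also have "\<dots> = K * s k / \<delta> + K * (C' (K * \<delta>) (grad (\<psi> k)))\<^sup>2"
      using \<delta> by (simp add: add_divide_distrib power2_eq_square)
    finally have "C \<delta> (\<psi> k) / \<delta> \<le> sqrt (K * s k / \<delta> + K * (C' (K * \<delta>) (grad (\<psi> k)))\<^sup>2)"
      by (rule real_le_rsqrt)
    also have "\<dots> \<le> sqrt (K * s k / \<delta>) + sqrt (K * (C' (K * \<delta>) (grad (\<psi> k)))\<^sup>2)"
      using K(1) \<delta> Sk by (intro sqrt_add_le_add_sqrt) auto
    also have "sqrt (K * (C' (K * \<delta>) (grad (\<psi> k)))\<^sup>2) = sqrt K * C' (K * \<delta>) (grad (\<psi> k))"
      by (simp add: real_sqrt_mult C'_def L2_norm_nonneg)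
    finally show ?thesis .
  qed
  define a where "a k = ?n (\<lambda>x. \<psi> k x - u x)" for k
  define b where "b k = ?n' (\<lambda>x. grad (\<psi> k) x - weak_grad D u x)" for k
  note \<psi>H = smooth_H1[OF D \<psi>] and \<psi>L = smooth_L2_fun_vol[OF D \<psi>]
  have bb: "?n' (weak_grad D (\<lambda>x. \<psi> k x - u x)) = b k" for k
    unfolding H1_diff(3)[OF D \<psi>H(1) u] b_def
    using \<psi>H(2)[of k] L2_funD(1)[OF U(1)] L2_funD(1)[OF weak_grad_H1(1)[OF \<psi>H(1)[of k]]] L2_funD(1)[OF \<psi>L(2)[of k]]
    by (intro L2_norm_cong_AE) auto
  have ab: "a \<longlonglongrightarrow> 0" "b \<longlonglongrightarrow> 0" using lim unfolding H1_norm_tendsto_0_iff bb by (auto simp: a_def[abs_def])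
  have Cind: "(\<lambda>x. indicator (collar D \<delta>) x *\<^sub>R w x) \<in> L2_fun (vol D)" if "w \<in> L2_fun (vol D)" for \<delta> and w :: "'a \<Rightarrow> 'a"
    using L2_fun_mult_bounded(1)[OF that im, of \<delta> 1] by (simp add: indicator_def)
  \<comment> \<open>On the collar the gradient of the k-th approximant is traded for that of the
    fixed limit \<open>u\<close> at the price \<open>b k\<close>, so that the smallness gained from
    \<delta> does not depend on k.\<close>
  have C'tri: "C' \<delta> (grad (\<psi> k)) \<le> b k + C' \<delta> (weak_grad D u)" for \<delta> k
  proof -
    have d: "(\<lambda>x. grad (\<psi> k) x - weak_grad D u x) \<in> L2_fun (vol D)" using L2_fun_diff(1)[OF \<psi>L(2) U(1)] .
    have "C' \<delta> (grad (\<psi> k)) = ?n' (\<lambda>x. indicator (collar D \<delta>) x *\<^sub>R (grad (\<psi> k) x - weak_grad D u x) + indicator (collar D \<delta>) x *\<^sub>R weak_grad D u x)"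
      unfolding C'_def by (simp add: scaleR_diff_right)
    also have "\<dots> \<le> ?n' (\<lambda>x. indicator (collar D \<delta>) x *\<^sub>R (grad (\<psi> k) x - weak_grad D u x)) + C' \<delta> (weak_grad D u)"
      unfolding C'_def by (rule L2_fun_add(2)[OF Cind[OF d] Cind[OF U(1)]])
    also have "?n' (\<lambda>x. indicator (collar D \<delta>) x *\<^sub>R (grad (\<psi> k) x - weak_grad D u x)) \<le> b k"
      unfolding b_def using L2_fun_mult_bounded(2)[OF d im, of \<delta> 1] by (simp add: indicator_def)
    finally show ?thesis by simp
  qed
  have main: "\<exists>w\<in>H10 D. H1_norm D (\<lambda>x. w x - u x) \<le>
      (a k + (1 + 4 * sqrt K) * b k + 4 * sqrt (K * s k / \<delta>)) + (C \<delta> u + C' \<delta> (weak_grad D u) + 4 * sqrt K * C' (K * \<delta>) (weak_grad D u))"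
    if \<delta>: "0 < \<delta>" "\<delta> < \<delta>0" and k: "S k < \<top>" for \<delta> k
  proof -
    obtain \<zeta> where \<zeta>: "\<zeta> \<in> test_fun D" "\<And>x. 0 \<le> \<zeta> x" "\<And>x. \<zeta> x \<le> 1" "\<And>x. norm (grad \<zeta> x) \<le> 4 / \<delta>"
      "\<And>x. infdist x (- D) \<ge> \<delta> \<Longrightarrow> \<zeta> x = 1"
      using smooth_cutoff_exists[OF D \<delta>(1)] by blast
    note \<zeta>s = test_funD(1)[OF \<zeta>(1)]
    define w where "w x = \<psi> k x * \<zeta> x" for x
    have wt: "w \<in> test_fun D" unfolding w_def using test_fun_mult[OF \<psi> \<zeta>(1)] .
    note ws = test_funD(1)[OF wt]
    have wg: "grad w x = \<psi> k x *\<^sub>R grad \<zeta> x + \<zeta> x *\<^sub>R grad (\<psi> k) x" for x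
      unfolding w_def by (rule grad_mult[OF \<psi> \<zeta>s])
    have out: "\<zeta> x = 1 \<and> grad \<zeta> x = 0" if "x \<in> D" "x \<notin> collar D \<delta>" for x
    proof -
      have "\<zeta> x = 1" using that \<zeta>(5) by (auto simp: collar_def)
      then show ?thesis using grad_eq_0_at_max[OF \<zeta>s, of x] \<zeta>(3) by simp
    qed
    have inD: "AE x in vol D. x \<in> D" by (rule AE_I2) (simp add: space_restrict_space)
    have \<zeta>m: "\<zeta> \<in> borel_measurable (vol D)" "grad \<zeta> \<in> borel_measurable (vol D)"
      using smooth_L2_fun_vol[OF D \<zeta>s] L2_funD(1) by blast+
    have d\<psi>: "(\<lambda>x. \<psi> k x - u x) \<in> L2_fun (vol D)" using L2_fun_diff(1)[OF \<psi>L(1) U(3)] .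
    have dg: "(\<lambda>x. grad (\<psi> k) x - weak_grad D u x) \<in> L2_fun (vol D)" using L2_fun_diff(1)[OF \<psi>L(2) U(1)] .
    have cut: "(\<lambda>x. (\<zeta> x - 1) *\<^sub>R v x) \<in> L2_fun (vol D) \<and> L2_norm (vol D) (\<lambda>x. (\<zeta> x - 1) *\<^sub>R v x) \<le> L2_norm (vol D) (\<lambda>x. indicator (collar D \<delta>) x *\<^sub>R v x)"
      if v: "v \<in> L2_fun (vol D)" for v :: "'a \<Rightarrow> 'c::euclidean_space"
    proof -
      have 1: "(\<lambda>x. indicator (collar D \<delta>) x *\<^sub>R v x) \<in> L2_fun (vol D)"
        using L2_fun_mult_bounded(1)[OF v im, of \<delta> 1] by (simp add: indicator_def)
      have 2: "AE x in vol D. norm ((\<zeta> x - 1) *\<^sub>R v x) \<le> norm (indicator (collar D \<delta>) x *\<^sub>R v x)"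
        using inD
      proof eventually_elim
        case (elim x)
        show ?case
        proof (cases "x \<in> collar D \<delta>")
          case True
          have "\<bar>\<zeta> x - 1\<bar> \<le> 1" using \<zeta>(2,3)[of x] by auto
          then show ?thesis using True by (simp add: mult_left_le_one_le)
        qed (use out[OF elim] in simp)
      qed
      have "(\<lambda>x. (\<zeta> x - 1) *\<^sub>R v x) \<in> borel_measurable (vol D)" using \<zeta>m L2_funD(1)[OF v] by simp
      then show ?thesis using L2_fun_bound[OF 1 _ 2] by blast
    qed
    have \<zeta>b: "AE x in vol D. \<bar>\<zeta> x\<bar> \<le> 1" using \<zeta>(2,3) by simp
    have n1: "?n (\<lambda>x. w x - u x) \<le> a k + C \<delta> u"
    proof -
      note p = L2_fun_mult_bounded[OF d\<psi> \<zeta>m(1) \<zeta>b] and q = cut[OF U(3)]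
      have "(\<lambda>x. w x - u x) = (\<lambda>x. \<zeta> x *\<^sub>R (\<psi> k x - u x) + (\<zeta> x - 1) *\<^sub>R u x)"
        by (simp add: w_def algebra_simps)
      then have "?n (\<lambda>x. w x - u x) \<le> ?n (\<lambda>x. \<zeta> x *\<^sub>R (\<psi> k x - u x)) + ?n (\<lambda>x. (\<zeta> x - 1) *\<^sub>R u x)"
        using L2_fun_add(2)[OF p(1) conjunct1[OF q]] by simp
      then show ?thesis using p(2) q unfolding a_def C_def by simp
    qed
    have n2: "?n' (\<lambda>x. grad w x - weak_grad D u x) \<le> 4 * (C \<delta> (\<psi> k) / \<delta>) + b k + C' \<delta> (weak_grad D u)"
    proof -
      note p = L2_fun_mult_bounded[OF dg \<zeta>m(1) \<zeta>b] and q = cut[OF U(1)]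
      have C\<psi>: "(\<lambda>x. indicator (collar D \<delta>) x *\<^sub>R \<psi> k x) \<in> L2_fun (vol D)"
        using L2_fun_mult_bounded(1)[OF \<psi>L(1)[of k] im[of \<delta>], of 1] by (simp add: indicator_def)
      have rm: "(\<lambda>x. \<psi> k x *\<^sub>R grad \<zeta> x) \<in> borel_measurable (vol D)"
        using \<zeta>m L2_funD(1)[OF \<psi>L(1)] by simp
      have rb: "AE x in vol D. norm (\<psi> k x *\<^sub>R grad \<zeta> x) \<le> norm ((4 / \<delta>) *\<^sub>R (indicator (collar D \<delta>) x *\<^sub>R \<psi> k x))"
        using inD
      proof eventually_elim
        case (elim x)
        show ?case
        proof (cases "x \<in> collar D \<delta>")
          case True
          have "\<bar>\<psi> k x\<bar> * norm (grad \<zeta> x) \<le> \<bar>\<psi> k x\<bar> * (4 / \<delta>)" using \<zeta>(4) by (intro mult_left_mono) auto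
          then show ?thesis using True \<delta> by (simp add: mult.commute)
        qed (use out[OF elim] in simp)
      qed
      note r = L2_fun_bound[OF L2_fun_scaleR(1)[OF C\<psi>] rm rb]
      have rn: "?n' (\<lambda>x. \<psi> k x *\<^sub>R grad \<zeta> x) \<le> 4 * (C \<delta> (\<psi> k) / \<delta>)"
        using r(2) L2_fun_scaleR(2)[OF C\<psi>, of "4 / \<delta>"] \<delta> by (simp add: C_def)
      have "(\<lambda>x. grad w x - weak_grad D u x) = (\<lambda>x. \<psi> k x *\<^sub>R grad \<zeta> x + (\<zeta> x *\<^sub>R (grad (\<psi> k) x - weak_grad D u x) + (\<zeta> x - 1) *\<^sub>R weak_grad D u x))"
        unfolding wg by (simp add: algebra_simps)
      then have "?n' (\<lambda>x. grad w x - weak_grad D u x) \<le> ?n' (\<lambda>x. \<psi> k x *\<^sub>R grad \<zeta> x) +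
          (?n' (\<lambda>x. \<zeta> x *\<^sub>R (grad (\<psi> k) x - weak_grad D u x)) + ?n' (\<lambda>x. (\<zeta> x - 1) *\<^sub>R weak_grad D u x))"
        using L2_fun_add(2)[OF r(1) L2_fun_add(1)[OF p(1) conjunct1[OF q]]] L2_fun_add(2)[OF p(1) conjunct1[OF q]] by simp
      then show ?thesis using rn p(2) q unfolding b_def C'_def by simp
    qed
    have wH: "w \<in> H10 D" by (rule test_fun_H10[OF D wt])
    have "H1_norm D (\<lambda>x. w x - u x) \<le> ?n (\<lambda>x. w x - u x) + ?n' (weak_grad D (\<lambda>x. w x - u x))"
      unfolding H1_norm_def by (rule sqrt_sum_squares_le_sum) (auto simp: L2_norm_nonneg)
    also have "?n' (weak_grad D (\<lambda>x. w x - u x)) = ?n' (\<lambda>x. grad w x - weak_grad D u x)"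
      unfolding H1_diff(3)[OF D H10D(1)[OF wH] u]
      using smooth_H1(2)[OF D ws] L2_funD(1)[OF U(1)] L2_funD(1)[OF weak_grad_H1(1)[OF H10D(1)[OF wH]]] L2_funD(1)[OF smooth_L2_fun_vol(2)[OF D ws]]
      by (intro L2_norm_cong_AE) auto
    also have "?n (\<lambda>x. w x - u x) + ?n' (\<lambda>x. grad w x - weak_grad D u x) \<le> (a k + C \<delta> u) + (4 * (C \<delta> (\<psi> k) / \<delta>) + b k + C' \<delta> (weak_grad D u))"
      using n1 n2 by (rule add_mono)
    also have "\<dots> \<le> (a k + (1 + 4 * sqrt K) * b k + 4 * sqrt (K * s k / \<delta>)) + (C \<delta> u + C' \<delta> (weak_grad D u) + 4 * sqrt K * C' (K * \<delta>) (weak_grad D u))"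
    proof -
      have "sqrt K * C' (K * \<delta>) (grad (\<psi> k)) \<le> sqrt K * (b k + C' (K * \<delta>) (weak_grad D u))"
        using K(1) C'tri by (intro mult_left_mono) auto
      then have "sqrt K * C' (K * \<delta>) (grad (\<psi> k)) \<le> sqrt K * b k + sqrt K * C' (K * \<delta>) (weak_grad D u)"
        by (simp only: distrib_left)
      moreover have "(1 + 4 * sqrt K) * b k = b k + 4 * (sqrt K * b k)"
        "4 * sqrt K * C' (K * \<delta>) (weak_grad D u) = 4 * (sqrt K * C' (K * \<delta>) (weak_grad D u))"
        by (simp_all add: algebra_simps)
      ultimately show ?thesis using hardy[OF \<delta> k] by linarith
    qed
    finally show ?thesis using wH by blast
  qed
  \<comment> \<open>The order of choice matters: \<delta> makes the terms in \<open>u\<close> small,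
    and only afterwards is k taken large, since \<open>s k\<close> is divided by \<delta>.\<close>
  have "(\<lambda>m. C (1 / real (Suc m)) u + C' (1 / real (Suc m)) (weak_grad D u) + 4 * sqrt K * C' (K / real (Suc m)) (weak_grad D u)) \<longlonglongrightarrow> 0 + 0 + 4 * sqrt K * 0"
    unfolding C_def C'_def using K(1) U by (intro tendsto_intros L2_norm_collar_tendsto_0[OF D]) auto
  then have "\<forall>\<^sub>F m in sequentially. C (1 / real (Suc m)) u + C' (1 / real (Suc m)) (weak_grad D u) + 4 * sqrt K * C' (K / real (Suc m)) (weak_grad D u) < e / 2"
    by (rule order_tendstoD(2)) (use e in simp)
  moreover have "\<forall>\<^sub>F m in sequentially. 1 / real (Suc m) < \<delta>0"
    using order_tendstoD(2)[OF LIMSEQ_inverse_real_of_nat K(2)] by (simp add: inverse_eq_divide)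
  ultimately have "\<forall>\<^sub>F m in sequentially. C (1 / real (Suc m)) u + C' (1 / real (Suc m)) (weak_grad D u) + 4 * sqrt K * C' (K / real (Suc m)) (weak_grad D u) < e / 2 \<and> 1 / real (Suc m) < \<delta>0"
    by (rule eventually_conj)
  then obtain m where m: "C (1 / real (Suc m)) u + C' (1 / real (Suc m)) (weak_grad D u) + 4 * sqrt K * C' (K / real (Suc m)) (weak_grad D u) < e / 2" "1 / real (Suc m) < \<delta>0"
    unfolding eventually_sequentially by blast
  define \<delta> where "\<delta> = 1 / real (Suc m)"
  have \<delta>: "0 < \<delta>" "\<delta> < \<delta>0" using m by (auto simp: \<delta>_def)
  have m': "C \<delta> u + C' \<delta> (weak_grad D u) + 4 * sqrt K * C' (K * \<delta>) (weak_grad D u) < e / 2"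
    using m(1) by (simp add: \<delta>_def)
  have "(\<lambda>k. a k + (1 + 4 * sqrt K) * b k + 4 * sqrt (K * s k / \<delta>)) \<longlonglongrightarrow> 0 + (1 + 4 * sqrt K) * 0 + 4 * sqrt (K * 0 / \<delta>)"
    using \<delta> by (intro tendsto_intros ab s) auto
  then have "\<forall>\<^sub>F k in sequentially. a k + (1 + 4 * sqrt K) * b k + 4 * sqrt (K * s k / \<delta>) < e / 2"
    by (rule order_tendstoD(2)) (use e in simp)
  then have "\<forall>\<^sub>F k in sequentially. a k + (1 + 4 * sqrt K) * b k + 4 * sqrt (K * s k / \<delta>) < e / 2 \<and> S k < \<top>"
    using Sfin by (rule eventually_conj)
  then obtain k where k: "a k + (1 + 4 * sqrt K) * b k + 4 * sqrt (K * s k / \<delta>) < e / 2" "S k < \<top>"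
    unfolding eventually_sequentially by blast
  obtain w where "w \<in> H10 D" "H1_norm D (\<lambda>x. w x - u x) \<le>
      (a k + (1 + 4 * sqrt K) * b k + 4 * sqrt (K * s k / \<delta>)) + (C \<delta> u + C' \<delta> (weak_grad D u) + 4 * sqrt K * C' (K * \<delta>) (weak_grad D u))"
    using main[OF \<delta> k(2)] by blast
  moreover from this(2) have "H1_norm D (\<lambda>x. w x - u x) < e" using k(1) m' by linarith
  ultimately show "\<exists>w\<in>H10 D. H1_norm D (\<lambda>x. w x - u x) < e" by blast
qed

text \<open>Where h \<le> 0, the positive part of the k-th smooth approximant is at most its
  distance to h, so its boundary values tend to 0 in L2. The smoothed parts appear in the conclusion
  because strong measurability of the positive part is later obtained through them.\<close>

lemma trace_nonpos_imp_pos_part_H10: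
  fixes D :: "'a::euclidean_space set"
  assumes D: "open D" "bounded D" and lip: "lipschitz_boundary D"
    and tr: "has_trace D g h" and h: "AE x in surface_measure D. h x \<le> 0"
  shows "g \<in> smooth_closure D" "\<epsilon> > 0 \<Longrightarrow> (\<lambda>x. spos \<epsilon> (g x)) \<in> H10 D" "(\<lambda>x. max 0 (g x)) \<in> H10 D"
proof -
  obtain \<phi> where \<phi>: "\<And>k. smooth (\<phi> k)" "(\<lambda>k. H1_norm D (\<lambda>x. \<phi> k x - g x)) \<longlonglongrightarrow> 0"
    "(\<lambda>k. \<integral>\<^sup>+x. ennreal ((\<phi> k x - h x)\<^sup>2) \<partial>surface_measure D) \<longlonglongrightarrow> 0"
    using tr unfolding has_trace_def by blast
  show g: "g \<in> smooth_closure D"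
    using tr \<phi>(1,2) unfolding has_trace_def smooth_closure_def by blast
  show sp: "(\<lambda>x. spos \<epsilon> (g x)) \<in> H10 D" if \<epsilon>: "\<epsilon> > 0" for \<epsilon>
  proof (rule H10_if_boundary_values_vanish[OF D lip spos_smooth_closure(1)[OF D \<epsilon> g], where \<psi> = "\<lambda>k x. spos \<epsilon> (\<phi> k x)"])
    show "smooth (\<lambda>x. spos \<epsilon> (\<phi> k x))" for k by (rule smooth_spos[OF \<epsilon> \<phi>(1)])
    show "(\<lambda>k. H1_norm D (\<lambda>x. spos \<epsilon> (\<phi> k x) - spos \<epsilon> (g x))) \<longlonglongrightarrow> 0"
      by (rule spos_H1_continuous[OF D \<epsilon> g smooth_in_smooth_closure[OF D \<phi>(1)] \<phi>(2)])
    have "(\<integral>\<^sup>+x. ennreal ((spos \<epsilon> (\<phi> k x))\<^sup>2) \<partial>surface_measure D) \<le> (\<integral>\<^sup>+x. ennreal ((\<phi> k x - h x)\<^sup>2) \<partial>surface_measure D)" for k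
    proof (rule nn_integral_mono_AE)
      show "AE x in surface_measure D. ennreal ((spos \<epsilon> (\<phi> k x))\<^sup>2) \<le> ennreal ((\<phi> k x - h x)\<^sup>2)"
        using h
      proof eventually_elim
        case (elim x)
        have "\<bar>spos \<epsilon> (\<phi> k x)\<bar> \<le> \<bar>\<phi> k x - h x\<bar>" using spos_bounds(1,2)[OF \<epsilon>, of "\<phi> k x"] elim by auto
        then show ?case by (intro ennreal_leI) (simp add: abs_le_square_iff)
      qed
    qed
    then show "(\<lambda>k. \<integral>\<^sup>+x. ennreal ((spos \<epsilon> (\<phi> k x))\<^sup>2) \<partial>surface_measure D) \<longlonglongrightarrow> 0"
      by (intro tendsto_sandwich[OF _ _ tendsto_const \<phi>(3)]) auto
  qed
  note P = pos_part_smooth_closure[OF D g]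
  show "(\<lambda>x. max 0 (g x)) \<in> H10 D"
  proof (rule H10_closed[OF D P(1)])
    fix e :: real assume "e > 0"
    then obtain n where "H1_norm D (\<lambda>x. spos (1 / real (Suc n)) (g x) - max 0 (g x)) < e"
      using order_tendstoD(2)[OF P(2)] unfolding eventually_sequentially by blast
    then show "\<exists>v\<in>H10 D. H1_norm D (\<lambda>x. v x - max 0 (g x)) < e"
      using sp[of "1 / real (Suc n)"] by force
  qed
qed

section \<open>Strong measurability\<close>

text \<open>The properties of a seminorm in the form in which the measurability arguments use them,
  namely for the distance N(u - v) on X. Symmetry takes the place of homogeneity.\<close>

definition pseudo_normed :: "('a \<Rightarrow> real) set \<Rightarrow> (('a \<Rightarrow> real) \<Rightarrow> real) \<Rightarrow> bool" where
  "pseudo_normed X N \<longleftrightarrow> (\<forall>v. 0 \<le> N v) \<and> (\<forall>u\<in>X. \<forall>v\<in>X. N (\<lambda>x. u x - v x) = N (\<lambda>x. v x - u x)) \<and>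
     (\<forall>u\<in>X. \<forall>v\<in>X. \<forall>w\<in>X. N (\<lambda>x. u x - w x) \<le> N (\<lambda>x. u x - v x) + N (\<lambda>x. v x - w x))"


lemma pseudo_normed_abs_diff:
  assumes "pseudo_normed X N" "t \<in> X" "u \<in> X" "v \<in> X"
  shows "\<bar>N (\<lambda>x. t x - u x) - N (\<lambda>x. t x - v x)\<bar> \<le> N (\<lambda>x. u x - v x)"
proof -
  have "N (\<lambda>x. t x - u x) \<le> N (\<lambda>x. t x - v x) + N (\<lambda>x. v x - u x)"
    "N (\<lambda>x. t x - v x) \<le> N (\<lambda>x. t x - u x) + N (\<lambda>x. u x - v x)"
    "N (\<lambda>x. v x - u x) = N (\<lambda>x. u x - v x)"
    using assms unfolding pseudo_normed_def by blast+
  then show ?thesis by linarith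
qed

lemma pseudo_normed_tendsto:
  assumes N: "pseudo_normed X N" and t: "t \<in> X" "u \<in> X" "\<And>k. uk k \<in> X"
    and lim: "(\<lambda>k. N (\<lambda>x. uk k x - u x)) \<longlonglongrightarrow> 0"
  shows "(\<lambda>k. N (\<lambda>x. t x - uk k x)) \<longlonglongrightarrow> N (\<lambda>x. t x - u x)"
proof (rule LIM_zero_cancel, rule tendsto_rabs_zero_cancel, rule tendsto_sandwich[OF _ _ tendsto_const lim])
  show "\<forall>\<^sub>F k in sequentially. \<bar>N (\<lambda>x. t x - uk k x) - N (\<lambda>x. t x - u x)\<bar> \<le> N (\<lambda>x. uk k x - u x)"
    using pseudo_normed_abs_diff[OF N t(1) t(3) t(2)] by simp
qed simp

lemma strongly_measurable_dist:
  assumes N: "pseudo_normed X N" and u: "strongly_measurable M X N u" and t: "t \<in> X"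
  shows "(\<lambda>\<omega>. N (\<lambda>x. t x - u \<omega> x)) \<in> borel_measurable M"
proof -
  obtain s where s: "\<And>k. simple_function M (s k)" "\<And>k. s k ` space M \<subseteq> X"
    "\<And>\<omega>. \<omega> \<in> space M \<Longrightarrow> (\<lambda>k. N (\<lambda>x. s k \<omega> x - u \<omega> x)) \<longlonglongrightarrow> 0" and uX: "\<And>\<omega>. \<omega> \<in> space M \<Longrightarrow> u \<omega> \<in> X"
    using u unfolding strongly_measurable_def by blast
  show ?thesis
  proof (rule borel_measurable_LIMSEQ_real)
    show "(\<lambda>k. N (\<lambda>x. t x - s k \<omega> x)) \<longlonglongrightarrow> N (\<lambda>x. t x - u \<omega> x)" if "\<omega> \<in> space M" for \<omega>
      using s that uX t by (intro pseudo_normed_tendsto[OF N]) auto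
    show "(\<lambda>\<omega>. N (\<lambda>x. t x - s k \<omega> x)) \<in> borel_measurable M" for k
      using simple_function_compose[OF s(1)[of k], of "\<lambda>c. N (\<lambda>x. t x - c x)"]
      by (intro borel_measurable_simple_function) (simp add: comp_def)
  qed
qed

text \<open>A function into a set with a countable dense subset is approximated by the nearest among the first
  \<open>k\<close> points of that subset.\<close>

lemma strongly_measurable_if_dense:
  assumes u: "\<And>\<omega>. \<omega> \<in> space M \<Longrightarrow> u \<omega> \<in> X" and t: "\<And>i::nat. t i \<in> X" and N: "\<And>v. 0 \<le> N v"
    and m: "\<And>i. (\<lambda>\<omega>. N (\<lambda>x. t i x - u \<omega> x)) \<in> borel_measurable M"
    and dense: "\<And>\<omega> e. \<omega> \<in> space M \<Longrightarrow> 0 < e \<Longrightarrow> \<exists>i. N (\<lambda>x. t i x - u \<omega> x) < e"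
  shows "strongly_measurable M X N u"
proof -
  define d where "d i \<omega> = N (\<lambda>x. t i x - u \<omega> x)" for i \<omega>
  have [measurable]: "d i \<in> borel_measurable M" for i using m unfolding d_def .
  \<comment> \<open>Ties are broken by the least index, which keeps the selection of the nearest
    point measurable.\<close>
  define j where "j k \<omega> = (LEAST i. i \<le> k \<and> (\<forall>l\<in>{..k}. d i \<omega> \<le> d l \<omega>))" for k \<omega>
  have jm: "j k \<in> measurable M (count_space UNIV)" for k
    unfolding j_def by measurable
  have j: "j k \<omega> \<le> k \<and> (\<forall>l\<in>{..k}. d (j k \<omega>) \<omega> \<le> d l \<omega>)" for k \<omega>
  proof -
    let ?A = "(\<lambda>i. d i \<omega>) ` {..k}"
    have "Min ?A \<in> ?A" by (rule Min_in) auto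
    then obtain i where i: "Min ?A = d i \<omega>" "i \<in> {..k}" by (rule imageE)
    have "i \<le> k \<and> (\<forall>l\<in>{..k}. d i \<omega> \<le> d l \<omega>)" unfolding i(1)[symmetric] using i(2) by simp
    then show ?thesis unfolding j_def by (rule LeastI)
  qed
  have jk: "j k \<omega> \<le> k" for k \<omega> using conjunct1[OF j] .
  have js: "simple_function M (j k)" for k
    unfolding simple_function_def
  proof
    show "finite (j k ` space M)" by (rule finite_subset[of _ "{..k}"]) (use jk in auto)
    show "\<forall>i\<in>j k ` space M. j k -` {i} \<inter> space M \<in> sets M"
      using measurable_sets[OF jm] by simp
  qed
  show ?thesis unfolding strongly_measurable_def
  proof (intro conjI exI[of _ "\<lambda>k \<omega>. t (j k \<omega>)"] allI ballI u)
    show "simple_function M (\<lambda>\<omega>. t (j k \<omega>))" for k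
      using simple_function_compose[OF js[of k], of t] by (simp add: comp_def)
    show "(\<lambda>\<omega>. t (j k \<omega>)) ` space M \<subseteq> X" for k using t by auto
    fix \<omega> assume \<omega>: "\<omega> \<in> space M"
    show "(\<lambda>k. N (\<lambda>x. t (j k \<omega>) x - u \<omega> x)) \<longlonglongrightarrow> 0"
    proof (rule order_tendstoI)
      fix e :: real assume "0 < e"
      then obtain i where i: "d i \<omega> < e" using dense[OF \<omega>] unfolding d_def by blast
      show "\<forall>\<^sub>F k in sequentially. N (\<lambda>x. t (j k \<omega>) x - u \<omega> x) < e"
      proof (rule eventually_sequentiallyI[of i])
        fix k assume "i \<le> k"
        then have "d (j k \<omega>) \<omega> \<le> d i \<omega>" by (intro bspec[OF conjunct2[OF j]]) simp
        then show "N (\<lambda>x. t (j k \<omega>) x - u \<omega> x) < e" using i unfolding d_def by simp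
      qed
    qed (auto intro!: always_eventually less_le_trans[OF _ N])
  qed
qed

text \<open>The values of all simple approximants of all the \<open>uk\<close> form one countable
  set, and it is dense along the values of the limit.\<close>

lemma strongly_measurable_limit:
  assumes ne: "space M \<noteq> {}" and N: "pseudo_normed X N" and u: "\<And>k. strongly_measurable M X N (uk k)"
    and uX: "\<And>\<omega>. \<omega> \<in> space M \<Longrightarrow> u \<omega> \<in> X"
    and lim: "\<And>\<omega>. \<omega> \<in> space M \<Longrightarrow> (\<lambda>k. N (\<lambda>x. uk k \<omega> x - u \<omega> x)) \<longlonglongrightarrow> 0"
  shows "strongly_measurable M X N u"
proof -
  have "\<forall>k. \<exists>s. (\<forall>j. simple_function M (s j) \<and> s j ` space M \<subseteq> X) \<and>
      (\<forall>\<omega>\<in>space M. (\<lambda>j. N (\<lambda>x. s j \<omega> x - uk k \<omega> x)) \<longlonglongrightarrow> 0)"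
    using u unfolding strongly_measurable_def by blast
  from choice[OF this] obtain s where s: "\<And>k j. simple_function M (s k j)" "\<And>k j. s k j ` space M \<subseteq> X"
    "\<And>k \<omega>. \<omega> \<in> space M \<Longrightarrow> (\<lambda>j. N (\<lambda>x. s k j \<omega> x - uk k \<omega> x)) \<longlonglongrightarrow> 0" by blast
  have ukX: "uk k \<omega> \<in> X" if "\<omega> \<in> space M" for k \<omega> using u that unfolding strongly_measurable_def by blast
  define T where "T = (\<Union>k. \<Union>j. s k j ` space M)"
  have cT: "countable T" unfolding T_def
    using s(1) by (intro countable_UN) (auto simp: simple_function_def intro: countable_finite)
  have T: "T \<noteq> {}" "T \<subseteq> X" using ne s(2) unfolding T_def by blast+
  have tX: "from_nat_into T i \<in> X" for i using from_nat_into[OF T(1)] T(2) by blast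
  have N0: "0 \<le> N v" for v using N by (simp add: pseudo_normed_def)
  show ?thesis
  proof (rule strongly_measurable_if_dense[where t = "from_nat_into T", OF uX tX N0])
    show "(\<lambda>\<omega>. N (\<lambda>x. from_nat_into T i x - u \<omega> x)) \<in> borel_measurable M" for i
    proof (rule borel_measurable_LIMSEQ_real)
      show "(\<lambda>k. N (\<lambda>x. from_nat_into T i x - uk k \<omega> x)) \<longlonglongrightarrow> N (\<lambda>x. from_nat_into T i x - u \<omega> x)" if "\<omega> \<in> space M" for \<omega>
        by (rule pseudo_normed_tendsto[OF N tX uX[OF that] ukX[OF that] lim[OF that]])
      show "(\<lambda>\<omega>. N (\<lambda>x. from_nat_into T i x - uk k \<omega> x)) \<in> borel_measurable M" for k
        by (rule strongly_measurable_dist[OF N u tX])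
    qed
    fix \<omega> and e :: real assume \<omega>: "\<omega> \<in> space M" and e: "0 < e"
    obtain k where k: "N (\<lambda>x. uk k \<omega> x - u \<omega> x) < e / 2"
      using order_tendstoD(2)[OF lim[OF \<omega>], of "e / 2"] e unfolding eventually_sequentially by auto
    obtain j where j: "N (\<lambda>x. s k j \<omega> x - uk k \<omega> x) < e / 2"
      using order_tendstoD(2)[OF s(3)[OF \<omega>, of k], of "e / 2"] e unfolding eventually_sequentially by auto
    have sT: "s k j \<omega> \<in> T" using \<omega> unfolding T_def by blast
    then obtain i where i: "from_nat_into T i = s k j \<omega>" using from_nat_into_surj[OF cT] by blast
    have "N (\<lambda>x. s k j \<omega> x - u \<omega> x) \<le> N (\<lambda>x. s k j \<omega> x - uk k \<omega> x) + N (\<lambda>x. uk k \<omega> x - u \<omega> x)"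
      using N sT T(2) ukX[OF \<omega>] uX[OF \<omega>] unfolding pseudo_normed_def by blast
    then show "\<exists>i. N (\<lambda>x. from_nat_into T i x - u \<omega> x) < e"
      using i j k by (intro exI[of _ i]) simp
  qed
qed

text \<open>The given simple approximants may leave Y. For each of their countably many values and
  each tolerance, an element of Y within that tolerance is picked if there is one; the elements so
  picked are dense along \<open>u\<close>.\<close>

lemma strongly_measurable_range_subset:
  assumes ne: "space M \<noteq> {}" and N: "pseudo_normed X N" and u: "strongly_measurable M X N u"
    and Y: "Y \<subseteq> X" "\<And>\<omega>. \<omega> \<in> space M \<Longrightarrow> u \<omega> \<in> Y"
  shows "strongly_measurable M Y N u"
proof -
  obtain s where s: "\<And>k. simple_function M (s k)" "\<And>k. s k ` space M \<subseteq> X"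
    "\<And>\<omega>. \<omega> \<in> space M \<Longrightarrow> (\<lambda>k. N (\<lambda>x. s k \<omega> x - u \<omega> x)) \<longlonglongrightarrow> 0"
    using u unfolding strongly_measurable_def by blast
  have N0: "0 \<le> N v" for v using N by (simp add: pseudo_normed_def)
  obtain y0 where y0: "y0 \<in> Y" using ne Y(2) by blast
  \<comment> \<open>The default \<open>y0\<close> only keeps the countable set inside Y. For a value
    c within 1/(m+1) of some value of \<open>u\<close> the selection succeeds, that value itself
    being a candidate.\<close>
  define y where "y c m = (if \<exists>y\<in>Y. N (\<lambda>x. y x - c x) < 1 / real (Suc m)
     then SOME y. y \<in> Y \<and> N (\<lambda>x. y x - c x) < 1 / real (Suc m) else y0)" for c and m :: nat
  have yP: "y c m \<in> Y \<and> N (\<lambda>x. y c m x - c x) < 1 / real (Suc m)" if "\<exists>y\<in>Y. N (\<lambda>x. y x - c x) < 1 / real (Suc m)" for c m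
  proof -
    have "\<exists>y. y \<in> Y \<and> N (\<lambda>x. y x - c x) < 1 / real (Suc m)" using that by blast
    from someI_ex[OF this] show ?thesis using that unfolding y_def by simp
  qed
  have yY: "y c m \<in> Y" for c m using yP[of c m] y0 by (cases "\<exists>y\<in>Y. N (\<lambda>x. y x - c x) < 1 / real (Suc m)") (auto simp: y_def)
  define T where "T = (\<Union>k. \<Union>m. (\<lambda>c. y c m) ` (s k ` space M))"
  have cs: "countable (s k ` space M)" for k
    using s(1)[of k] by (simp add: simple_function_def countable_finite)
  have cT: "countable T" unfolding T_def
    by (intro countable_UN countableI_type countable_image[OF cs])
  have T: "T \<noteq> {}" "T \<subseteq> Y" using ne yY unfolding T_def by blast+
  have tY: "from_nat_into T i \<in> Y" for i using from_nat_into[OF T(1)] T(2) by blast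
  show ?thesis
  proof (rule strongly_measurable_if_dense[where t = "from_nat_into T", OF Y(2) tY N0])
    show "(\<lambda>\<omega>. N (\<lambda>x. from_nat_into T i x - u \<omega> x)) \<in> borel_measurable M" for i
      using tY Y(1) by (intro strongly_measurable_dist[OF N u]) blast
    fix \<omega> and e :: real assume \<omega>: "\<omega> \<in> space M" and e: "0 < e"
    obtain m where m: "1 / real (Suc m) < e / 2"
      using reals_Archimedean[of "e / 2"] e by (auto simp: inverse_eq_divide)
    obtain k where k: "N (\<lambda>x. s k \<omega> x - u \<omega> x) < 1 / real (Suc m)"
      using order_tendstoD(2)[OF s(3)[OF \<omega>], of "1 / real (Suc m)"] unfolding eventually_sequentially by auto
    let ?c = "s k \<omega>"
    have cX: "?c \<in> X" and uX: "u \<omega> \<in> X" using s(2) \<omega> Y by blast+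
    have "N (\<lambda>x. u \<omega> x - ?c x) = N (\<lambda>x. ?c x - u \<omega> x)" using N cX uX unfolding pseudo_normed_def by blast
    then have "\<exists>y\<in>Y. N (\<lambda>x. y x - ?c x) < 1 / real (Suc m)" using k Y(2)[OF \<omega>] by (intro bexI[of _ "u \<omega>"]) simp
    note yc = yP[OF this]
    have "y ?c m \<in> T" using \<omega> unfolding T_def by blast
    then obtain i where i: "from_nat_into T i = y ?c m" using from_nat_into_surj[OF cT] by blast
    have "N (\<lambda>x. y ?c m x - u \<omega> x) \<le> N (\<lambda>x. y ?c m x - ?c x) + N (\<lambda>x. ?c x - u \<omega> x)"
      using N cX uX yY Y(1) unfolding pseudo_normed_def by blast
    then show "\<exists>i. N (\<lambda>x. from_nat_into T i x - u \<omega> x) < e"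
      using i yc k m by (intro exI[of _ i]) simp
  qed
qed

text \<open>This allows exceptional events to be overwritten by a constant, as
  \<open>strongly_measurable\<close> asks for convergence at every \<omega>.\<close>

lemma strongly_measurable_restrict:
  assumes u: "strongly_measurable M X N u" and A: "A \<in> sets M" and z: "z \<in> X" "N (\<lambda>x. 0) = 0"
  shows "strongly_measurable M X N (\<lambda>\<omega>. if \<omega> \<in> A then u \<omega> else z)"
proof -
  obtain s where s: "\<And>k. simple_function M (s k)" "\<And>k. s k ` space M \<subseteq> X"
    "\<And>\<omega>. \<omega> \<in> space M \<Longrightarrow> (\<lambda>k. N (\<lambda>x. s k \<omega> x - u \<omega> x)) \<longlonglongrightarrow> 0" and uX: "\<And>\<omega>. \<omega> \<in> space M \<Longrightarrow> u \<omega> \<in> X"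
    using u unfolding strongly_measurable_def by blast
  show ?thesis unfolding strongly_measurable_def
  proof (intro conjI exI[of _ "\<lambda>k \<omega>. if \<omega> \<in> A then s k \<omega> else z"] allI ballI)
    show "simple_function M (\<lambda>\<omega>. if \<omega> \<in> A then s k \<omega> else z)" for k
      using A by (intro simple_function_If_set s(1) simple_function_const) (auto simp: sets.Int_space_eq2)
    show "(\<lambda>\<omega>. if \<omega> \<in> A then s k \<omega> else z) ` space M \<subseteq> X" for k using s(2)[of k] z by auto
    show "(\<lambda>k. N (\<lambda>x. (if \<omega> \<in> A then s k \<omega> else z) x - (if \<omega> \<in> A then u \<omega> else z) x)) \<longlonglongrightarrow> 0" if "\<omega> \<in> space M" for \<omega>
      using s(3)[OF that] z(2) by (cases "\<omega> \<in> A") auto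
  qed (use uX z in auto)
qed

lemma pseudo_normed_H10:
  assumes D: "open D" "bounded D"
  shows "pseudo_normed (H10 D) (H10_norm D)"
  unfolding pseudo_normed_def H10_norm_def
proof (intro conjI allI ballI L2_norm_nonneg)
  fix u v w assume "u \<in> H10 D" "v \<in> H10 D" "w \<in> H10 D"
  then have H: "u \<in> H1 D" "v \<in> H1 D" "w \<in> H1 D" by (auto dest: H10D(1))
  show "L2_norm (vol D) (weak_grad D (\<lambda>x. u x - w x)) \<le> L2_norm (vol D) (weak_grad D (\<lambda>x. u x - v x)) + L2_norm (vol D) (weak_grad D (\<lambda>x. v x - w x))"
    unfolding H1_diff(3)[OF D H(1,3)] H1_diff(3)[OF D H(1,2)] H1_diff(3)[OF D H(2,3)]
    by (rule L2_norm_triangle[OF H[THEN weak_grad_H1(1)]])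
next
  fix u v assume "u \<in> H10 D" "v \<in> H10 D"
  then have H: "u \<in> H1 D" "v \<in> H1 D" by (auto dest: H10D(1))
  show "L2_norm (vol D) (weak_grad D (\<lambda>x. u x - v x)) = L2_norm (vol D) (weak_grad D (\<lambda>x. v x - u x))"
    unfolding H1_diff(3)[OF D H] H1_diff(3)[OF D H(2,1)] by (rule L2_norm_diff_commute)
qed

lemma pseudo_normed_H1:
  assumes D: "open D" "bounded D"
  shows "pseudo_normed (H1 D) (H1_norm D)"
  unfolding pseudo_normed_def using H1_norm_nonneg H1_norm_commute[OF D] H1_norm_triangle[OF D] by blast

text \<open>By Poincare the increments are summable in L2 together with their gradients, and
  closedness of the weak gradient identifies the limit. As in \<open>L2_Riesz_Fischer\<close>, the
  limit function is supplied from outside.\<close>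

lemma H10_complete:
  fixes D :: "'a::euclidean_space set"
  assumes D: "open D" "bounded D" and w: "\<And>k. w k \<in> H10 D"
    and sm: "summable (\<lambda>k. H10_norm D (\<lambda>x. w (Suc k) x - w k x))"
  shows "AE x in vol D. convergent (\<lambda>k. w k x)"
    and "v \<in> borel_measurable (vol D) \<Longrightarrow> AE x in vol D. (\<lambda>k. w k x) \<longlonglongrightarrow> v x \<Longrightarrow>
      v \<in> H10 D \<and> (\<lambda>k. H10_norm D (\<lambda>x. w k x - v x)) \<longlonglongrightarrow> 0"
proof -
  note fin = finite_measure_vol[OF D]
  obtain C where C: "C > 0" "\<And>u. u \<in> H10 D \<Longrightarrow> L2_norm (vol D) u \<le> C * L2_norm (vol D) (weak_grad D u)"
    using poincare_H10[OF D] by blast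
  have wH: "w k \<in> H1 D" for k using w H10D(1) by blast
  note W = weak_grad_H1[OF wH]
  have dH: "(\<lambda>x. w (Suc k) x - w k x) \<in> H10 D" for k
    using H10_linear[OF D w[of "Suc k"] w[of k], of 1 "-1"] by simp
  have sm1: "summable (\<lambda>k. L2_norm (vol D) (\<lambda>x. w (Suc k) x - w k x))"
    by (rule summable_comparison_test'[OF summable_mult[OF sm, of C], of 0])
       (use C(2)[OF dH] in \<open>auto simp: L2_norm_nonneg H10_norm_def\<close>)
  have sm2: "summable (\<lambda>k. L2_norm (vol D) (\<lambda>x. weak_grad D (w (Suc k)) x - weak_grad D (w k) x))"
    using sm unfolding H10_norm_def H1_diff(3)[OF D wH wH] .
  show "AE x in vol D. convergent (\<lambda>k. w k x)" by (rule L2_Riesz_Fischer(1)[OF fin W(3) sm1])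
  assume v: "v \<in> borel_measurable (vol D)" and lim: "AE x in vol D. (\<lambda>k. w k x) \<longlonglongrightarrow> v x"
  have V: "v \<in> L2_fun (vol D)" "(\<lambda>k. L2_norm (vol D) (\<lambda>x. w k x - v x)) \<longlonglongrightarrow> 0"
    using L2_Riesz_Fischer(2)[OF fin W(3) sm1 v lim] by auto
  define G where "G x = lim (\<lambda>k. weak_grad D (w k) x)" for x
  have Gm: "G \<in> borel_measurable (vol D)" unfolding G_def
    using W(1) L2_funD(1) by (intro borel_measurable_lim_metric) blast
  have "AE x in vol D. (\<lambda>k. weak_grad D (w k) x) \<longlonglongrightarrow> G x"
    using L2_Riesz_Fischer(1)[OF fin W(1) sm2] unfolding G_def by eventually_elim (simp add: convergent_LIMSEQ_iff)
  then have G: "G \<in> L2_fun (vol D)" "(\<lambda>k. L2_norm (vol D) (\<lambda>x. weak_grad D (w k) x - G x)) \<longlonglongrightarrow> 0"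
    using L2_Riesz_Fischer(2)[OF fin W(1) sm2 Gm] by auto
  have wg: "has_weak_grad D v G" by (rule has_weak_grad_limit[OF D(1) V(1) W(3) V(2) G(1) W(1) G(2) W(2)])
  note vW = weak_grad_AE[OF D V(1) G(1) wg]
  have e: "L2_norm (vol D) (weak_grad D (\<lambda>x. w k x - v x)) = L2_norm (vol D) (\<lambda>x. weak_grad D (w k) x - G x)" for k
    unfolding H1_diff(3)[OF D wH vW(1)]
    using vW(2) L2_funD(1)[OF W(1)[of k]] L2_funD(1)[OF weak_grad_H1(1)[OF vW(1)]] Gm
    by (intro L2_norm_cong_AE) auto
  have h: "(\<lambda>k. H1_norm D (\<lambda>x. w k x - v x)) \<longlonglongrightarrow> 0"
    unfolding H1_norm_tendsto_0_iff e using V(2) G(2) by blast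
  have "v \<in> H10 D"
  proof (rule H10_closed[OF D vW(1)])
    fix e :: real assume "e > 0"
    then obtain k where "H1_norm D (\<lambda>x. w k x - v x) < e"
      using order_tendstoD(2)[OF h] unfolding eventually_sequentially by blast
    then show "\<exists>u\<in>H10 D. H1_norm D (\<lambda>x. u x - v x) < e" using w by blast
  qed
  then show "v \<in> H10 D \<and> (\<lambda>k. H10_norm D (\<lambda>x. w k x - v x)) \<longlonglongrightarrow> 0"
    unfolding H10_norm_def e using G(2) by blast
qed

section \<open>The space of random fields\<close>

locale random_fields = prob_space M for M :: "'w measure" +
  fixes D :: "'a::euclidean_space set"
  assumes open_D: "open D" and bounded_D: "bounded D"
begin

lemmas D = open_D bounded_D

sublocale vol: finite_measure "vol D" by (rule finite_measure_vol[OF D])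

sublocale P: pair_sigma_finite M "vol D" ..

abbreviation "V \<equiv> L2_H10 M D"

definition Vnorm :: "('w \<Rightarrow> 'a \<Rightarrow> real) \<Rightarrow> real" where
  "Vnorm u = L2_norm M (\<lambda>\<omega>. H10_norm D (u \<omega>))"

lemma L2_norm_measurable:
  assumes "case_prod h \<in> borel_measurable (M \<Otimes>\<^sub>M vol D)"
  shows "(\<lambda>\<omega>. L2_norm (vol D) (h \<omega>)) \<in> borel_measurable M"
proof -
  have [measurable]: "case_prod h \<in> borel_measurable (M \<Otimes>\<^sub>M vol D)" by fact
  show ?thesis unfolding L2_norm_def by measurable
qed

lemma H10_norm_nonneg: "H10_norm D v \<ge> 0"
  unfolding H10_norm_def by (rule L2_norm_nonneg)

lemma H10_norm_linear_le:
  assumes u: "u \<in> H10 D" and v: "v \<in> H10 D"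
  shows "H10_norm D (\<lambda>x. s * u x + t * v x) \<le> \<bar>s\<bar> * H10_norm D u + \<bar>t\<bar> * H10_norm D v"
proof -
  note U = weak_grad_H1[OF H10D(1)[OF u]] and W = weak_grad_H1[OF H10D(1)[OF v]]
  show ?thesis
    unfolding H10_norm_def H1_linear(3)[OF D H10D(1)[OF u] H10D(1)[OF v]]
    using L2_fun_add(2)[OF L2_fun_scaleR(1)[OF U(1), of s] L2_fun_scaleR(1)[OF W(1), of t]]
      L2_fun_scaleR(2)[OF U(1), of s] L2_fun_scaleR(2)[OF W(1), of t] by simp
qed

lemma H10_norm_zero: "H10_norm D (\<lambda>x. 0) = 0"
  unfolding H10_norm_def by (rule zero_H10(2)[OF D])

lemma H10_norm_measurable:
  assumes "strongly_measurable M (H10 D) (H10_norm D) u"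
  shows "(\<lambda>\<omega>. H10_norm D (u \<omega>)) \<in> borel_measurable M"
proof -
  have "(\<lambda>\<omega>. H10_norm D (\<lambda>x. 0 - u \<omega> x)) \<in> borel_measurable M"
    by (rule strongly_measurable_dist[OF pseudo_normed_H10[OF D] assms zero_H10(1)[OF D]])
  moreover have "H10_norm D (\<lambda>x. 0 - u \<omega> x) = H10_norm D (u \<omega>)" if "\<omega> \<in> space M" for \<omega>
  proof -
    have "u \<omega> \<in> H10 D" using assms that by (simp add: strongly_measurable_def)
    then have "H10_norm D (\<lambda>x. 0 - u \<omega> x) = H10_norm D (\<lambda>x. u \<omega> x - 0)"
      using pseudo_normed_H10[OF D, unfolded pseudo_normed_def, THEN conjunct2, THEN conjunct1,
          rule_format, of "\<lambda>x. 0" "u \<omega>"] zero_H10(1)[OF D] by simp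
    then show ?thesis by simp
  qed
  ultimately show ?thesis by (simp cong: measurable_cong)
qed

lemma V_I:
  assumes "case_prod u \<in> borel_measurable (M \<Otimes>\<^sub>M vol D)" "strongly_measurable M (H10 D) (H10_norm D) u"
    "h \<in> L2_fun M" "AE \<omega> in M. H10_norm D (u \<omega>) \<le> h \<omega>"
  shows "u \<in> V"
proof -
  have "(\<lambda>\<omega>. H10_norm D (u \<omega>)) \<in> L2_fun M"
    by (rule L2_fun_bound(1)[OF assms(3) H10_norm_measurable[OF assms(2)]])
       (use assms(4) in \<open>auto simp: H10_norm_nonneg elim!: eventually_mono\<close>)
  then show ?thesis using assms unfolding L2_H10_def bochner_L2_def by (auto simp: L2_fun_def)
qed

lemma V_D:
  assumes "u \<in> V"
  shows "case_prod u \<in> borel_measurable (M \<Otimes>\<^sub>M vol D)" "strongly_measurable M (H10 D) (H10_norm D) u"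
    "\<omega> \<in> space M \<Longrightarrow> u \<omega> \<in> H10 D" "(\<lambda>\<omega>. H10_norm D (u \<omega>)) \<in> L2_fun M"
proof -
  show 1: "case_prod u \<in> borel_measurable (M \<Otimes>\<^sub>M vol D)" and 2: "strongly_measurable M (H10 D) (H10_norm D) u"
    using assms unfolding L2_H10_def bochner_L2_def by auto
  show "\<omega> \<in> space M \<Longrightarrow> u \<omega> \<in> H10 D" using 2 by (simp add: strongly_measurable_def)
  show "(\<lambda>\<omega>. H10_norm D (u \<omega>)) \<in> L2_fun M"
    using assms H10_norm_measurable[OF 2] unfolding L2_H10_def bochner_L2_def L2_fun_def by auto
qed

lemma strongly_measurable_H10_linear:
  assumes U: "strongly_measurable M (H10 D) (H10_norm D) u" and W: "strongly_measurable M (H10 D) (H10_norm D) v"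
  shows "strongly_measurable M (H10 D) (H10_norm D) (\<lambda>\<omega> x. s * u \<omega> x + t * v \<omega> x)"
proof -
  have uH: "u \<omega> \<in> H10 D" and vH: "v \<omega> \<in> H10 D" if "\<omega> \<in> space M" for \<omega>
    using U W that by (auto simp: strongly_measurable_def)
  obtain p where p: "\<And>k. simple_function M (p k)" "\<And>k. p k ` space M \<subseteq> H10 D"
    "\<And>\<omega>. \<omega> \<in> space M \<Longrightarrow> (\<lambda>k. H10_norm D (\<lambda>x. p k \<omega> x - u \<omega> x)) \<longlonglongrightarrow> 0"
    using U unfolding strongly_measurable_def by blast
  obtain q where q: "\<And>k. simple_function M (q k)" "\<And>k. q k ` space M \<subseteq> H10 D"
    "\<And>\<omega>. \<omega> \<in> space M \<Longrightarrow> (\<lambda>k. H10_norm D (\<lambda>x. q k \<omega> x - v \<omega> x)) \<longlonglongrightarrow> 0"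
    using W unfolding strongly_measurable_def by blast
  show ?thesis
    unfolding strongly_measurable_def
  proof (intro conjI exI[of _ "\<lambda>k \<omega> x. s * p k \<omega> x + t * q k \<omega> x"] allI ballI)
    show "(\<lambda>x. s * u \<omega> x + t * v \<omega> x) \<in> H10 D" if "\<omega> \<in> space M" for \<omega>
      using uH vH that by (intro H10_linear[OF D])
    show "simple_function M (\<lambda>\<omega> x. s * p k \<omega> x + t * q k \<omega> x)" for k
      by (rule simple_function_compose2[OF p(1) q(1), of "\<lambda>a b x. s * a x + t * b x"])
    show "(\<lambda>\<omega> x. s * p k \<omega> x + t * q k \<omega> x) ` space M \<subseteq> H10 D" for k
    proof
      fix y assume "y \<in> (\<lambda>\<omega> x. s * p k \<omega> x + t * q k \<omega> x) ` space M"
      then obtain \<omega> where \<omega>: "\<omega> \<in> space M" "y = (\<lambda>x. s * p k \<omega> x + t * q k \<omega> x)" by blast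
      have "p k \<omega> \<in> H10 D" "q k \<omega> \<in> H10 D" using p(2) q(2) \<omega>(1) by blast+
      then show "y \<in> H10 D" unfolding \<omega>(2) by (rule H10_linear[OF D])
    qed
    fix \<omega> assume \<omega>: "\<omega> \<in> space M"
    show "(\<lambda>k. H10_norm D (\<lambda>x. s * p k \<omega> x + t * q k \<omega> x - (s * u \<omega> x + t * v \<omega> x))) \<longlonglongrightarrow> 0"
    proof (rule tendsto_sandwich[OF _ _ tendsto_const])
      have "(\<lambda>k. \<bar>s\<bar> * H10_norm D (\<lambda>x. p k \<omega> x - u \<omega> x) + \<bar>t\<bar> * H10_norm D (\<lambda>x. q k \<omega> x - v \<omega> x)) \<longlonglongrightarrow> \<bar>s\<bar> * 0 + \<bar>t\<bar> * 0"
        by (intro tendsto_intros p(3) q(3) \<omega>)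
      then show "(\<lambda>k. \<bar>s\<bar> * H10_norm D (\<lambda>x. p k \<omega> x - u \<omega> x) + \<bar>t\<bar> * H10_norm D (\<lambda>x. q k \<omega> x - v \<omega> x)) \<longlonglongrightarrow> 0" by simp
      have "H10_norm D (\<lambda>x. s * p k \<omega> x + t * q k \<omega> x - (s * u \<omega> x + t * v \<omega> x))
        \<le> \<bar>s\<bar> * H10_norm D (\<lambda>x. p k \<omega> x - u \<omega> x) + \<bar>t\<bar> * H10_norm D (\<lambda>x. q k \<omega> x - v \<omega> x)" for k
      proof -
        have pk: "p k \<omega> \<in> H10 D" "q k \<omega> \<in> H10 D" using p(2) q(2) \<omega> by blast+
        have a: "(\<lambda>x. p k \<omega> x - u \<omega> x) \<in> H10 D" using H10_linear[OF D pk(1) uH[OF \<omega>], of 1 "-1"] by simp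
        have b: "(\<lambda>x. q k \<omega> x - v \<omega> x) \<in> H10 D" using H10_linear[OF D pk(2) vH[OF \<omega>], of 1 "-1"] by simp
        show ?thesis using H10_norm_linear_le[OF a b, of s t] by (simp add: algebra_simps)
      qed
      then show "\<forall>\<^sub>F k in sequentially. H10_norm D (\<lambda>x. s * p k \<omega> x + t * q k \<omega> x - (s * u \<omega> x + t * v \<omega> x))
        \<le> \<bar>s\<bar> * H10_norm D (\<lambda>x. p k \<omega> x - u \<omega> x) + \<bar>t\<bar> * H10_norm D (\<lambda>x. q k \<omega> x - v \<omega> x)" by simp
    qed (simp add: H10_norm_nonneg)
  qed
qed

lemma V_linear:
  assumes u: "u \<in> V" and v: "v \<in> V"
  shows "(\<lambda>\<omega> x. s * u \<omega> x + t * v \<omega> x) \<in> V" "Vnorm (\<lambda>\<omega> x. s * u \<omega> x + t * v \<omega> x) \<le> \<bar>s\<bar> * Vnorm u + \<bar>t\<bar> * Vnorm v"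
proof -
  note U = V_D[OF u] and W = V_D[OF v]
  let ?w = "\<lambda>\<omega> x. s * u \<omega> x + t * v \<omega> x"
  have m: "case_prod ?w \<in> borel_measurable (M \<Otimes>\<^sub>M vol D)"
  proof -
    have [measurable]: "(\<lambda>p. u (fst p) (snd p)) \<in> borel_measurable (M \<Otimes>\<^sub>M vol D)" "(\<lambda>p. v (fst p) (snd p)) \<in> borel_measurable (M \<Otimes>\<^sub>M vol D)"
      using U(1) W(1) by (simp_all add: case_prod_beta')
    show ?thesis unfolding case_prod_beta' by measurable
  qed
  note sm = strongly_measurable_H10_linear[OF U(2) W(2), of s t]
  let ?h = "\<lambda>\<omega>. \<bar>s\<bar> * H10_norm D (u \<omega>) + \<bar>t\<bar> * H10_norm D (v \<omega>)"
  note su = L2_fun_scaleR[OF U(4), of "\<bar>s\<bar>"] and tv = L2_fun_scaleR[OF W(4), of "\<bar>t\<bar>"]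
  note h = L2_fun_add[OF su(1) tv(1)]
  have h1: "?h \<in> L2_fun M" "L2_norm M ?h \<le> \<bar>s\<bar> * Vnorm u + \<bar>t\<bar> * Vnorm v"
    using h su(2) tv(2) unfolding Vnorm_def by simp_all
  have le: "AE \<omega> in M. H10_norm D (?w \<omega>) \<le> ?h \<omega>"
    using H10_norm_linear_le[OF U(3) W(3)] by (intro AE_I2) auto
  show wV: "?w \<in> V" by (rule V_I[OF m sm h1(1) le])
  have "AE \<omega> in M. norm (H10_norm D (?w \<omega>)) \<le> norm (?h \<omega>)"
    using le by eventually_elim (simp add: H10_norm_nonneg)
  then have "Vnorm ?w \<le> L2_norm M ?h"
    unfolding Vnorm_def by (rule L2_fun_bound(2)[OF h1(1) L2_funD(1)[OF V_D(4)[OF wV]]])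
  then show "Vnorm ?w \<le> \<bar>s\<bar> * Vnorm u + \<bar>t\<bar> * Vnorm v" using h1(2) by simp
qed

lemma V_diff: "u \<in> V \<Longrightarrow> v \<in> V \<Longrightarrow> (\<lambda>\<omega> x. u \<omega> x - v \<omega> x) \<in> V"
  using V_linear(1)[of u v 1 "-1"] by simp

lemma Vnorm_nonneg: "Vnorm u \<ge> 0"
  unfolding Vnorm_def by (rule L2_norm_nonneg)

lemma section_measurable:
  assumes "case_prod h \<in> borel_measurable (M \<Otimes>\<^sub>M vol D)" "\<omega> \<in> space M"
  shows "h \<omega> \<in> borel_measurable (vol D)"
  using measurable_Pair2[OF assms] by simp

text \<open>For almost every \<omega> the increments are summable in \<open>H10 D\<close>, so the
  pointwise limit is a single jointly measurable field whose paths are limits in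
  \<open>H10 D\<close>; Fatou in \<omega> gives the convergence in \<open>V\<close>. The convergence
  almost everywhere is recorded because closedness of the obstacle set is read off from it.\<close>

lemma V_complete:
  assumes u: "\<And>k. u k \<in> V" and sm: "summable (\<lambda>k. Vnorm (\<lambda>\<omega> x. u (Suc k) \<omega> x - u k \<omega> x))"
  obtains v where "v \<in> V" "(\<lambda>k. Vnorm (\<lambda>\<omega> x. u k \<omega> x - v \<omega> x)) \<longlonglongrightarrow> 0"
    "AE \<omega> in M. AE x in vol D. (\<lambda>k. u k \<omega> x) \<longlonglongrightarrow> v \<omega> x"
proof -
  note U = V_D[OF u]
  define n where "n k \<omega> = H10_norm D (\<lambda>x. u (Suc k) \<omega> x - u k \<omega> x)" for k \<omega>
  have nL: "n k \<in> L2_fun M" and nV: "L2_norm M (n k) = Vnorm (\<lambda>\<omega> x. u (Suc k) \<omega> x - u k \<omega> x)" for k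
    using V_D(4)[OF V_diff[OF u u]] unfolding n_def Vnorm_def by auto
  have [measurable]: "n k \<in> borel_measurable M" for k using nL L2_funD(1) by blast
  have n0: "n k \<omega> \<ge> 0" for k \<omega> unfolding n_def by (rule H10_norm_nonneg)
  define A where "A = {\<omega> \<in> space M. (\<Sum>k. ennreal (n k \<omega>)) \<noteq> \<top>}"
  have A[measurable]: "A \<in> sets M" unfolding A_def by measurable
  have AE_A: "AE \<omega> in M. \<omega> \<in> A"
  proof -
    have "(\<integral>\<^sup>+\<omega>. (\<Sum>k. ennreal (n k \<omega>)) \<partial>M) = (\<Sum>k. \<integral>\<^sup>+\<omega>. ennreal (n k \<omega>) \<partial>M)"
      by (intro nn_integral_suminf) measurable
    also have "\<dots> = (\<Sum>k. ennreal (\<integral>\<omega>. n k \<omega> \<partial>M))"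
      using L2_fun_integrable(1)[OF finite_measure_axioms nL] n0 by (intro suminf_cong nn_integral_eq_integral) auto
    also have "\<dots> \<le> (\<Sum>k. ennreal (Vnorm (\<lambda>\<omega> x. u (Suc k) \<omega> x - u k \<omega> x)))"
    proof (intro suminf_le ennreal_leI)
      show "(\<integral>\<omega>. n k \<omega> \<partial>M) \<le> Vnorm (\<lambda>\<omega> x. u (Suc k) \<omega> x - u k \<omega> x)" for k
        using L2_fun_integrable(2)[OF finite_measure_axioms nL[of k]] n0 by (simp add: prob_space nV)
    qed auto
    also have "\<dots> < \<top>" using sm by (subst suminf_ennreal2) (auto simp: Vnorm_nonneg)
    finally have "AE \<omega> in M. (\<Sum>k. ennreal (n k \<omega>)) \<noteq> \<top>"
      by (intro nn_integral_PInf_AE[unfolded infinity_ennreal_def]) auto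
    then show ?thesis using AE_space by eventually_elim (auto simp: A_def)
  qed
  have smA: "summable (\<lambda>k. n k \<omega>)" if "\<omega> \<in> A" for \<omega>
    using that n0 unfolding A_def by (intro summable_suminf_not_top) auto
  \<comment> \<open>\<open>lim\<close> is measurable even where the sequence diverges, so this field
    is jointly measurable. The value 0 off \<open>A\<close> makes every path a member of
    \<open>H10 D\<close>.\<close>
  define v where "v \<omega> x = (if \<omega> \<in> A then lim (\<lambda>k. u k \<omega> x) else 0)" for \<omega> x
  have um [measurable]: "(\<lambda>p. u k (fst p) (snd p)) \<in> borel_measurable (M \<Otimes>\<^sub>M vol D)" for k
    using U(1)[of k] by (simp add: case_prod_beta')
  have vm: "case_prod v \<in> borel_measurable (M \<Otimes>\<^sub>M vol D)"
    unfolding case_prod_beta' v_def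
    by (intro measurable_If borel_measurable_lim_metric um) measurable
  have AM: "A \<subseteq> space M" by (auto simp: A_def)
  have good: "AE x in vol D. (\<lambda>k. u k \<omega> x) \<longlonglongrightarrow> v \<omega> x" "v \<omega> \<in> H10 D" "(\<lambda>k. H10_norm D (\<lambda>x. u k \<omega> x - v \<omega> x)) \<longlonglongrightarrow> 0" if \<omega>: "\<omega> \<in> A" for \<omega>
  proof -
    have uH: "u k \<omega> \<in> H10 D" for k using U(3) \<omega> AM by blast
    note H = H10_complete[OF D uH smA[OF \<omega>, unfolded n_def]]
    show l: "AE x in vol D. (\<lambda>k. u k \<omega> x) \<longlonglongrightarrow> v \<omega> x"
      using H(1) by eventually_elim (simp add: v_def \<omega> convergent_LIMSEQ_iff)
    have "v \<omega> \<in> borel_measurable (vol D)" using section_measurable[OF vm] \<omega> AM by blast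
    from H(2)[OF this l] show "v \<omega> \<in> H10 D" "(\<lambda>k. H10_norm D (\<lambda>x. u k \<omega> x - v \<omega> x)) \<longlonglongrightarrow> 0" by auto
  qed
  have bad: "v \<omega> = (\<lambda>x. 0)" if "\<omega> \<notin> A" for \<omega> using that by (auto simp: v_def)
  \<comment> \<open>Overwriting off \<open>A\<close> makes the paths converge at every \<omega>, not
    just at almost every one.\<close>
  define u' where "u' k \<omega> = (if \<omega> \<in> A then u k \<omega> else (\<lambda>x. 0))" for k \<omega>
  have vs: "strongly_measurable M (H10 D) (H10_norm D) v"
  proof (rule strongly_measurable_limit[OF not_empty pseudo_normed_H10[OF D]])
    show "strongly_measurable M (H10 D) (H10_norm D) (u' k)" for k
      unfolding u'_def by (rule strongly_measurable_restrict[OF U(2) A zero_H10(1)[OF D] H10_norm_zero])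
    show "v \<omega> \<in> H10 D" if "\<omega> \<in> space M" for \<omega>
      using good(2) bad zero_H10(1)[OF D] by (cases "\<omega> \<in> A") auto
    show "(\<lambda>k. H10_norm D (\<lambda>x. u' k \<omega> x - v \<omega> x)) \<longlonglongrightarrow> 0" if "\<omega> \<in> space M" for \<omega>
      using good(3)[of \<omega>] bad[of \<omega>] H10_norm_zero by (cases "\<omega> \<in> A") (auto simp: u'_def)
  qed
  let ?t = "\<lambda>k. Vnorm (\<lambda>\<omega> x. u (Suc k) \<omega> x - u k \<omega> x)"
  have ts: "summable (\<lambda>i. ?t (i + k))" for k using summable_ignore_initial_segment[OF sm] .
  have tel: "Vnorm (\<lambda>\<omega> x. u j \<omega> x - u k \<omega> x) \<le> (\<Sum>i=k..<j. ?t i)" if "k \<le> j" for k j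
    using that
  proof (induction j rule: dec_induct)
    case base
    then show ?case by (simp add: Vnorm_def H10_norm_zero L2_norm_zero)
  next
    case (step j)
    have "Vnorm (\<lambda>\<omega> x. u (Suc j) \<omega> x - u k \<omega> x) \<le> ?t j + Vnorm (\<lambda>\<omega> x. u j \<omega> x - u k \<omega> x)"
      using V_linear(2)[OF V_diff[OF u[of "Suc j"] u[of j]] V_diff[OF u[of j] u[of k]], of 1 1] by simp
    then show ?case using step by simp
  qed
  have tail: "(\<lambda>\<omega>. H10_norm D (\<lambda>x. u k \<omega> x - v \<omega> x)) \<in> L2_fun M \<and> Vnorm (\<lambda>\<omega> x. u k \<omega> x - v \<omega> x) \<le> (\<Sum>i. ?t (i + k))" for k
  proof -
    let ?h = "\<lambda>j \<omega>. H10_norm D (\<lambda>x. u k \<omega> x - u j \<omega> x)"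
    have hL: "?h j \<in> L2_fun M" for j using V_D(4)[OF V_diff[OF u u]] .
    have "\<forall>\<^sub>F j in sequentially. L2_norm M (?h j) \<le> (\<Sum>i. ?t (i + k))"
    proof (rule eventually_sequentiallyI[of k])
      fix j assume "k \<le> j"
      have "L2_norm M (?h j) = Vnorm (\<lambda>\<omega> x. u k \<omega> x - u j \<omega> x)" by (simp add: Vnorm_def)
      also have "\<dots> \<le> Vnorm (\<lambda>\<omega> x. u j \<omega> x - u k \<omega> x)"
        using V_linear(2)[OF V_diff[OF u[of j] u[of k]] V_diff[OF u[of j] u[of k]], of "-1" 0] by simp
      also have "\<dots> \<le> (\<Sum>i=k..<j. ?t i)" by (rule tel[OF \<open>k \<le> j\<close>])
      also have "\<dots> = (\<Sum>i<j-k. ?t (i + k))"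
        using sum.shift_bounds_nat_ivl[of ?t 0 k "j - k"] \<open>k \<le> j\<close> by (simp add: atLeast0LessThan)
      also have "\<dots> \<le> (\<Sum>i. ?t (i + k))"
        using ts[of k] by (intro sum_le_suminf) (auto simp: Vnorm_nonneg)
      finally show "L2_norm M (?h j) \<le> (\<Sum>i. ?t (i + k))" .
    qed
    moreover have "AE \<omega> in M. (\<lambda>j. ?h j \<omega>) \<longlonglongrightarrow> H10_norm D (\<lambda>x. u k \<omega> x - v \<omega> x)"
      using AE_A
    proof eventually_elim
      case (elim \<omega>)
      show ?case
        using elim AM U(3) good[OF elim] by (intro pseudo_normed_tendsto[OF pseudo_normed_H10[OF D]]) auto
    qed
    moreover have "(\<lambda>\<omega>. H10_norm D (\<lambda>x. u k \<omega> x - v \<omega> x)) \<in> borel_measurable M"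
    proof (rule H10_norm_measurable)
      show "strongly_measurable M (H10 D) (H10_norm D) (\<lambda>\<omega> x. u k \<omega> x - v \<omega> x)"
        using strongly_measurable_H10_linear[OF U(2)[of k] vs, of 1 "-1"] by simp
    qed
    ultimately show ?thesis
      unfolding Vnorm_def using L2_norm_liminf_le[where hk = ?h and h = "\<lambda>\<omega>. H10_norm D (\<lambda>x. u k \<omega> x - v \<omega> x)", OF hL] by blast
  qed
  have vV: "v \<in> V"
  proof (rule V_I[OF vm vs])
    show "(\<lambda>\<omega>. H10_norm D (u 0 \<omega>) + H10_norm D (\<lambda>x. u 0 \<omega> x - v \<omega> x)) \<in> L2_fun M"
      using L2_fun_add(1)[OF U(4)[of 0] conjunct1[OF tail[of 0]]] .
    show "AE \<omega> in M. H10_norm D (v \<omega>) \<le> H10_norm D (u 0 \<omega>) + H10_norm D (\<lambda>x. u 0 \<omega> x - v \<omega> x)"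
      using AE_A
    proof eventually_elim
      case (elim \<omega>)
      have a: "u 0 \<omega> \<in> H10 D" using U(3) elim AM by blast
      have b: "(\<lambda>x. u 0 \<omega> x - v \<omega> x) \<in> H10 D" using H10_linear[OF D a good(2)[OF elim], of 1 "-1"] by simp
      show ?case using H10_norm_linear_le[OF a b, of 1 "-1"] by simp
    qed
  qed
  have "(\<lambda>k. Vnorm (\<lambda>\<omega> x. u k \<omega> x - v \<omega> x)) \<longlonglongrightarrow> 0"
    by (rule tendsto_sandwich[OF _ _ tendsto_const suminf_exist_split2[OF sm]])
       (use tail in \<open>auto simp: Vnorm_nonneg\<close>)
  moreover have "AE \<omega> in M. AE x in vol D. (\<lambda>k. u k \<omega> x) \<longlonglongrightarrow> v \<omega> x"
    using AE_A by eventually_elim (rule good(1))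
  ultimately show ?thesis using that[OF vV] by blast
qed

end

section \<open>Weighted energies along paths and their measurability\<close>

lemma Linf_fun_AE_bound:
  assumes "h \<in> Linf_fun \<mu>"
  obtains B where "B \<ge> 0" "AE x in \<mu>. \<bar>h x\<bar> \<le> B" "h \<in> borel_measurable \<mu>"
proof -
  have m: "h \<in> borel_measurable \<mu>" and fin: "esssup \<mu> (\<lambda>x. ereal \<bar>h x\<bar>) < \<infinity>"
    using assms by (auto simp: Linf_fun_def)
  let ?S = "esssup \<mu> (\<lambda>x. ereal \<bar>h x\<bar>)"
  have "AE x in \<mu>. ereal \<bar>h x\<bar> \<le> ?S" using m by (intro esssup_AE)
  then have "AE x in \<mu>. \<bar>h x\<bar> \<le> max 0 (real_of_ereal ?S)"
  proof eventually_elim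
    case (elim x)
    then show ?case using fin by (cases ?S) auto
  qed
  then show ?thesis using that[of "max 0 (real_of_ereal ?S)"] m by simp
qed

lemma weighted_inner:
  fixes G H :: "'a \<Rightarrow> 'b::euclidean_space"
  assumes b: "b \<in> borel_measurable \<mu>" "AE x in \<mu>. \<bar>b x\<bar> \<le> B" and G: "G \<in> L2_fun \<mu>" and H: "H \<in> L2_fun \<mu>"
  shows "integrable \<mu> (\<lambda>x. b x * (G x \<bullet> H x))" "\<bar>\<integral>x. b x * (G x \<bullet> H x) \<partial>\<mu>\<bar> \<le> \<bar>B\<bar> * L2_norm \<mu> G * L2_norm \<mu> H"
proof -
  note bG = L2_fun_mult_bounded[OF G b]
  show "integrable \<mu> (\<lambda>x. b x * (G x \<bullet> H x))" using L2_fun_integrable_prod(2)[OF bG(1) H] by simp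
  have "\<bar>\<integral>x. b x * (G x \<bullet> H x) \<partial>\<mu>\<bar> \<le> L2_norm \<mu> (\<lambda>x. b x *\<^sub>R G x) * L2_norm \<mu> H"
    using L2_inner_le[OF bG(1) H] by simp
  also have "\<dots> \<le> \<bar>B\<bar> * L2_norm \<mu> G * L2_norm \<mu> H"
    using bG(2) by (intro mult_right_mono) (auto simp: L2_norm_nonneg)
  finally show "\<bar>\<integral>x. b x * (G x \<bullet> H x) \<partial>\<mu>\<bar> \<le> \<bar>B\<bar> * L2_norm \<mu> G * L2_norm \<mu> H" .
qed

context random_fields
begin

definition energy :: "('a \<Rightarrow> real) \<Rightarrow> ('a \<Rightarrow> real) \<Rightarrow> ('a \<Rightarrow> real) \<Rightarrow> real" where
  "energy b p q = (\<integral>x. b x * (weak_grad D p x \<bullet> weak_grad D q x) \<partial>vol D)"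

lemma bilin_form_eq: "bilin_form M D a u v = (\<integral>\<omega>. energy (a \<omega>) (u \<omega>) (v \<omega>) \<partial>M)"
  by (simp add: bilin_form_def energy_def)

lemma energy_commute: "energy b p q = energy b q p"
  by (simp add: energy_def inner_commute)

lemma energy_bound:
  assumes b: "b \<in> borel_measurable (vol D)" "AE x in vol D. \<bar>b x\<bar> \<le> B" and p: "p \<in> H1 D" and q: "q \<in> H1 D"
  shows "\<bar>energy b p q\<bar> \<le> \<bar>B\<bar> * H10_norm D p * H10_norm D q"
  unfolding energy_def H10_norm_def by (rule weighted_inner(2)[OF b weak_grad_H1(1)[OF p] weak_grad_H1(1)[OF q]])

lemma energy_linear:
  assumes b: "b \<in> Linf_fun (vol D)" and p: "p \<in> H1 D" and p': "p' \<in> H1 D" and q: "q \<in> H1 D"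
  shows "energy b (\<lambda>x. s * p x + t * p' x) q = s * energy b p q + t * energy b p' q"
proof -
  obtain B where B: "B \<ge> 0" "AE x in vol D. \<bar>b x\<bar> \<le> B" and bm: "b \<in> borel_measurable (vol D)"
    using Linf_fun_AE_bound[OF b] by blast
  note i = weighted_inner(1)[OF bm B(2) weak_grad_H1(1)[OF p] weak_grad_H1(1)[OF q]]
    weighted_inner(1)[OF bm B(2) weak_grad_H1(1)[OF p'] weak_grad_H1(1)[OF q]]
  note [measurable] = bm L2_funD(1)[OF weak_grad_H1(1)[OF p]] L2_funD(1)[OF weak_grad_H1(1)[OF p']]
    L2_funD(1)[OF weak_grad_H1(1)[OF q]] L2_funD(1)[OF weak_grad_H1(1)[OF H1_linear(1)[OF D p p', of s t]]]
  have "energy b (\<lambda>x. s * p x + t * p' x) q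
      = (\<integral>x. s * (b x * (weak_grad D p x \<bullet> weak_grad D q x)) + t * (b x * (weak_grad D p' x \<bullet> weak_grad D q x)) \<partial>vol D)"
    unfolding energy_def
  proof (rule integral_cong_AE)
    show "AE x in vol D. b x * (weak_grad D (\<lambda>x. s * p x + t * p' x) x \<bullet> weak_grad D q x)
      = s * (b x * (weak_grad D p x \<bullet> weak_grad D q x)) + t * (b x * (weak_grad D p' x \<bullet> weak_grad D q x))"
      using H1_linear(2)[OF D p p', of s t] by eventually_elim (simp add: inner_add_left algebra_simps)
  qed measurable
  also have "\<dots> = s * energy b p q + t * energy b p' q" unfolding energy_def using i by simp
  finally show ?thesis .
qed

lemma energy_tendsto:
  assumes b: "b \<in> Linf_fun (vol D)" and p: "\<And>k. pk k \<in> H10 D" "p \<in> H10 D" "(\<lambda>k. H10_norm D (\<lambda>x. pk k x - p x)) \<longlonglongrightarrow> 0"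
    and q: "\<And>k. qk k \<in> H10 D" "q \<in> H10 D" "(\<lambda>k. H10_norm D (\<lambda>x. qk k x - q x)) \<longlonglongrightarrow> 0"
  shows "(\<lambda>k. energy b (pk k) (qk k)) \<longlonglongrightarrow> energy b p q"
proof -
  obtain B where B: "B \<ge> 0" "AE x in vol D. \<bar>b x\<bar> \<le> B" and bm: "b \<in> borel_measurable (vol D)"
    using Linf_fun_AE_bound[OF b] by blast
  have H: "pk k \<in> H1 D" "p \<in> H1 D" "qk k \<in> H1 D" "q \<in> H1 D" for k using p q H10D(1) by blast+
  have dH: "(\<lambda>x. pk k x - p x) \<in> H1 D" "(\<lambda>x. qk k x - q x) \<in> H1 D" for k using H1_diff(1)[OF D] H by blast+
  have eq: "energy b (pk k) (qk k) = energy b p q + (energy b (\<lambda>x. pk k x - p x) (\<lambda>x. qk k x - q x)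
      + energy b (\<lambda>x. pk k x - p x) q + energy b (\<lambda>x. qk k x - q x) p)" for k
  proof -
    have "energy b (pk k) (qk k) = energy b (\<lambda>x. pk k x - p x) (qk k) + energy b p (qk k)"
      using energy_linear[OF b dH(1) H(2) H(3), of 1 k 1 k] by simp
    moreover have "energy b r (qk k) = energy b r (\<lambda>x. qk k x - q x) + energy b r q" if "r \<in> H1 D" for r
      using energy_linear[OF b dH(2) H(4) that, of 1 k 1] by (simp add: energy_commute[of b r])
    ultimately show ?thesis using dH(1) H(2) energy_commute[of b p "\<lambda>x. qk k x - q x"] by simp
  qed
  have bd: "\<bar>energy b (\<lambda>x. pk k x - p x) (\<lambda>x. qk k x - q x) + energy b (\<lambda>x. pk k x - p x) q + energy b (\<lambda>x. qk k x - q x) p\<bar>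
    \<le> B * H10_norm D (\<lambda>x. pk k x - p x) * H10_norm D (\<lambda>x. qk k x - q x) + B * H10_norm D (\<lambda>x. pk k x - p x) * H10_norm D q
     + B * H10_norm D (\<lambda>x. qk k x - q x) * H10_norm D p" for k
    using energy_bound[OF bm B(2) dH(1)[of k] dH(2)[of k]] energy_bound[OF bm B(2) dH(1)[of k] H(4)]
      energy_bound[OF bm B(2) dH(2)[of k] H(2)] B(1) by linarith
  have "(\<lambda>k. B * H10_norm D (\<lambda>x. pk k x - p x) * H10_norm D (\<lambda>x. qk k x - q x) + B * H10_norm D (\<lambda>x. pk k x - p x) * H10_norm D q
     + B * H10_norm D (\<lambda>x. qk k x - q x) * H10_norm D p) \<longlonglongrightarrow> B * 0 * 0 + B * 0 * H10_norm D q + B * 0 * H10_norm D p"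
    by (intro tendsto_intros p q)
  then have z: "(\<lambda>k. B * H10_norm D (\<lambda>x. pk k x - p x) * H10_norm D (\<lambda>x. qk k x - q x) + B * H10_norm D (\<lambda>x. pk k x - p x) * H10_norm D q
     + B * H10_norm D (\<lambda>x. qk k x - q x) * H10_norm D p) \<longlonglongrightarrow> 0" by simp
  have "(\<lambda>k. energy b (\<lambda>x. pk k x - p x) (\<lambda>x. qk k x - q x) + energy b (\<lambda>x. pk k x - p x) q + energy b (\<lambda>x. qk k x - q x) p) \<longlonglongrightarrow> 0"
    by (rule Lim_null_comparison[OF _ z]) (use bd in simp)
  from tendsto_add[OF tendsto_const[of "energy b p q"] this] show ?thesis using eq by simp
qed

text \<open>\<open>weak_grad D (u \<omega>)\<close> is chosen for each \<omega> separately, so the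
  integrand need not be jointly measurable. Simple fields involve only finitely many gradients, each
  pair of which gives a measurable integral against \<open>a\<close>; continuity of the energy
  reaches general fields.\<close>

lemma energy_measurable:
  assumes a: "a \<in> Linf_Linf M D" and u: "u \<in> V" and v: "v \<in> V"
  shows "(\<lambda>\<omega>. energy (a \<omega>) (u \<omega>) (v \<omega>)) \<in> borel_measurable M"
proof -
  have am: "(\<lambda>p. a (fst p) (snd p)) \<in> borel_measurable (M \<Otimes>\<^sub>M vol D)" and aL: "\<And>\<omega>. \<omega> \<in> space M \<Longrightarrow> a \<omega> \<in> Linf_fun (vol D)"
    using a unfolding Linf_Linf_def bochner_Linf_def strongly_measurable_def by (auto simp: case_prod_beta')
  note U = V_D[OF u] and W = V_D[OF v]
  obtain p where p: "\<And>k. simple_function M (p k)" "\<And>k. p k ` space M \<subseteq> H10 D"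
    "\<And>\<omega>. \<omega> \<in> space M \<Longrightarrow> (\<lambda>k. H10_norm D (\<lambda>x. p k \<omega> x - u \<omega> x)) \<longlonglongrightarrow> 0"
    using U(2) unfolding strongly_measurable_def by blast
  obtain q where q: "\<And>k. simple_function M (q k)" "\<And>k. q k ` space M \<subseteq> H10 D"
    "\<And>\<omega>. \<omega> \<in> space M \<Longrightarrow> (\<lambda>k. H10_norm D (\<lambda>x. q k \<omega> x - v \<omega> x)) \<longlonglongrightarrow> 0"
    using W(2) unfolding strongly_measurable_def by blast
  have fixed: "(\<lambda>\<omega>. energy (a \<omega>) c d) \<in> borel_measurable M" if c: "c \<in> H1 D" and d: "d \<in> H1 D" for c d
  proof -
    have wm: "weak_grad D c \<in> borel_measurable (vol D)" "weak_grad D d \<in> borel_measurable (vol D)"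
      using weak_grad_H1(1)[OF c] weak_grad_H1(1)[OF d] L2_funD(1) by blast+
    have "(\<lambda>p. a (fst p) (snd p) * (weak_grad D c (snd p) \<bullet> weak_grad D d (snd p))) \<in> borel_measurable (M \<Otimes>\<^sub>M vol D)"
      by (intro borel_measurable_times am borel_measurable_inner measurable_compose[OF measurable_snd wm(1)]
          measurable_compose[OF measurable_snd wm(2)])
    then show ?thesis unfolding energy_def by (intro vol.borel_measurable_lebesgue_integral) (simp add: case_prod_beta')
  qed
  show ?thesis
  proof (rule borel_measurable_LIMSEQ_real)
    show "(\<lambda>k. energy (a \<omega>) (p k \<omega>) (q k \<omega>)) \<longlonglongrightarrow> energy (a \<omega>) (u \<omega>) (v \<omega>)" if \<omega>: "\<omega> \<in> space M" for \<omega>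
    proof -
      have "p k \<omega> \<in> H10 D" "q k \<omega> \<in> H10 D" for k using p(2) q(2) \<omega> by blast+
      then show ?thesis
        by (intro energy_tendsto[OF aL[OF \<omega>]] U(3)[OF \<omega>] W(3)[OF \<omega>] p(3)[OF \<omega>] q(3)[OF \<omega>])
    qed
    fix k
    \<comment> \<open>Pairing the two simple functions produces one finite index set of pairs of
      fixed functions.\<close>
    define c where "c \<omega> = (p k \<omega>, q k \<omega>)" for \<omega>
    have cs: "simple_function M c" unfolding c_def using p(1) q(1) by (intro simple_function_Pair)
    define I where "I = c ` space M"
    have I: "finite I" "I \<subseteq> H1 D \<times> H1 D"
      using cs p(2)[of k] q(2)[of k] H10D(1) unfolding I_def c_def simple_function_def by blast+
    have "(\<lambda>\<omega>. energy (a \<omega>) (fst (c \<omega>)) (snd (c \<omega>))) \<in> borel_measurable M"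
    proof (rule measurable_compose_countable'[where I = I and f = "\<lambda>c \<omega>. energy (a \<omega>) (fst c) (snd c)" and g = c])
      show "(\<lambda>\<omega>. energy (a \<omega>) (fst i) (snd i)) \<in> borel_measurable M" if "i \<in> I" for i
        using that I(2) by (intro fixed) auto
      show "c \<in> measurable M (count_space I)"
        using cs I(1) unfolding I_def simple_function_def by (subst measurable_count_space_eq2) auto
      show "countable I" using I(1) by (rule countable_finite)
    qed
    then show "(\<lambda>\<omega>. energy (a \<omega>) (p k \<omega>) (q k \<omega>)) \<in> borel_measurable M" by (simp add: c_def)
  qed
qed

lemma load_measurable:
  fixes f v :: "'w \<Rightarrow> 'a \<Rightarrow> real"
  assumes "case_prod f \<in> borel_measurable (M \<Otimes>\<^sub>M vol D)" "case_prod v \<in> borel_measurable (M \<Otimes>\<^sub>M vol D)"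
  shows "(\<lambda>\<omega>. \<integral>x. f \<omega> x * v \<omega> x \<partial>vol D) \<in> borel_measurable M"
proof -
  note [measurable] = assms[unfolded case_prod_beta']
  have "(\<lambda>p. f (fst p) (snd p) * v (fst p) (snd p)) \<in> borel_measurable (M \<Otimes>\<^sub>M vol D)"
    by measurable
  then show ?thesis by (intro vol.borel_measurable_lebesgue_integral) (simp add: case_prod_beta')
qed

end

section \<open>The variational inequality over a nonempty obstacle set\<close>

locale obstacle_problem = random_fields M D for M :: "'w measure" and D :: "'a::euclidean_space set" +
  fixes a f g :: "'w \<Rightarrow> 'a \<Rightarrow> real" and a_min a_max :: real
  assumes a: "a \<in> Linf_Linf M D" and a_min: "0 < a_min"
    and a_bounds: "AE (\<omega>, x) in M \<Otimes>\<^sub>M vol D. a_min \<le> a \<omega> x \<and> a \<omega> x \<le> a_max"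
    and f: "f \<in> L2_L2 M D" and g: "case_prod g \<in> borel_measurable (M \<Otimes>\<^sub>M vol D)"
    and ne: "obstacle_set M D g \<noteq> {}"
begin

abbreviation "bil \<equiv> bilin_form M D a"
abbreviation "ld \<equiv> load_form M D f"
abbreviation "K \<equiv> obstacle_set M D g"

lemma a_sections: "AE \<omega> in M. AE x in vol D. a_min \<le> a \<omega> x \<and> a \<omega> x \<le> a_max"
  using P.AE_pair[OF a_bounds] by simp

lemma a_Linf: "\<omega> \<in> space M \<Longrightarrow> a \<omega> \<in> Linf_fun (vol D)"
  using a unfolding Linf_Linf_def bochner_Linf_def strongly_measurable_def by auto

lemma bil_integrable:
  assumes u: "u \<in> V" and v: "v \<in> V"
  shows "integrable M (\<lambda>\<omega>. energy (a \<omega>) (u \<omega>) (v \<omega>))" "\<bar>bil u v\<bar> \<le> \<bar>a_max\<bar> * Vnorm u * Vnorm v"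
proof -
  note U = V_D[OF u] and W = V_D[OF v]
  have le: "AE \<omega> in M. \<bar>energy (a \<omega>) (u \<omega>) (v \<omega>)\<bar> \<le> \<bar>a_max\<bar> * (norm (H10_norm D (u \<omega>)) * norm (H10_norm D (v \<omega>)))"
    using a_sections AE_space
  proof eventually_elim
    case (elim \<omega>)
    have "AE x in vol D. \<bar>a \<omega> x\<bar> \<le> \<bar>a_max\<bar>" using elim(1) by eventually_elim (use a_min in auto)
    moreover have "a \<omega> \<in> borel_measurable (vol D)" using a_Linf[OF elim(2)] by (simp add: Linf_fun_def)
    ultimately show ?case
      using energy_bound[of "a \<omega>" "\<bar>a_max\<bar>" "u \<omega>" "v \<omega>"] H10D(1)[OF U(3)[OF elim(2)]] H10D(1)[OF W(3)[OF elim(2)]]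
      by (simp add: H10_norm_nonneg mult.assoc)
  qed
  have i: "integrable M (\<lambda>\<omega>. \<bar>a_max\<bar> * (norm (H10_norm D (u \<omega>)) * norm (H10_norm D (v \<omega>))))"
    using L2_fun_integrable_prod(1)[OF U(4) W(4)] by simp
  show int: "integrable M (\<lambda>\<omega>. energy (a \<omega>) (u \<omega>) (v \<omega>))"
    by (rule Bochner_Integration.integrable_bound[OF i energy_measurable[OF a u v]])
       (use le in eventually_elim, simp)
  have "\<bar>bil u v\<bar> \<le> (\<integral>\<omega>. \<bar>energy (a \<omega>) (u \<omega>) (v \<omega>)\<bar> \<partial>M)" unfolding bilin_form_eq by (rule integral_abs_bound)
  also have "\<dots> \<le> (\<integral>\<omega>. \<bar>a_max\<bar> * (norm (H10_norm D (u \<omega>)) * norm (H10_norm D (v \<omega>))) \<partial>M)"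
    using int i le by (intro integral_mono_AE) auto
  also have "\<dots> = \<bar>a_max\<bar> * (\<integral>\<omega>. norm (H10_norm D (u \<omega>)) * norm (H10_norm D (v \<omega>)) \<partial>M)" by simp
  also have "\<dots> \<le> \<bar>a_max\<bar> * (Vnorm u * Vnorm v)"
    unfolding Vnorm_def by (intro mult_left_mono L2_Cauchy_Schwarz U(4) W(4)) simp
  finally show "\<bar>bil u v\<bar> \<le> \<bar>a_max\<bar> * Vnorm u * Vnorm v" by (simp add: mult.assoc)
qed

lemma bil_commute: "bil u v = bil v u"
  by (simp add: bilin_form_eq energy_commute)

lemma bil_linear:
  assumes u: "u \<in> V" and v: "v \<in> V" and w: "w \<in> V"
  shows "bil (\<lambda>\<omega> x. s * u \<omega> x + t * v \<omega> x) w = s * bil u w + t * bil v w"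
proof -
  have "bil (\<lambda>\<omega> x. s * u \<omega> x + t * v \<omega> x) w = (\<integral>\<omega>. s * energy (a \<omega>) (u \<omega>) (w \<omega>) + t * energy (a \<omega>) (v \<omega>) (w \<omega>) \<partial>M)"
    unfolding bilin_form_eq
    by (intro Bochner_Integration.integral_cong refl energy_linear a_Linf H10D(1)[OF V_D(3)[OF u]]
        H10D(1)[OF V_D(3)[OF v]] H10D(1)[OF V_D(3)[OF w]])
  then show ?thesis unfolding bilin_form_eq using bil_integrable(1)[OF u w] bil_integrable(1)[OF v w] by simp
qed

lemma bil_coercive:
  assumes u: "u \<in> V"
  shows "a_min * (Vnorm u)\<^sup>2 \<le> bil u u"
proof -
  note U = V_D[OF u]
  have "a_min * (Vnorm u)\<^sup>2 = (\<integral>\<omega>. a_min * (norm (H10_norm D (u \<omega>)))\<^sup>2 \<partial>M)"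
    unfolding Vnorm_def L2_norm_power2 by simp
  also have "\<dots> \<le> (\<integral>\<omega>. energy (a \<omega>) (u \<omega>) (u \<omega>) \<partial>M)"
  proof (rule integral_mono_AE)
    show "AE \<omega> in M. a_min * (norm (H10_norm D (u \<omega>)))\<^sup>2 \<le> energy (a \<omega>) (u \<omega>) (u \<omega>)"
      using a_sections AE_space
    proof eventually_elim
      case (elim \<omega>)
      note G = weak_grad_H1(1)[OF H10D(1)[OF U(3)[OF elim(2)]]]
      have b: "AE x in vol D. \<bar>a \<omega> x\<bar> \<le> \<bar>a_max\<bar>" using elim(1) by eventually_elim (use a_min in auto)
      have am: "a \<omega> \<in> borel_measurable (vol D)" using a_Linf[OF elim(2)] by (simp add: Linf_fun_def)
      have "a_min * (norm (H10_norm D (u \<omega>)))\<^sup>2 = (\<integral>x. a_min * (norm (weak_grad D (u \<omega>) x))\<^sup>2 \<partial>vol D)"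
        by (simp add: H10_norm_def L2_norm_power2)
      also have "\<dots> \<le> (\<integral>x. a \<omega> x * (weak_grad D (u \<omega>) x \<bullet> weak_grad D (u \<omega>) x) \<partial>vol D)"
      proof (rule integral_mono_AE)
        show "integrable (vol D) (\<lambda>x. a_min * (norm (weak_grad D (u \<omega>) x))\<^sup>2)" using L2_funD(2)[OF G] by simp
        show "integrable (vol D) (\<lambda>x. a \<omega> x * (weak_grad D (u \<omega>) x \<bullet> weak_grad D (u \<omega>) x))"
          by (rule weighted_inner(1)[OF am b G G])
        show "AE x in vol D. a_min * (norm (weak_grad D (u \<omega>) x))\<^sup>2 \<le> a \<omega> x * (weak_grad D (u \<omega>) x \<bullet> weak_grad D (u \<omega>) x)"
          using elim(1) by eventually_elim (simp add: power2_norm_eq_inner mult_right_mono)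
      qed
      finally show ?case by (simp add: energy_def)
    qed
    show "integrable M (\<lambda>\<omega>. a_min * (norm (H10_norm D (u \<omega>)))\<^sup>2)" using L2_funD(2)[OF U(4)] by simp
  qed (rule bil_integrable(1)[OF u u])
  finally show ?thesis by (simp add: bilin_form_eq)
qed

lemma f_facts:
  shows "case_prod f \<in> borel_measurable (M \<Otimes>\<^sub>M vol D)" "\<omega> \<in> space M \<Longrightarrow> f \<omega> \<in> L2_fun (vol D)"
    "(\<lambda>\<omega>. L2_norm (vol D) (f \<omega>)) \<in> L2_fun M"
proof -
  show m: "case_prod f \<in> borel_measurable (M \<Otimes>\<^sub>M vol D)" and "\<omega> \<in> space M \<Longrightarrow> f \<omega> \<in> L2_fun (vol D)"
    using f unfolding L2_L2_def bochner_L2_def strongly_measurable_def by auto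
  show "(\<lambda>\<omega>. L2_norm (vol D) (f \<omega>)) \<in> L2_fun M"
    using f L2_norm_measurable[OF m] unfolding L2_L2_def bochner_L2_def L2_fun_def by auto
qed

text \<open>\<open>Vnorm\<close> sees gradients only, so the boundedness of the load rests on the
  Poincare inequality along each path.\<close>

lemma ld_linear:
  assumes u: "u \<in> V" and v: "v \<in> V"
  shows "ld (\<lambda>\<omega> x. s * u \<omega> x + t * v \<omega> x) = s * ld u + t * ld v"
    and "\<exists>F. \<forall>u\<in>V. \<bar>ld u\<bar> \<le> F * Vnorm u"
proof -
  obtain C where C: "C > 0" "\<And>u. u \<in> H10 D \<Longrightarrow> L2_norm (vol D) u \<le> C * L2_norm (vol D) (weak_grad D u)"
    using poincare_H10[OF D] by blast
  define F where "F = L2_norm M (\<lambda>\<omega>. L2_norm (vol D) (f \<omega>))"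
  have sec: "integrable (vol D) (\<lambda>x. f \<omega> x * u \<omega> x)"
    "\<bar>\<integral>x. f \<omega> x * u \<omega> x \<partial>vol D\<bar> \<le> C * (norm (L2_norm (vol D) (f \<omega>)) * norm (H10_norm D (u \<omega>)))"
    if u: "u \<in> V" and \<omega>: "\<omega> \<in> space M" for u \<omega>
  proof -
    note uH = V_D(3)[OF u \<omega>]
    note uL = weak_grad_H1(3)[OF H10D(1)[OF uH]] and fL = f_facts(2)[OF \<omega>]
    show "integrable (vol D) (\<lambda>x. f \<omega> x * u \<omega> x)" using L2_fun_integrable_prod(2)[OF fL uL] by simp
    have "\<bar>\<integral>x. f \<omega> x * u \<omega> x \<partial>vol D\<bar> \<le> L2_norm (vol D) (f \<omega>) * L2_norm (vol D) (u \<omega>)"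
      using L2_inner_le[OF fL uL] by simp
    also have "\<dots> \<le> L2_norm (vol D) (f \<omega>) * (C * H10_norm D (u \<omega>))"
      using C(2)[OF uH] unfolding H10_norm_def by (intro mult_left_mono) (auto simp: L2_norm_nonneg)
    finally show "\<bar>\<integral>x. f \<omega> x * u \<omega> x \<partial>vol D\<bar> \<le> C * (norm (L2_norm (vol D) (f \<omega>)) * norm (H10_norm D (u \<omega>)))"
      by (simp add: L2_norm_nonneg H10_norm_nonneg mult_ac)
  qed
  have int: "integrable M (\<lambda>\<omega>. \<integral>x. f \<omega> x * u \<omega> x \<partial>vol D)" "\<bar>ld u\<bar> \<le> (C * F) * Vnorm u" if u: "u \<in> V" for u
  proof -
    have i: "integrable M (\<lambda>\<omega>. C * (norm (L2_norm (vol D) (f \<omega>)) * norm (H10_norm D (u \<omega>))))"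
      using L2_fun_integrable_prod(1)[OF f_facts(3) V_D(4)[OF u]] by simp
    have le: "AE \<omega> in M. \<bar>\<integral>x. f \<omega> x * u \<omega> x \<partial>vol D\<bar> \<le> C * (norm (L2_norm (vol D) (f \<omega>)) * norm (H10_norm D (u \<omega>)))"
      by (rule AE_I2) (rule sec(2)[OF u])
    show int: "integrable M (\<lambda>\<omega>. \<integral>x. f \<omega> x * u \<omega> x \<partial>vol D)"
      by (rule Bochner_Integration.integrable_bound[OF i load_measurable[OF f_facts(1) V_D(1)[OF u]]])
         (use le in eventually_elim, simp)
    have "\<bar>ld u\<bar> \<le> (\<integral>\<omega>. \<bar>\<integral>x. f \<omega> x * u \<omega> x \<partial>vol D\<bar> \<partial>M)" unfolding load_form_def by (rule integral_abs_bound)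
    also have "\<dots> \<le> (\<integral>\<omega>. C * (norm (L2_norm (vol D) (f \<omega>)) * norm (H10_norm D (u \<omega>))) \<partial>M)"
      using int i le by (intro integral_mono_AE) auto
    also have "\<dots> = C * (\<integral>\<omega>. norm (L2_norm (vol D) (f \<omega>)) * norm (H10_norm D (u \<omega>)) \<partial>M)" by simp
    also have "\<dots> \<le> C * (F * Vnorm u)"
      unfolding F_def Vnorm_def using C(1) by (intro mult_left_mono L2_Cauchy_Schwarz f_facts(3) V_D(4)[OF u]) simp
    finally show "\<bar>ld u\<bar> \<le> (C * F) * Vnorm u" by (simp add: mult.assoc)
  qed
  show "\<exists>F. \<forall>u\<in>V. \<bar>ld u\<bar> \<le> F * Vnorm u" using int(2) by blast
  have "ld (\<lambda>\<omega> x. s * u \<omega> x + t * v \<omega> x) = (\<integral>\<omega>. s * (\<integral>x. f \<omega> x * u \<omega> x \<partial>vol D) + t * (\<integral>x. f \<omega> x * v \<omega> x \<partial>vol D) \<partial>M)"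
    unfolding load_form_def
  proof (rule Bochner_Integration.integral_cong[OF refl])
    fix \<omega> assume \<omega>: "\<omega> \<in> space M"
    have "(\<integral>x. f \<omega> x * (s * u \<omega> x + t * v \<omega> x) \<partial>vol D) = (\<integral>x. s * (f \<omega> x * u \<omega> x) + t * (f \<omega> x * v \<omega> x) \<partial>vol D)"
      by (simp add: algebra_simps)
    then show "(\<integral>x. f \<omega> x * (s * u \<omega> x + t * v \<omega> x) \<partial>vol D) = s * (\<integral>x. f \<omega> x * u \<omega> x \<partial>vol D) + t * (\<integral>x. f \<omega> x * v \<omega> x \<partial>vol D)"
      using sec(1)[OF u \<omega>] sec(1)[OF v \<omega>] by simp
  qed
  then show "ld (\<lambda>\<omega> x. s * u \<omega> x + t * v \<omega> x) = s * ld u + t * ld v"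
    unfolding load_form_def using int(1)[OF u] int(1)[OF v] by simp
qed

definition J :: "('w \<Rightarrow> 'a \<Rightarrow> real) \<Rightarrow> real" where
  "J u = bil u u / 2 - ld u"

text \<open>The functional is quadratic, so this second-order expansion is exact. The convexity gap,
  the continuity along minimising sequences and the first-order condition are all read off from
  it.\<close>

lemma J_expand:
  assumes u: "u \<in> V" and v: "v \<in> V"
  shows "J (\<lambda>\<omega> x. u \<omega> x + t * v \<omega> x) = J u + t * (bil u v - ld v) + t\<^sup>2 / 2 * bil v v"
proof -
  let ?w = "\<lambda>\<omega> x. u \<omega> x + t * v \<omega> x"
  have w: "?w \<in> V" using V_linear(1)[OF u v, of 1 t] by simp
  have 1: "bil ?w z = bil u z + t * bil v z" if "z \<in> V" for z using bil_linear[OF u v that, of 1 t] by simp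
  have "bil ?w ?w = bil u u + 2 * t * bil u v + t\<^sup>2 * bil v v"
    using 1[OF w] 1[OF u] 1[OF v] bil_commute[of u ?w] bil_commute[of v ?w] bil_commute[of v u]
    by (simp add: power2_eq_square algebra_simps)
  moreover have "ld ?w = ld u + t * ld v" using ld_linear(1)[OF u v, of 1 t] by simp
  ultimately show ?thesis by (simp add: J_def algebra_simps)
qed

lemma K_V: "u \<in> K \<Longrightarrow> u \<in> V"
  by (simp add: obstacle_set_def)

lemma K_convex:
  assumes u: "u \<in> K" and v: "v \<in> K" and t: "0 \<le> t" "t \<le> 1"
  shows "(\<lambda>\<omega> x. u \<omega> x + t * (v \<omega> x - u \<omega> x)) \<in> K"
proof -
  have "(\<lambda>\<omega> x. u \<omega> x + t * (v \<omega> x - u \<omega> x)) \<in> V"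
    using V_linear(1)[OF K_V[OF u] V_diff[OF K_V[OF v] K_V[OF u]], of 1 t] by simp
  moreover have "AE z in M \<Otimes>\<^sub>M vol D. g (fst z) (snd z) \<le> u (fst z) (snd z) + t * (v (fst z) (snd z) - u (fst z) (snd z))"
  proof -
    have "AE z in M \<Otimes>\<^sub>M vol D. g (fst z) (snd z) \<le> u (fst z) (snd z)" "AE z in M \<Otimes>\<^sub>M vol D. g (fst z) (snd z) \<le> v (fst z) (snd z)"
      using u v by (simp_all add: obstacle_set_def case_prod_beta')
    then show ?thesis
    proof eventually_elim
      case (elim z)
      have "(1 - t) * g (fst z) (snd z) + t * g (fst z) (snd z) \<le> (1 - t) * u (fst z) (snd z) + t * v (fst z) (snd z)"
        using elim t by (intro add_mono mult_left_mono) auto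
      then show ?case by (simp add: algebra_simps)
    qed
  qed
  ultimately show ?thesis by (simp add: obstacle_set_def case_prod_beta')
qed

lemma minimizer_exists: "\<exists>u\<in>K. \<forall>v\<in>K. J u \<le> J v"
proof -
  obtain v0 where v0: "v0 \<in> K" using ne by blast
  obtain F where F: "\<And>u. u \<in> V \<Longrightarrow> \<bar>ld u\<bar> \<le> F * Vnorm u"
    using ld_linear(2)[OF K_V[OF v0] K_V[OF v0]] by blast
  \<comment> \<open>Coercivity leaves a quadratic in \<open>Vnorm u\<close>, bounded below by
    completing the square.\<close>
  have lower: "J u \<ge> - F\<^sup>2 / (2 * a_min)" if "u \<in> V" for u
  proof -
    have "0 \<le> (a_min * Vnorm u - F)\<^sup>2 / (2 * a_min)" using a_min by simp
    also have "\<dots> = a_min * (Vnorm u)\<^sup>2 / 2 - F * Vnorm u + F\<^sup>2 / (2 * a_min)"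
      using a_min by (simp add: power2_diff field_simps power2_eq_square)
    finally show ?thesis using bil_coercive[OF that] F[OF that] unfolding J_def by simp
  qed
  define m where "m = Inf (J ` K)"
  have bdd: "bdd_below (J ` K)" using lower K_V by (intro bdd_belowI[of _ "- F\<^sup>2 / (2 * a_min)"]) blast
  have m: "m \<le> J u" if "u \<in> K" for u unfolding m_def using bdd that by (intro cInf_lower) auto
  \<comment> \<open>The rate 1/4^k makes consecutive terms as close as a multiple of 1/2^k, so that
    the sequence has summable increments without passing to a subsequence.\<close>
  have "\<exists>u\<in>K. J u < m + (1/4)^k" for k :: nat
    using cInf_lessD[of "J ` K" "m + (1/4)^k"] v0 unfolding m_def by auto
  then have "\<forall>k. \<exists>u. u \<in> K \<and> J u < m + (1/4)^k" by blast
  from choice[OF this] obtain u where u: "\<And>k. u k \<in> K" "\<And>k. J (u k) < m + (1/4)^k" by blast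
  note uV = K_V[OF u(1)]
  \<comment> \<open>With d = w - v, the sum J v + J w exceeds twice the value at the midpoint by a
    quarter of b(d, d), and the midpoint lies in \<open>K\<close>.\<close>
  have gap: "a_min * (Vnorm (\<lambda>\<omega> x. w \<omega> x - v \<omega> x))\<^sup>2 \<le> 4 * (J v + J w - 2 * m)" if v: "v \<in> K" and w: "w \<in> K" for v w
  proof -
    let ?d = "\<lambda>\<omega> x. w \<omega> x - v \<omega> x"
    have dV: "?d \<in> V" using V_diff K_V v w by blast
    have "J w = J v + (bil v ?d - ld ?d) + 1 / 2 * bil ?d ?d"
      using J_expand[OF K_V[OF v] dV, of 1] by simp
    moreover have "J (\<lambda>\<omega> x. v \<omega> x + 1 / 2 * ?d \<omega> x) = J v + 1 / 2 * (bil v ?d - ld ?d) + 1 / 8 * bil ?d ?d"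
      unfolding J_expand[OF K_V[OF v] dV] by (simp add: power2_eq_square)
    moreover have "m \<le> J (\<lambda>\<omega> x. v \<omega> x + 1 / 2 * ?d \<omega> x)" by (intro m K_convex v w) auto
    moreover have "a_min * (Vnorm ?d)\<^sup>2 \<le> bil ?d ?d" by (rule bil_coercive[OF dV])
    ultimately show ?thesis by argo
  qed
  have step: "Vnorm (\<lambda>\<omega> x. u (Suc k) \<omega> x - u k \<omega> x) \<le> sqrt (8 / a_min) * (1/2)^k" for k
  proof -
    have "a_min * (Vnorm (\<lambda>\<omega> x. u (Suc k) \<omega> x - u k \<omega> x))\<^sup>2 \<le> 4 * (J (u k) + J (u (Suc k)) - 2 * m)"
      by (rule gap[OF u(1) u(1)])
    also have "\<dots> \<le> 8 * (1/4)^k"     proof -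
      have "4 * (x + y - 2 * m) \<le> 8 * q" if "x < m + q" "y < m + r" "r \<le> q" for x y q r :: real
        using that by argo
      from this[OF u(2)[of k] u(2)[of "Suc k"]] show ?thesis by simp
    qed
    finally have "(Vnorm (\<lambda>\<omega> x. u (Suc k) \<omega> x - u k \<omega> x))\<^sup>2 \<le> 8 / a_min * (1/4)^k" using a_min by (simp add: field_simps)
    also have "\<dots> = (sqrt (8 / a_min) * (1/2)^k)\<^sup>2"
    proof -
      have "((1/2)^k)\<^sup>2 = (1/4 :: real)^k" by (simp add: power2_eq_square flip: power_mult_distrib)
      then show ?thesis using a_min by (simp add: power_mult_distrib)
    qed
    finally show ?thesis by (rule power2_le_imp_le) (use a_min in auto)
  qed
  have "summable (\<lambda>k. Vnorm (\<lambda>\<omega> x. u (Suc k) \<omega> x - u k \<omega> x))"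
  proof (rule summable_comparison_test'[where N = 0])
    show "summable (\<lambda>k. sqrt (8 / a_min) * (1/2)^k)" by (intro summable_mult summable_geometric) simp
  qed (use step Vnorm_nonneg in auto)
  then obtain v where v: "v \<in> V" "(\<lambda>k. Vnorm (\<lambda>\<omega> x. u k \<omega> x - v \<omega> x)) \<longlonglongrightarrow> 0"
    "AE \<omega> in M. AE x in vol D. (\<lambda>k. u k \<omega> x) \<longlonglongrightarrow> v \<omega> x" by (rule V_complete[OF uV])
  have vK: "v \<in> K"
  proof -
    have "AE \<omega> in M. AE x in vol D. \<forall>k. g \<omega> x \<le> u k \<omega> x"
    proof -
      have "AE \<omega> in M. AE x in vol D. g \<omega> x \<le> u k \<omega> x" for k
        using P.AE_pair[of "\<lambda>(\<omega>, x). g \<omega> x \<le> u k \<omega> x"] u(1)[of k] by (simp add: obstacle_set_def)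
      then show ?thesis by (simp add: AE_all_countable)
    qed
    then have ae: "AE \<omega> in M. AE x in vol D. g \<omega> x \<le> v \<omega> x"
      using v(3)
    proof eventually_elim
      case (elim \<omega>)
      then show ?case by eventually_elim (auto intro: LIMSEQ_le_const)
    qed
    have [measurable]: "(\<lambda>p. g (fst p) (snd p)) \<in> borel_measurable (M \<Otimes>\<^sub>M vol D)" "(\<lambda>p. v (fst p) (snd p)) \<in> borel_measurable (M \<Otimes>\<^sub>M vol D)"
      using g V_D(1)[OF v(1)] by (simp_all add: case_prod_beta')
    have "AE z in M \<Otimes>\<^sub>M vol D. g (fst z) (snd z) \<le> v (fst z) (snd z)"
      by (rule P.AE_pair_measure) (use ae in \<open>measurable, simp\<close>)
    then show ?thesis using v(1) by (simp add: obstacle_set_def case_prod_beta')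
  qed
  have "(\<lambda>k. J (u k)) \<longlonglongrightarrow> J v"
  proof -
    let ?d = "\<lambda>k \<omega> x. u k \<omega> x - v \<omega> x"
    have dV: "?d k \<in> V" for k using V_diff[OF uV v(1)] .
    have e: "J (u k) = J v + ((bil v (?d k) - ld (?d k)) + 1 / 2 * bil (?d k) (?d k))" for k
      using J_expand[OF v(1) dV[of k], of 1] by simp
    have "(\<lambda>k. (bil v (?d k) - ld (?d k)) + 1 / 2 * bil (?d k) (?d k)) \<longlonglongrightarrow> 0"
    proof (rule Lim_null_comparison[OF always_eventually], rule allI)
      fix k
      show "norm ((bil v (?d k) - ld (?d k)) + 1 / 2 * bil (?d k) (?d k)) \<le>
        \<bar>a_max\<bar> * Vnorm v * Vnorm (?d k) + F * Vnorm (?d k) + \<bar>a_max\<bar> * Vnorm (?d k) * Vnorm (?d k)"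
        using bil_integrable(2)[OF v(1) dV[of k]] F[OF dV[of k]] bil_integrable(2)[OF dV[of k] dV[of k]] by simp
      have "(\<lambda>k. \<bar>a_max\<bar> * Vnorm v * Vnorm (?d k) + F * Vnorm (?d k) + \<bar>a_max\<bar> * Vnorm (?d k) * Vnorm (?d k))
        \<longlonglongrightarrow> \<bar>a_max\<bar> * Vnorm v * 0 + F * 0 + \<bar>a_max\<bar> * 0 * 0" by (intro tendsto_intros v(2))
      then show "(\<lambda>k. \<bar>a_max\<bar> * Vnorm v * Vnorm (?d k) + F * Vnorm (?d k) + \<bar>a_max\<bar> * Vnorm (?d k) * Vnorm (?d k)) \<longlonglongrightarrow> 0" by simp
    qed
    from tendsto_add[OF tendsto_const[of "J v"] this] show ?thesis using e by simp
  qed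
  moreover have "(\<lambda>k. J (u k)) \<longlonglongrightarrow> m"
  proof (rule tendsto_sandwich[OF _ _ tendsto_const])
    have "(\<lambda>k. m + (1/4)^k) \<longlonglongrightarrow> m + 0" by (intro tendsto_intros LIMSEQ_power_zero) simp
    then show "(\<lambda>k. m + (1/4)^k) \<longlonglongrightarrow> m" by simp
  qed (use m[OF u(1)] u(2) in \<open>auto intro!: always_eventually less_imp_le\<close>)
  ultimately have "J v = m" by (rule LIMSEQ_unique)
  then show ?thesis using vK m by blast
qed

lemma minimizer_solves:
  assumes u: "u \<in> K" and min: "\<And>v. v \<in> K \<Longrightarrow> J u \<le> J v"
  shows "solves_obstacle M D a f g u"
  unfolding solves_obstacle_def
proof (intro conjI ballI u)
  fix v assume v: "v \<in> K"
  let ?d = "\<lambda>\<omega> x. v \<omega> x - u \<omega> x"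
  have dV: "?d \<in> V" using V_diff K_V u v by blast
  let ?X = "bil u ?d - ld ?d"
  have pos: "0 \<le> t * z \<Longrightarrow> 0 < t \<Longrightarrow> 0 \<le> z" for t z :: real by (simp add: zero_le_mult_iff)
  \<comment> \<open>Minimality along the segment towards v at t = 1/(n+1), divided by t; the
    quadratic term then disappears as n grows.\<close>
  have "- (1 / real (Suc n)) / 2 * bil ?d ?d \<le> ?X" for n
  proof -
    let ?t = "1 / real (Suc n)"
    have "J u \<le> J (\<lambda>\<omega> x. u \<omega> x + ?t * ?d \<omega> x)" by (intro min K_convex u v) auto
    then have "0 \<le> ?t * ?X + ?t\<^sup>2 / 2 * bil ?d ?d" unfolding J_expand[OF K_V[OF u] dV] by simp
    also have "\<dots> = ?t * (?X + ?t / 2 * bil ?d ?d)" by (simp add: power2_eq_square algebra_simps)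
    finally have "0 \<le> ?t * (?X + ?t / 2 * bil ?d ?d)" .
    moreover have "?t > 0" by simp
    ultimately have "0 \<le> ?X + ?t / 2 * bil ?d ?d" by (rule pos)
    then show ?thesis by simp
  qed
  moreover have "(\<lambda>n. - inverse (real (Suc n)) / 2 * bil ?d ?d) \<longlonglongrightarrow> - 0 / 2 * bil ?d ?d"
    by (intro tendsto_intros LIMSEQ_inverse_real_of_nat) simp
  ultimately have "0 \<le> ?X" by (intro LIMSEQ_le_const2[of "\<lambda>n. - inverse (real (Suc n)) / 2 * bil ?d ?d" 0 ?X]) (auto simp: inverse_eq_divide)
  then show "ld ?d \<le> bil u ?d" by simp
qed

text \<open>Each solution is a competitor for the other. Adding the two inequalities gives b(d, d)
  \<le> 0 for the difference d; coercivity annihilates its gradient, and Poincare the difference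
  itself.\<close>

lemma solution_unique:
  assumes u: "solves_obstacle M D a f g u" and w: "solves_obstacle M D a f g w"
  shows "AE (\<omega>, x) in M \<Otimes>\<^sub>M vol D. w \<omega> x = u \<omega> x"
proof -
  have uV: "u \<in> V" and wV: "w \<in> V" using u w K_V by (auto simp: solves_obstacle_def)
  let ?d = "\<lambda>\<omega> x. w \<omega> x - u \<omega> x"
  have dV: "?d \<in> V" using V_diff[OF wV uV] .
  have "ld ?d \<le> bil u ?d" "ld (\<lambda>\<omega> x. u \<omega> x - w \<omega> x) \<le> bil w (\<lambda>\<omega> x. u \<omega> x - w \<omega> x)"
    using u w unfolding solves_obstacle_def by auto
  moreover have "ld (\<lambda>\<omega> x. u \<omega> x - w \<omega> x) = - ld ?d"
    using ld_linear(1)[OF dV dV, of "-1" 0] by simp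
  moreover have "bil w (\<lambda>\<omega> x. u \<omega> x - w \<omega> x) = - bil w ?d"
    using bil_linear[OF dV dV wV, of "-1" 0] by (simp add: bil_commute[of w])
  moreover have "bil ?d ?d = bil w ?d - bil u ?d" using bil_linear[OF wV uV dV, of 1 "-1"] by simp
  ultimately have "bil ?d ?d \<le> 0" by linarith
  then have "a_min * (Vnorm ?d)\<^sup>2 \<le> 0" using bil_coercive[OF dV] by linarith
  then have "Vnorm ?d = 0" using a_min by (simp add: mult_le_0_iff)
  then have z: "AE \<omega> in M. H10_norm D (?d \<omega>) = 0"
    unfolding Vnorm_def using L2_norm_eq_0_iff[OF V_D(4)[OF dV]] by simp
  obtain C where C: "C > 0" "\<And>u. u \<in> H10 D \<Longrightarrow> L2_norm (vol D) u \<le> C * L2_norm (vol D) (weak_grad D u)"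
    using poincare_H10[OF D] by blast
  have ae: "AE \<omega> in M. AE x in vol D. w \<omega> x = u \<omega> x"
    using z AE_space
  proof eventually_elim
    case (elim \<omega>)
    have dH: "?d \<omega> \<in> H10 D" using V_D(3)[OF dV elim(2)] .
    have "L2_norm (vol D) (?d \<omega>) = 0"
      using C(2)[OF dH] elim(1) L2_norm_nonneg[of "vol D" "?d \<omega>"] by (simp add: H10_norm_def)
    then have "AE x in vol D. ?d \<omega> x = 0"
      using L2_norm_eq_0_iff[OF weak_grad_H1(3)[OF H10D(1)[OF dH]]] by simp
    then show ?case by eventually_elim simp
  qed
  have [measurable]: "(\<lambda>p. u (fst p) (snd p)) \<in> borel_measurable (M \<Otimes>\<^sub>M vol D)" "(\<lambda>p. w (fst p) (snd p)) \<in> borel_measurable (M \<Otimes>\<^sub>M vol D)"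
    using V_D(1)[OF uV] V_D(1)[OF wV] by (simp_all add: case_prod_beta')
  have "AE z in M \<Otimes>\<^sub>M vol D. w (fst z) (snd z) = u (fst z) (snd z)"
    by (rule P.AE_pair_measure) (use ae in \<open>measurable, simp\<close>)
  then show ?thesis by (simp add: case_prod_beta')
qed

lemma unique_solution:
  "\<exists>u. solves_obstacle M D a f g u \<and>
     (\<forall>w. solves_obstacle M D a f g w \<longrightarrow> (AE (\<omega>, x) in M \<Otimes>\<^sub>M vol D. w \<omega> x = u \<omega> x))"
proof -
  obtain u where "u \<in> K" "\<And>v. v \<in> K \<Longrightarrow> J u \<le> J v" using minimizer_exists by blast
  then have u: "solves_obstacle M D a f g u" by (rule minimizer_solves)
  then show ?thesis using solution_unique[OF u] by blast
qed

end

section \<open>Existence of admissible fields\<close>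

context random_fields
begin

lemma H10_norm_le_H1_norm: "H10_norm D v \<le> H1_norm D v"
  unfolding H10_norm_def H1_norm_def by (rule real_le_rsqrt) simp

lemma H1_norm_zero: "H1_norm D (\<lambda>x. 0) = 0"
  using zero_H10(2)[OF D] by (simp add: H1_norm_def L2_norm_zero)

lemma H1_norm_measurable:
  assumes "strongly_measurable M (H1 D) (H1_norm D) u"
  shows "(\<lambda>\<omega>. H1_norm D (u \<omega>)) \<in> borel_measurable M"
proof -
  have z: "(\<lambda>x. 0) \<in> H1 D" by (rule H10D(1)[OF zero_H10(1)[OF D]])
  have "(\<lambda>\<omega>. H1_norm D (\<lambda>x. 0 - u \<omega> x)) \<in> borel_measurable M"
    by (rule strongly_measurable_dist[OF pseudo_normed_H1[OF D] assms z])
  moreover have "H1_norm D (\<lambda>x. 0 - u \<omega> x) = H1_norm D (u \<omega>)" if "\<omega> \<in> space M" for \<omega>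
    using H1_norm_commute[OF D z, of "u \<omega>"] assms that by (simp add: strongly_measurable_def)
  ultimately show ?thesis by (simp cong: measurable_cong)
qed

text \<open>The witness is the positive part of g, set to 0 on an exceptional event. Membership in
  \<open>H10 D\<close> is settled path by path. Strong measurability is the remaining issue:
  \<open>spos\<close> with \<epsilon> = 1/(n+1) is applied to simple approximants, and n tends to
  infinity in a second limit.\<close>

lemma obstacle_set_nonempty:
  assumes lip: "lipschitz_boundary D" and g: "g \<in> L2_H1 M D"
    and tr: "AE \<omega> in M. \<exists>h. has_trace D (g \<omega>) h \<and> (AE x in surface_measure D. h x \<le> 0)"
  shows "obstacle_set M D g \<noteq> {}"
proof -
  have gm: "case_prod g \<in> borel_measurable (M \<Otimes>\<^sub>M vol D)" and gs: "strongly_measurable M (H1 D) (H1_norm D) g"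
    and gi: "integrable M (\<lambda>\<omega>. (H1_norm D (g \<omega>))\<^sup>2)"
    using g unfolding L2_H1_def bochner_L2_def by auto
  \<comment> \<open>The set of \<omega> at which the trace condition holds need not be measurable,
    so a measurable set of full measure inside it is taken.\<close>
  obtain A where A: "A \<in> sets M" "AE \<omega> in M. \<omega> \<in> A"
    "\<And>\<omega>. \<omega> \<in> A \<Longrightarrow> \<exists>h. has_trace D (g \<omega>) h \<and> (AE x in surface_measure D. h x \<le> 0)"
  proof -
    obtain N where N: "N \<in> null_sets M" "{\<omega> \<in> space M. \<not> (\<exists>h. has_trace D (g \<omega>) h \<and> (AE x in surface_measure D. h x \<le> 0))} \<subseteq> N"
      using tr unfolding eventually_ae_filter by blast
    show ?thesis
    proof (rule that[of "space M - N"])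
      show "space M - N \<in> sets M" using N(1) by auto
      show "AE \<omega> in M. \<omega> \<in> space M - N" using AE_not_in[OF N(1)] AE_space by eventually_elim simp
    qed (use N(2) in blast)
  qed
  \<comment> \<open>The simple approximants must themselves have positive parts in
    \<open>H10 D\<close>, whereas those given with g lie only in \<open>H1 D\<close>.
    \<open>strongly_measurable_range_subset\<close> moves them into this set.\<close>
  define S where "S = {w \<in> smooth_closure D. (\<forall>\<epsilon>>0. (\<lambda>x. spos \<epsilon> (w x)) \<in> H10 D) \<and> (\<lambda>x. max 0 (w x)) \<in> H10 D}"
  have SH: "S \<subseteq> H1 D" by (auto simp: S_def smooth_closure_def)
  define g0 where "g0 \<omega> = (if \<omega> \<in> A then g \<omega> else (\<lambda>x. 0))" for \<omega>
  have zS: "(\<lambda>x. 0) \<in> S"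
    using smooth_in_smooth_closure[OF D smooth_const] zero_H10(1)[OF D] by (simp add: S_def spos_def)
  have g0S: "g0 \<omega> \<in> S" for \<omega>
  proof (cases "\<omega> \<in> A")
    case True
    then obtain h where "has_trace D (g \<omega>) h" "AE x in surface_measure D. h x \<le> 0" using A(3) by blast
    from trace_nonpos_imp_pos_part_H10[OF D lip this] show ?thesis using True by (simp add: S_def g0_def)
  qed (use zS in \<open>simp add: g0_def\<close>)
  have g0W: "g0 \<omega> \<in> smooth_closure D" for \<omega> using g0S by (simp add: S_def)
  have "strongly_measurable M (H1 D) (H1_norm D) g0"
    unfolding g0_def using zS SH by (intro strongly_measurable_restrict[OF gs A(1) _ H1_norm_zero]) blast
  then have g0s: "strongly_measurable M S (H1_norm D) g0"
    by (rule strongly_measurable_range_subset[OF not_empty pseudo_normed_H1[OF D] _ SH g0S])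
  obtain s where s: "\<And>k. simple_function M (s k)" "\<And>k. s k ` space M \<subseteq> S"
    "\<And>\<omega>. \<omega> \<in> space M \<Longrightarrow> (\<lambda>k. H1_norm D (\<lambda>x. s k \<omega> x - g0 \<omega> x)) \<longlonglongrightarrow> 0"
    using g0s unfolding strongly_measurable_def by blast
  have sandwich: "(\<lambda>k. H10_norm D (w k)) \<longlonglongrightarrow> 0" if "(\<lambda>k. H1_norm D (w k)) \<longlonglongrightarrow> 0" for w
    by (rule tendsto_sandwich[OF _ _ tendsto_const that]) (simp_all add: H10_norm_nonneg H10_norm_le_H1_norm)
  let ?e = "\<lambda>n. 1 / real (Suc n)"
  have ws: "strongly_measurable M (H10 D) (H10_norm D) (\<lambda>\<omega> x. spos (?e n) (g0 \<omega> x))" for n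
    unfolding strongly_measurable_def
  proof (intro conjI exI[of _ "\<lambda>k \<omega> x. spos (?e n) (s k \<omega> x)"] allI ballI)
    show "(\<lambda>x. spos (?e n) (g0 \<omega> x)) \<in> H10 D" for \<omega> using g0S by (simp add: S_def)
    show "simple_function M (\<lambda>\<omega> x. spos (?e n) (s k \<omega> x))" for k
      using simple_function_compose[OF s(1)[of k], of "\<lambda>w x. spos (?e n) (w x)"] by (simp add: comp_def)
    show "(\<lambda>\<omega> x. spos (?e n) (s k \<omega> x)) ` space M \<subseteq> H10 D" for k
      using s(2)[of k] by (auto simp: S_def image_subset_iff)
    fix \<omega> assume \<omega>: "\<omega> \<in> space M"
    have "s k \<omega> \<in> smooth_closure D" for k using s(2)[of k] \<omega> by (auto simp: S_def image_subset_iff)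
    then show "(\<lambda>k. H10_norm D (\<lambda>x. spos (?e n) (s k \<omega> x) - spos (?e n) (g0 \<omega> x))) \<longlonglongrightarrow> 0"
      by (intro sandwich spos_H1_continuous[OF D _ g0W _ s(3)[OF \<omega>]]) auto
  qed
  define v where "v \<omega> x = max 0 (g0 \<omega> x)" for \<omega> x
  have vs: "strongly_measurable M (H10 D) (H10_norm D) v"
  proof (rule strongly_measurable_limit[OF not_empty pseudo_normed_H10[OF D] ws])
    show "v \<omega> \<in> H10 D" for \<omega> using g0S[of \<omega>] by (simp add: S_def v_def[abs_def])
    show "(\<lambda>n. H10_norm D (\<lambda>x. spos (?e n) (g0 \<omega> x) - v \<omega> x)) \<longlonglongrightarrow> 0" for \<omega>
      unfolding v_def by (intro sandwich pos_part_smooth_closure(2)[OF D g0W])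
  qed
  have gm' [measurable]: "(\<lambda>p. g (fst p) (snd p)) \<in> borel_measurable (M \<Otimes>\<^sub>M vol D)"
    using gm by (simp add: case_prod_beta')
  have Am [measurable]: "A \<in> sets M" by (rule A(1))
  have vm': "(\<lambda>p. v (fst p) (snd p)) \<in> borel_measurable (M \<Otimes>\<^sub>M vol D)"
  proof -
    have "(\<lambda>p. max 0 (if fst p \<in> A then g (fst p) (snd p) else 0)) \<in> borel_measurable (M \<Otimes>\<^sub>M vol D)"
      by measurable
    moreover have "(\<lambda>p. max 0 (if fst p \<in> A then g (fst p) (snd p) else 0)) = (\<lambda>p. v (fst p) (snd p))"
      by (auto simp: v_def g0_def)
    ultimately show ?thesis by simp
  qed
  have vm: "case_prod v \<in> borel_measurable (M \<Otimes>\<^sub>M vol D)" using vm' by (simp add: case_prod_beta')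
  have "v \<in> V"
  proof (rule V_I[OF vm vs])
    show "(\<lambda>\<omega>. H1_norm D (g \<omega>)) \<in> L2_fun M"
      using H1_norm_measurable[OF gs] gi by (simp add: L2_fun_def)
    show "AE \<omega> in M. H10_norm D (v \<omega>) \<le> H1_norm D (g \<omega>)"
      using A(2)
    proof eventually_elim
      case (elim \<omega>)
      have "H10_norm D (v \<omega>) \<le> H10_norm D (g0 \<omega>)"
        unfolding v_def H10_norm_def by (rule pos_part_smooth_closure(3)[OF D g0W])
      also have "\<dots> \<le> H1_norm D (g0 \<omega>)" by (rule H10_norm_le_H1_norm)
      finally show ?case using elim by (simp add: g0_def)
    qed
  qed
  moreover have "AE z in M \<Otimes>\<^sub>M vol D. g (fst z) (snd z) \<le> v (fst z) (snd z)"
  proof (rule P.AE_pair_measure)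
    show "{z \<in> space (M \<Otimes>\<^sub>M vol D). g (fst z) (snd z) \<le> v (fst z) (snd z)} \<in> sets (M \<Otimes>\<^sub>M vol D)"
      using vm' by measurable
    show "AE \<omega> in M. AE x in vol D. g (fst (\<omega>, x)) (snd (\<omega>, x)) \<le> v (fst (\<omega>, x)) (snd (\<omega>, x))"
      using A(2) by eventually_elim (simp add: v_def g0_def)
  qed
  ultimately show ?thesis unfolding obstacle_set_def by (auto simp: case_prod_beta')
qed

end

theorem theorem2p4:
  fixes D :: "(real ^ 'n) set" and M :: "'w measure"
    and a g f :: "'w \<Rightarrow> real ^ 'n \<Rightarrow> real" and a_min a_max :: real
  assumes "open D" and "bounded D" and "lipschitz_boundary D"
    and "prob_space M"
    and "a \<in> Linf_Linf M D"
    and "0 < a_min"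
    and "AE (\<omega>, x) in M \<Otimes>\<^sub>M vol D. a_min \<le> a \<omega> x \<and> a \<omega> x \<le> a_max"
    and "g \<in> L2_H1 M D"
    and "AE \<omega> in M. \<exists>h. has_trace D (g \<omega>) h \<and> (AE x in surface_measure D. h x \<le> 0)"
    and "f \<in> L2_L2 M D"
  shows "\<exists>u. solves_obstacle M D a f g u \<and>
           (\<forall>w. solves_obstacle M D a f g w \<longrightarrow>
              (AE (\<omega>, x) in M \<Otimes>\<^sub>M vol D. w \<omega> x = u \<omega> x))"
proof -
  interpret prob_space M by fact
  interpret random_fields M D by unfold_locales fact+
  interpret obstacle_problem M D a f g a_min a_max
  proof
    show "case_prod g \<in> borel_measurable (M \<Otimes>\<^sub>M vol D)"
      using assms(8) unfolding L2_H1_def bochner_L2_def by simp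
    show "obstacle_set M D g \<noteq> {}"
      by (rule obstacle_set_nonempty[OF assms(3,8,9)])
  qed fact+
  show ?thesis by (rule unique_solution)
qed

end
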